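(* Let $V$ be a real Kato-Rellich potential on $\mathbb{R}^N$, let $A=-\Delta+V$, and suppose $\sigma_{\mathrm{dis}}(A)\neq\varnothing$ and $\inf\sigma(A)=\inf\sigma_{\mathrm{dis}}(A)$. Put $\sigma_0=\inf\sigma_{\mathrm{ess}}(A)$. Let $r$ be a Carath\'eodory function on $\mathbb{R}^N\times\mathbb{R}$ satisfying: ($r_1$) $r(x,0)=0$ and $\lim_{|s|\to\infty}\frac{r(x,s)}{s}=0$ uniformly with respect to $x\in\mathbb{R}^N$; ($\widetilde r_2$) there exists $\beta>0$ such that $|r(x,s_1)-r(x,s_2)|\le\beta|s_1-s_2|$ for all $s_1,s_2\in\mathbb{R}$ and all $x\in\mathbb{R}^N$; ($r_3$) $\frac{r(x,s)}{s}\le 0$ for all $s\in\mathbb{R}\setminus\{0\}$ and all $x\in\mathbb{R}^N$; ($r_4$) the limit $r_0:=\lim_{s\to0}\frac{r(x,s)}{s}$ exists uniformly with respect to $x\in\mathbb{R}^N$ (with $r_0$ a constant). Let $a,b\in\mathbb{R}$ and $f(x,t)=at^-+bt^++r(x,t)$, $F(x,u)=\int_0^uf(x,s)\,ds$, and $$J(u)=\frac12\int_{\mathbb{R}^N}\left(|\nabla u|^2+V(x)u^2\right)dx-\int_{\mathbb{R}^N}F(x,u)\,dx,\qquad u\in X.$$ If $(a,b)\notin\Sigma(A)$ and $\max\{a,b\}<\sigma_0$, then $J$ satisfies the Palais-Smale (PS) condition on $X$.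
   Context: Kato-Rellich potential: $V=V_1+V_2$ real with $V_1\in L^p(\mathbb{R}^N)$, $V_2\in L^\infty(\mathbb{R}^N)$, where $p=2$ if $N\le3$, $p>2$ if $N=4$, $p>\frac N2$ if $N\ge5$. $A=-\Delta+V$ is self-adjoint on $L^2(\mathbb{R}^N)$ with domain $H^2(\mathbb{R}^N)$; $\sigma$, $\sigma_{\mathrm{dis}}$, $\sigma_{\mathrm{ess}}$ are the spectrum, discrete spectrum and essential spectrum. Notation: $t^+=\max\{t,0\}$, $t^-=\min\{t,0\}$ (so $t=t^++t^-$), and likewise $u^\pm$ for functions. Fučík spectrum: $\Sigma(A)$ is the set of all $(a,b)\in\mathbb{R}^2$ such that $Au=au^-+bu^+$ in $\mathbb{R}^N$, $u(x)\to0$ as $|x|\to\infty$, has a nontrivial solution $u$ in the form domain $H^1(\mathbb{R}^N)$ of $A$. The space $X$: fix $m>0$ large enough that $m+\inf\sigma(A)>0$ and $\inf\sigma(-\Delta+2V+2m)>1$. Then $X$ is $H^1(\mathbb{R}^N)$ with the norm $\|u\|_m=\left[\int_{\mathbb{R}^N}|\nabla u|^2+(V+m)u^2\,dx\right]^{1/2}$ and corresponding inner product; this norm is equivalent to the usual $H^1$ norm. (PS) condition: every sequence $\{u_n\}\subset X$ with $J(u_n)$ bounded and $J'(u_n)\to0$ has a convergent subsequence in $X$. *)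

theory Defs
  imports "HOL-Analysis.Analysis"
begin

text \<open>
  Functions on $\mathbb{R}^N$ are modelled as ordinary functions \<open>real ^ 'n \<Rightarrow> real\<close>, \<open>N = CARD('n)\<close>, with
  respect to Lebesgue measure; identification of functions that agree almost everywhere is made
  explicit with \<open>AE\<close>.
\<close>

subsection \<open>Lebesgue spaces\<close>

definition Lp :: "real \<Rightarrow> (real ^ 'n \<Rightarrow> real) set" where
  "Lp p = {u \<in> borel_measurable lebesgue. integrable lebesgue (\<lambda>x. \<bar>u x\<bar> powr p)}"

definition Linf :: "(real ^ 'n \<Rightarrow> real) set" where
  "Linf = {u \<in> borel_measurable lebesgue. \<exists>C. AE x in lebesgue. \<bar>u x\<bar> \<le> C}"

definition L2 :: "(real ^ 'n \<Rightarrow> real) set" where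
  "L2 = {u \<in> borel_measurable lebesgue. integrable lebesgue (\<lambda>x. (u x)\<^sup>2)}"

definition L2norm :: "(real ^ 'n \<Rightarrow> real) \<Rightarrow> real" where
  "L2norm u = sqrt (LINT x|lebesgue. (u x)\<^sup>2)"

definition locally_integrable :: "(real ^ 'n \<Rightarrow> real) \<Rightarrow> bool" where
  "locally_integrable u \<longleftrightarrow> (\<forall>K. compact K \<longrightarrow> set_integrable lebesgue K u)"

subsection \<open>Weak derivatives and Sobolev spaces\<close>

definition partial :: "'n \<Rightarrow> (real ^ 'n \<Rightarrow> real) \<Rightarrow> real ^ 'n \<Rightarrow> real" where
  "partial i f x = frechet_derivative f (at x) (axis i 1)"

primrec Ck :: "nat \<Rightarrow> (real ^ 'n \<Rightarrow> real) \<Rightarrow> bool" where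
  "Ck 0 f \<longleftrightarrow> continuous_on UNIV f"
| "Ck (Suc k) f \<longleftrightarrow> f differentiable_on UNIV \<and> (\<forall>i. Ck k (partial i f))"

definition test_function :: "(real ^ 'n \<Rightarrow> real) \<Rightarrow> bool" where
  "test_function \<phi> \<longleftrightarrow> (\<forall>k. Ck k \<phi>) \<and> compact (closure {x. \<phi> x \<noteq> 0})"

definition has_weak_partial :: "'n \<Rightarrow> (real ^ 'n \<Rightarrow> real) \<Rightarrow> (real ^ 'n \<Rightarrow> real) \<Rightarrow> bool" where
  "has_weak_partial i u g \<longleftrightarrow> locally_integrable u \<and> locally_integrable g \<and>
    (\<forall>\<phi>. test_function \<phi> \<longrightarrow>
      (LINT x|lebesgue. u x * partial i \<phi> x) = - (LINT x|lebesgue. g x * \<phi> x))"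

text \<open>A weak derivative is determined only almost everywhere; an arbitrary representative is chosen.\<close>

definition weak_partial :: "'n \<Rightarrow> (real ^ 'n \<Rightarrow> real) \<Rightarrow> real ^ 'n \<Rightarrow> real" where
  "weak_partial i u = (SOME g. has_weak_partial i u g)"

definition weak_grad :: "(real ^ 'n \<Rightarrow> real) \<Rightarrow> real ^ 'n \<Rightarrow> real ^ 'n" where
  "weak_grad u x = (\<chi> i. weak_partial i u x)"

definition weak_laplacian :: "(real ^ 'n \<Rightarrow> real) \<Rightarrow> real ^ 'n \<Rightarrow> real" where
  "weak_laplacian u x = (\<Sum>i\<in>UNIV. weak_partial i (weak_partial i u) x)"

definition H1 :: "(real ^ 'n \<Rightarrow> real) set" where
  "H1 = {u \<in> L2. \<forall>i. \<exists>g\<in>L2. has_weak_partial i u g}"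

definition H2 :: "(real ^ 'n \<Rightarrow> real) set" where
  "H2 = {u \<in> H1. \<forall>i. weak_partial i u \<in> H1}"

subsection \<open>Spectra of operators in \<open>L2\<close>\<close>

text \<open>
  An unbounded operator is given by its domain \<open>D\<close> and its action \<open>A\<close>. Everything takes place in the
  real space \<open>L2\<close>, and only real spectral parameters are considered: the operators of interest are
  self-adjoint with real coefficients, so their spectrum is real, and for real \<open>\<mu>\<close> invertibility of
  \<open>A - \<mu>\<close> and the dimension of its kernel are the same over the real and the complex scalars.
  In \<open>resolvent_set\<close>, the estimate makes \<open>A - \<mu>\<close> injective modulo null sets, with bounded inverse.
\<close>

definition resolvent_set ::
    "(real ^ 'n \<Rightarrow> real) set \<Rightarrow> ((real ^ 'n \<Rightarrow> real) \<Rightarrow> real ^ 'n \<Rightarrow> real) \<Rightarrow> real set" where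
  "resolvent_set D A = {\<mu>.
     (\<forall>f\<in>L2. \<exists>u\<in>D. AE x in lebesgue. A u x - \<mu> * u x = f x) \<and>
     (\<exists>C. \<forall>u\<in>D. L2norm u \<le> C * L2norm (\<lambda>x. A u x - \<mu> * u x))}"

definition spectrum ::
    "(real ^ 'n \<Rightarrow> real) set \<Rightarrow> ((real ^ 'n \<Rightarrow> real) \<Rightarrow> real ^ 'n \<Rightarrow> real) \<Rightarrow> real set" where
  "spectrum D A = - resolvent_set D A"

definition eigenspace ::
    "(real ^ 'n \<Rightarrow> real) set \<Rightarrow> ((real ^ 'n \<Rightarrow> real) \<Rightarrow> real ^ 'n \<Rightarrow> real) \<Rightarrow> real
      \<Rightarrow> (real ^ 'n \<Rightarrow> real) set" where
  "eigenspace D A \<mu> = {u \<in> D. AE x in lebesgue. A u x = \<mu> * u x}"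

definition finite_dim_ae :: "(real ^ 'n \<Rightarrow> real) set \<Rightarrow> bool" where
  "finite_dim_ae E \<longleftrightarrow> (\<exists>(k::nat) e. (\<forall>j<k. e j \<in> E) \<and>
     (\<forall>u\<in>E. \<exists>c :: nat \<Rightarrow> real. AE x in lebesgue. u x = (\<Sum>j<k. c j * e j x)))"

definition discrete_spectrum ::
    "(real ^ 'n \<Rightarrow> real) set \<Rightarrow> ((real ^ 'n \<Rightarrow> real) \<Rightarrow> real ^ 'n \<Rightarrow> real) \<Rightarrow> real set" where
  "discrete_spectrum D A = {\<mu>. \<mu> isolated_in spectrum D A \<and>
     (\<exists>u\<in>eigenspace D A \<mu>. \<not> (AE x in lebesgue. u x = 0)) \<and>
     finite_dim_ae (eigenspace D A \<mu>)}"

definition essential_spectrum ::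
    "(real ^ 'n \<Rightarrow> real) set \<Rightarrow> ((real ^ 'n \<Rightarrow> real) \<Rightarrow> real ^ 'n \<Rightarrow> real) \<Rightarrow> real set" where
  "essential_spectrum D A = spectrum D A - discrete_spectrum D A"

subsection \<open>Schroedinger operators\<close>

definition kato_rellich :: "(real ^ 'n \<Rightarrow> real) \<Rightarrow> bool" where
  "kato_rellich V \<longleftrightarrow> (\<exists>p V1 V2.
     (CARD('n) \<le> 3 \<longrightarrow> p = 2) \<and>
     (CARD('n) = 4 \<longrightarrow> p > 2) \<and>
     (CARD('n) \<ge> 5 \<longrightarrow> p > real CARD('n) / 2) \<and>
     V1 \<in> Lp p \<and> V2 \<in> Linf \<and> V = (\<lambda>x. V1 x + V2 x))"

text \<open>The operator $-\Delta + V$; its domain is always taken to be \<open>H2\<close>.\<close>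

definition schroedinger :: "(real ^ 'n \<Rightarrow> real) \<Rightarrow> (real ^ 'n \<Rightarrow> real) \<Rightarrow> real ^ 'n \<Rightarrow> real" where
  "schroedinger V u x = - weak_laplacian u x + V x * u x"

definition neg_part :: "real \<Rightarrow> real" where "neg_part t = min t 0"
definition pos_part :: "real \<Rightarrow> real" where "pos_part t = max t 0"

text \<open>Limit at infinity of a function known up to null sets.\<close>

definition vanishes_at_infinity :: "(real ^ 'n \<Rightarrow> real) \<Rightarrow> bool" where
  "vanishes_at_infinity u \<longleftrightarrow>
    (\<forall>\<epsilon>>0. \<exists>R. AE x in lebesgue. norm x \<ge> R \<longrightarrow> \<bar>u x\<bar> < \<epsilon>)"

text \<open>
  Solutions are sought in the form domain \<open>H1\<close>, so the equation $Au = au^- + bu^+$ is read in the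
  sense of the quadratic form of $A$.
\<close>

definition fucik_spectrum :: "(real ^ 'n \<Rightarrow> real) \<Rightarrow> (real \<times> real) set" where
  "fucik_spectrum V = {(a, b). \<exists>u\<in>H1.
     \<not> (AE x in lebesgue. u x = 0) \<and>
     (\<forall>\<phi>\<in>H1. (LINT x|lebesgue. weak_grad u x \<bullet> weak_grad \<phi> x + V x * u x * \<phi> x) =
            (LINT x|lebesgue. (a * neg_part (u x) + b * pos_part (u x)) * \<phi> x)) \<and>
     vanishes_at_infinity u}"

subsection \<open>The Palais-Smale condition\<close>

text \<open>
  A normed space of functions is given by its carrier \<open>X\<close> and its norm \<open>\<nu>\<close>
  (which is definite only modulo null sets).
\<close>

definition has_frechet_deriv ::
    "('a \<Rightarrow> real) set \<Rightarrow> (('a \<Rightarrow> real) \<Rightarrow> real) \<Rightarrow> (('a \<Rightarrow> real) \<Rightarrow> real)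
      \<Rightarrow> ('a \<Rightarrow> real) \<Rightarrow> (('a \<Rightarrow> real) \<Rightarrow> real) \<Rightarrow> bool" where
  "has_frechet_deriv X \<nu> J u L \<longleftrightarrow>
     (\<forall>g\<in>X. \<forall>h\<in>X. L (\<lambda>x. g x + h x) = L g + L h) \<and>
     (\<forall>c. \<forall>h\<in>X. L (\<lambda>x. c * h x) = c * L h) \<and>
     (\<exists>C. \<forall>h\<in>X. \<bar>L h\<bar> \<le> C * \<nu> h) \<and>
     (\<forall>\<epsilon>>0. \<exists>\<delta>>0. \<forall>h\<in>X. \<nu> h < \<delta> \<longrightarrow> \<bar>J (\<lambda>x. u x + h x) - J u - L h\<bar> \<le> \<epsilon> * \<nu> h)"

definition frechet_deriv ::
    "('a \<Rightarrow> real) set \<Rightarrow> (('a \<Rightarrow> real) \<Rightarrow> real) \<Rightarrow> (('a \<Rightarrow> real) \<Rightarrow> real)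
      \<Rightarrow> ('a \<Rightarrow> real) \<Rightarrow> ('a \<Rightarrow> real) \<Rightarrow> real" where
  "frechet_deriv X \<nu> J u = (SOME L. has_frechet_deriv X \<nu> J u L)"

definition dual_norm ::
    "('a \<Rightarrow> real) set \<Rightarrow> (('a \<Rightarrow> real) \<Rightarrow> real) \<Rightarrow> (('a \<Rightarrow> real) \<Rightarrow> real) \<Rightarrow> real" where
  "dual_norm X \<nu> L = (SUP h\<in>{h \<in> X. \<nu> h \<le> 1}. \<bar>L h\<bar>)"

definition palais_smale ::
    "('a \<Rightarrow> real) set \<Rightarrow> (('a \<Rightarrow> real) \<Rightarrow> real) \<Rightarrow> (('a \<Rightarrow> real) \<Rightarrow> real) \<Rightarrow> bool" where
  "palais_smale X \<nu> J \<longleftrightarrow> (\<forall>u :: nat \<Rightarrow> 'a \<Rightarrow> real.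
     (\<forall>n. u n \<in> X) \<and> bounded (range (\<lambda>n. J (u n))) \<and>
     (\<lambda>n. dual_norm X \<nu> (frechet_deriv X \<nu> J (u n))) \<longlonglongrightarrow> 0 \<longrightarrow>
     (\<exists>k. strict_mono k \<and> (\<exists>v\<in>X. (\<lambda>n. \<nu> (\<lambda>x. u (k n) x - v x)) \<longlonglongrightarrow> 0)))"

subsection \<open>The variational setting\<close>

definition norm_m :: "(real ^ 'n \<Rightarrow> real) \<Rightarrow> real \<Rightarrow> (real ^ 'n \<Rightarrow> real) \<Rightarrow> real" where
  "norm_m V m u = sqrt (LINT x|lebesgue. (norm (weak_grad u x))\<^sup>2 + (V x + m) * (u x)\<^sup>2)"

definition caratheodory :: "(real ^ 'n \<Rightarrow> real \<Rightarrow> real) \<Rightarrow> bool" where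
  "caratheodory r \<longleftrightarrow> (\<forall>s. (\<lambda>x. r x s) \<in> borel_measurable lebesgue) \<and>
     (AE x in lebesgue. continuous_on UNIV (r x))"

definition nonlin :: "real \<Rightarrow> real \<Rightarrow> (real ^ 'n \<Rightarrow> real \<Rightarrow> real) \<Rightarrow> real ^ 'n \<Rightarrow> real \<Rightarrow> real" where
  "nonlin a b r x t = a * neg_part t + b * pos_part t + r x t"

text \<open>The interval integral is oriented, so \<open>primitive f x t\<close> is also correct for negative \<open>t\<close>.\<close>

definition primitive :: "(real ^ 'n \<Rightarrow> real \<Rightarrow> real) \<Rightarrow> real ^ 'n \<Rightarrow> real \<Rightarrow> real" where
  "primitive f x t = (LBINT s=ereal 0..ereal t. f x s)"

definition energy :: "(real ^ 'n \<Rightarrow> real) \<Rightarrow> (real ^ 'n \<Rightarrow> real \<Rightarrow> real) \<Rightarrow> (real ^ 'n \<Rightarrow> real) \<Rightarrow> real" where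
  "energy V f u = 1 / 2 * (LINT x|lebesgue. (norm (weak_grad u x))\<^sup>2 + V x * (u x)\<^sup>2)
     - (LINT x|lebesgue. primitive f x (u x))"

end

(*
  The embedding of H^1 into L^2 is not compact on R^N; compactness is recovered from the spectral gap
  below the essential spectrum. Since r(x,s)/s <= 0, the nonlinearity is f(x,u) = d(x) u with
  d <= M = max(a,b) < sigma_0, while <A w, w> >= gamma |w|^2 - o(1) along weakly null sequences for every
  gamma < sigma_0. Hence bounded Palais-Smale sequences are precompact. If a Palais-Smale sequence is
  unbounded, the sequence normalised by s_n = |u_n| is precompact for the same reason, and its limit v,
  of norm one, solves A v = a v^- + b v^+ because r(x, s_n v) / s_n -> 0. A De Giorgi iteration against
  exponential barriers shows that v vanishes at infinity, so (a,b) lies in the Fucik spectrum, a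
  contradiction.

  All spectral facts are derived from the bounded symmetric resolvent R = (A + lambda)^(-1). If, for every
  T > t, the norm of (T - R) w_n controls that of w_n up to o(1) along a class of bounded sequences stable
  under R, then t - R is almost nonnegative along that class; this is applied to constant sequences and to
  weakly null ones, which isolated eigenvalues of finite multiplicity do not see. Multiplication by a
  function in L^p is controlled by averages over boxes at dyadic scales, in place of Sobolev embeddings.
*)
theory Submission
  imports Defs "HOL-Complex_Analysis.Great_Picard"
begin

text \<open>Two obstacles shape the proof. Spectral hypotheses on the unbounded A are read as lower
  bounds for |(T - R) w|, where mu = 1/T - lambda is the corresponding point for A. The resulting
  bound on <R w, w> returns to the form through the Cauchy-Schwarz inequality of A + lambda between
  w and R w, that is |w|^4 <= (<A w, w> + lambda |w|^2) <R w, w>.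

  The potential is only in L^p plus bounded. Multiplying a box average at scale h by V_1 costs
  h^(-N/p), while the averaging error is of order h^2 on H^2; for the form, sqrt |V_1| costs
  h^(-N/(2p)) against an error of order h on H^1. In both cases p > N/2 makes the sum over scales
  converge. Only translations are involved, and their difference quotients also give the weak
  derivatives and the H^2 regularity of the free resolvent.

  The Fucik spectrum asks for solutions that vanish at infinity, which convergence in H^1 does not
  supply; hence the De Giorgi iteration. The right-hand side a v^- + b v^+ equals c v with c bounded
  and is absorbed into the potential there.\<close>

section \<open>The Hilbert space \<open>L2\<close>\<close>

lemma L2_measurable: "u \<in> L2 \<Longrightarrow> u \<in> borel_measurable lebesgue"
  by (simp add: L2_def)

lemma L2_integrable_mult:
  assumes "u \<in> L2" "v \<in> L2"
  shows "integrable lebesgue (\<lambda>x. u x * v x)"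
proof (rule Bochner_Integration.integrable_bound[of _ "\<lambda>x. (u x)\<^sup>2 + (v x)\<^sup>2"])
  show "integrable lebesgue (\<lambda>x. (u x)\<^sup>2 + (v x)\<^sup>2)"
    using assms by (auto simp: L2_def)
  have [measurable]: "u \<in> borel_measurable lebesgue" "v \<in> borel_measurable lebesgue"
    using assms by (auto simp: L2_def)
  show "(\<lambda>x. u x * v x) \<in> borel_measurable lebesgue" by measurable
  have "\<bar>a * b\<bar> \<le> a\<^sup>2 + b\<^sup>2" for a b :: real
  proof -
    have "0 \<le> (\<bar>a\<bar> - \<bar>b\<bar>)\<^sup>2" by simp
    then have "2 * \<bar>a * b\<bar> \<le> a\<^sup>2 + b\<^sup>2" by (simp add: power2_diff abs_mult mult.assoc)
    then show ?thesis using abs_ge_zero[of "a * b"] by linarith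
  qed
  then show "AE x in lebesgue. norm (u x * v x) \<le> norm ((u x)\<^sup>2 + (v x)\<^sup>2)"
    by (intro AE_I2) (auto intro: order_trans)
qed

lemma L2_zero: "(\<lambda>x. 0) \<in> L2"
  by (simp add: L2_def)

lemma L2_scale: "u \<in> L2 \<Longrightarrow> (\<lambda>x. c * u x) \<in> L2"
  by (auto simp: L2_def power_mult_distrib)

lemma L2_add:
  assumes "u \<in> L2" "v \<in> L2"
  shows "(\<lambda>x. u x + v x) \<in> L2"
proof -
  have "integrable lebesgue (\<lambda>x. (u x)\<^sup>2 + (v x)\<^sup>2 + 2 * (u x * v x))"
    using assms L2_integrable_mult[OF assms] by (auto simp: L2_def)
  then show ?thesis
    using assms by (auto simp: L2_def power2_sum mult.assoc)
qed

lemma L2_uminus: "u \<in> L2 \<Longrightarrow> (\<lambda>x. - u x) \<in> L2"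
  by (auto simp: L2_def)

lemma L2_diff:
  assumes "u \<in> L2" "v \<in> L2"
  shows "(\<lambda>x. u x - v x) \<in> L2"
  using L2_add[OF assms(1) L2_uminus[OF assms(2)]] by simp

lemma L2_bound:
  assumes "u \<in> L2" and [measurable]: "v \<in> borel_measurable lebesgue"
    and "AE x in lebesgue. \<bar>v x\<bar> \<le> \<bar>u x\<bar>"
  shows "v \<in> L2"
proof -
  have [measurable]: "u \<in> borel_measurable lebesgue" using assms(1) by (rule L2_measurable)
  have "integrable lebesgue (\<lambda>x. (v x)\<^sup>2)"
    by (rule Bochner_Integration.integrable_bound[of _ "\<lambda>x. (u x)\<^sup>2"])
      (use assms in \<open>auto simp: L2_def abs_le_square_iff\<close>)
  then show ?thesis by (simp add: L2_def)
qed

lemma L2_cong_AE: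
  assumes "u \<in> L2" "v \<in> borel_measurable lebesgue" "AE x in lebesgue. u x = v x"
  shows "v \<in> L2"
  by (rule L2_bound[OF assms(1,2)]) (use assms(3) in auto)

lemma L2_abs: "u \<in> L2 \<Longrightarrow> (\<lambda>x. \<bar>u x\<bar>) \<in> L2"
  by (rule L2_bound) (auto simp: L2_def)

lemma L2_sum: "(\<And>i. i \<in> I \<Longrightarrow> f i \<in> L2) \<Longrightarrow> (\<lambda>x. \<Sum>i\<in>I. f i x) \<in> L2"
proof (induction I rule: infinite_finite_induct)
  case (insert a F) then show ?case by (auto intro: L2_add)
qed (auto simp: L2_zero)

lemma L2_mult_bounded:
  assumes "u \<in> L2" and [measurable]: "g \<in> borel_measurable lebesgue" and "AE x in lebesgue. \<bar>g x\<bar> \<le> C"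
  shows "(\<lambda>x. g x * u x) \<in> L2"
proof (rule L2_bound[OF L2_scale[OF assms(1), of C]])
  have [measurable]: "u \<in> borel_measurable lebesgue" using assms(1) by (rule L2_measurable)
  show "(\<lambda>x. g x * u x) \<in> borel_measurable lebesgue" by measurable
  show "AE x in lebesgue. \<bar>g x * u x\<bar> \<le> \<bar>C * u x\<bar>"
    using assms(3) by eventually_elim (auto simp: abs_mult intro!: mult_right_mono)
qed

text \<open>Membership in \<open>L2\<close> is part of the relation, so it is reflexive exactly on
  \<open>L2\<close> and the partial quotient contains no classes of other functions.\<close>

definition l2eq :: "(real ^ 'n \<Rightarrow> real) \<Rightarrow> (real ^ 'n \<Rightarrow> real) \<Rightarrow> bool" where
  "l2eq u v \<longleftrightarrow> u \<in> L2 \<and> v \<in> L2 \<and> (AE x in lebesgue. u x = v x)"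

lemma part_equivp_l2eq: "part_equivp (l2eq :: (real ^ 'n \<Rightarrow> real) \<Rightarrow> _)"
proof (rule part_equivpI)
  show "\<exists>x::real ^ 'n \<Rightarrow> real. l2eq x x" by (auto simp: l2eq_def intro!: exI[of _ "\<lambda>_. 0"] L2_zero)
  show "symp (l2eq :: (real ^ 'n \<Rightarrow> real) \<Rightarrow> _)" by (auto simp: symp_def l2eq_def elim: AE_mp)
  show "transp (l2eq :: (real ^ 'n \<Rightarrow> real) \<Rightarrow> _)" unfolding transp_def l2eq_def by (auto elim: AE_mp)
qed

\<comment> \<open>The quotient of \<open>L2\<close> by equality almost everywhere as a Hilbert
  space\<close>
quotient_type 'n l2 = "real ^ ('n::finite) \<Rightarrow> real" / partial: l2eq
  by (rule part_equivp_l2eq)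

instantiation l2 :: (finite) real_vector
begin

lift_definition zero_l2 :: "'a l2" is "\<lambda>x. 0"
  by (auto simp: l2eq_def L2_zero)

lift_definition plus_l2 :: "'a l2 \<Rightarrow> 'a l2 \<Rightarrow> 'a l2" is "\<lambda>u v x. u x + v x"
  by (auto simp: l2eq_def intro!: L2_add)

lift_definition minus_l2 :: "'a l2 \<Rightarrow> 'a l2 \<Rightarrow> 'a l2" is "\<lambda>u v x. u x - v x"
  by (auto simp: l2eq_def intro!: L2_diff)

lift_definition uminus_l2 :: "'a l2 \<Rightarrow> 'a l2" is "\<lambda>u x. - u x"
  by (auto simp: l2eq_def intro!: L2_uminus)

lift_definition scaleR_l2 :: "real \<Rightarrow> 'a l2 \<Rightarrow> 'a l2" is "\<lambda>c u x. c * u x"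
  by (auto simp: l2eq_def intro!: L2_scale)

instance
proof
  fix a b c :: "'a l2" and r s :: real
  show "a + b + c = a + (b + c)" by transfer (auto simp: l2eq_def L2_add add.assoc)
  show "a + b = b + a" by transfer (auto simp: l2eq_def L2_add add.commute)
  show "0 + a = a" by transfer (auto simp: l2eq_def)
  show "- a + a = 0" by transfer (auto simp: l2eq_def L2_zero)
  show "a - b = a + - b" by transfer (auto simp: l2eq_def L2_diff)
  show "r *\<^sub>R (a + b) = r *\<^sub>R a + r *\<^sub>R b"
    by transfer (auto simp: l2eq_def L2_add L2_scale algebra_simps)
  show "(r + s) *\<^sub>R a = r *\<^sub>R a + s *\<^sub>R a"
    by transfer (auto simp: l2eq_def L2_add L2_scale algebra_simps)
  show "r *\<^sub>R s *\<^sub>R a = (r * s) *\<^sub>R a"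
    by transfer (auto simp: l2eq_def L2_scale algebra_simps)
  show "1 *\<^sub>R a = a" by transfer (auto simp: l2eq_def)
qed

end

instantiation l2 :: (finite) real_inner
begin

lift_definition inner_l2 :: "'a l2 \<Rightarrow> 'a l2 \<Rightarrow> real" is "\<lambda>u v. LINT x|lebesgue. u x * v x"
proof -
  fix u v u' v' :: "real ^ 'a \<Rightarrow> real"
  assume h: "l2eq u v" "l2eq u' v'"
  have [measurable]: "u \<in> borel_measurable lebesgue" "v \<in> borel_measurable lebesgue"
     "u' \<in> borel_measurable lebesgue" "v' \<in> borel_measurable lebesgue"
    using h by (auto simp: l2eq_def L2_def)
  show "(LINT x|lebesgue. u x * u' x) = (LINT x|lebesgue. v x * v' x)"
    using h by (intro integral_cong_AE) (auto simp: l2eq_def)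
qed

definition norm_l2 :: "'a l2 \<Rightarrow> real" where "norm_l2 x = sqrt (inner x x)"
definition dist_l2 :: "'a l2 \<Rightarrow> 'a l2 \<Rightarrow> real" where "dist_l2 x y = norm (x - y)"
definition sgn_l2 :: "'a l2 \<Rightarrow> 'a l2" where "sgn_l2 x = x /\<^sub>R norm x"
definition uniformity_l2 :: "('a l2 \<times> 'a l2) filter" where
  "uniformity_l2 = (INF e\<in>{0 <..}. principal {(x, y). dist x y < e})"
definition open_l2 :: "'a l2 set \<Rightarrow> bool" where
  "open_l2 U \<longleftrightarrow> (\<forall>x\<in>U. eventually (\<lambda>(x', y). x' = x \<longrightarrow> y \<in> U) uniformity)"

instance
proof
  fix a b c :: "'a l2" and r s :: real
  show "dist a b = norm (a - b)" by (rule dist_l2_def)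
  show "sgn a = a /\<^sub>R norm a" by (rule sgn_l2_def)
  show "uniformity = (INF e\<in>{0 <..}. principal {(x :: 'a l2, y). dist x y < e})"
    by (rule uniformity_l2_def)
  show "open U = (\<forall>x\<in>U. eventually (\<lambda>(x', y). x' = x \<longrightarrow> y \<in> U) uniformity)" for U :: "'a l2 set"
    by (rule open_l2_def)
  show "a \<bullet> b = b \<bullet> a" by transfer (simp add: mult.commute)
  show "(a + b) \<bullet> c = a \<bullet> c + b \<bullet> c"
    by transfer (simp add: l2eq_def algebra_simps L2_integrable_mult)
  show "(r *\<^sub>R a) \<bullet> b = r * (a \<bullet> b)"
    by transfer (simp add: mult.assoc)
  show "0 \<le> a \<bullet> a" by transfer simp
  show "(a \<bullet> a = 0) = (a = 0)"
  proof transfer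
    fix u :: "real ^ 'a \<Rightarrow> real" assume "l2eq u u"
    then have "u \<in> L2" by (simp add: l2eq_def)
    then have "(LINT x|lebesgue. u x * u x) = 0 \<longleftrightarrow> (AE x in lebesgue. u x * u x = 0)"
      using L2_integrable_mult[of u u] by (intro integral_nonneg_eq_0_iff_AE) auto
    then show "(LINT x|lebesgue. u x * u x) = 0 \<longleftrightarrow> l2eq u (\<lambda>x. 0)"
      using \<open>u \<in> L2\<close> by (auto simp: l2eq_def L2_zero)
  qed
  show "norm a = sqrt (a \<bullet> a)" by (rule norm_l2_def)
qed

end

definition l2_of :: "(real ^ 'n \<Rightarrow> real) \<Rightarrow> 'n l2" where "l2_of = abs_l2"
text \<open>The representative is an arbitrary choice, so every pointwise identity for it holds only
  almost everywhere.\<close>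

definition rep :: "'n l2 \<Rightarrow> real ^ 'n \<Rightarrow> real" where "rep = rep_l2"

lemma rep_L2 [simp]: "rep x \<in> L2"
  using Quotient3_rep_reflp[OF Quotient3_l2, of x] by (simp add: l2eq_def rep_def)

lemma rep_measurable [measurable, simp]: "rep x \<in> borel_measurable lebesgue"
  using rep_L2 by (rule L2_measurable)

lemma l2_of_rep [simp]: "l2_of (rep x) = x"
  using Quotient3_abs_rep[OF Quotient3_l2] by (simp add: l2_of_def rep_def)

lemma rep_l2_of: "u \<in> L2 \<Longrightarrow> AE x in lebesgue. rep (l2_of u) x = u x"
  using Quotient3_rep_abs[OF Quotient3_l2, of u] by (simp add: l2eq_def rep_def l2_of_def)

lemma l2_of_eq_iff:
  assumes "u \<in> L2" "v \<in> L2"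
  shows "l2_of u = l2_of v \<longleftrightarrow> (AE x in lebesgue. u x = v x)"
  using Quotient3_rel[OF Quotient3_l2, of u v] assms by (simp add: l2eq_def l2_of_def)

lemma l2_of_cong:
  assumes "u \<in> L2" "v \<in> borel_measurable lebesgue" "AE x in lebesgue. u x = v x"
  shows "l2_of u = l2_of v"
  using l2_of_eq_iff[OF assms(1) L2_cong_AE[OF assms]] assms(3) by simp

lemma l2_of_zero: "l2_of (\<lambda>x. 0) = 0"
  by (simp add: l2_of_def zero_l2_def)

lemma l2_of_add:
  assumes "u \<in> L2" "v \<in> L2"
  shows "l2_of (\<lambda>x. u x + v x) = l2_of u + l2_of v"
  using assms by (simp add: l2_of_def plus_l2.abs_eq l2eq_def)

lemma l2_of_diff:
  assumes "u \<in> L2" "v \<in> L2"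
  shows "l2_of (\<lambda>x. u x - v x) = l2_of u - l2_of v"
  using assms by (simp add: l2_of_def minus_l2.abs_eq l2eq_def)

lemma l2_of_uminus: "u \<in> L2 \<Longrightarrow> l2_of (\<lambda>x. - u x) = - l2_of u"
  by (simp add: l2_of_def uminus_l2.abs_eq l2eq_def)

lemma l2_of_scale: "u \<in> L2 \<Longrightarrow> l2_of (\<lambda>x. c * u x) = c *\<^sub>R l2_of u"
  by (simp add: l2_of_def scaleR_l2.abs_eq l2eq_def)

lemma l2_of_sum:
  assumes "\<And>i. i \<in> I \<Longrightarrow> f i \<in> L2"
  shows "l2_of (\<lambda>x. \<Sum>i\<in>I. f i x) = (\<Sum>i\<in>I. l2_of (f i))"
  using assms
proof (induction I rule: infinite_finite_induct)
  case (insert a F) then show ?case by (simp add: l2_of_add L2_sum)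
qed (auto simp: l2_of_zero)

lemma inner_l2_of:
  assumes "u \<in> L2" "v \<in> L2"
  shows "l2_of u \<bullet> l2_of v = (LINT x|lebesgue. u x * v x)"
  using assms by (simp add: l2_of_def inner_l2.abs_eq l2eq_def)

lemma inner_l2_rep: "x \<bullet> y = (LINT t|lebesgue. rep x t * rep y t)"
  using inner_l2_of[of "rep x" "rep y"] by simp

lemma norm_l2_of: "u \<in> L2 \<Longrightarrow> norm (l2_of u) = L2norm u"
  by (simp add: norm_eq_sqrt_inner inner_l2_of L2norm_def power2_eq_square)

lemma norm_l2_rep: "(norm x)\<^sup>2 = (LINT t|lebesgue. (rep x t)\<^sup>2)"
  unfolding power2_norm_eq_inner unfolding inner_l2_rep power2_eq_square ..

lemma norm_l2_of_sq: "u \<in> L2 \<Longrightarrow> (norm (l2_of u))\<^sup>2 = (LINT t|lebesgue. (u t)\<^sup>2)"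
  unfolding power2_norm_eq_inner by (simp only: inner_l2_of power2_eq_square)

lemma rep_add: "AE t in lebesgue. rep (x + y) t = rep x t + rep y t"
  using rep_l2_of[OF L2_add[of "rep x" "rep y"]] by (simp add: l2_of_add)

lemma rep_diff: "AE t in lebesgue. rep (x - y) t = rep x t - rep y t"
  using rep_l2_of[OF L2_diff[of "rep x" "rep y"]] by (simp add: l2_of_diff)

lemma rep_scale: "AE t in lebesgue. rep (c *\<^sub>R x) t = c * rep x t"
  using rep_l2_of[OF L2_scale[of "rep x" c]] by (simp add: l2_of_scale)

lemma rep_zero: "AE t in lebesgue. rep 0 t = 0"
  using rep_l2_of[OF L2_zero] by (simp add: l2_of_zero)

lemma rep_eq_iff: "x = y \<longleftrightarrow> (AE t in lebesgue. rep x t = rep y t)"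
  using l2_of_eq_iff[of "rep x" "rep y"] by simp

lemma l2_of_norm_mono:
  assumes "u \<in> L2" "v \<in> L2" "AE x in lebesgue. \<bar>v x\<bar> \<le> \<bar>u x\<bar>"
  shows "norm (l2_of v) \<le> norm (l2_of u)"
proof -
  have "(norm (l2_of v))\<^sup>2 \<le> (norm (l2_of u))\<^sup>2"
    unfolding norm_l2_of_sq[OF assms(1)] norm_l2_of_sq[OF assms(2)]
    using assms by (intro integral_mono_AE) (auto simp: L2_def abs_le_square_iff)
  then show ?thesis by (rule power2_le_imp_le) simp
qed

lemma nn_integral_L2:
  assumes "u \<in> L2"
  shows "(\<integral>\<^sup>+x. ennreal ((u x)\<^sup>2) \<partial>lebesgue) = ennreal ((norm (l2_of u))\<^sup>2)"
  using assms by (subst nn_integral_eq_integral) (auto simp: L2_def norm_l2_of_sq)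

lemma L2_nn_integral:
  assumes [measurable]: "u \<in> borel_measurable lebesgue" and "(\<integral>\<^sup>+x. ennreal ((u x)\<^sup>2) \<partial>lebesgue) < \<infinity>"
  shows "u \<in> L2"
  unfolding L2_def using assms by (auto intro!: integrableI_nonneg)

text \<open>The squared differences converge to 0 in L1, and L1 convergence gives a subsequence
  converging almost everywhere.\<close>

lemma tendsto_l2_AE_subseq:
  assumes "f \<longlonglongrightarrow> (x :: 'n::finite l2)"
  obtains k where "strict_mono (k::nat \<Rightarrow> nat)" "AE t in lebesgue. (\<lambda>n. rep (f (k n)) t) \<longlonglongrightarrow> rep x t"
proof -
  define u where "u n t = (rep (f n) t - rep x t)\<^sup>2" for n t
  have d: "(\<lambda>t. rep (f n) t - rep x t) \<in> L2" for n by (rule L2_diff) auto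
  have int: "integrable lebesgue (u n)" for n
    using d[of n] by (auto simp: L2_def u_def[abs_def])
  have "(LINT t|lebesgue. norm (u n t)) = (norm (f n - x))\<^sup>2" for n
    using norm_l2_of_sq[OF d[of n]] by (simp add: u_def l2_of_diff)
  moreover have "(\<lambda>n. (norm (f n - x))\<^sup>2) \<longlonglongrightarrow> 0"
    using assms by (auto intro!: tendsto_eq_intros simp: tendsto_norm_zero_iff LIM_zero_iff)
  ultimately obtain k where "strict_mono k" "AE t in lebesgue. (\<lambda>n. u (k n) t) \<longlonglongrightarrow> 0"
    using tendsto_L1_AE_subseq[of lebesgue u, OF int] by auto
  moreover have "(\<lambda>n. rep (f (k n)) t) \<longlonglongrightarrow> rep x t" if "(\<lambda>n. u (k n) t) \<longlonglongrightarrow> 0" for t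
  proof -
    have "(\<lambda>n. sqrt (u (k n) t)) \<longlonglongrightarrow> 0" using tendsto_real_sqrt[OF that] by simp
    then have "(\<lambda>n. \<bar>rep (f (k n)) t - rep x t\<bar>) \<longlonglongrightarrow> 0" by (simp add: u_def)
    then show ?thesis using LIM_zero_iff tendsto_rabs_zero_iff by blast
  qed
  ultimately show ?thesis by (intro that[of k]) auto
qed

text \<open>Riesz-Fischer. Along a subsequence with increments of norm at most 2^(-k) the series of
  increments converges almost everywhere; Fatou's lemma shows that the pointwise limit is also the
  limit in norm.\<close>

instance l2 :: (finite) complete_space
proof
  fix X :: "nat \<Rightarrow> 'a l2" assume "Cauchy X"
  then have "\<forall>k. \<exists>N. \<forall>m\<ge>N. \<forall>n\<ge>N. norm (X m - X n) < (1/2)^k"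
    by (auto simp: Cauchy_def dist_norm)
  then obtain N where N: "\<And>k m n. m \<ge> N k \<Longrightarrow> n \<ge> N k \<Longrightarrow> norm (X m - X n) < (1/2)^k"
    by metis
  \<comment> \<open>Summing the thresholds makes the indices increasing in \<open>k\<close> while
    \<open>M k\<close> still dominates \<open>N k\<close>.\<close>
  define M where "M k = (\<Sum>j\<le>k. N j) + k" for k
  have MN: "M k \<ge> N k" for k unfolding M_def by (auto intro!: trans_le_add1 member_le_sum)
  have M_mono: "M j \<le> M k" if "j \<le> k" for j k
    unfolding M_def using that by (auto intro!: add_mono sum_mono2)
  define f where "f k = rep (X (M k))" for k
  define d where "d k t = f (Suc k) t - f k t" for k t
  have [measurable]: "f k \<in> borel_measurable lebesgue" "d k \<in> borel_measurable lebesgue" for k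
    by (auto simp: f_def d_def[abs_def])
  have dL: "d k \<in> L2" for k unfolding d_def f_def by (rule L2_diff) auto
  have "norm (l2_of (d k)) \<le> (1/2)^k" for k
    using N[of k "M (Suc k)" "M k"] MN[of k] M_mono[of k "Suc k"]
    by (simp add: d_def[abs_def] f_def l2_of_diff)
  then have dn: "(norm (l2_of (d k)))\<^sup>2 \<le> (1/4)^k" for k
    using power_mono[of "norm (l2_of (d k))" "(1/2)^k" 2] by (simp add: power2_eq_square flip: power_mult_distrib)
  have "(\<integral>\<^sup>+t. (\<Sum>k. ennreal (2^k * (d k t)\<^sup>2)) \<partial>lebesgue) = (\<Sum>k. \<integral>\<^sup>+t. ennreal (2^k * (d k t)\<^sup>2) \<partial>lebesgue)"
    by (rule nn_integral_suminf) measurable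
  also have "\<dots> = (\<Sum>k. ennreal (2^k * (norm (l2_of (d k)))\<^sup>2))"
    by (simp add: ennreal_mult' nn_integral_cmult nn_integral_L2[OF dL])
  also have "\<dots> \<le> (\<Sum>k. ennreal ((1/2)^k))"
  proof (rule suminf_le)
    fix k :: nat
    have "2^k * (norm (l2_of (d k)))\<^sup>2 \<le> 2^k * (1/4)^k" using dn[of k] by (intro mult_left_mono) auto
    also have "\<dots> = (1/2)^k" by (simp flip: power_mult_distrib)
    finally show "ennreal (2^k * (norm (l2_of (d k)))\<^sup>2) \<le> ennreal ((1/2)^k)" by (rule ennreal_leI)
  qed auto
  also have "\<dots> = ennreal (\<Sum>k. (1/2)^k)"
    by (intro suminf_ennreal2) (auto intro: summable_geometric)
  also have "\<dots> < \<infinity>" by simp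
  finally have "AE t in lebesgue. (\<Sum>k. ennreal (2^k * (d k t)\<^sup>2)) \<noteq> \<infinity>"
    by (intro nn_integral_noteq_infinite) auto
  then have "AE t in lebesgue. convergent (\<lambda>k. f k t)"
  proof eventually_elim
    fix t assume "(\<Sum>k. ennreal (2^k * (d k t)\<^sup>2)) \<noteq> \<infinity>"
    then have s: "summable (\<lambda>k. 2^k * (d k t)\<^sup>2)"
      by (intro summable_suminf_not_top) auto
    have "summable (\<lambda>k. d k t)"
    proof (rule summable_comparison_test')
      show "summable (\<lambda>k. 2^k * (d k t)\<^sup>2 + (1/2)^k)"
        using s by (intro summable_add summable_geometric) auto
      fix k :: nat
      \<comment> \<open>The weight 2^k in the series above is chosen for this inequality: it bounds
        the increment itself by two summable terms.\<close>
      have "2 * \<bar>d k t\<bar> \<le> 2^k * (d k t)\<^sup>2 + (1/2)^k"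
      proof -
        have "0 \<le> 2^k * (\<bar>d k t\<bar> - (1/2)^k)\<^sup>2" by simp
        also have "\<dots> = 2^k * (d k t)\<^sup>2 + (2^k * (1/2)^k) * (1/2)^k - 2 * (2^k * (1/2)^k) * \<bar>d k t\<bar>"
          by (simp add: power2_eq_square algebra_simps flip: abs_mult)
        also have "2^k * (1/2::real)^k = 1" by (simp flip: power_mult_distrib)
        finally show ?thesis by simp
      qed
      then show "norm (d k t) \<le> 2^k * (d k t)\<^sup>2 + (1/2)^k" by simp
    qed
    then have "convergent (\<lambda>n. \<Sum>k<n. d k t)" by (simp add: summable_iff_convergent)
    moreover have "(\<Sum>k<n. d k t) = f n t - f 0 t" for n
      using sum_lessThan_telescope[of "\<lambda>k. f k t" n] by (simp add: d_def)
    ultimately have "convergent (\<lambda>n. f n t - f 0 t)" by simp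
    then have "convergent (\<lambda>n. (f n t - f 0 t) + f 0 t)"
      using convergent_add[OF _ convergent_const] by blast
    then show "convergent (\<lambda>n. f n t)" by simp
  qed
  then have lim: "AE t in lebesgue. (\<lambda>k. f k t) \<longlonglongrightarrow> lim (\<lambda>k. f k t)"
    by eventually_elim (simp add: convergent_LIMSEQ_iff)
  define g where "g t = lim (\<lambda>k. f k t)" for t
  have [measurable]: "g \<in> borel_measurable lebesgue"
    unfolding g_def by (rule borel_measurable_lim_metric) measurable
  have main: "(\<integral>\<^sup>+t. ennreal ((g t - rep (X n) t)\<^sup>2) \<partial>lebesgue) \<le> ennreal (((1/2)^j)\<^sup>2)" if "n \<ge> N j" for n j
  proof -
    have "(\<integral>\<^sup>+t. ennreal ((g t - rep (X n) t)\<^sup>2) \<partial>lebesgue)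
        = (\<integral>\<^sup>+t. liminf (\<lambda>k. ennreal ((f k t - rep (X n) t)\<^sup>2)) \<partial>lebesgue)"
    proof (rule nn_integral_cong_AE)
      show "AE t in lebesgue. ennreal ((g t - rep (X n) t)\<^sup>2) = liminf (\<lambda>k. ennreal ((f k t - rep (X n) t)\<^sup>2))"
        using lim
      proof eventually_elim
        fix t assume "(\<lambda>k. f k t) \<longlonglongrightarrow> lim (\<lambda>k. f k t)"
        then have "(\<lambda>k. ennreal ((f k t - rep (X n) t)\<^sup>2)) \<longlonglongrightarrow> ennreal ((g t - rep (X n) t)\<^sup>2)"
          by (intro tendsto_intros) (auto simp: g_def)
        then show "ennreal ((g t - rep (X n) t)\<^sup>2) = liminf (\<lambda>k. ennreal ((f k t - rep (X n) t)\<^sup>2))"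
          by (metis lim_imp_Liminf trivial_limit_sequentially)
      qed
    qed
    also have "\<dots> \<le> liminf (\<lambda>k. \<integral>\<^sup>+t. ennreal ((f k t - rep (X n) t)\<^sup>2) \<partial>lebesgue)"
      by (rule nn_integral_liminf) measurable
    also have "\<dots> \<le> ennreal (((1/2)^j)\<^sup>2)"
    proof (rule Liminf_le)
      show "eventually (\<lambda>k. (\<integral>\<^sup>+t. ennreal ((f k t - rep (X n) t)\<^sup>2) \<partial>lebesgue) \<le> ennreal (((1/2)^j)\<^sup>2)) sequentially"
        using eventually_ge_at_top[of j]
      proof eventually_elim
        fix k assume "k \<ge> j"
        have "(\<integral>\<^sup>+t. ennreal ((f k t - rep (X n) t)\<^sup>2) \<partial>lebesgue) = ennreal ((norm (X (M k) - X n))\<^sup>2)"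
          by (subst nn_integral_L2) (auto simp: f_def l2_of_diff intro!: L2_diff)
        also have "\<dots> \<le> ennreal (((1/2)^j)\<^sup>2)"
          using N[of j "M k" n] that MN[of j] M_mono[OF \<open>k \<ge> j\<close>] by (intro ennreal_leI power_mono) auto
        finally show "(\<integral>\<^sup>+t. ennreal ((f k t - rep (X n) t)\<^sup>2) \<partial>lebesgue) \<le> ennreal (((1/2)^j)\<^sup>2)" .
      qed
    qed simp
    finally show ?thesis .
  qed
  have dL2: "(\<lambda>t. g t - rep (X n) t) \<in> L2" if "n \<ge> N j" for n j
    by (rule L2_nn_integral) (auto intro: le_less_trans[OF main[OF that]])
  have gL: "g \<in> L2" using L2_add[OF dL2[OF order_refl[of "N 0"]] rep_L2[of "X (N 0)"]] by simp
  have "norm (l2_of g - X n) \<le> (1/2)^j" if "n \<ge> N j" for n j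
  proof -
    have "ennreal ((norm (l2_of g - X n))\<^sup>2) \<le> ennreal (((1/2)^j)\<^sup>2)"
      using main[OF that] nn_integral_L2[OF dL2[OF that]] by (simp add: l2_of_diff[OF gL])
    then have "(norm (l2_of g - X n))\<^sup>2 \<le> ((1/2)^j)\<^sup>2" by (subst (asm) ennreal_le_iff) auto
    then show ?thesis by (rule power2_le_imp_le) simp
  qed
  note close = this
  have "X \<longlonglongrightarrow> l2_of g"
  proof (rule metric_LIMSEQ_I)
    fix r :: real assume "r > 0"
    then obtain j where "(1/2::real)^j < r" using real_arch_pow_inv[of r "1/2"] by auto
    then show "\<exists>no. \<forall>n\<ge>no. dist (X n) (l2_of g) < r"
      using close[of j] by (intro exI[of _ "N j"]) (auto simp: dist_norm norm_minus_commute intro: le_less_trans)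
  qed
  then show "convergent X" by (rule convergentI)
qed

instance l2 :: (finite) banach ..

section \<open>Hilbert space preliminaries\<close>

text \<open>A minimising sequence for the distance is Cauchy by the parallelogram identity, since
  midpoints stay in \<open>S\<close>; the limit is the foot of the perpendicular.\<close>

lemma orthogonal_projection_exists:
  fixes S :: "'a::{real_inner, complete_space} set"
  assumes "subspace S" "closed S"
  obtains p where "p \<in> S" "\<And>y. y \<in> S \<Longrightarrow> (x - p) \<bullet> y = 0"
proof -
  define d where "d = infdist x S"
  have ne: "S \<noteq> {}" using subspace_0[OF assms(1)] by auto
  have dle: "d \<le> norm (x - y)" if "y \<in> S" for y
    using infdist_le[OF that, of x] by (simp add: d_def dist_norm)
  have d0: "d \<ge> 0" by (simp add: d_def infdist_nonneg)
  have "\<exists>y\<in>S. norm (x - y) < d + 1 / Suc n" for n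
  proof (rule ccontr)
    assume "\<not> ?thesis"
    then have "d + 1 / Suc n \<le> infdist x S"
      unfolding infdist_def using ne by (auto intro!: cINF_greatest simp: dist_norm not_less)
    then show False by (simp add: d_def)
  qed
  then obtain y where yS: "\<And>n. y n \<in> S" and y: "\<And>n. norm (x - y n) < d + 1 / Suc n" by metis
  have lim: "(\<lambda>n. norm (x - y n)) \<longlonglongrightarrow> d"
  proof (rule tendsto_sandwich[of "\<lambda>_. d" _ _ "\<lambda>n. d + 1 / Suc n"])
    show "(\<lambda>n. d + 1 / real (Suc n)) \<longlonglongrightarrow> d"
      using LIMSEQ_inverse_real_of_nat_add[of d] by (simp add: inverse_eq_divide)
  qed (use dle yS y in \<open>auto intro!: always_eventually less_imp_le simp del: of_nat_Suc\<close>)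
  have par: "(norm (y m - y n))\<^sup>2 \<le> 2 * (norm (x - y m))\<^sup>2 + 2 * (norm (x - y n))\<^sup>2 - 4 * d\<^sup>2" for m n
  proof -
    have "(1/2) *\<^sub>R (y m + y n) \<in> S" using assms(1) yS by (auto intro: subspace_add subspace_scale)
    from dle[OF this] have "d\<^sup>2 \<le> (norm (x - (1/2) *\<^sub>R (y m + y n)))\<^sup>2"
      using d0 by (rule power_mono)
    moreover have "(norm (y m - y n))\<^sup>2 + 4 * (norm (x - (1/2) *\<^sub>R (y m + y n)))\<^sup>2
        = 2 * (norm (x - y m))\<^sup>2 + 2 * (norm (x - y n))\<^sup>2"
      unfolding power2_norm_eq_inner by (simp add: inner_simps inner_commute algebra_simps)
    ultimately show ?thesis by linarith
  qed
  have "Cauchy y"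
  proof (rule metric_CauchyI)
    fix e :: real assume "e > 0"
    have "(\<lambda>n. (norm (x - y n))\<^sup>2) \<longlonglongrightarrow> d\<^sup>2" using lim by (intro tendsto_intros)
    from order_tendstoD(2)[OF this, of "d\<^sup>2 + e\<^sup>2 / 4"] \<open>e > 0\<close>
    obtain N where N: "\<And>n. n \<ge> N \<Longrightarrow> (norm (x - y n))\<^sup>2 < d\<^sup>2 + e\<^sup>2 / 4"
      by (auto simp: eventually_sequentially)
    show "\<exists>M. \<forall>m\<ge>M. \<forall>n\<ge>M. dist (y m) (y n) < e"
    proof (intro exI[of _ N] allI impI)
      fix m n assume "m \<ge> N" "n \<ge> N"
      then have "(norm (y m - y n))\<^sup>2 < e\<^sup>2" using par[of m n] N[of m] N[of n] by linarith
      then show "dist (y m) (y n) < e" using \<open>e > 0\<close> by (simp add: dist_norm power2_less_imp_less)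
    qed
  qed
  then obtain p where p: "y \<longlonglongrightarrow> p" using Cauchy_convergent_iff convergent_def by blast
  have pS: "p \<in> S" using assms(2) yS p by (meson closed_sequentially)
  have np: "norm (x - p) = d"
    using tendsto_norm[OF tendsto_diff[OF tendsto_const p]] lim LIMSEQ_unique by blast
  have "(x - p) \<bullet> z = 0" if "z \<in> S" for z
  proof (cases "z = 0")
    case False
    \<comment> \<open>The minimiser of the quadratic polynomial |x - p - t z|^2; minimality of
      \<open>p\<close> forces it to be 0.\<close>
    define t where "t = ((x - p) \<bullet> z) / (z \<bullet> z)"
    have "p + t *\<^sub>R z \<in> S" using assms(1) pS that by (auto intro: subspace_add subspace_scale)
    from power_mono[OF dle[OF this] d0, of 2] have "(norm (x - p))\<^sup>2 \<le> (norm (x - p - t *\<^sub>R z))\<^sup>2"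
      by (simp add: np diff_diff_eq)
    also have "\<dots> = (norm (x - p))\<^sup>2 - 2 * t * ((x - p) \<bullet> z) + t\<^sup>2 * (z \<bullet> z)"
      unfolding power2_norm_eq_inner by (simp add: inner_simps inner_commute algebra_simps power2_eq_square)
    finally have "2 * t * ((x - p) \<bullet> z) \<le> t\<^sup>2 * (z \<bullet> z)" by simp
    moreover have "t * (z \<bullet> z) = (x - p) \<bullet> z" using False by (simp add: t_def)
    ultimately have "t * (t * (z \<bullet> z)) \<le> 0" by (simp add: power2_eq_square mult.assoc)
    then have "t\<^sup>2 * (z \<bullet> z) \<le> 0" by (simp add: power2_eq_square mult.assoc)
    moreover have "z \<bullet> z > 0" using False by simp
    ultimately have "t\<^sup>2 \<le> 0" by (simp add: mult_le_0_iff)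
    then show ?thesis using \<open>t * (z \<bullet> z) = (x - p) \<bullet> z\<close> by simp
  qed simp
  with pS that show thesis by blast
qed

text \<open>Linearity is required on \<open>S\<close> only, because the functionals to be
  represented are quadratic forms that make sense only on the graph of the gradient. The
  representing vector is a multiple of the component of \<open>a\<close> orthogonal to the
  kernel.\<close>

lemma riesz_subspace:
  fixes S :: "'a::{real_inner, complete_space} set" and l :: "'a \<Rightarrow> real"
  assumes "subspace S" "closed S"
    and add: "\<And>x y. x \<in> S \<Longrightarrow> y \<in> S \<Longrightarrow> l (x + y) = l x + l y"
    and scale: "\<And>c x. x \<in> S \<Longrightarrow> l (c *\<^sub>R x) = c * l x"
    and bd: "\<And>x. x \<in> S \<Longrightarrow> \<bar>l x\<bar> \<le> C * norm x"
  obtains z where "z \<in> S" "\<And>x. x \<in> S \<Longrightarrow> l x = z \<bullet> x"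
proof (cases "\<forall>x\<in>S. l x = 0")
  case True
  then show ?thesis using that[of 0] subspace_0[OF assms(1)] by auto
next
  case False
  then obtain a where a: "a \<in> S" "l a \<noteq> 0" by auto
  define K where "K = {x \<in> S. l x = 0}"
  have diff: "l (x - y) = l x - l y" if "x \<in> S" "y \<in> S" for x y
  proof -
    have "l (x + (-1) *\<^sub>R y) = l x + (-1) * l y"
      using that by (subst add) (auto intro: subspace_neg[OF assms(1)] simp only: scale subspace_scale[OF assms(1)])
    then show ?thesis by simp
  qed
  have l0: "l 0 = 0" using scale[of 0 0] subspace_0[OF assms(1)] by simp
  have sK: "subspace K"
    using assms(1) by (auto simp: K_def subspace_def l0 add scale)
  have "closed K"
  proof (rule closed_sequential_limits[THEN iffD2], intro allI impI)
    fix x m assume h: "(\<forall>n. x n \<in> K) \<and> x \<longlonglongrightarrow> m"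
    then have xS: "x n \<in> S" "l (x n) = 0" for n by (auto simp: K_def)
    have mS: "m \<in> S" using assms(2) xS(1) h by (meson closed_sequentially)
    have "\<bar>l m\<bar> \<le> C * norm (m - x n)" for n
      using bd[OF subspace_diff[OF assms(1) mS xS(1)], of n] diff[OF mS xS(1), of n] xS(2)[of n] by simp
    moreover have "(\<lambda>n. C * norm (m - x n)) \<longlonglongrightarrow> C * norm (m - m)" using h by (intro tendsto_intros) auto
    ultimately have "\<bar>l m\<bar> \<le> C * norm (m - m)" by (intro LIMSEQ_le_const) auto
    then show "m \<in> K" using mS by (simp add: K_def)
  qed
  then obtain p where p: "p \<in> K" "\<And>y. y \<in> K \<Longrightarrow> (a - p) \<bullet> y = 0"
    using orthogonal_projection_exists[OF sK, of a] by blast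
  define e where "e = a - p"
  have eS: "e \<in> S" and le: "l e = l a" using p a diff[of a p] subspace_diff[OF assms(1)]
    by (auto simp: e_def K_def)
  have ne: "e \<bullet> e \<noteq> 0" using le a(2) l0 by auto
  define z where "z = (l a / (e \<bullet> e)) *\<^sub>R e"
  show ?thesis
  proof (rule that[of z])
    show "z \<in> S" by (simp add: z_def eS subspace_scale[OF assms(1)])
    fix x assume x: "x \<in> S"
    have "x - (l x / l a) *\<^sub>R e \<in> K"
      using x eS a by (auto simp: K_def diff scale le subspace_diff[OF assms(1)] subspace_scale[OF assms(1)])
    then have "e \<bullet> (x - (l x / l a) *\<^sub>R e) = 0" using p(2) by (simp add: e_def)
    then have "e \<bullet> x = (l x / l a) * (e \<bullet> e)" by (simp add: inner_simps)
    then show "l x = z \<bullet> x" using ne a by (simp add: z_def field_simps)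
  qed
qed

lemma subspace_closure:
  fixes S :: "'a::real_normed_vector set"
  assumes "subspace S"
  shows "subspace (closure S)"
  unfolding subspace_def
proof (intro conjI ballI allI)
  show "0 \<in> closure S" using subspace_0[OF assms] closure_subset by blast
next
  fix x y assume "x \<in> closure S" "y \<in> closure S"
  then obtain f g where "\<And>n. f n \<in> S" "f \<longlonglongrightarrow> x" "\<And>n. g n \<in> S" "g \<longlonglongrightarrow> y"
    by (auto simp: closure_sequential)
  then show "x + y \<in> closure S"
    unfolding closure_sequential using subspace_add[OF assms]
    by (intro exI[of _ "\<lambda>n. f n + g n"]) (auto intro: tendsto_add)
next
  fix c and x assume "x \<in> closure S"
  then obtain f where "\<And>n. f n \<in> S" "f \<longlonglongrightarrow> x" by (auto simp: closure_sequential)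
  then show "c *\<^sub>R x \<in> closure S"
    unfolding closure_sequential using subspace_scale[OF assms]
    by (intro exI[of _ "\<lambda>n. c *\<^sub>R f n"]) (auto intro: tendsto_scaleR)
qed

lemma dense_if_orthogonal_complement_trivial:
  fixes S :: "'a::{real_inner, complete_space} set"
  assumes "subspace S" and triv: "\<And>x. (\<And>y. y \<in> S \<Longrightarrow> x \<bullet> y = 0) \<Longrightarrow> x = 0"
  shows "closure S = UNIV"
proof -
  have "x \<in> closure S" for x
  proof -
    obtain p where p: "p \<in> closure S" "\<And>y. y \<in> closure S \<Longrightarrow> (x - p) \<bullet> y = 0"
      using orthogonal_projection_exists[of "closure S" x] assms(1) subspace_closure by auto
    have "x - p = 0" by (rule triv) (use p(2) closure_subset in blast)
    then show ?thesis using p(1) by simp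
  qed
  then show ?thesis by auto
qed

section \<open>Weak convergence and weak sequential compactness\<close>

definition wconv :: "(nat \<Rightarrow> 'a::real_inner) \<Rightarrow> 'a \<Rightarrow> bool" where
  "wconv x a \<longleftrightarrow> (\<forall>y. (\<lambda>n. x n \<bullet> y) \<longlonglongrightarrow> a \<bullet> y)"

text \<open>The diagonal extraction uses only the countably many members of the sequence as test
  vectors. The set \<open>T\<close> of vectors against which the subsequence converges is a closed
  subspace containing them, and a vector orthogonal to \<open>T\<close> pairs to 0 with every
  member, so \<open>T\<close> is the whole space.\<close>

lemma weakly_convergent_subseq:
  fixes x :: "nat \<Rightarrow> 'a::{real_inner, complete_space}"
  assumes bd: "\<And>n. norm (x n) \<le> B"
  obtains k a where "strict_mono (k :: nat \<Rightarrow> nat)" "wconv (\<lambda>n. x (k n)) a"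
proof -
  have B0: "B \<ge> 0" using bd[of 0] norm_ge_zero order_trans by blast
  have "norm (x n \<bullet> x j) \<le> B * B" for n j
    using Cauchy_Schwarz_ineq2[of "x n" "x j"] mult_mono[OF bd[of n] bd[of j]] B0 by simp
  then obtain k where k: "strict_mono k" and kx: "\<And>j. \<exists>l. (\<lambda>n. x (k n) \<bullet> x j) \<longlonglongrightarrow> l"
    using function_convergent_subsequence[of UNIV "\<lambda>n j. x n \<bullet> x j" "B * B"] by (metis UNIV_I countableI_type)
  define T where "T = {y. convergent (\<lambda>n. x (k n) \<bullet> y)}"
  have sT: "subspace T"
    unfolding subspace_def T_def
    by (auto simp: inner_simps convergent_const intro!: convergent_add convergent_mult)
  have xT: "range x \<subseteq> T" using kx by (auto simp: T_def convergent_def)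
  have clT: "closure T \<subseteq> T"
  proof
    fix y assume "y \<in> closure T"
    have "Cauchy (\<lambda>n. x (k n) \<bullet> y)"
    proof (rule metric_CauchyI)
      fix e :: real assume "e > 0"
      \<comment> \<open>Replacing \<open>y\<close> by \<open>z\<close> costs at most
        \<open>B * \<delta>\<close> in each of two places; the shift by 1 covers
        \<open>B = 0\<close>.\<close>
      define \<delta> where "\<delta> = e / (3 * (B + 1))"
      have "\<delta> > 0" using \<open>e > 0\<close> B0 by (simp add: \<delta>_def)
      then obtain z where z: "z \<in> T" "norm (z - y) < \<delta>"
        using \<open>y \<in> closure T\<close> by (auto simp: closure_approachable dist_norm)
      have close: "\<bar>x (k n) \<bullet> y - x (k n) \<bullet> z\<bar> < e / 3" for n
      proof -
        have "\<bar>x (k n) \<bullet> y - x (k n) \<bullet> z\<bar> \<le> norm (x (k n)) * norm (y - z)"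
          using Cauchy_Schwarz_ineq2[of "x (k n)" "y - z"] by (simp add: inner_simps)
        also have "\<dots> \<le> B * norm (y - z)" by (intro mult_right_mono bd) auto
        also have "\<dots> \<le> (B + 1) * norm (y - z)" by (simp add: distrib_right)
        also have "\<dots> < (B + 1) * \<delta>" using z(2) B0 by (simp add: norm_minus_commute)
        also have "\<dots> = e / 3" using B0 by (simp add: \<delta>_def field_simps add_eq_0_iff)
        finally show ?thesis .
      qed
      have "Cauchy (\<lambda>n. x (k n) \<bullet> z)" using z(1) by (simp add: T_def convergent_Cauchy)
      then obtain N where N: "\<And>m n. m \<ge> N \<Longrightarrow> n \<ge> N \<Longrightarrow> dist (x (k m) \<bullet> z) (x (k n) \<bullet> z) < e / 3"
        using \<open>e > 0\<close> by (metis Cauchy_def divide_pos_pos zero_less_numeral)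
      have "dist (x (k m) \<bullet> y) (x (k n) \<bullet> y) < e" if "m \<ge> N" "n \<ge> N" for m n
        using N[OF that] close[of m] close[of n] unfolding dist_real_def by linarith
      then show "\<exists>M. \<forall>m\<ge>M. \<forall>n\<ge>M. dist (x (k m) \<bullet> y) (x (k n) \<bullet> y) < e" by blast
    qed
    then show "y \<in> T" by (simp add: T_def Cauchy_convergent_iff)
  qed
  then have cT: "closed T" using closure_subset_eq by blast
  have T: "T = UNIV"
  proof -
    have "y \<in> T" for y
    proof -
      obtain p where p: "p \<in> T" "\<And>z. z \<in> T \<Longrightarrow> (y - p) \<bullet> z = 0"
        using orthogonal_projection_exists[OF sT cT, of y] by blast
      have "x (k n) \<bullet> y = x (k n) \<bullet> p" for n
      proof -
        have "(y - p) \<bullet> x (k n) = 0" using p(2) xT by blast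
        then show ?thesis by (simp add: inner_simps inner_commute)
      qed
      then show ?thesis using p(1) by (simp add: T_def)
    qed
    then show ?thesis by auto
  qed
  define l where "l y = lim (\<lambda>n. x (k n) \<bullet> y)" for y
  have l: "(\<lambda>n. x (k n) \<bullet> y) \<longlonglongrightarrow> l y" for y
    using T by (auto simp: T_def l_def convergent_LIMSEQ_iff)
  obtain a where a: "\<And>y. l y = a \<bullet> y"
  proof (rule riesz_subspace[of UNIV l B])
    fix u v :: 'a and c :: real
    show "l (u + v) = l u + l v"
      using tendsto_add[OF l[of u] l[of v]] l[of "u + v"] by (intro LIMSEQ_unique) (auto simp: inner_simps)
    show "l (c *\<^sub>R u) = c * l u"
      using tendsto_mult_left[OF l[of u], of c] l[of "c *\<^sub>R u"] by (intro LIMSEQ_unique) (auto simp: inner_simps)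
    have "\<bar>x (k n) \<bullet> u\<bar> \<le> B * norm u" for n
      using Cauchy_Schwarz_ineq2[of "x (k n)" u] mult_right_mono[OF bd[of "k n"], of "norm u"] by simp
    then show "\<bar>l u\<bar> \<le> B * norm u"
      using tendsto_rabs[OF l[of u]] by (intro LIMSEQ_le_const2) auto
  qed auto
  show ?thesis by (rule that[of k a]) (use k l a in \<open>auto simp: wconv_def\<close>)
qed

lemma wconv_tendsto: "wconv x a \<Longrightarrow> (\<lambda>n. x n \<bullet> y) \<longlonglongrightarrow> a \<bullet> y"
  by (simp add: wconv_def)

lemma wconv_diff: "wconv x a \<Longrightarrow> wconv (\<lambda>n. x n - a) 0"
  by (auto simp: wconv_def inner_diff_left intro: tendsto_eq_intros)

section \<open>Bounded symmetric operators\<close>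

text \<open>Gradient-type perturbation \<open>w - \<tau> *\<^sub>R (T - R) w\<close>: if a bounded symmetric form is almost
  nonnegative along a class of sequences, then it controls \<open>(T - R) w\<close>.\<close>

lemma symmetric_lower_bound_step:
  fixes R :: "'a::real_inner \<Rightarrow> 'a"
  assumes lin: "bounded_linear R" and sym: "\<And>x y. R x \<bullet> y = x \<bullet> R y"
    and W0: "\<And>w. w \<in> W \<Longrightarrow> Bseq w"
    and W1: "\<And>w \<tau> T. w \<in> W \<Longrightarrow> (\<lambda>n. w n - \<tau> *\<^sub>R (T *\<^sub>R w n - R (w n))) \<in> W"
    and step: "\<And>T. T > t1 \<Longrightarrow> \<exists>c>0. \<forall>w\<in>W. \<forall>e>0. eventually (\<lambda>n. (norm (T *\<^sub>R w n - R (w n)))\<^sup>2 \<ge> c * (norm (w n))\<^sup>2 - e) sequentially"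
    and w: "w \<in> W" and "e > 0"
  shows "eventually (\<lambda>n. t1 * (norm (w n))\<^sup>2 - R (w n) \<bullet> w n \<ge> - e) sequentially"
proof -
  define good where "good t \<longleftrightarrow> (\<forall>w\<in>W. \<forall>e>0. eventually (\<lambda>n. t * (norm (w n))\<^sup>2 - R (w n) \<bullet> w n \<ge> - e) sequentially)" for t
  obtain K where K: "K > 0" "\<And>x. norm (R x) \<le> norm x * K" using bounded_linear.pos_bounded[OF lin] by blast
  have RK: "R x \<bullet> x \<le> K * (norm x)\<^sup>2" for x
    using norm_cauchy_schwarz[of "R x" x] mult_right_mono[OF K(2)[of x], of "norm x"]
    by (simp add: power2_eq_square mult_ac)
  have gK: "good K" unfolding good_def using RK by (auto intro!: always_eventually order_trans[OF _ iffD2[OF diff_ge_0_iff_ge]])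
  have up: "good t" if "good s" "s \<le> t" for s t
    unfolding good_def
  proof (intro ballI allI impI)
    fix w and e :: real assume "w \<in> W" "e > 0"
    with that(1) have "eventually (\<lambda>n. s * (norm (w n))\<^sup>2 - R (w n) \<bullet> w n \<ge> - e) sequentially" by (simp add: good_def)
    then show "eventually (\<lambda>n. t * (norm (w n))\<^sup>2 - R (w n) \<bullet> w n \<ge> - e) sequentially"
    proof eventually_elim
      case (elim n)
      have "s * (norm (w n))\<^sup>2 \<le> t * (norm (w n))\<^sup>2" using that(2) by (intro mult_right_mono) auto
      with elim show ?case by linarith
    qed
  qed
  have cl: "good t" if "\<And>s. s > t \<Longrightarrow> good s" for t
    unfolding good_def
  proof (intro ballI allI impI)
    fix w and e :: real assume w: "w \<in> W" and "e > 0"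
    obtain B where B: "B > 0" "\<And>n. norm (w n) \<le> B" using W0[OF w] by (auto elim: BseqE)
    \<comment> \<open>Raising the level by e / (2 B^2) changes the form by at most e / 2 on vectors
      of norm at most \<open>B\<close>.\<close>
    define s where "s = t + e / (2 * B\<^sup>2)"
    have "s > t" using \<open>e > 0\<close> B by (simp add: s_def)
    with that w \<open>e > 0\<close> have "eventually (\<lambda>n. s * (norm (w n))\<^sup>2 - R (w n) \<bullet> w n \<ge> - (e/2)) sequentially"
      unfolding good_def by (meson half_gt_zero)
    then show "eventually (\<lambda>n. t * (norm (w n))\<^sup>2 - R (w n) \<bullet> w n \<ge> - e) sequentially"
    proof eventually_elim
      case (elim n)
      have "(norm (w n))\<^sup>2 \<le> B\<^sup>2" using B by (intro power_mono) auto
      then have "e / (2 * B\<^sup>2) * (norm (w n))\<^sup>2 \<le> e / (2 * B\<^sup>2) * B\<^sup>2" using \<open>e > 0\<close> by (intro mult_left_mono) auto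
      also have "\<dots> = e/2" using B by simp
      finally have "e / (2 * B\<^sup>2) * (norm (w n))\<^sup>2 \<le> e / 2" .
      then show ?case using elim unfolding s_def distrib_right by linarith
    qed
  qed
  have "good t1"
  proof (rule ccontr)
    assume ng: "\<not> good t1"
    \<comment> \<open>The least good level is itself good by \<open>cl\<close>; if it lay above
      \<open>t1\<close>, the perturbation below would lower it further.\<close>
    define T where "T = Inf {t. t \<ge> t1 \<and> good t}"
    have nm: "max K t1 \<in> {t. t \<ge> t1 \<and> good t}" using up[OF gK] by simp
    then have ne: "{t. t \<ge> t1 \<and> good t} \<noteq> {}" by blast
    have bb: "bdd_below {t. t \<ge> t1 \<and> good t}" by (rule bdd_belowI[of _ t1]) auto
    have Tt1: "T \<ge> t1" unfolding T_def using ne by (intro cInf_greatest) auto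
    have gT: "good T"
    proof (rule cl)
      fix s assume "s > T"
      then obtain t where "t < s" "good t" using cInf_lessD[of "{t. t \<ge> t1 \<and> good t}" s] ne by (auto simp: T_def)
      then show "good s" using up by auto
    qed
    have "T > t1" using Tt1 gT ng by (cases "T = t1") auto
    from step[OF this] obtain c where c: "c > 0"
      and cw: "\<And>w e. w \<in> W \<Longrightarrow> e > 0 \<Longrightarrow> eventually (\<lambda>n. (norm (T *\<^sub>R w n - R (w n)))\<^sup>2 \<ge> c * (norm (w n))\<^sup>2 - e) sequentially" by blast
    define L where "L x = T *\<^sub>R x - R x" for x
    \<comment> \<open>|T| + K bounds the norm of \<open>L = T - R\<close>. With this step length the
      second order term \<tau>^2 <L L x, L x> is at most \<tau> |L x|^2, so it consumes only half of
      the first order decrease 2 \<tau> |L x|^2.\<close>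
    define \<tau> where "\<tau> = 1 / (\<bar>T\<bar> + K)"
    have \<tau>: "\<tau> > 0" using K by (simp add: \<tau>_def add_nonneg_pos)
    \<comment> \<open>Goodness of \<open>T\<close> is applied to the perturbed sequence.
      Nonnegativity there, up to o(1), forces <L w, w> >= \<tau> |L w|^2 - o(1), and the hypothesis
      \<open>step\<close> turns this into a gain of \<tau> c |w|^2.\<close>
    have g': "good (T - \<tau> * c)"
      unfolding good_def
    proof (intro ballI allI impI)
      fix w and e :: real assume w: "w \<in> W" and "e > 0"
      have z: "(\<lambda>n. w n - \<tau> *\<^sub>R L (w n)) \<in> W" using W1[OF w] by (simp add: L_def)
      have e1: "eventually (\<lambda>n. T * (norm (w n - \<tau> *\<^sub>R L (w n)))\<^sup>2 - R (w n - \<tau> *\<^sub>R L (w n)) \<bullet> (w n - \<tau> *\<^sub>R L (w n)) \<ge> - (e/2)) sequentially"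
        using gT z \<open>e > 0\<close> unfolding good_def by (meson half_gt_zero)
      have e2: "eventually (\<lambda>n. (norm (L (w n)))\<^sup>2 \<ge> c * (norm (w n))\<^sup>2 - e / (2 * \<tau>)) sequentially"
        using cw[OF w, of "e / (2 * \<tau>)"] \<open>e > 0\<close> \<tau> by (simp add: L_def)
      from e1 e2 show "eventually (\<lambda>n. (T - \<tau> * c) * (norm (w n))\<^sup>2 - R (w n) \<bullet> w n \<ge> - e) sequentially"
      proof eventually_elim
        case (elim n)
        define x where "x = w n"
        interpret bounded_linear R by (rule lin)
        have form: "T * (norm y)\<^sup>2 - R y \<bullet> y = L y \<bullet> y" for y
          by (simp add: L_def inner_simps power2_norm_eq_inner)
        have Lsym: "L y \<bullet> z = y \<bullet> L z" for y z by (simp add: L_def inner_simps sym)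
        have Llin: "L (y - a *\<^sub>R z) = L y - a *\<^sub>R L z" for y z a
          by (simp add: L_def diff scaleR algebra_simps)
        have "L (x - \<tau> *\<^sub>R L x) \<bullet> (x - \<tau> *\<^sub>R L x) = L x \<bullet> x - 2 * \<tau> * (L x \<bullet> L x) + \<tau>\<^sup>2 * (L (L x) \<bullet> L x)"
          using Lsym[of "L x" x] by (simp add: Llin inner_simps power2_eq_square algebra_simps)
        moreover have "\<tau>\<^sup>2 * (L (L x) \<bullet> L x) \<le> \<tau> * (norm (L x))\<^sup>2"
        proof -
          have "L y \<bullet> y \<le> (\<bar>T\<bar> + K) * (norm y)\<^sup>2" for y
          proof -
            have "norm (L y) \<le> norm (T *\<^sub>R y) + norm (R y)" unfolding L_def by (rule norm_triangle_ineq4)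
            also have "\<dots> \<le> (\<bar>T\<bar> + K) * norm y" using K(2)[of y] by (simp add: algebra_simps)
            finally have "norm (L y) * norm y \<le> (\<bar>T\<bar> + K) * norm y * norm y" by (rule mult_right_mono) simp
            then show ?thesis using norm_cauchy_schwarz[of "L y" y] by (simp add: power2_eq_square mult.assoc)
          qed
          from mult_left_mono[OF this[of "L x"], of "\<tau>\<^sup>2"]
          have "\<tau>\<^sup>2 * (L (L x) \<bullet> L x) \<le> \<tau> * (\<tau> * (\<bar>T\<bar> + K)) * (norm (L x))\<^sup>2"
            by (simp add: power2_eq_square mult_ac)
          also have "\<tau> * (\<bar>T\<bar> + K) = 1" using K by (auto simp: \<tau>_def add_nonneg_pos less_imp_neq[symmetric])
          finally show ?thesis by simp
        qed
        ultimately have "L x \<bullet> x \<ge> \<tau> * (norm (L x))\<^sup>2 - e/2"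
          using elim(1) form[of "x - \<tau> *\<^sub>R L x"] by (simp add: x_def[symmetric] power2_norm_eq_inner)
        moreover have "\<tau> * (norm (L x))\<^sup>2 \<ge> \<tau> * (c * (norm x)\<^sup>2 - e / (2 * \<tau>))"
          using elim(2) \<tau> by (intro mult_left_mono) (auto simp: x_def)
        moreover have "\<tau> * (c * (norm x)\<^sup>2 - e / (2 * \<tau>)) = \<tau> * c * (norm x)\<^sup>2 - e/2"
          using \<tau> by (simp add: field_simps)
        ultimately show ?case using form[of x] by (simp add: x_def left_diff_distrib)
      qed
    qed
    have "T - \<tau> * c < T" using \<tau> c by simp
    then have "good (max t1 (T - \<tau> * c))" "max t1 (T - \<tau> * c) < T"
      using up[OF g', of "max t1 (T - \<tau> * c)"] \<open>T > t1\<close> by simp_all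
    moreover have "T \<le> s" if "good s" "s \<ge> t1" for s
      unfolding T_def by (rule cInf_lower[OF _ bb]) (use that in simp)
    ultimately show False by (meson linorder_not_less max.cobounded1)
  qed
  then show ?thesis using w \<open>e > 0\<close> by (simp add: good_def)
qed

text \<open>Spectrally, \<open>S\<close> has nothing in (-\<epsilon>, \<epsilon>) except possibly 0.
  With K = S^2 and D = \<epsilon>^2 the gap becomes (K - D/2)^2 >= D^2/4, that is K^2 >= D K. This
  yields the bound on the range of \<open>K\<close>, whose closure is the orthogonal complement of
  the kernel of \<open>S\<close>.\<close>

lemma isolated_point_lower_bound:
  fixes S :: "'a::{real_inner, complete_space} \<Rightarrow> 'a"
  assumes lin: "bounded_linear S" and sym: "\<And>x y. S x \<bullet> y = x \<bullet> S y" and "\<epsilon> > 0"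
    and iso: "\<And>s. s \<noteq> 0 \<Longrightarrow> \<bar>s\<bar> < \<epsilon> \<Longrightarrow> \<exists>c>0. \<forall>x. norm (S x - s *\<^sub>R x) \<ge> c * norm x"
    and y: "\<And>z. S z = 0 \<Longrightarrow> y \<bullet> z = 0"
  shows "norm (S y) \<ge> \<epsilon> * norm y"
proof -
  interpret S: bounded_linear S by (rule lin)
  define K where "K x = S (S x)" for x
  define D where "D = \<epsilon>\<^sup>2"
  have D: "D > 0" using \<open>\<epsilon> > 0\<close> by (simp add: D_def)
  have linK: "bounded_linear K" unfolding K_def using bounded_linear_compose[OF lin lin] by simp
  interpret K: bounded_linear K by (rule linK)
  have symK: "K x \<bullet> y = x \<bullet> K y" for x y by (simp add: K_def sym)
  have Kin: "K x \<bullet> x = (norm (S x))\<^sup>2" for x by (simp add: K_def sym power2_norm_eq_inner)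
  \<comment> \<open>Composition of maps bounded below; it serves the factorisations S^2 - q = (S -
    sqrt q)(S + sqrt q) and the analogous one for K below.\<close>
  have comp: "\<exists>c>0. \<forall>x. norm (F (G x)) \<ge> c * norm x"
    if "\<exists>c>0. \<forall>x. norm (F x) \<ge> c * norm x" "\<exists>c>0. \<forall>x. norm (G x) \<ge> c * norm x" for F G :: "'a \<Rightarrow> 'a"
  proof -
    from that obtain c d where cd: "c > 0" "d > 0" "\<And>x. norm (F x) \<ge> c * norm x" "\<And>x. norm (G x) \<ge> d * norm x"
      by metis
    have "norm (F (G x)) \<ge> c * d * norm x" for x
      using order_trans[OF mult_left_mono[OF cd(4)[of x], of c] cd(3)[of "G x"]] cd(1) by (simp add: mult.assoc)
    then show ?thesis using cd(1,2) by (intro exI[of _ "c * d"]) auto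
  qed
  have Kq: "\<exists>c>0. \<forall>x. norm (K x - q *\<^sub>R x) \<ge> c * norm x" if "0 < q" "q < D" for q
  proof -
    have "sqrt q < \<epsilon>" using that \<open>\<epsilon> > 0\<close> by (simp add: D_def real_less_lsqrt)
    then have "\<exists>c>0. \<forall>x. norm (S x - sqrt q *\<^sub>R x) \<ge> c * norm x" "\<exists>c>0. \<forall>x. norm (S x - (- sqrt q) *\<^sub>R x) \<ge> c * norm x"
      using that iso[of "sqrt q"] iso[of "- sqrt q"] by auto
    note comp[OF this]
    moreover have "S (S x - (- sqrt q) *\<^sub>R x) - sqrt q *\<^sub>R (S x - (- sqrt q) *\<^sub>R x) = K x - q *\<^sub>R x" for x
      using that by (simp add: K_def S.add S.diff S.scaleR algebra_simps)
    ultimately show ?thesis by simp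
  qed
  define L where "L x = K x - (D/2) *\<^sub>R x" for x
  have linL: "bounded_linear L" unfolding L_def using linK by (intro bounded_linear_sub bounded_linear_scaleR_right)
  interpret L: bounded_linear L by (rule linL)
  have symL: "L x \<bullet> y = x \<bullet> L y" for x y by (simp add: L_def inner_simps symK)
  \<comment> \<open>The gap becomes a statement about the bottom of L^2:
    \<open>symmetric_lower_bound_step\<close> for the operator -L^2 at the level -D^2/4, along
    constant sequences.\<close>
  have Lbd: "D\<^sup>2 / 4 * (norm x)\<^sup>2 \<le> (norm (L x))\<^sup>2" for x
  proof (rule field_le_epsilon)
    fix e :: real assume "e > 0"
    have "eventually (\<lambda>n. - (D\<^sup>2 / 4) * (norm x)\<^sup>2 - (- L (L x)) \<bullet> x \<ge> - e) (sequentially :: nat filter)"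
    proof (rule symmetric_lower_bound_step[where W = "{\<lambda>n. y | y. True}" and R = "\<lambda>x. - L (L x)" and w = "\<lambda>n. x"])
      show "bounded_linear (\<lambda>x. - L (L x))"
        by (intro bounded_linear_minus bounded_linear_compose[OF linL linL])
      show "- L (L x) \<bullet> y = x \<bullet> - L (L y)" for x y by (simp add: symL)
      show "\<exists>c>0. \<forall>w\<in>{\<lambda>n. y | y. True}. \<forall>e>0. \<forall>\<^sub>F n in sequentially.
           c * (norm (w n))\<^sup>2 - e \<le> (norm (T *\<^sub>R w n - - L (L (w n))))\<^sup>2"
        if T: "- (D\<^sup>2 / 4) < T" for T
      proof -
        have "\<exists>c>0. \<forall>y. norm (T *\<^sub>R y + L (L y)) \<ge> c * norm y"
        proof (cases "T > 0")
          case True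
          have "norm (T *\<^sub>R y + L (L y)) \<ge> T * norm y" for y
          proof (cases "y = 0")
            case False
            have "T * (norm y)\<^sup>2 \<le> (T *\<^sub>R y + L (L y)) \<bullet> y"
              using inner_ge_zero[of "L y"] by (simp add: inner_simps symL power2_norm_eq_inner)
            also have "\<dots> \<le> norm (T *\<^sub>R y + L (L y)) * norm y" by (rule norm_cauchy_schwarz)
            finally show ?thesis using False by (simp add: power2_eq_square)
          qed simp
          then show ?thesis using True by blast
        next
          case False
          \<comment> \<open>Now T + L^2 factors as (K - (D/2 + s)) (K - (D/2 - s)), and both points
            lie in the gap (0, D) of \<open>K\<close>.\<close>
          define s where "s = sqrt (- T)"
          have s: "0 \<le> s" "s < D/2" "s\<^sup>2 = - T"
            using False T D real_less_lsqrt[of "D/2" "- T"] by (simp_all add: s_def power_divide)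
          have "\<exists>c>0. \<forall>x. norm (K x - (D/2 + s) *\<^sub>R x) \<ge> c * norm x" "\<exists>c>0. \<forall>x. norm (K x - (D/2 - s) *\<^sub>R x) \<ge> c * norm x"
            using s D by (auto intro!: Kq)
          note comp[OF this]
          moreover have "K (K x - (D/2 - s) *\<^sub>R x) - (D/2 + s) *\<^sub>R (K x - (D/2 - s) *\<^sub>R x) = T *\<^sub>R x + L (L x)" for x
          proof -
            define h where "h = D/2"
            have T: "T = - (s * s)" using s(3) by (simp add: power2_eq_square)
            show ?thesis unfolding L_def h_def[symmetric] T by (simp add: K.diff K.add K.scaleR algebra_simps)
          qed
          ultimately show ?thesis by simp
        qed
        then obtain c where c: "c > 0" "\<And>y. norm (T *\<^sub>R y + L (L y)) \<ge> c * norm y" by blast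
        have "c\<^sup>2 * (norm y)\<^sup>2 \<le> (norm (T *\<^sub>R y + L (L y)))\<^sup>2" for y
          using power_mono[OF c(2)[of y], of 2] c(1) by (simp add: power_mult_distrib)
        then have "c\<^sup>2 * (norm y)\<^sup>2 - e \<le> (norm (T *\<^sub>R y + L (L y)))\<^sup>2" if "e > 0" for y e
          using that by (smt (verit))
        then show ?thesis using c(1) by (intro exI[of _ "c\<^sup>2"]) auto
      qed
      show "Bseq w" if "w \<in> {\<lambda>n. y | y. True}" for w :: "nat \<Rightarrow> 'a"
        using that by (auto intro: convergent_imp_Bseq convergent_const)
    qed (use \<open>e > 0\<close> in auto)
    then show "D\<^sup>2 / 4 * (norm x)\<^sup>2 \<le> (norm (L x))\<^sup>2 + e"
      by (simp add: symL power2_norm_eq_inner)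
  qed
  have KS: "D * (norm (S x))\<^sup>2 \<le> (norm (K x))\<^sup>2" for x
  proof -
    have "(norm (L x))\<^sup>2 = (norm (K x))\<^sup>2 - D * (K x \<bullet> x) + D\<^sup>2/4 * (norm x)\<^sup>2"
      unfolding power2_norm_eq_inner L_def by (simp add: inner_simps inner_commute power2_eq_square algebra_simps)
    then show ?thesis using Lbd[of x] by (simp add: Kin)
  qed
  \<comment> \<open>For y = K x one has |y|^2 = <S x, S y> <= |S x| |S y|, and \<open>KS\<close>
    gives \<epsilon> |S x| <= |y|.\<close>
  have rng: "\<epsilon> * norm y \<le> norm (S y)" if "y = K x" for x y
  proof (cases "y = 0")
    case False
    have "(\<epsilon> * norm (S x))\<^sup>2 \<le> (norm y)\<^sup>2" using KS[of x] by (simp add: that D_def power_mult_distrib)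
    then have 1: "\<epsilon> * norm (S x) \<le> norm y" by (rule power2_le_imp_le) simp
    have "\<epsilon> * (norm y * norm y) = \<epsilon> * (S x \<bullet> S y)"
      using power2_norm_eq_inner[of y] that symK sym by (simp add: power2_eq_square K_def)
    also have "\<dots> \<le> \<epsilon> * (norm (S x) * norm (S y))" using \<open>\<epsilon> > 0\<close> by (intro mult_left_mono norm_cauchy_schwarz) auto
    also have "\<dots> \<le> norm y * norm (S y)" using mult_right_mono[OF 1, of "norm (S y)"] by (simp add: mult.assoc)
    finally show ?thesis using False by (simp add: mult.left_commute)
  qed simp
  have subK: "subspace (range K)" by (rule linear_subspace_image) (auto intro: K.linear)
  obtain p where p: "p \<in> closure (range K)" "\<And>z. z \<in> closure (range K) \<Longrightarrow> (y - p) \<bullet> z = 0"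
    using orthogonal_projection_exists[of "closure (range K)" y] subspace_closure[OF subK] by auto
  \<comment> \<open>The part of \<open>y\<close> orthogonal to the range of \<open>K\<close> lies in
    the kernel of \<open>S\<close>, to which \<open>y\<close> is orthogonal; hence that part is
    0.\<close>
  have "K (y - p) \<bullet> x = 0" for x
    using p(2)[of "K x"] closure_subset[of "range K"] by (auto simp: symK)
  then have "K (y - p) = 0" by (metis inner_eq_zero_iff)
  then have "S (y - p) = 0" using Kin[of "y - p"] by simp
  then have "y \<bullet> (y - p) = 0" by (rule y)
  moreover have "(y - p) \<bullet> p = 0" by (rule p(2)[OF p(1)])
  ultimately have "(y - p) \<bullet> (y - p) = 0" by (simp add: inner_simps inner_commute)
  then have "y = p" by simp
  then obtain f where f: "\<And>n. f n \<in> range K" "f \<longlonglongrightarrow> y" using p(1) by (auto simp: closure_sequential)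
  have "(\<lambda>n. \<epsilon> * norm (f n)) \<longlonglongrightarrow> \<epsilon> * norm y" "(\<lambda>n. norm (S (f n))) \<longlonglongrightarrow> norm (S y)"
    using f(2) by (auto intro!: tendsto_intros S.tendsto)
  moreover have "\<epsilon> * norm (f n) \<le> norm (S (f n))" for n using f(1)[of n] rng by auto
  ultimately show ?thesis by (intro LIMSEQ_le) auto
qed

text \<open>The kernel is finite dimensional, so the projections of a weakly null sequence onto it
  tend to 0 in norm, and the remainder satisfies \<open>isolated_point_lower_bound\<close>.\<close>

lemma isolated_point_weakly_null:
  fixes S :: "'a::{real_inner, complete_space} \<Rightarrow> 'a"
  assumes lin: "bounded_linear S" and sym: "\<And>x y. S x \<bullet> y = x \<bullet> S y" and "\<epsilon> > 0"
    and iso: "\<And>s. s \<noteq> 0 \<Longrightarrow> \<bar>s\<bar> < \<epsilon> \<Longrightarrow> \<exists>c>0. \<forall>x. norm (S x - s *\<^sub>R x) \<ge> c * norm x"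
    and fin: "finite E" "\<And>x. S x = 0 \<longleftrightarrow> x \<in> span E"
    and w: "wconv w 0" and "e > 0"
  shows "eventually (\<lambda>n. (norm (S (w n)))\<^sup>2 \<ge> \<epsilon>\<^sup>2 * (norm (w n))\<^sup>2 - e) sequentially"
proof -
  interpret S: bounded_linear S by (rule lin)
  obtain C where C: "finite C" "span C = span E" "pairwise orthogonal C"
    using basis_orthogonal[OF fin(1)] by blast
  \<comment> \<open>Projection onto the kernel. If \<open>C\<close> contains the zero vector, its
    coefficient is 0 by the convention for division, which is harmless.\<close>
  define p where "p n = (\<Sum>c\<in>C. ((w n \<bullet> c) / (c \<bullet> c)) *\<^sub>R c)" for n
  have "(\<lambda>n. \<epsilon>\<^sup>2 * (norm (p n))\<^sup>2) \<longlonglongrightarrow> \<epsilon>\<^sup>2 * (norm (\<Sum>c\<in>C. ((0 \<bullet> c) / (c \<bullet> c)) *\<^sub>R c))\<^sup>2"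
    unfolding p_def divide_inverse
    by (intro tendsto_intros wconv_tendsto[OF w])
  then have "eventually (\<lambda>n. \<epsilon>\<^sup>2 * (norm (p n))\<^sup>2 < e) sequentially"
    using \<open>e > 0\<close> by (intro order_tendstoD(2)) auto
  then show ?thesis
  proof eventually_elim
    case (elim n)
    have pC: "p n \<bullet> c = w n \<bullet> c" if "c \<in> C" for c
    proof -
      have "p n \<bullet> c = (\<Sum>c'\<in>C. if c' = c then w n \<bullet> c else 0)"
        unfolding p_def inner_sum_left
      proof (rule sum.cong)
        fix c' assume "c' \<in> C"
        then show "((w n \<bullet> c') / (c' \<bullet> c')) *\<^sub>R c' \<bullet> c = (if c' = c then w n \<bullet> c else 0)"
          using C(3) that by (auto simp: pairwise_def orthogonal_def)
      qed simp
      then show ?thesis using that C(1) by simp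
    qed
    have orth: "(w n - p n) \<bullet> z = 0" if "z \<in> span C" for z
      using that pC by (induction rule: span_induct_alt) (auto simp: inner_simps)
    have pS: "p n \<in> span C" unfolding p_def by (intro span_sum span_scale span_base)
    then have "S (p n) = 0" using fin(2) C(2) by simp
    then have "S (w n) = S (w n - p n)" by (simp add: S.diff)
    moreover have "\<epsilon> * norm (w n - p n) \<le> norm (S (w n - p n))"
      by (rule isolated_point_lower_bound[OF lin sym \<open>\<epsilon> > 0\<close> iso]) (use orth fin(2) C(2) in auto)
    ultimately have "\<epsilon>\<^sup>2 * (norm (w n - p n))\<^sup>2 \<le> (norm (S (w n)))\<^sup>2"
      using \<open>\<epsilon> > 0\<close> power_mono[of "\<epsilon> * norm (w n - p n)" "norm (S (w n))" 2] by (simp add: power_mult_distrib)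
    moreover have "(norm (w n))\<^sup>2 = (norm (w n - p n))\<^sup>2 + (norm (p n))\<^sup>2"
      using orth[OF pS] unfolding power2_norm_eq_inner by (simp add: inner_simps inner_commute)
    ultimately show ?case using elim by (simp add: distrib_left)
  qed
qed

section \<open>Test functions\<close>

text \<open>\<open>em 0\<close> is the classical flat function exp(-1/t). The extra powers of 1/t
  make the family closed under differentiation, so that smoothness is an induction.\<close>

definition em :: "nat \<Rightarrow> real \<Rightarrow> real" where
  "em m t = (if t > 0 then exp (- inverse t) * inverse t ^ m else 0)"

text \<open>A single term of the exponential series beats every power of 1/t. The bound is linear in
  t so that it yields continuity and the vanishing derivative at 0.\<close>

lemma em_bounds: "0 \<le> em m t" "em m t \<le> fact (Suc m) * \<bar>t\<bar>"
proof -
  show "0 \<le> em m t" by (simp add: em_def)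
  show "em m t \<le> fact (Suc m) * \<bar>t\<bar>"
  proof (cases "t > 0")
    case True
    define x where "x = inverse t"
    have x: "x > 0" using True by (simp add: x_def)
    have "x ^ Suc m / fact (Suc m) \<le> exp x"
    proof -
      have "(\<Sum>n\<in>{Suc m}. x ^ n /\<^sub>R fact n) \<le> (\<Sum>n. x ^ n /\<^sub>R fact n)"
        using x by (intro sum_le_suminf summable_exp_generic) auto
      then show ?thesis by (simp add: exp_def field_simps)
    qed
    then have "x ^ m * x \<le> fact (Suc m) * exp x" by (simp add: field_simps del: fact_Suc)
    then have "exp (- x) * x ^ m \<le> fact (Suc m) * inverse x"
      using x by (simp add: exp_minus field_simps del: fact_Suc)
    then show ?thesis using True by (simp add: em_def x_def del: fact_Suc)
  next
    case False
    then have "em m t = 0" by (simp add: em_def)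
    then show ?thesis by (simp del: fact_Suc)
  qed
qed

lemma em_0_le_1: "em 0 t \<le> 1"
  by (simp add: em_def)

lemma em_has_derivative: "(em m has_real_derivative (em (m + 2) t - real m * em (m + 1) t)) (at t)"
proof -
  consider "t > 0" | "t < 0" | "t = 0" by linarith
  then show ?thesis
  proof cases
    case 1
    have "((\<lambda>t. exp (- inverse t) * inverse t ^ m) has_real_derivative (em (m + 2) t - real m * em (m + 1) t)) (at t)"
    proof (rule DERIV_cong)
      show "((\<lambda>t. exp (- inverse t) * inverse t ^ m) has_real_derivative
          exp (- inverse t) * (inverse t * inverse t) * inverse t ^ m
          + real m * inverse t ^ (m - 1) * (- (inverse t * inverse t)) * exp (- inverse t)) (at t)"
        using 1 by (auto intro!: derivative_eq_intros simp: algebra_simps)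
      show "exp (- inverse t) * (inverse t * inverse t) * inverse t ^ m
          + real m * inverse t ^ (m - 1) * (- (inverse t * inverse t)) * exp (- inverse t)
          = em (m + 2) t - real m * em (m + 1) t"
        using 1 by (cases m) (auto simp: em_def algebra_simps)
    qed
    then show ?thesis
      by (rule has_field_derivative_transform_within_open[of _ _ _ "{0<..}"]) (use 1 in \<open>auto simp: em_def\<close>)
  next
    case 2
    have "((\<lambda>t. 0) has_real_derivative (em (m + 2) t - real m * em (m + 1) t)) (at t)"
      using 2 by (simp add: em_def)
    then show ?thesis
      by (rule has_field_derivative_transform_within_open[of _ _ _ "{..<0}"]) (use 2 in \<open>auto simp: em_def\<close>)
  next
    case 3
    have "((\<lambda>h. (em m h - em m 0) / h) \<longlongrightarrow> 0) (at 0)"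
    proof (rule tendsto_0_le[where K = 1])
      show "((\<lambda>h. fact (Suc (Suc m)) * \<bar>h\<bar>) \<longlongrightarrow> (0::real)) (at 0)"
        by (auto intro!: tendsto_eq_intros)
      \<comment> \<open>The difference quotient at 0 is again a member of the family, so the linear
        bound applies to it.\<close>
      have "(em m h - em m 0) / h = em (Suc m) h" for h
        by (auto simp: em_def field_simps)
      then show "\<forall>\<^sub>F h in at 0. norm ((em m h - em m 0) / h) \<le> norm (fact (Suc (Suc m)) * \<bar>h\<bar>) * 1"
        using em_bounds[of "Suc m"] by (auto simp: abs_mult simp del: fact_Suc)
    qed
    then show ?thesis using 3 by (simp add: has_field_derivative_iff em_def)
  qed
qed

text \<open>An algebra of functions that contains its own partial derivatives. Membership gives
  \<open>Ck k\<close> for every \<open>k\<close> without differentiating the product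
  \<open>bump\<close> explicitly.\<close>

inductive smooth_elem :: "(real ^ 'n \<Rightarrow> real) \<Rightarrow> bool" where
  const: "smooth_elem (\<lambda>x. c)"
| em: "smooth_elem (\<lambda>x. em m (c * x $ i + d))"
| add: "smooth_elem f \<Longrightarrow> smooth_elem g \<Longrightarrow> smooth_elem (\<lambda>x. f x + g x)"
| mult: "smooth_elem f \<Longrightarrow> smooth_elem g \<Longrightarrow> smooth_elem (\<lambda>x. f x * g x)"

lemma smooth_elem_derivative:
  assumes "smooth_elem f"
  shows "\<exists>f'. (\<forall>x. (f has_derivative f' x) (at x)) \<and> (\<forall>i. smooth_elem (\<lambda>x. f' x (axis i 1)))"
  using assms
proof induction
  case (const c)
  show ?case by (rule exI[of _ "\<lambda>x h. 0"]) (auto intro: smooth_elem.const)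
next
  case (em m c i d)
  define g where "g x = (em (m + 2) (c * x $ i + d) - real m * em (m + 1) (c * x $ i + d)) * c" for x :: "real ^ 'a"
  have "smooth_elem (\<lambda>x. (em (m + 2) (c * x $ i + d) + (- real m) * em (m + 1) (c * x $ i + d)) * c)"
    by (intro smooth_elem.intros)
  then have sg: "smooth_elem g" by (simp add: g_def[abs_def])
  show ?case
  proof (intro exI[of _ "\<lambda>x h. g x * (h $ i)"] conjI allI)
    fix x :: "real ^ 'a"
    have inner: "((\<lambda>x. c * x $ i + d) has_derivative (\<lambda>h. c * h $ i)) (at x)"
      by (auto intro!: derivative_eq_intros bounded_linear_imp_has_derivative bounded_linear_vec_nth)
    show "((\<lambda>x. em m (c * x $ i + d)) has_derivative (\<lambda>h. g x * h $ i)) (at x)"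
      using has_derivative_compose[OF inner em_has_derivative[unfolded has_field_derivative_def]]
      by (simp add: g_def mult.assoc)
    fix j
    show "smooth_elem (\<lambda>x. g x * axis j 1 $ i)" by (intro smooth_elem.intros sg)
  qed
next
  case (add f g)
  obtain f' where f': "\<And>x. (f has_derivative f' x) (at x)" "\<And>i. smooth_elem (\<lambda>x. f' x (axis i 1))"
    using add.IH(1) by blast
  obtain g' where g': "\<And>x. (g has_derivative g' x) (at x)" "\<And>i. smooth_elem (\<lambda>x. g' x (axis i 1))"
    using add.IH(2) by blast
  show ?case
  proof (intro exI[of _ "\<lambda>x h. f' x h + g' x h"] conjI allI)
    show "((\<lambda>x. f x + g x) has_derivative (\<lambda>h. f' x h + g' x h)) (at x)" for x
      by (rule has_derivative_add[OF f'(1) g'(1)])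
    show "smooth_elem (\<lambda>x. f' x (axis i 1) + g' x (axis i 1))" for i
      by (rule smooth_elem.add[OF f'(2) g'(2)])
  qed
next
  case (mult f g)
  obtain f' where f': "\<And>x. (f has_derivative f' x) (at x)" "\<And>i. smooth_elem (\<lambda>x. f' x (axis i 1))"
    using mult.IH(1) by blast
  obtain g' where g': "\<And>x. (g has_derivative g' x) (at x)" "\<And>i. smooth_elem (\<lambda>x. g' x (axis i 1))"
    using mult.IH(2) by blast
  show ?case
  proof (intro exI[of _ "\<lambda>x h. f x * g' x h + f' x h * g x"] conjI allI)
    show "((\<lambda>x. f x * g x) has_derivative (\<lambda>h. f x * g' x h + f' x h * g x)) (at x)" for x
      by (rule has_derivative_mult[OF f'(1) g'(1)])
    show "smooth_elem (\<lambda>x. f x * g' x (axis i 1) + f' x (axis i 1) * g x)" for i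
      by (rule smooth_elem.add[OF smooth_elem.mult[OF mult.hyps(1) g'(2)] smooth_elem.mult[OF f'(2) mult.hyps(2)]])
  qed
qed

lemma partial_eq: "(f has_derivative f') (at x) \<Longrightarrow> partial i f x = f' (axis i 1)"
  unfolding partial_def using frechet_derivative_at[of f f' x] by simp

lemma smooth_elem_Ck: "smooth_elem f \<Longrightarrow> Ck k f"
proof (induction k arbitrary: f)
  case 0
  obtain f' where "\<And>x. (f has_derivative f' x) (at x)" "\<And>i. smooth_elem (\<lambda>x. f' x (axis i 1))"
    using smooth_elem_derivative[OF 0] by blast
  then show ?case by (auto simp: continuous_on_eq_continuous_at intro: has_derivative_continuous)
next
  case (Suc k)
  obtain f' where f': "\<And>x. (f has_derivative f' x) (at x)" "\<And>i. smooth_elem (\<lambda>x. f' x (axis i 1))"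
    using smooth_elem_derivative[OF Suc.prems] by blast
  have "partial i f = (\<lambda>x. f' x (axis i 1))" for i
    by (intro ext partial_eq f')
  then show ?case using f' Suc.IH by (auto simp: differentiable_on_def differentiable_def intro: has_derivative_at_withinI)
qed

lemma smooth_elem_prod: "(\<And>i. i \<in> I \<Longrightarrow> smooth_elem (f i)) \<Longrightarrow> smooth_elem (\<lambda>x. \<Prod>i\<in>I. f i x)"
  by (induction I rule: infinite_finite_induct) (auto intro: smooth_elem.const smooth_elem.mult)

text \<open>For growing \<open>k\<close> the factors tend to 1 inside the box and the function stays
  0 outside: test functions approximating the indicator of the open box from below.\<close>

definition bump :: "nat \<Rightarrow> real ^ 'n \<Rightarrow> real ^ 'n \<Rightarrow> real ^ 'n \<Rightarrow> real" where
  "bump k a b x = (\<Prod>i\<in>UNIV. em 0 (real (Suc k) * (x $ i - a $ i)) * em 0 (real (Suc k) * (b $ i - x $ i)))"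

lemma bump_outside: "x \<notin> box a b \<Longrightarrow> bump k a b x = 0"
proof -
  assume "x \<notin> box a b"
  then obtain i where "\<not> (a $ i < x $ i \<and> x $ i < b $ i)" by (auto simp: mem_box_cart)
  then have "em 0 (real (Suc k) * (x $ i - a $ i)) = 0 \<or> em 0 (real (Suc k) * (b $ i - x $ i)) = 0"
    unfolding em_def by (simp add: zero_less_mult_iff not_less) linarith
  then show ?thesis unfolding bump_def by (intro prod_zero) (auto intro!: bexI[of _ i])
qed

lemma bump_bounds: "0 \<le> bump k a b x" "bump k a b x \<le> 1"
  unfolding bump_def by (auto intro!: prod_nonneg prod_le_1 mult_nonneg_nonneg mult_le_one em_bounds em_0_le_1)

lemma test_function_bump: "test_function (bump k a b)"
proof -
  have "smooth_elem (\<lambda>x. \<Prod>i\<in>UNIV. em 0 (real (Suc k) * x $ i + - real (Suc k) * a $ i) *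
          em 0 (- real (Suc k) * x $ i + real (Suc k) * b $ i))"
    by (rule smooth_elem_prod, rule smooth_elem.mult; rule smooth_elem.em)
  then have "smooth_elem (bump k a b)"
    unfolding bump_def[abs_def] by (simp add: algebra_simps)
  moreover have "compact (closure {x. bump k a b x \<noteq> 0})"
  proof -
    have "bounded {x. bump k a b x \<noteq> 0}"
      by (rule bounded_subset[OF bounded_box[of a b]]) (use bump_outside in blast)
    then show ?thesis by (rule compact_closure[THEN iffD2])
  qed
  ultimately show ?thesis by (simp add: test_function_def smooth_elem_Ck)
qed

lemma bump_tendsto: "(\<lambda>k. bump k a b x) \<longlonglongrightarrow> indicator (box a b) x"
proof (cases "x \<in> box a b")
  case True
  have e: "(\<lambda>k. em 0 (real (Suc k) * t)) \<longlonglongrightarrow> 1" if "t > 0" for t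
  proof -
    have "(\<lambda>k. exp (- (inverse (real (Suc k)) * inverse t))) \<longlonglongrightarrow> exp (- (0 * inverse t))"
      by (intro tendsto_intros LIMSEQ_inverse_real_of_nat)
    then show ?thesis using that by (simp add: em_def zero_less_mult_iff mult.commute)
  qed
  have "(\<lambda>k. bump k a b x) \<longlonglongrightarrow> (\<Prod>i\<in>(UNIV::'a set). 1 * 1)"
    unfolding bump_def using True by (intro tendsto_prod tendsto_mult e) (auto simp: mem_box_cart)
  then show ?thesis using True by simp
qed (simp add: bump_outside)

section \<open>Elementary properties of test functions and the fundamental lemma\<close>

lemma test_function_continuous: "test_function \<phi> \<Longrightarrow> continuous_on UNIV \<phi>"
  unfolding test_function_def by (metis Ck.simps(1))

lemma test_function_measurable: "test_function \<phi> \<Longrightarrow> \<phi> \<in> borel_measurable borel"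
  by (intro borel_measurable_continuous_onI test_function_continuous)

lemma test_function_measurable_lebesgue: "test_function \<phi> \<Longrightarrow> \<phi> \<in> borel_measurable lebesgue"
  using test_function_measurable by (intro measurable_completion) simp

lemma test_function_has_derivative:
  assumes "test_function \<phi>"
  shows "(\<phi> has_derivative frechet_derivative \<phi> (at x)) (at x)"
proof -
  have "Ck (Suc 0) \<phi>" using assms by (simp only: test_function_def)
  then show ?thesis using frechet_derivative_works[of \<phi> "at x"] by (simp add: differentiable_on_def)
qed

lemma test_function_partial:
  assumes "test_function \<phi>"
  shows "test_function (partial i \<phi>)"
proof -
  have "Ck k (partial i \<phi>)" for k
  proof -
    have "Ck (Suc k) \<phi>" using assms by (simp only: test_function_def)
    then show ?thesis by simp
  qed
  moreover have "{x. partial i \<phi> x \<noteq> 0} \<subseteq> closure {x. \<phi> x \<noteq> 0}"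
  proof (rule ccontr)
    assume "\<not> ?thesis"
    then obtain x where x: "partial i \<phi> x \<noteq> 0" "x \<in> - closure {x. \<phi> x \<noteq> 0}" by auto
    have "((\<lambda>_. 0) has_derivative (\<lambda>h. 0)) (at x)" by simp
    then have "(\<phi> has_derivative (\<lambda>h. 0)) (at x)"
      by (rule has_derivative_transform_within_open[of _ _ _ UNIV "- closure {x. \<phi> x \<noteq> 0}"])
        (use x closure_subset[of "{x. \<phi> x \<noteq> 0}"] in auto)
    then show False using partial_eq x(1) by metis
  qed
  then have "bounded {x. partial i \<phi> x \<noteq> 0}"
    using assms bounded_subset compact_imp_bounded unfolding test_function_def by blast
  then have "compact (closure {x. partial i \<phi> x \<noteq> 0})" by (rule compact_closure[THEN iffD2])
  ultimately show ?thesis by (simp add: test_function_def)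
qed

lemma test_function_bounded:
  assumes "test_function \<phi>"
  obtains B where "\<And>x. \<bar>\<phi> x\<bar> \<le> B"
proof -
  define K where "K = closure {x. \<phi> x \<noteq> 0}"
  have "compact (\<phi> ` K)"
    using assms by (intro compact_continuous_image continuous_on_subset[OF test_function_continuous])
      (auto simp: test_function_def K_def)
  then obtain B where B: "\<And>y. y \<in> \<phi> ` K \<Longrightarrow> norm y \<le> B" using compact_imp_bounded bounded_iff by metis
  have "\<bar>\<phi> x\<bar> \<le> max B 0" for x
  proof (cases "\<phi> x = 0")
    case False
    then have "x \<in> K" using closure_subset[of "{x. \<phi> x \<noteq> 0}"] by (auto simp: K_def)
    then show ?thesis using B[of "\<phi> x"] by auto
  qed simp
  then show ?thesis by (rule that)
qed

lemma test_function_bounded_support: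
  assumes "test_function \<phi>"
  obtains R where "R > 0" "\<And>x. norm x > R \<Longrightarrow> \<phi> x = 0"
proof -
  have "bounded (closure {x. \<phi> x \<noteq> 0})" using assms by (auto simp: test_function_def intro: compact_imp_bounded)
  then obtain R where R: "R > 0" "\<And>x. x \<in> closure {x. \<phi> x \<noteq> 0} \<Longrightarrow> norm x \<le> R" by (auto simp: bounded_pos)
  show ?thesis
  proof (rule that[OF R(1)])
    fix x :: "real ^ 'a" assume "norm x > R"
    then have "x \<notin> closure {x. \<phi> x \<noteq> 0}" using R(2)[of x] by auto
    then show "\<phi> x = 0" using closure_subset[of "{x. \<phi> x \<noteq> 0}"] by auto
  qed
qed

lemma L2_compact_bounded:
  fixes \<phi> :: "real ^ 'n \<Rightarrow> real"
  assumes [measurable]: "\<phi> \<in> borel_measurable lebesgue" and "\<And>x. \<bar>\<phi> x\<bar> \<le> B" "\<And>x. norm x > R \<Longrightarrow> \<phi> x = 0"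
  shows "\<phi> \<in> L2"
proof (rule L2_bound)
  have "integrable lebesgue (\<lambda>x. B\<^sup>2 * indicator (cball (0 :: real^'n) R) x :: real)"
    using emeasure_lborel_cball_finite[of "0 :: real^'n" R]
    by (intro integrable_mult_right integrable_real_indicator) auto
  note i = this
  show "(\<lambda>x. B * indicator (cball (0 :: real^'n) R) x) \<in> L2"
  proof -
    have "(B * indicator (cball (0 :: real^'n) R) x)\<^sup>2 = B\<^sup>2 * indicator (cball (0 :: real^'n) R) x" for x
      by (simp add: indicator_def)
    then show ?thesis using i unfolding L2_def by (auto intro!: borel_measurable_times borel_measurable_indicator)
  qed
  show "AE x in lebesgue. \<bar>\<phi> x\<bar> \<le> \<bar>B * indicator (cball 0 R) x\<bar>"
    using assms(2,3) by (intro AE_I2) (auto simp: indicator_def intro: order_trans[OF _ abs_ge_self])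
qed simp

lemma test_function_L2: "test_function \<phi> \<Longrightarrow> \<phi> \<in> L2"
  by (rule test_function_bounded, assumption, rule test_function_bounded_support, assumption)
    (rule L2_compact_bounded[OF test_function_measurable_lebesgue])

lemma locally_integrable_test:
  assumes "locally_integrable g" and "test_function \<phi>"
  shows "integrable lebesgue (\<lambda>x. g x * \<phi> x)"
proof -
  obtain B where B: "\<And>x. \<bar>\<phi> x\<bar> \<le> B" using test_function_bounded[OF assms(2)] by blast
  define K where "K = closure {x. \<phi> x \<noteq> 0}"
  have gi: "integrable lebesgue (\<lambda>x. indicator K x * g x)"
    using assms by (auto simp: locally_integrable_def set_integrable_def test_function_def K_def)
  have [measurable]: "\<phi> \<in> borel_measurable lebesgue" by (rule test_function_measurable_lebesgue[OF assms(2)])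
  have eq: "g x * \<phi> x = (indicator K x * g x) * \<phi> x" for x
  proof (cases "\<phi> x = 0")
    case False
    then have "x \<in> K" using closure_subset[of "{x. \<phi> x \<noteq> 0}"] by (auto simp: K_def)
    then show ?thesis by simp
  qed simp
  have [measurable]: "(\<lambda>x. indicator K x * g x) \<in> borel_measurable lebesgue" using gi by auto
  show ?thesis
    unfolding eq
  proof (rule Bochner_Integration.integrable_bound[of _ "\<lambda>x. B * (indicator K x * g x)"])
    show "AE x in lebesgue. norm (indicator K x * g x * \<phi> x) \<le> norm (B * (indicator K x * g x))"
    proof (intro AE_I2)
      fix x have "\<bar>indicator K x * g x\<bar> * \<bar>\<phi> x\<bar> \<le> \<bar>indicator K x * g x\<bar> * \<bar>B\<bar>" using B[of x] by (intro mult_left_mono) auto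
      then show "norm (indicator K x * g x * \<phi> x) \<le> norm (B * (indicator K x * g x))" by (simp add: abs_mult mult_ac)
    qed
    show "(\<lambda>x. indicator K x * g x * \<phi> x) \<in> borel_measurable lebesgue" by measurable
  qed (use gi in auto)
qed

text \<open>Dynkin's argument: open boxes form an intersection-stable generator of the Borel sets.
  The total integral enters in the step for complements.\<close>

lemma AE_zero_if_box_integrals_zero:
  fixes g :: "real ^ 'n \<Rightarrow> real"
  assumes int: "integrable lborel g" and z: "\<And>a b. (LINT x|lborel. indicator (box a b) x * g x) = 0"
    and tot: "(LINT x|lborel. g x) = 0"
  shows "AE x in lborel. g x = 0"
proof -
  have [measurable]: "g \<in> borel_measurable borel" using int by auto
  have i: "integrable lborel (\<lambda>x. indicator A x * g x)" if "A \<in> sets borel" for A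
    using integrable_mult_indicator[of A lborel g] that int by simp
  have "(LINT x|lborel. indicator A x * g x) = 0" if "A \<in> sets borel" for A
  proof -
    have G: "A \<in> sigma_sets UNIV (range (\<lambda>(a, b). box a b :: (real^'n) set))"
      using that by (simp add: borel_eq_box)
    have I: "Int_stable (range (\<lambda>(a, b). box a b :: (real^'n) set))"
      by (auto simp: Int_stable_def box_Int_box)
    have "range (\<lambda>(a, b). box a b :: (real^'n) set) \<subseteq> Pow UNIV" by simp
    from I this G show ?thesis
    proof (induction rule: sigma_sets_induct_disjoint)
      case (basic A) then show ?case using z by auto
    next
      case empty then show ?case by simp
    next
      case (compl A)
      then have A: "A \<in> sets borel" by (simp add: borel_eq_box)
      have "(LINT x|lborel. indicator (UNIV - A) x * g x) = (LINT x|lborel. g x - indicator A x * g x)"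
        by (intro Bochner_Integration.integral_cong) (auto simp: indicator_def)
      then show ?case using compl i[OF A] int tot by simp
    next
      case (union A)
      then have A: "\<And>n. A n \<in> sets borel" by (auto simp: borel_eq_box)
      have "(\<lambda>n. LINT x|lborel. indicator (\<Union>i<n. A i) x * g x) \<longlonglongrightarrow> (LINT x|lborel. indicator (\<Union>i. A i) x * g x)"
      proof (rule integral_dominated_convergence[where w = "\<lambda>x. \<bar>g x\<bar>"])
        show "(\<lambda>x. indicator (\<Union>i. A i) x * g x) \<in> borel_measurable lborel"
          "\<And>n. (\<lambda>x. indicator (\<Union>i<n. A i) x * g x) \<in> borel_measurable lborel" using A by measurable
        show "AE x in lborel. (\<lambda>n. indicator (\<Union>i<n. A i) x * g x) \<longlonglongrightarrow> indicator (\<Union>i. A i) x * g x"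
          by (intro AE_I2 tendsto_intros LIMSEQ_indicator_UN)
        show "integrable lborel (\<lambda>x. \<bar>g x\<bar>)" using int by (rule integrable_abs)
        show "AE x in lborel. norm (indicator (\<Union>i<n. A i) x * g x) \<le> \<bar>g x\<bar>" for n
          by (intro AE_I2) (simp add: indicator_def)
      qed
      moreover have "(LINT x|lborel. indicator (\<Union>i<n. A i) x * g x) = 0" for n
      proof (induction n)
        case (Suc n)
        have "A i \<inter> A n = {}" if "i < n" for i
          by (rule disjoint_family_onD[OF union(1)]) (use that in auto)
        then have "x \<notin> A n" if "x \<in> A i" "i < n" for x i using that by blast
        then have "indicator (\<Union>i<Suc n. A i) x * g x = indicator (\<Union>i<n. A i) x * g x + indicator (A n) x * g x" for x
          by (auto simp: indicator_def less_Suc_eq)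
        then show ?case using Suc i[OF A[of n]] union(3)[of n] i[of "\<Union>i<n. A i"] A by simp
      qed simp
      ultimately show ?case by (simp add: LIMSEQ_const_iff)
    qed
  qed
  then have "AE x in lborel. g x = (\<lambda>x. 0) x"
    using int by (intro density_unique_real) (auto simp: set_lebesgue_integral_def)
  then show ?thesis by simp
qed

text \<open>Bump functions converge to indicators of boxes, so all box integrals of \<open>g\<close>
  vanish. After cutting \<open>g\<close> off to a large box it is integrable and the preceding lemma
  applies.\<close>

lemma fundamental_lemma:
  fixes g :: "real ^ 'n \<Rightarrow> real"
  assumes g: "locally_integrable g" and z: "\<And>\<phi>. test_function \<phi> \<Longrightarrow> (LINT x|lebesgue. g x * \<phi> x) = 0"
  shows "AE x in lebesgue. g x = 0"
proof -
  have gi: "integrable lebesgue (\<lambda>x. indicator (box a b) x * g x)" for a b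
  proof -
    have "set_integrable lebesgue (cbox a b) g" using g by (simp add: locally_integrable_def)
    then have "set_integrable lebesgue (box a b) g"
      by (rule set_integrable_subset) (auto simp: box_subset_cbox)
    then show ?thesis by (simp add: set_integrable_def)
  qed
  have box0: "(LINT x|lebesgue. indicator (box a b) x * g x) = 0" for a b
  proof -
    have "(\<lambda>k. LINT x|lebesgue. g x * bump k a b x) \<longlonglongrightarrow> (LINT x|lebesgue. indicator (box a b) x * g x)"
    proof (rule integral_dominated_convergence[where w = "\<lambda>x. \<bar>indicator (box a b) x * g x\<bar>"])
      show "AE x in lebesgue. (\<lambda>k. g x * bump k a b x) \<longlonglongrightarrow> indicator (box a b) x * g x"
        by (subst mult.commute) (intro AE_I2 tendsto_intros bump_tendsto)
      show "(\<lambda>x. g x * bump k a b x) \<in> borel_measurable lebesgue" for k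
        using locally_integrable_test[OF g test_function_bump, of k a b] by auto
      show "AE x in lebesgue. norm (g x * bump k a b x) \<le> \<bar>indicator (box a b) x * g x\<bar>" for k
      proof (intro AE_I2)
        fix x show "norm (g x * bump k a b x) \<le> \<bar>indicator (box a b) x * g x\<bar>"
          using bump_outside[of x a b k] bump_bounds[where x=x and k=k and a=a and b=b] mult_left_le[of "\<bar>bump k a b x\<bar>" "\<bar>g x\<bar>"]
          by (cases "x \<in> box a b") (auto simp: abs_mult)
      qed
    qed (use gi in auto)
    moreover have "(LINT x|lebesgue. g x * bump k a b x) = 0" for k
      by (intro z test_function_bump)
    ultimately show ?thesis by (simp add: LIMSEQ_const_iff)
  qed
  have "AE x in lebesgue. indicator (box (vec (- real n)) (vec (real n))) x * g x = 0" for n :: nat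
  proof -
    define B where "B = box (vec (- real n)) (vec (real n) :: real^'n)"
    \<comment> \<open>The box argument runs over the Borel sets, whereas \<open>g\<close> is only
      Lebesgue measurable; hence a Borel version.\<close>
    obtain h where h: "h \<in> borel_measurable lborel" "AE x in lborel. indicator B x * g x = h x"
      using completion_ex_borel_measurable_real[of "\<lambda>x. indicator B x * g x" lborel] gi by (auto simp: B_def)
    have hAE: "AE x in lebesgue. indicator B x * g x = h x" using h(2) by (rule AE_completion)
    have [measurable]: "h \<in> borel_measurable borel" using h(1) by simp
    have hl: "h \<in> borel_measurable lebesgue" using h(1) by (rule measurable_completion)
    have eq: "(LINT x|lborel. indicator A x * h x) = (LINT x|lebesgue. indicator (A \<inter> B) x * g x)" if "A \<in> sets borel" for A
    proof -
      have "(LINT x|lborel. indicator A x * h x) = (LINT x|lebesgue. indicator A x * h x)"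
        using that by (intro integral_completion[symmetric]) auto
      also have "\<dots> = (LINT x|lebesgue. indicator (A \<inter> B) x * g x)"
      proof (intro integral_cong_AE)
        have A: "A \<in> sets lebesgue" using that by (auto intro: sets_completionI_sets)
        have gB: "(\<lambda>x. indicator B x * g x) \<in> borel_measurable lebesgue"
          using gi[of "vec (- real n)" "vec (real n)", folded B_def] by auto
        show "(\<lambda>x. indicator A x * h x) \<in> borel_measurable lebesgue"
          by (intro borel_measurable_times borel_measurable_indicator A hl)
        have "(\<lambda>x. indicator A x * (indicator B x * g x)) \<in> borel_measurable lebesgue"
          by (intro borel_measurable_times[OF _ gB] borel_measurable_indicator A)
        then show "(\<lambda>x. indicator (A \<inter> B) x * g x) \<in> borel_measurable lebesgue"
          by (simp add: indicator_inter_arith mult.assoc)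
        show "AE x in lebesgue. indicator A x * h x = indicator (A \<inter> B) x * g x"
          using hAE by eventually_elim (simp add: indicator_inter_arith mult.assoc)
      qed
      finally show ?thesis .
    qed
    have "AE x in lborel. h x = 0"
    proof (rule AE_zero_if_box_integrals_zero)
      have "integrable lebesgue h" using integrable_cong_AE[OF _ hl hAE] gi[of "vec (- real n)" "vec (real n)", folded B_def] by auto
      then show "integrable lborel h" by (subst integrable_completion[symmetric]) (auto intro: h)
      show "(LINT x|lborel. indicator (box a b) x * h x) = 0" for a b
        using eq[of "box a b"] box0 by (simp add: B_def box_Int_box)
      show "(LINT x|lborel. h x) = 0"
        using eq[of UNIV] box0 by (simp add: B_def)
    qed
    then have "AE x in lebesgue. h x = 0" by (rule AE_completion)
    with hAE show ?thesis unfolding B_def by eventually_elim simp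
  qed
  then have "AE x in lebesgue. \<forall>n::nat. indicator (box (vec (- real n)) (vec (real n))) x * g x = 0"
    by (subst AE_all_countable) blast
  then show ?thesis
  proof eventually_elim
    case (elim x)
    obtain n :: nat where "norm x < n" using reals_Archimedean2 by blast
    then have "x \<in> box (vec (- real n)) (vec (real n))"
      using component_le_norm_cart[of x] by (auto simp: mem_box_cart abs_le_iff intro: le_less_trans[of _ "norm x"]) (smt (verit))
    then show ?case using elim[rule_format, of n] by simp
  qed
qed

lemma L2_locally_integrable:
  assumes "u \<in> L2"
  shows "locally_integrable u"
  unfolding locally_integrable_def
proof (intro allI impI)
  fix K :: "(real^'a) set" assume "compact K"
  then obtain R where R: "\<And>x. x \<in> K \<Longrightarrow> norm x \<le> R" by (meson bounded_iff compact_imp_bounded)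
  have "indicator K \<in> (L2 :: (real^'a \<Rightarrow> real) set)"
  proof (rule L2_compact_bounded[of _ 1 R])
    show "indicator K \<in> borel_measurable lebesgue"
      using \<open>compact K\<close> by (intro borel_measurable_indicator sets_completionI_sets) (simp add: compact_imp_closed)
    show "indicator K x = (0::real)" if "R < norm x" for x
      using R[of x] that by (auto simp: indicator_def)
  qed (simp add: indicator_def)
  from L2_integrable_mult[OF this assms] show "set_integrable lebesgue K u" by (simp add: set_integrable_def)
qed

definition test_l2 :: "'n::finite l2 set" where "test_l2 = l2_of ` {\<phi>. test_function \<phi>}"

lemma l2_zero_if_orthogonal_test:
  assumes "\<And>\<phi>. test_function \<phi> \<Longrightarrow> x \<bullet> l2_of \<phi> = 0"
  shows "x = 0"
proof -
  have "AE t in lebesgue. rep x t = 0"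
  proof (rule fundamental_lemma[OF L2_locally_integrable[OF rep_L2]])
    fix \<phi> :: "real^'a \<Rightarrow> real" assume "test_function \<phi>"
    then show "(LINT t|lebesgue. rep x t * \<phi> t) = 0"
      using assms[of \<phi>] inner_l2_of[of "rep x" \<phi>] test_function_L2[of \<phi>] by simp
  qed
  then have "AE t in lebesgue. rep x t = rep 0 t" using rep_zero by eventually_elim simp
  then show ?thesis by (simp add: rep_eq_iff)
qed

lemma span_test_dense: "closure (span test_l2) = (UNIV :: 'n::finite l2 set)"
  by (rule dense_if_orthogonal_complement_trivial)
    (auto simp: test_l2_def intro!: l2_zero_if_orthogonal_test span_base)

text \<open>Completeness of Lebesgue measure supplies the measurability of \<open>v\<close>.\<close>

lemma L2_cong_AE':
  assumes "u \<in> L2" "AE x in lebesgue. u x = v x"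
  shows "v \<in> L2"
proof (rule L2_cong_AE[OF assms(1) _ assms(2)])
  show "v \<in> borel_measurable lebesgue"
  proof (rule measurableI)
    fix A :: "real set" assume "A \<in> sets borel"
    then have m: "u -` A \<inter> space lebesgue \<in> sets lebesgue"
      using L2_measurable[OF assms(1)] by (rule measurable_sets[rotated])
    have "AE x in lebesgue. x \<in> u -` A \<inter> space lebesgue \<longleftrightarrow> x \<in> v -` A \<inter> space lebesgue"
      using assms(2) by eventually_elim auto
    from completion.in_sets_AE[OF this m] show "v -` A \<inter> space lebesgue \<in> sets lebesgue" by simp
  qed simp
qed

lemma l2_dominated_convergence:
  fixes f :: "nat \<Rightarrow> real ^ 'n \<Rightarrow> real"
  assumes w: "w \<in> L2" and m: "\<And>n. f n \<in> borel_measurable lebesgue" "g \<in> borel_measurable lebesgue"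
    and lim: "AE x in lebesgue. (\<lambda>n. f n x) \<longlonglongrightarrow> g x"
    and bd: "\<And>n. AE x in lebesgue. \<bar>f n x\<bar> \<le> w x"
  shows "g \<in> L2" "(\<lambda>n. l2_of (f n)) \<longlonglongrightarrow> l2_of g"
proof -
  note [measurable] = m L2_measurable[OF w]
  have fL: "f n \<in> L2" for n
    by (rule L2_bound[OF w m(1)]) (use bd[of n] in \<open>eventually_elim, simp\<close>)
  have "AE x in lebesgue. \<forall>n. \<bar>f n x\<bar> \<le> w x" using bd by (simp add: AE_all_countable)
  with lim have gb: "AE x in lebesgue. \<bar>g x\<bar> \<le> w x"
  proof eventually_elim
    case (elim x)
    show ?case by (rule LIMSEQ_le_const2[OF tendsto_rabs[OF elim(1)]]) (use elim(2) in auto)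
  qed
  show gL: "g \<in> L2" by (rule L2_bound[OF w m(2)]) (use gb in \<open>eventually_elim, simp\<close>)
  have "(\<lambda>n. LINT x|lebesgue. (f n x - g x)\<^sup>2) \<longlonglongrightarrow> (LINT x|(lebesgue :: (real^'n) measure). 0)"
  proof (rule integral_dominated_convergence[where w = "\<lambda>x. 4 * (w x)\<^sup>2"])
    show "integrable lebesgue (\<lambda>x. 4 * (w x)\<^sup>2)" using w by (auto simp: L2_def)
    show "AE x in lebesgue. (\<lambda>n. (f n x - g x)\<^sup>2) \<longlonglongrightarrow> 0"
      using lim by eventually_elim (auto intro!: tendsto_eq_intros)
    show "AE x in lebesgue. norm ((f n x - g x)\<^sup>2) \<le> 4 * (w x)\<^sup>2" for n
      using gb bd[of n]
    proof eventually_elim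
      case (elim x)
      have "\<bar>f n x - g x\<bar>\<^sup>2 \<le> (2 * w x)\<^sup>2" using elim by (intro power_mono) auto
      then show ?case by (simp add: power_mult_distrib)
    qed
  qed auto
  then have "(\<lambda>n. (norm (l2_of (f n) - l2_of g))\<^sup>2) \<longlonglongrightarrow> 0"
    using norm_l2_of_sq[OF L2_diff[OF fL gL]] by (simp add: l2_of_diff fL gL)
  then have "(\<lambda>n. sqrt ((norm (l2_of (f n) - l2_of g))\<^sup>2)) \<longlonglongrightarrow> sqrt 0" by (rule tendsto_real_sqrt)
  then show "(\<lambda>n. l2_of (f n)) \<longlonglongrightarrow> l2_of g"
    by (subst LIM_zero_iff[symmetric], subst tendsto_norm_zero_iff[symmetric]) simp
qed

section \<open>Translations\<close>

lemma lebesgue_translation: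
  fixes y :: "real ^ 'n"
  shows "(\<lambda>x. x + y) \<in> lebesgue \<rightarrow>\<^sub>M lebesgue" "distr lebesgue lebesgue (\<lambda>x. x + y) = lebesgue"
proof -
  have eq: "(\<lambda>x::real^'n. y + (\<Sum>j\<in>Basis. (1 * (x \<bullet> j)) *\<^sub>R j)) = (\<lambda>x. x + y)"
    by (simp add: euclidean_representation add.commute)
  show "(\<lambda>x. x + y) \<in> lebesgue \<rightarrow>\<^sub>M lebesgue"
    using lebesgue_affine_measurable[of "\<lambda>_::real^'n. 1" y] unfolding eq by simp
  show "distr lebesgue lebesgue (\<lambda>x. x + y) = lebesgue"
    using lebesgue_affine_euclidean[of "\<lambda>_::real^'n. 1" y] unfolding eq by (simp add: density_1)
qed

lemma measurable_translation: "f \<in> borel_measurable lebesgue \<Longrightarrow> (\<lambda>x. f (x + y)) \<in> borel_measurable lebesgue"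
  for y :: "real ^ 'n"
  using measurable_compose[OF lebesgue_translation(1)] by blast

lemma integral_translation:
  fixes f :: "real ^ 'n \<Rightarrow> real"
  assumes "f \<in> borel_measurable lebesgue"
  shows "(LINT x|lebesgue. f (x + y)) = (LINT x|lebesgue. f x)"
  using integral_distr[OF lebesgue_translation(1)[of y], of f] assms by (simp add: lebesgue_translation)

lemma integrable_translation:
  fixes f :: "real ^ 'n \<Rightarrow> real"
  assumes "integrable lebesgue f"
  shows "integrable lebesgue (\<lambda>x. f (x + y))"
  using integrable_distr[OF lebesgue_translation(1)[of y], of f] assms by (simp add: lebesgue_translation)

lemma AE_translation:
  fixes y :: "real ^ 'n"
  assumes "AE x in lebesgue. P x"
  shows "AE x in lebesgue. P (x + y)"
proof -
  have "AE x in distr lebesgue lebesgue (\<lambda>x. x + y). P x" using assms unfolding lebesgue_translation(2) .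
  from AE_distrD[OF lebesgue_translation(1) this] show ?thesis .
qed

lemma L2_translation: "u \<in> L2 \<Longrightarrow> (\<lambda>x. u (x + y)) \<in> L2"
  unfolding L2_def by (auto intro: measurable_translation integrable_translation[where f = "\<lambda>x. (u x)\<^sup>2"])

text \<open>Translations form a strongly continuous unitary group on the classes. Weak derivatives,
  elliptic regularity and box averages are all obtained from it.\<close>

definition tr :: "real ^ 'n \<Rightarrow> 'n l2 \<Rightarrow> 'n l2" where
  "tr y x = l2_of (\<lambda>t. rep x (t + y))"

lemma tr_l2_of:
  assumes "u \<in> L2"
  shows "tr y (l2_of u) = l2_of (\<lambda>t. u (t + y))"
  unfolding tr_def using AE_translation[OF rep_l2_of[OF assms]] assms
  by (subst l2_of_eq_iff) (auto intro: L2_translation)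

lemma l2_induct: "(\<And>u. u \<in> L2 \<Longrightarrow> P (l2_of u)) \<Longrightarrow> P x"
  using l2_of_rep rep_L2 by metis

lemma tr_add: "tr y (a + b) = tr y a + tr y b"
  by (induction a rule: l2_induct, induction b rule: l2_induct)
    (simp add: tr_l2_of L2_add L2_translation flip: l2_of_add)

lemma tr_scale: "tr y (c *\<^sub>R a) = c *\<^sub>R tr y a"
  by (induction a rule: l2_induct) (simp add: tr_l2_of L2_scale L2_translation flip: l2_of_scale)

lemma inner_tr_tr: "tr y a \<bullet> tr y b = a \<bullet> b"
  using integral_translation[of "\<lambda>t. rep a t * rep b t" y]
  unfolding tr_def inner_l2_rep[of a b] by (subst inner_l2_of) (auto intro: L2_translation)

lemma norm_tr [simp]: "norm (tr y a) = norm a"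
  by (simp add: norm_eq_sqrt_inner inner_tr_tr)

lemma tr_0 [simp]: "tr 0 a = a"
  by (simp add: tr_def)

lemma tr_tr: "tr y (tr z a) = tr (y + z) a"
  by (induction a rule: l2_induct) (simp add: tr_l2_of L2_translation add.assoc)

lemma inner_tr_left: "tr y a \<bullet> b = a \<bullet> tr (- y) b"
  using inner_tr_tr[of "- y" "tr y a" b] by (simp add: tr_tr)

lemma bounded_linear_tr: "bounded_linear (tr y)"
  by (rule bounded_linear_intro[of _ 1]) (auto simp: tr_add tr_scale)

lemma tr_diff: "tr y (a - b) = tr y a - tr y b"
  using bounded_linear_tr[of y] by (simp add: bounded_linear.linear linear_diff)

section \<open>Stability and density of test functions, continuity of translations\<close>

lemma Ck_add: "Ck k f \<Longrightarrow> Ck k g \<Longrightarrow> Ck k (\<lambda>x. f x + g x)"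
proof (induction k arbitrary: f g)
  case 0 then show ?case by (auto intro: continuous_on_add)
next
  case (Suc k)
  have d: "(f has_derivative frechet_derivative f (at x)) (at x)" "(g has_derivative frechet_derivative g (at x)) (at x)" for x
    using Suc.prems by (simp_all add: differentiable_on_def flip: frechet_derivative_works)
  have "partial i (\<lambda>x. f x + g x) = (\<lambda>x. partial i f x + partial i g x)" for i
    using has_derivative_add[OF d] partial_eq by (fastforce simp: partial_def fun_eq_iff)
  then show ?case using Suc by (auto intro: differentiable_on_add)
qed

lemma Ck_scale: "Ck k f \<Longrightarrow> Ck k (\<lambda>x. c * f x)"
proof (induction k arbitrary: f)
  case 0 then show ?case by (auto intro: continuous_on_mult_left)
next
  case (Suc k)
  have d: "(f has_derivative frechet_derivative f (at x)) (at x)" for x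
    using Suc.prems by (simp_all add: differentiable_on_def flip: frechet_derivative_works)
  have "partial i (\<lambda>x. c * f x) = (\<lambda>x. c * partial i f x)" for i
    using has_derivative_mult_right[OF d, of c] partial_eq by (fastforce simp: partial_def fun_eq_iff)
  then show ?case using Suc by auto
qed

lemma Ck_translation: "Ck k f \<Longrightarrow> Ck k (\<lambda>x. f (x + y)) \<and> (k > 0 \<longrightarrow> partial i (\<lambda>x. f (x + y)) = (\<lambda>x. partial i f (x + y)))"
proof (induction k arbitrary: f i)
  case 0 then show ?case
    by (auto intro!: continuous_on_compose2[of UNIV f UNIV "\<lambda>x. x + y"] continuous_intros)
next
  case (Suc k)
  have d: "(f has_derivative frechet_derivative f (at x)) (at x)" for x
    using Suc.prems by (simp_all add: differentiable_on_def flip: frechet_derivative_works)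
  have d': "((\<lambda>x. f (x + y)) has_derivative frechet_derivative f (at (x + y))) (at x)" for x
  proof -
    have "((\<lambda>x. x + y) has_derivative (\<lambda>h. h)) (at x)" by (auto intro!: derivative_eq_intros)
    from has_derivative_compose[OF this d] show ?thesis .
  qed
  then have p: "partial i (\<lambda>x. f (x + y)) = (\<lambda>x. partial i f (x + y))" for i
    using partial_eq[OF d'] by (simp add: fun_eq_iff partial_def)
  moreover have "(\<lambda>x. f (x + y)) differentiable_on UNIV"
    using d' by (auto simp: differentiable_on_def differentiable_def)
  ultimately show ?case using Suc.IH Suc.prems by auto
qed

lemma partial_translation: "test_function \<phi> \<Longrightarrow> partial i (\<lambda>x. \<phi> (x + y)) = (\<lambda>x. partial i \<phi> (x + y))"
  using Ck_translation[of "Suc 0" \<phi> y i] unfolding test_function_def by blast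

lemma test_functionI_bounded:
  assumes "\<And>k. Ck k \<phi>" "\<And>x. norm x > R \<Longrightarrow> \<phi> x = 0"
  shows "test_function \<phi>"
proof -
  have "bounded {x. \<phi> x \<noteq> 0}"
    by (rule bounded_subset[OF bounded_cball[of 0 R]]) (use assms(2) in \<open>force simp: not_le[symmetric]\<close>)
  then show ?thesis using assms(1) by (simp add: test_function_def)
qed

lemma test_function_Ck: "test_function \<phi> \<Longrightarrow> Ck k \<phi>"
  by (simp only: test_function_def)

lemma test_function_translation:
  assumes "test_function \<phi>"
  shows "test_function (\<lambda>x. \<phi> (x + y))"
proof -
  obtain R where R: "R > 0" "\<And>x. norm x > R \<Longrightarrow> \<phi> x = 0"
    using test_function_bounded_support[OF assms] by blast
  show ?thesis
  proof (rule test_functionI_bounded[of _ "R + norm y"])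
    show "Ck k (\<lambda>x. \<phi> (x + y))" for k using Ck_translation[of k \<phi> y] test_function_Ck[OF assms] by blast
    fix x :: "real ^ 'a" assume "norm x > R + norm y"
    then have "norm (x + y) > R" using norm_triangle_ineq4[of "x + y" y] by simp
    then show "\<phi> (x + y) = 0" by (rule R(2))
  qed
qed

lemma test_function_add:
  assumes "test_function \<phi>" "test_function \<psi>"
  shows "test_function (\<lambda>x. \<phi> x + \<psi> x)"
proof -
  obtain R where R: "R > 0" "\<And>x. norm x > R \<Longrightarrow> \<phi> x = 0"
    using test_function_bounded_support[OF assms(1)] by blast
  obtain R' where R': "R' > 0" "\<And>x. norm x > R' \<Longrightarrow> \<psi> x = 0"
    using test_function_bounded_support[OF assms(2)] by blast
  show ?thesis
    by (rule test_functionI_bounded[of _ "max R R'"])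
      (use R R' in \<open>auto intro: Ck_add test_function_Ck[OF assms(1)] test_function_Ck[OF assms(2)]\<close>)
qed

lemma test_function_scale:
  assumes "test_function \<phi>"
  shows "test_function (\<lambda>x. c * \<phi> x)"
proof -
  obtain R where R: "R > 0" "\<And>x. norm x > R \<Longrightarrow> \<phi> x = 0"
    using test_function_bounded_support[OF assms(1)] by blast
  show ?thesis
    by (rule test_functionI_bounded[of _ R]) (use R in \<open>auto intro: Ck_scale test_function_Ck[OF assms]\<close>)
qed

lemma subspace_test_l2: "subspace (test_l2 :: 'n::finite l2 set)"
  unfolding subspace_def
proof (intro conjI ballI allI)
  have "test_function (\<lambda>x. 0 * bump 0 0 0 x :: real)" by (rule test_function_scale[OF test_function_bump])
  then have "test_function (\<lambda>x::real^'n. 0::real)" by simp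
  then show "0 \<in> (test_l2 :: 'n l2 set)" unfolding test_l2_def using l2_of_zero by force
next
  fix x y :: "'n l2" assume "x \<in> test_l2" "y \<in> test_l2"
  then obtain f g where f: "test_function f" "x = l2_of f" and g: "test_function g" "y = l2_of g"
    unfolding test_l2_def by blast
  then have "x + y = l2_of (\<lambda>t. f t + g t)" by (simp add: l2_of_add test_function_L2)
  then show "x + y \<in> test_l2" unfolding test_l2_def using test_function_add[OF f(1) g(1)] by blast
next
  fix c and x :: "'n l2" assume "x \<in> test_l2"
  then obtain f where f: "test_function f" "x = l2_of f" unfolding test_l2_def by blast
  then have "c *\<^sub>R x = l2_of (\<lambda>t. c * f t)" by (simp add: l2_of_scale test_function_L2)
  then show "c *\<^sub>R x \<in> test_l2" unfolding test_l2_def using test_function_scale[OF f(1)] by blast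
qed

lemma test_dense: "closure test_l2 = (UNIV :: 'n::finite l2 set)"
  using span_test_dense subspace_test_l2 by (metis span_eq_iff)

text \<open>By density the test functions may approach \<open>v\<close> itself, and in the limit the
  hypothesis reads |v|^2 <= C |v|.\<close>

lemma norm_le_if_test:
  fixes v :: "'n::finite l2"
  assumes "C \<ge> 0" and "\<And>\<phi>. test_function \<phi> \<Longrightarrow> \<bar>v \<bullet> l2_of \<phi>\<bar> \<le> C * norm (l2_of \<phi>)"
  shows "norm v \<le> C"
proof -
  have "v \<in> closure test_l2" by (simp add: test_dense)
  then obtain f where f: "\<And>n. f n \<in> test_l2" "f \<longlonglongrightarrow> v" unfolding closure_sequential by blast
  have "\<bar>v \<bullet> f n\<bar> \<le> C * norm (f n)" for n
    using f(1)[of n] assms(2) by (auto simp: test_l2_def)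
  moreover have "(\<lambda>n. \<bar>v \<bullet> f n\<bar>) \<longlonglongrightarrow> \<bar>v \<bullet> v\<bar>" "(\<lambda>n. C * norm (f n)) \<longlonglongrightarrow> C * norm v"
    by (intro tendsto_intros f(2))+
  ultimately have "\<bar>v \<bullet> v\<bar> \<le> C * norm v" by (intro LIMSEQ_le) auto
  then have "norm v * norm v \<le> C * norm v" by (simp add: power2_norm_eq_inner[symmetric] power2_eq_square)
  then show ?thesis using assms(1) by (cases "v = 0") simp_all
qed

text \<open>A common majorant for all translates of length at most one, as needed for dominated
  convergence.\<close>

lemma test_shift_bound:
  assumes "test_function \<phi>"
  obtains w where "w \<in> L2" "\<And>x h. norm h \<le> 1 \<Longrightarrow> \<bar>\<phi> (x + h)\<bar> \<le> w x"
proof -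
  obtain R where R: "R > 0" "\<And>x. norm x > R \<Longrightarrow> \<phi> x = 0"
    using test_function_bounded_support[OF assms] by blast
  obtain B where B: "\<And>x. \<bar>\<phi> x\<bar> \<le> B" using test_function_bounded[OF assms] by blast
  define w where "w x = B * indicator (cball 0 (R + 1)) x" for x :: "real ^ 'a"
  have B0: "B \<ge> 0" using order_trans[OF abs_ge_zero B] .
  have "\<bar>\<phi> (x + h)\<bar> \<le> w x" if "norm h \<le> 1" for x h
  proof (cases "norm x \<le> R + 1")
    case True then show ?thesis using B by (simp add: w_def)
  next
    case False
    then have "norm (x + h) > R" using norm_triangle_ineq4[of "x + h" h] that by simp
    then show ?thesis using R(2) B0 by (simp add: w_def)
  qed
  moreover have "w \<in> L2"
  proof (rule L2_compact_bounded[of _ B "R + 1"])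
    show "w \<in> borel_measurable lebesgue" unfolding w_def
      by (intro borel_measurable_times borel_measurable_indicator borel_measurable_const sets_completionI_sets) auto
  qed (use B0 in \<open>auto simp: w_def indicator_def\<close>)
  ultimately show ?thesis using that by blast
qed

lemma tr_test_tendsto:
  assumes "test_function \<phi>"
  shows "((\<lambda>h. tr h (l2_of \<phi>)) \<longlongrightarrow> l2_of \<phi>) (at 0)"
  unfolding tendsto_at_iff_sequentially
proof (intro allI impI)
  fix X :: "nat \<Rightarrow> real ^ 'a" assume X: "X \<longlonglongrightarrow> 0"
  obtain w where w: "w \<in> L2" "\<And>x h. norm h \<le> 1 \<Longrightarrow> \<bar>\<phi> (x + h)\<bar> \<le> w x"
    using test_shift_bound[OF assms] by blast
  have "eventually (\<lambda>n. norm (X n) < 1) sequentially"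
    using tendsto_norm_zero[OF X] by (rule order_tendstoD(2)) simp
  then obtain N where N: "\<And>n. n \<ge> N \<Longrightarrow> norm (X n) \<le> 1" unfolding eventually_sequentially by (metis less_imp_le)
  have "(\<lambda>n. l2_of (\<lambda>x. \<phi> (x + X (n + N)))) \<longlonglongrightarrow> l2_of \<phi>"
  proof (rule l2_dominated_convergence(2)[OF w(1)])
    have "(\<lambda>n. \<phi> (x + X (n + N))) \<longlonglongrightarrow> \<phi> (x + 0)" for x
    proof (rule isCont_tendsto_compose[of _ \<phi>])
      show "isCont \<phi> (x + 0)" using test_function_continuous[OF assms] by (simp add: continuous_on_eq_continuous_at)
      show "(\<lambda>n. x + X (n + N)) \<longlonglongrightarrow> x + 0" by (intro tendsto_intros LIMSEQ_ignore_initial_segment X)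
    qed
    then show "AE x in lebesgue. (\<lambda>n. \<phi> (x + X (n + N))) \<longlonglongrightarrow> \<phi> x" by simp
    show "AE x in lebesgue. \<bar>\<phi> (x + X (n + N))\<bar> \<le> w x" for n using w(2) N by simp
  qed (use assms in \<open>auto intro: measurable_translation test_function_measurable_lebesgue\<close>)
  then have "(\<lambda>n. tr (X (n + N)) (l2_of \<phi>)) \<longlonglongrightarrow> l2_of \<phi>"
    by (simp add: tr_l2_of test_function_L2[OF assms])
  from LIMSEQ_offset[OF this] show "((\<lambda>h. tr h (l2_of \<phi>)) \<circ> X) \<longlonglongrightarrow> l2_of \<phi>" by (simp add: o_def)
qed

text \<open>Strong continuity passes from the dense set of test functions to all vectors because
  translations are isometries.\<close>

lemma tr_tendsto_0: "((\<lambda>h. tr h x) \<longlongrightarrow> x) (at 0)"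
proof (rule tendstoI)
  fix e :: real assume "e > 0"
  have "x \<in> closure test_l2" by (simp add: test_dense)
  then obtain y where "y \<in> test_l2" "dist y x < e / 3" using \<open>e > 0\<close> closure_approachable
    by (metis divide_pos_pos zero_less_numeral)
  then obtain \<phi> where \<phi>: "test_function \<phi>" "norm (l2_of \<phi> - x) < e / 3" by (auto simp: test_l2_def dist_norm)
  have "eventually (\<lambda>h. dist (tr h (l2_of \<phi>)) (l2_of \<phi>) < e / 3) (at 0)"
    using tr_test_tendsto[OF \<phi>(1)] \<open>e > 0\<close> by (intro tendstoD) auto
  then show "eventually (\<lambda>h. dist (tr h x) x < e) (at 0)"
  proof eventually_elim
    case (elim h)
    have "norm (tr h x - x) \<le> norm (tr h (x - l2_of \<phi>)) + norm (tr h (l2_of \<phi>) - l2_of \<phi>) + norm (l2_of \<phi> - x)"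
      using norm_triangle_ineq[of "tr h (x - l2_of \<phi>) + (tr h (l2_of \<phi>) - l2_of \<phi>)" "l2_of \<phi> - x"]
        norm_triangle_ineq[of "tr h (x - l2_of \<phi>)" "tr h (l2_of \<phi>) - l2_of \<phi>"]
      by (simp add: tr_diff)
    also have "\<dots> < e" using elim \<phi>(2) unfolding dist_norm norm_tr norm_minus_commute[of x "l2_of \<phi>"] by linarith
    finally show ?case by (simp add: dist_norm)
  qed
qed

lemma continuous_tr: "continuous_on UNIV (\<lambda>y. tr y x)"
proof -
  have "((\<lambda>h. tr y (tr h x)) \<longlongrightarrow> tr y x) (at 0)" for y
    by (intro bounded_linear.tendsto[OF bounded_linear_tr] tr_tendsto_0)
  then show ?thesis
    by (simp add: continuous_on_eq_continuous_at isCont_iff tr_tr)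
qed

section \<open>Weak derivatives in \<open>L2\<close>\<close>

text \<open>The weak partial derivative on classes, kept as a relation because existence is itself
  the question; uniqueness follows from the density of test functions.\<close>

definition hwp :: "'n::finite \<Rightarrow> 'n l2 \<Rightarrow> 'n l2 \<Rightarrow> bool" where
  "hwp i x g \<longleftrightarrow> (\<forall>\<phi>. test_function \<phi> \<longrightarrow> x \<bullet> l2_of (partial i \<phi>) = - (g \<bullet> l2_of \<phi>))"

lemma hwp_iff_has_weak_partial:
  assumes "u \<in> L2" "g \<in> L2"
  shows "hwp i (l2_of u) (l2_of g) \<longleftrightarrow> has_weak_partial i u g"
  unfolding hwp_def has_weak_partial_def using assms L2_locally_integrable
  by (auto simp: inner_l2_of test_function_L2 test_function_partial)

lemma hwp_unique: "hwp i x g \<Longrightarrow> hwp i x g' \<Longrightarrow> g = g'"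
  using l2_zero_if_orthogonal_test[of "g - g'"] by (auto simp: hwp_def inner_diff_left)

lemma hwp_add: "hwp i x g \<Longrightarrow> hwp i y k \<Longrightarrow> hwp i (x + y) (g + k)"
  by (auto simp: hwp_def inner_add_left)

lemma hwp_diff: "hwp i x g \<Longrightarrow> hwp i y k \<Longrightarrow> hwp i (x - y) (g - k)"
  by (auto simp: hwp_def inner_diff_left)

lemma hwp_scale: "hwp i x g \<Longrightarrow> hwp i (c *\<^sub>R x) (c *\<^sub>R g)"
  by (auto simp: hwp_def)

lemma hwp_tr:
  assumes "hwp i x g"
  shows "hwp i (tr y x) (tr y g)"
  unfolding hwp_def
proof (intro allI impI)
  fix \<phi> :: "real ^ 'a \<Rightarrow> real" assume \<phi>: "test_function \<phi>"
  show "tr y x \<bullet> l2_of (partial i \<phi>) = - (tr y g \<bullet> l2_of \<phi>)"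
  proof -
    have "x \<bullet> l2_of (partial i (\<lambda>t. \<phi> (t + - y))) = - (g \<bullet> l2_of (\<lambda>t. \<phi> (t + - y)))"
      using assms test_function_translation[OF \<phi>, of "- y"] unfolding hwp_def by blast
    then show ?thesis
      unfolding partial_translation[OF \<phi>]
      by (simp add: inner_tr_left tr_l2_of test_function_L2[OF \<phi>] test_function_L2[OF test_function_partial[OF \<phi>]])
  qed
qed

lemma hwp_weak_limit:
  assumes "\<And>n. hwp i (x n) (g n)" "wconv x a" "wconv g b"
  shows "hwp i a b"
  unfolding hwp_def
proof (intro allI impI)
  fix \<phi> :: "real ^ 'a \<Rightarrow> real" assume "test_function \<phi>"
  then have "(\<lambda>n. x n \<bullet> l2_of (partial i \<phi>)) \<longlonglongrightarrow> - (b \<bullet> l2_of \<phi>)"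
    using assms(1) tendsto_minus[OF wconv_tendsto[OF assms(3), of "l2_of \<phi>"]] by (simp add: hwp_def)
  then show "a \<bullet> l2_of (partial i \<phi>) = - (b \<bullet> l2_of \<phi>)"
    using wconv_tendsto[OF assms(2)] LIMSEQ_unique by blast
qed

lemma tr_test_has_derivative:
  assumes "test_function \<phi>"
  shows "((\<lambda>h. (tr (h *\<^sub>R axis i 1) (l2_of \<phi>) - l2_of \<phi>) /\<^sub>R h) \<longlongrightarrow> l2_of (partial i \<phi>)) (at 0)"
  unfolding tendsto_at_iff_sequentially
proof (intro allI impI)
  fix X :: "nat \<Rightarrow> real" assume X0: "\<forall>n. X n \<in> UNIV - {0}" and X: "X \<longlonglongrightarrow> 0"
  let ?e = "axis i 1 :: real ^ 'a"
  have n1: "norm (s *\<^sub>R ?e) = \<bar>s\<bar>" for s :: real by simp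
  have der: "((\<lambda>s. \<phi> (x + s *\<^sub>R ?e)) has_real_derivative partial i \<phi> (x + s *\<^sub>R ?e)) (at s)" for x s
  proof -
    have 1: "((\<lambda>s. x + s *\<^sub>R ?e) has_derivative (\<lambda>h. h *\<^sub>R ?e)) (at s)" by (auto intro!: derivative_eq_intros)
    note d = test_function_has_derivative[OF assms, of "x + s *\<^sub>R ?e"]
    have "((\<lambda>s. \<phi> (x + s *\<^sub>R ?e)) has_derivative (\<lambda>h. frechet_derivative \<phi> (at (x + s *\<^sub>R ?e)) (h *\<^sub>R ?e))) (at s)"
      using has_derivative_compose[OF 1 d] .
    moreover have "frechet_derivative \<phi> (at (x + s *\<^sub>R ?e)) (h *\<^sub>R ?e) = partial i \<phi> (x + s *\<^sub>R ?e) * h" for h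
      using linear_scale[OF has_derivative_linear[OF d], of h ?e] by (simp add: partial_def)
    ultimately show ?thesis by (simp add: has_field_derivative_def)
  qed
  obtain w where w: "w \<in> L2" "\<And>x h. norm h \<le> 1 \<Longrightarrow> \<bar>partial i \<phi> (x + h)\<bar> \<le> w x"
    using test_shift_bound[OF test_function_partial[OF assms]] by blast
  have "eventually (\<lambda>n. \<bar>X n\<bar> < 1) sequentially"
    using tendsto_norm_zero[OF X] by (intro order_tendstoD(2)) auto
  then obtain N where N: "\<And>n. n \<ge> N \<Longrightarrow> \<bar>X n\<bar> \<le> 1" unfolding eventually_sequentially by (metis less_imp_le)
  define f where "f n x = (\<phi> (x + X (n + N) *\<^sub>R ?e) - \<phi> x) / X (n + N)" for n x
  have [measurable]: "\<phi> \<in> borel_measurable lebesgue" "(\<lambda>x. \<phi> (x + y)) \<in> borel_measurable lebesgue" for y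
    using test_function_measurable_lebesgue[OF assms] measurable_translation by auto
  have "(\<lambda>n. l2_of (f n)) \<longlonglongrightarrow> l2_of (partial i \<phi>)"
  proof (rule l2_dominated_convergence(2)[OF w(1)])
    show "AE x in lebesgue. (\<lambda>n. f n x) \<longlonglongrightarrow> partial i \<phi> x"
    proof (intro AE_I2)
      fix x
      have "((\<lambda>h. (\<phi> (x + h *\<^sub>R ?e) - \<phi> x) / h) \<longlongrightarrow> partial i \<phi> x) (at 0)"
        using der[of x 0] by (simp add: has_field_derivative_iff)
      then have "((\<lambda>h. (\<phi> (x + h *\<^sub>R ?e) - \<phi> x) / h) \<circ> (\<lambda>n. X (n + N))) \<longlonglongrightarrow> partial i \<phi> x"
        unfolding tendsto_at_iff_sequentially using X0 X by (auto intro: LIMSEQ_ignore_initial_segment)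
      then show "(\<lambda>n. f n x) \<longlonglongrightarrow> partial i \<phi> x" by (simp add: f_def o_def)
    qed
    show "AE x in lebesgue. \<bar>f n x\<bar> \<le> w x" for n
    proof (intro AE_I2)
      fix x
      define h where "h = X (n + N)"
      have h: "\<bar>h\<bar> \<le> 1" "h \<noteq> 0" using N X0 by (auto simp: h_def)
      have "norm (\<phi> (x + h *\<^sub>R ?e) - \<phi> (x + 0 *\<^sub>R ?e)) \<le> w x * norm (h - 0)"
      proof (rule field_differentiable_bound[where S = "cball 0 1" and f = "\<lambda>s. \<phi> (x + s *\<^sub>R ?e)"])
        show "norm (partial i \<phi> (x + s *\<^sub>R ?e)) \<le> w x" if "s \<in> cball 0 1" for s
          using w(2)[of "s *\<^sub>R ?e" x] that by simp
      qed (use h der in \<open>auto intro: has_field_derivative_at_within\<close>)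
      then have "\<bar>\<phi> (x + h *\<^sub>R ?e) - \<phi> x\<bar> / \<bar>h\<bar> \<le> w x" using h(2) by (simp add: pos_divide_le_eq)
      then show "\<bar>f n x\<bar> \<le> w x" by (simp add: f_def h_def)
    qed
    show "f n \<in> borel_measurable lebesgue" for n unfolding f_def by measurable
  qed (use test_function_measurable_lebesgue[OF test_function_partial[OF assms]] in auto)
  moreover have "l2_of (f n) = (tr (X (n + N) *\<^sub>R ?e) (l2_of \<phi>) - l2_of \<phi>) /\<^sub>R X (n + N)" for n
    using l2_of_scale[OF L2_diff[OF L2_translation[OF test_function_L2[OF assms]] test_function_L2[OF assms]],
        of "inverse (X (n + N))" "X (n + N) *\<^sub>R ?e"]
    by (simp add: f_def[abs_def] tr_l2_of l2_of_diff L2_translation test_function_L2[OF assms] divide_inverse mult.commute)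
  ultimately have "(\<lambda>n. (tr (X (n + N) *\<^sub>R ?e) (l2_of \<phi>) - l2_of \<phi>) /\<^sub>R X (n + N)) \<longlonglongrightarrow> l2_of (partial i \<phi>)"
    by simp
  from LIMSEQ_offset[OF this]
  show "((\<lambda>h. (tr (h *\<^sub>R ?e) (l2_of \<phi>) - l2_of \<phi>) /\<^sub>R h) \<circ> X) \<longlonglongrightarrow> l2_of (partial i \<phi>)" by (simp add: o_def)
qed

lemma tr_test_has_derivative_minus:
  assumes "test_function \<phi>"
  shows "((\<lambda>h. (tr (- h *\<^sub>R axis i 1) (l2_of \<phi>) - l2_of \<phi>) /\<^sub>R h) \<longlongrightarrow> - l2_of (partial i \<phi>)) (at 0)"
proof -
  have "((\<lambda>h. (tr (- h *\<^sub>R axis i 1) (l2_of \<phi>) - l2_of \<phi>) /\<^sub>R (- h)) \<longlongrightarrow> l2_of (partial i \<phi>)) (at 0)"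
  proof (rule filterlim_compose[OF tr_test_has_derivative[OF assms]])
    have "((\<lambda>h::real. - h) \<longlongrightarrow> - 0) (at 0)" by (intro tendsto_intros)
    then show "filterlim (\<lambda>h::real. - h) (at 0) (at 0)"
      by (auto simp: filterlim_at eventually_at intro!: exI[of _ 1])
  qed
  from tendsto_minus[OF this] show ?thesis by simp
qed

text \<open>The translation is moved onto the test function, where the difference quotient converges
  in norm. This gives a scalar function to which the mean value inequality applies.\<close>

lemma hwp_pairing_derivative:
  assumes h: "hwp i x g" and \<phi>: "test_function \<phi>"
  shows "((\<lambda>s. tr (s *\<^sub>R axis i 1) x \<bullet> l2_of \<phi>) has_real_derivative tr (s *\<^sub>R axis i 1) g \<bullet> l2_of \<phi>) (at s)"
proof -
  let ?e = "axis i 1 :: real ^ 'a"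
  have "((\<lambda>h. tr (s *\<^sub>R ?e) x \<bullet> ((tr (- h *\<^sub>R ?e) (l2_of \<phi>) - l2_of \<phi>) /\<^sub>R h))
      \<longlongrightarrow> tr (s *\<^sub>R ?e) x \<bullet> (- l2_of (partial i \<phi>))) (at 0)"
    by (intro tendsto_intros tr_test_has_derivative_minus[OF \<phi>])
  moreover have "tr (s *\<^sub>R ?e) x \<bullet> (- l2_of (partial i \<phi>)) = tr (s *\<^sub>R ?e) g \<bullet> l2_of \<phi>"
    using hwp_tr[OF h] \<phi> by (simp add: hwp_def)
  moreover have "tr (s *\<^sub>R ?e) x \<bullet> ((tr (- h *\<^sub>R ?e) (l2_of \<phi>) - l2_of \<phi>) /\<^sub>R h)
     = (tr ((s + h) *\<^sub>R ?e) x \<bullet> l2_of \<phi> - tr (s *\<^sub>R ?e) x \<bullet> l2_of \<phi>) / h" for h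
    using inner_tr_left[of "h *\<^sub>R ?e" "tr (s *\<^sub>R ?e) x" "l2_of \<phi>"]
    by (simp add: inner_diff_right tr_tr algebra_simps divide_inverse)
  ultimately show ?thesis by (simp add: DERIV_def)
qed

text \<open>Mean value inequality for the pairing with each test function, then duality.\<close>

lemma hwp_difference_bound:
  assumes h: "hwp i x g"
  shows "norm (tr (t *\<^sub>R axis i 1) x - x) \<le> \<bar>t\<bar> * norm g"
proof (rule norm_le_if_test)
  let ?e = "axis i 1 :: real ^ 'a"
  fix \<phi> :: "real ^ 'a \<Rightarrow> real" assume \<phi>: "test_function \<phi>"
  have "norm (tr (t *\<^sub>R ?e) x \<bullet> l2_of \<phi> - tr (0 *\<^sub>R ?e) x \<bullet> l2_of \<phi>) \<le> (norm g * norm (l2_of \<phi>)) * norm (t - 0)"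
  proof (rule field_differentiable_bound[where S = UNIV and f = "\<lambda>s. tr (s *\<^sub>R ?e) x \<bullet> l2_of \<phi>"])
    show "norm (tr (s *\<^sub>R ?e) g \<bullet> l2_of \<phi>) \<le> norm g * norm (l2_of \<phi>)" for s
      using Cauchy_Schwarz_ineq2[of "tr (s *\<^sub>R ?e) g" "l2_of \<phi>"] by simp
  qed (use hwp_pairing_derivative[OF h \<phi>] in auto)
  then show "\<bar>(tr (t *\<^sub>R ?e) x - x) \<bullet> l2_of \<phi>\<bar> \<le> \<bar>t\<bar> * norm g * norm (l2_of \<phi>)"
    by (simp add: inner_diff_left mult_ac)
qed simp

text \<open>The same argument for the pairing minus its linear part: its derivative is the pairing
  with \<open>tr (s *\<^sub>R axis i 1) g - g\<close>, small by strong continuity.\<close>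

lemma hwp_difference_tendsto:
  assumes h: "hwp i x g"
  shows "((\<lambda>t. (tr (t *\<^sub>R axis i 1) x - x) /\<^sub>R t) \<longlongrightarrow> g) (at 0)"
proof (rule tendstoI)
  let ?e = "axis i 1 :: real ^ 'a"
  fix e :: real assume "e > 0"
  have "isCont (\<lambda>y. tr y g) 0" using continuous_tr[of g] by (simp add: continuous_on_eq_continuous_at)
  then obtain d where d: "d > 0" "\<And>y. norm y < d \<Longrightarrow> norm (tr y g - g) < e / 2"
    using \<open>e > 0\<close> unfolding continuous_at_eps_delta dist_norm
    by (metis diff_zero half_gt_zero tr_0)
  have "norm ((tr (t *\<^sub>R ?e) x - x) /\<^sub>R t - g) < e" if "t \<noteq> 0" "\<bar>t\<bar> < d" for t
  proof -
    have "norm (tr (t *\<^sub>R ?e) x - x - t *\<^sub>R g) \<le> \<bar>t\<bar> * (e / 2)"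
    proof (rule norm_le_if_test)
      fix \<phi> :: "real ^ 'a \<Rightarrow> real" assume \<phi>: "test_function \<phi>"
      have "norm ((tr (t *\<^sub>R ?e) x \<bullet> l2_of \<phi> - t * (g \<bullet> l2_of \<phi>)) - (tr (0 *\<^sub>R ?e) x \<bullet> l2_of \<phi> - 0 * (g \<bullet> l2_of \<phi>)))
          \<le> (e / 2 * norm (l2_of \<phi>)) * norm (t - 0)"
      proof (rule field_differentiable_bound[where S = "ball 0 d" and f = "\<lambda>s. tr (s *\<^sub>R ?e) x \<bullet> l2_of \<phi> - s * (g \<bullet> l2_of \<phi>)"])
        fix s :: real assume s: "s \<in> ball 0 d"
        show "((\<lambda>s. tr (s *\<^sub>R ?e) x \<bullet> l2_of \<phi> - s * (g \<bullet> l2_of \<phi>)) has_field_derivative (tr (s *\<^sub>R ?e) g - g) \<bullet> l2_of \<phi>) (at s within ball 0 d)"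
          using has_field_derivative_at_within[OF hwp_pairing_derivative[OF h \<phi>, of s]]
          by (auto intro!: derivative_eq_intros simp: inner_diff_left)
        have "norm (tr (s *\<^sub>R ?e) g - g) * norm (l2_of \<phi>) \<le> e / 2 * norm (l2_of \<phi>)"
          using d(2)[of "s *\<^sub>R ?e"] s by (intro mult_right_mono) auto
        then show "norm ((tr (s *\<^sub>R ?e) g - g) \<bullet> l2_of \<phi>) \<le> e / 2 * norm (l2_of \<phi>)"
          using Cauchy_Schwarz_ineq2[of "tr (s *\<^sub>R ?e) g - g" "l2_of \<phi>"] by simp
      qed (use that d in auto)
      then show "\<bar>(tr (t *\<^sub>R ?e) x - x - t *\<^sub>R g) \<bullet> l2_of \<phi>\<bar> \<le> \<bar>t\<bar> * (e / 2) * norm (l2_of \<phi>)"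
        by (simp add: inner_diff_left inner_add_left mult_ac diff_diff_eq add.commute)
    qed (use \<open>e > 0\<close> in simp)
    moreover have "(tr (t *\<^sub>R ?e) x - x) /\<^sub>R t - g = (tr (t *\<^sub>R ?e) x - x - t *\<^sub>R g) /\<^sub>R t"
      using that(1) by (simp add: scaleR_diff_right)
    then have "norm ((tr (t *\<^sub>R ?e) x - x) /\<^sub>R t - g) = norm (tr (t *\<^sub>R ?e) x - x - t *\<^sub>R g) / \<bar>t\<bar>"
      by (simp only: norm_scaleR) (simp add: divide_inverse mult.commute)
    ultimately have "norm ((tr (t *\<^sub>R ?e) x - x) /\<^sub>R t - g) \<le> e / 2"
      using that(1) by (simp add: pos_divide_le_eq mult.commute)
    then show ?thesis using \<open>e > 0\<close> by simp
  qed
  then show "\<forall>\<^sub>F t in at 0. dist ((tr (t *\<^sub>R ?e) x - x) /\<^sub>R t) g < e"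
    unfolding eventually_at using d(1) by (intro exI[of _ d]) (auto simp: dist_norm)
qed

text \<open>Converse direction: bounded difference quotients have a weakly convergent subsequence,
  and the weak limit is the weak derivative. This is how membership in H1 and H2 is proved
  later.\<close>

lemma hwp_if_difference_bound:
  assumes "\<delta> > 0" and bd: "\<And>t. 0 < t \<Longrightarrow> t < \<delta> \<Longrightarrow> norm (tr (t *\<^sub>R axis i 1) x - x) \<le> C * t"
  obtains g where "hwp i x g" "norm g \<le> C"
proof -
  let ?e = "axis i 1 :: real ^ 'a"
  define t where "t n = \<delta> / (real n + 2)" for n
  have t: "0 < t n" "t n < \<delta>" for n using assms(1) by (auto simp: t_def field_simps add_pos_nonneg)
  have t0: "t \<longlonglongrightarrow> 0" unfolding t_def by real_asymp
  define q where "q n = (tr (t n *\<^sub>R ?e) x - x) /\<^sub>R t n" for n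
  have qC: "norm (q n) \<le> C" for n
  proof -
    have "norm (q n) = norm (tr (t n *\<^sub>R ?e) x - x) / t n"
      using t(1)[of n] unfolding q_def norm_scaleR by (simp add: divide_inverse mult.commute)
    then show ?thesis using bd[OF t[of n]] t(1)[of n] by (simp add: pos_divide_le_eq)
  qed
  then obtain k g where k: "strict_mono k" and kg: "wconv (\<lambda>n. q (k n)) g"
    using weakly_convergent_subseq[of q C] by blast
  have "hwp i x g" unfolding hwp_def
  proof (intro allI impI)
    fix \<phi> :: "real ^ 'a \<Rightarrow> real" assume \<phi>: "test_function \<phi>"
    have "(\<lambda>n. x \<bullet> ((tr (- t (k n) *\<^sub>R ?e) (l2_of \<phi>) - l2_of \<phi>) /\<^sub>R t (k n))) \<longlonglongrightarrow> x \<bullet> (- l2_of (partial i \<phi>))"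
    proof (intro tendsto_inner tendsto_const)
      have "filterlim (\<lambda>n. t (k n)) (at 0) sequentially"
        unfolding filterlim_at using LIMSEQ_subseq_LIMSEQ[OF t0 k] t(1) by (auto simp: o_def less_imp_neq[symmetric])
      from filterlim_compose[OF tr_test_has_derivative_minus[OF \<phi>] this]
      show "(\<lambda>n. (tr (- t (k n) *\<^sub>R ?e) (l2_of \<phi>) - l2_of \<phi>) /\<^sub>R t (k n)) \<longlonglongrightarrow> - l2_of (partial i \<phi>)" .
    qed
    moreover have "x \<bullet> ((tr (- t (k n) *\<^sub>R ?e) (l2_of \<phi>) - l2_of \<phi>) /\<^sub>R t (k n)) = q (k n) \<bullet> l2_of \<phi>" for n
      by (simp add: q_def inner_simps inner_tr_left)
    ultimately have "(\<lambda>n. q (k n) \<bullet> l2_of \<phi>) \<longlonglongrightarrow> - (x \<bullet> l2_of (partial i \<phi>))" by simp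
    with wconv_tendsto[OF kg] have "g \<bullet> l2_of \<phi> = - (x \<bullet> l2_of (partial i \<phi>))" by (rule LIMSEQ_unique)
    then show "x \<bullet> l2_of (partial i \<phi>) = - (g \<bullet> l2_of \<phi>)" by simp
  qed
  moreover have "norm g \<le> C"
  proof -
    have "q (k n) \<bullet> g \<le> C * norm g" for n
      using norm_cauchy_schwarz[of "q (k n)" g] mult_right_mono[OF qC[of "k n"], of "norm g"] by simp
    then have "g \<bullet> g \<le> C * norm g" by (intro LIMSEQ_le_const2[OF wconv_tendsto[OF kg]]) auto
    then show ?thesis using order_trans[OF norm_ge_zero qC[of 0]]
      by (cases "g = 0") (auto simp: power2_norm_eq_inner[symmetric] power2_eq_square)
  qed
  ultimately show ?thesis by (rule that)
qed

text \<open>Integration by parts without cutoffs: the adjoint of a difference quotient with step h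
  is minus the one with step -h, and both converge in norm.\<close>

lemma hwp_skew:
  assumes "hwp i x g" "hwp i y k"
  shows "g \<bullet> y = - (x \<bullet> k)"
proof -
  let ?e = "axis i 1 :: real ^ 'a"
  have lim: "filterlim (\<lambda>n. inverse (real (Suc n))) (at 0) sequentially" "filterlim (\<lambda>n. - inverse (real (Suc n))) (at 0) sequentially"
    using LIMSEQ_inverse_real_of_nat tendsto_minus[OF LIMSEQ_inverse_real_of_nat] by (auto simp: filterlim_at simp del: of_nat_Suc)
  have 1: "(\<lambda>n. ((tr (inverse (real (Suc n)) *\<^sub>R ?e) x - x) /\<^sub>R inverse (real (Suc n))) \<bullet> y) \<longlonglongrightarrow> g \<bullet> y"
    by (intro tendsto_intros filterlim_compose[OF hwp_difference_tendsto[OF assms(1)] lim(1)])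
  have 2: "(\<lambda>n. x \<bullet> ((tr (- inverse (real (Suc n)) *\<^sub>R ?e) y - y) /\<^sub>R (- inverse (real (Suc n))))) \<longlonglongrightarrow> x \<bullet> k"
    by (intro tendsto_intros filterlim_compose[OF hwp_difference_tendsto[OF assms(2)] lim(2)])
  have "((tr (inverse (real (Suc n)) *\<^sub>R ?e) x - x) /\<^sub>R inverse (real (Suc n))) \<bullet> y
     = - (x \<bullet> ((tr (- inverse (real (Suc n)) *\<^sub>R ?e) y - y) /\<^sub>R (- inverse (real (Suc n)))))" for n
    by (simp add: inner_simps inner_tr_left del: of_nat_Suc)
  then show ?thesis using LIMSEQ_unique[OF 1] tendsto_minus[OF 2] by simp
qed

text \<open>\<open>dom1\<close> and \<open>dom2\<close> are H1 and H2 on the level of classes; the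
  link is made by \<open>H1_iff\<close> and \<open>H2_iff\<close>.\<close>

definition dom1 :: "'n::finite l2 set" where "dom1 = {x. \<forall>i. \<exists>g. hwp i x g}"
definition pd :: "'n::finite \<Rightarrow> 'n l2 \<Rightarrow> 'n l2" where "pd i x = (THE g. hwp i x g)"
definition dom2 :: "'n::finite l2 set" where "dom2 = {x \<in> dom1. \<forall>i. pd i x \<in> dom1}"
definition lap :: "'n::finite l2 \<Rightarrow> 'n l2" where "lap x = (\<Sum>i\<in>UNIV. pd i (pd i x))"

lemma pd_eq: "hwp i x g \<Longrightarrow> pd i x = g"
  unfolding pd_def using hwp_unique by blast

lemma hwp_pd: "x \<in> dom1 \<Longrightarrow> hwp i x (pd i x)"
  using pd_eq unfolding dom1_def by auto

lemma dom1_add: "x \<in> dom1 \<Longrightarrow> y \<in> dom1 \<Longrightarrow> x + y \<in> dom1"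
  unfolding dom1_def using hwp_add by blast
lemma dom1_diff: "x \<in> dom1 \<Longrightarrow> y \<in> dom1 \<Longrightarrow> x - y \<in> dom1"
  unfolding dom1_def using hwp_diff by blast
lemma dom1_scale: "x \<in> dom1 \<Longrightarrow> c *\<^sub>R x \<in> dom1"
  unfolding dom1_def using hwp_scale by blast
lemma dom1_tr: "x \<in> dom1 \<Longrightarrow> tr y x \<in> dom1"
  unfolding dom1_def using hwp_tr by blast
lemma dom1_zero: "0 \<in> dom1"
  unfolding dom1_def hwp_def by (auto intro!: exI[of _ 0])

lemma pd_add: "x \<in> dom1 \<Longrightarrow> y \<in> dom1 \<Longrightarrow> pd i (x + y) = pd i x + pd i y"
  by (intro pd_eq hwp_add hwp_pd)
lemma pd_diff: "x \<in> dom1 \<Longrightarrow> y \<in> dom1 \<Longrightarrow> pd i (x - y) = pd i x - pd i y"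
  by (intro pd_eq hwp_diff hwp_pd)
lemma pd_scale: "x \<in> dom1 \<Longrightarrow> pd i (c *\<^sub>R x) = c *\<^sub>R pd i x"
  by (intro pd_eq hwp_scale hwp_pd)
lemma pd_tr: "x \<in> dom1 \<Longrightarrow> pd i (tr y x) = tr y (pd i x)"
  by (intro pd_eq hwp_tr hwp_pd)
lemma pd_zero: "pd i 0 = 0"
  by (intro pd_eq) (simp add: hwp_def)

lemma pd_skew: "x \<in> dom1 \<Longrightarrow> y \<in> dom1 \<Longrightarrow> pd i x \<bullet> y = - (x \<bullet> pd i y)"
  by (rule hwp_skew[OF hwp_pd hwp_pd])

lemma dom2_dom1: "x \<in> dom2 \<Longrightarrow> x \<in> dom1" "x \<in> dom2 \<Longrightarrow> pd i x \<in> dom1"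
  by (auto simp: dom2_def)
lemma dom2_add: "x \<in> dom2 \<Longrightarrow> y \<in> dom2 \<Longrightarrow> x + y \<in> dom2"
  by (auto simp: dom2_def dom1_add pd_add)
lemma dom2_diff: "x \<in> dom2 \<Longrightarrow> y \<in> dom2 \<Longrightarrow> x - y \<in> dom2"
  by (auto simp: dom2_def dom1_diff pd_diff)
lemma dom2_scale: "x \<in> dom2 \<Longrightarrow> c *\<^sub>R x \<in> dom2"
  by (auto simp: dom2_def dom1_scale pd_scale)

lemma lap_add: "x \<in> dom2 \<Longrightarrow> y \<in> dom2 \<Longrightarrow> lap (x + y) = lap x + lap y"
  by (simp add: lap_def dom2_dom1 pd_add sum.distrib)
lemma lap_diff: "x \<in> dom2 \<Longrightarrow> y \<in> dom2 \<Longrightarrow> lap (x - y) = lap x - lap y"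
  by (simp add: lap_def dom2_dom1 pd_diff sum_subtractf)
lemma lap_scale: "x \<in> dom2 \<Longrightarrow> lap (c *\<^sub>R x) = c *\<^sub>R lap x"
  by (simp add: lap_def dom2_dom1 pd_scale scaleR_sum_right)

lemma inner_lap:
  assumes "x \<in> dom2" "y \<in> dom1"
  shows "lap x \<bullet> y = - (\<Sum>i\<in>UNIV. pd i x \<bullet> pd i y)"
  unfolding lap_def inner_sum_left using assms by (simp add: pd_skew dom2_dom1 sum_negf)

lemma H1_iff: "u \<in> H1 \<longleftrightarrow> u \<in> L2 \<and> l2_of u \<in> dom1"
proof -
  have "(\<exists>g\<in>L2. has_weak_partial i u g) \<longleftrightarrow> (\<exists>g. hwp i (l2_of u) g)" if "u \<in> L2" for i
    using hwp_iff_has_weak_partial[OF that] rep_L2 l2_of_rep by metis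
  then show ?thesis by (auto simp: H1_def dom1_def)
qed

lemma locally_integrable_diff:
  "locally_integrable f \<Longrightarrow> locally_integrable g \<Longrightarrow> locally_integrable (\<lambda>x. f x - g x)"
  by (auto simp: locally_integrable_def set_integrable_def algebra_simps)

text \<open>The derivative chosen in \<open>weak_partial\<close> is only known to be locally
  integrable. The fundamental lemma identifies it with a square integrable one.\<close>

lemma weak_partial_H1:
  assumes "u \<in> H1"
  shows "weak_partial i u \<in> L2" "l2_of (weak_partial i u) = pd i (l2_of u)"
proof -
  obtain g where g: "g \<in> L2" "has_weak_partial i u g" using assms unfolding H1_def by blast
  from someI[of "has_weak_partial i u", OF g(2)] have w: "has_weak_partial i u (weak_partial i u)"
    unfolding weak_partial_def .
  have "AE x in lebesgue. g x - weak_partial i u x = 0"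
  proof (rule fundamental_lemma)
    show "locally_integrable (\<lambda>x. g x - weak_partial i u x)"
      using g w by (auto simp: has_weak_partial_def intro: locally_integrable_diff)
    fix \<phi> :: "real ^ 'a \<Rightarrow> real" assume \<phi>: "test_function \<phi>"
    have "(LINT x|lebesgue. (g x - weak_partial i u x) * \<phi> x)
        = (LINT x|lebesgue. g x * \<phi> x) - (LINT x|lebesgue. weak_partial i u x * \<phi> x)"
      using locally_integrable_test[OF _ \<phi>, of g] locally_integrable_test[OF _ \<phi>, of "weak_partial i u"] g(2) w
      by (simp add: left_diff_distrib has_weak_partial_def)
    then show "(LINT x|lebesgue. (g x - weak_partial i u x) * \<phi> x) = 0"
      using g(2) w \<phi> by (auto simp: has_weak_partial_def)
  qed
  then have ae: "AE x in lebesgue. g x = weak_partial i u x" by eventually_elim simp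
  show L: "weak_partial i u \<in> L2" using L2_cong_AE'[OF g(1) ae] .
  have "u \<in> L2" using assms by (simp add: H1_iff)
  from hwp_iff_has_weak_partial[OF this L, of i] w show "l2_of (weak_partial i u) = pd i (l2_of u)"
    using pd_eq by metis
qed

lemma H2_iff: "u \<in> H2 \<longleftrightarrow> u \<in> L2 \<and> l2_of u \<in> dom2"
proof -
  have "weak_partial i u \<in> H1 \<longleftrightarrow> pd i (l2_of u) \<in> dom1" if "u \<in> H1" for i
    unfolding H1_iff[of "weak_partial i u"] using weak_partial_H1[OF that, of i] by simp
  then show ?thesis unfolding H2_def dom2_def using H1_iff[of u] by blast
qed

lemma weak_laplacian_H2:
  assumes "u \<in> H2"
  shows "weak_laplacian u \<in> L2" "l2_of (weak_laplacian u) = lap (l2_of u)"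
proof -
  have u: "u \<in> H1" "weak_partial i u \<in> H1" for i using assms by (auto simp: H2_def)
  show "weak_laplacian u \<in> L2" "l2_of (weak_laplacian u) = lap (l2_of u)"
    unfolding weak_laplacian_def[abs_def] lap_def
    using weak_partial_H1[OF u(2)] weak_partial_H1(2)[OF u(1)] by (simp_all add: L2_sum l2_of_sum)
qed

lemma rep_H1: "x \<in> dom1 \<longleftrightarrow> rep x \<in> H1"
  by (simp add: H1_iff)

text \<open>The shift is carried out one coordinate at a time, each translation being an
  isometry.\<close>

lemma tr_sum_difference_bound:
  assumes "x \<in> dom1" "finite F"
  shows "norm (tr (\<Sum>i\<in>F. c i *\<^sub>R axis i 1) x - x) \<le> (\<Sum>i\<in>F. \<bar>c i\<bar> * norm (pd i x))"
  using assms(2)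
proof induction
  case (insert a F)
  let ?y = "\<Sum>i\<in>F. c i *\<^sub>R axis i 1 :: real ^ 'a" and ?e = "c a *\<^sub>R axis a 1 :: real ^ 'a"
  have eq: "tr (?e + ?y) x - x = tr ?e (tr ?y x - x) + (tr ?e x - x)" by (simp add: tr_diff tr_tr)
  have "norm (tr (?e + ?y) x - x) \<le> norm (tr ?e (tr ?y x - x)) + norm (tr ?e x - x)"
    unfolding eq by (rule norm_triangle_ineq)
  then have "norm (tr (?e + ?y) x - x) \<le> norm (tr ?y x - x) + norm (tr ?e x - x)" by simp
  then show ?case using insert hwp_difference_bound[OF hwp_pd[OF assms(1)], of "c a" a] by simp
qed simp

lemma tr_difference_bound:
  assumes "x \<in> dom1" "\<And>i. \<bar>y $ i\<bar> \<le> h"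
  shows "norm (tr y x - x) \<le> h * (\<Sum>i\<in>UNIV. norm (pd i x))"
proof -
  have "(\<Sum>i\<in>UNIV. y $ i *\<^sub>R axis i 1) = y"
    using basis_expansion[of y] by (simp add: vec_eq_iff)
  then have "norm (tr y x - x) \<le> (\<Sum>i\<in>UNIV. \<bar>y $ i\<bar> * norm (pd i x))"
    using tr_sum_difference_bound[OF assms(1), of UNIV "\<lambda>i. y $ i"] by simp
  also have "\<dots> \<le> (\<Sum>i\<in>UNIV. h * norm (pd i x))"
    by (intro sum_mono mult_right_mono assms) auto
  finally show ?thesis by (simp add: sum_distrib_left)
qed

text \<open>The centred second difference is a translate of the first difference of the first
  difference, so each of the two contributes a factor h.\<close>

lemma tr_second_difference_bound:
  assumes x: "x \<in> dom2" and y: "\<And>i. \<bar>y $ i\<bar> \<le> h"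
  shows "norm (tr y x + tr (- y) x - 2 *\<^sub>R x) \<le> h\<^sup>2 * (\<Sum>i\<in>UNIV. \<Sum>j\<in>UNIV. norm (pd j (pd i x)))"
proof -
  have h: "h \<ge> 0" using order_trans[OF abs_ge_zero y] .
  have "tr y x + tr (- y) x - 2 *\<^sub>R x = tr (- y) (tr y (tr y x - x) - (tr y x - x))"
    by (simp add: tr_diff tr_tr scaleR_2)
  then have "norm (tr y x + tr (- y) x - 2 *\<^sub>R x) = norm (tr y (tr y x - x) - (tr y x - x))" by simp
  also have "\<dots> \<le> h * (\<Sum>i\<in>UNIV. norm (pd i (tr y x - x)))"
    by (intro tr_difference_bound dom1_diff dom1_tr dom2_dom1 x y)
  also have "\<dots> = h * (\<Sum>i\<in>UNIV. norm (tr y (pd i x) - pd i x))"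
    using x by (simp add: pd_diff pd_tr dom1_tr dom2_dom1)
  also have "\<dots> \<le> h * (\<Sum>i\<in>UNIV. h * (\<Sum>j\<in>UNIV. norm (pd j (pd i x))))"
    by (intro mult_left_mono sum_mono tr_difference_bound dom2_dom1(2) x y h)
  finally show ?thesis by (simp add: sum_distrib_left power2_eq_square mult.assoc)
qed

section \<open>Box averages\<close>

definition Q :: "real \<Rightarrow> (real ^ 'n) set" where "Q h = cbox (- vec h) (vec h)"

text \<open>Convolution with the normalised indicator of a box, written as an integral of translates
  with values in the Hilbert space: bounds for \<open>tr y x - x\<close> average at once, and
  operators commuting with translations commute with it.\<close>

definition avg :: "real \<Rightarrow> 'n::finite l2 \<Rightarrow> 'n l2" where
  "avg h x = (1 / (2 * h) ^ CARD('n)) *\<^sub>R integral (Q h) (\<lambda>y. tr y x)"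

lemma content_Q: "h > 0 \<Longrightarrow> measure lborel (Q h :: (real ^ 'n) set) = (2 * h) ^ CARD('n)"
  unfolding Q_def by (subst content_cbox_cart) (auto simp: interval_eq_empty_cart)

lemma mem_Q: "y \<in> Q h \<longleftrightarrow> (\<forall>i. \<bar>y $ i\<bar> \<le> h)"
  by (auto simp: Q_def mem_box_cart abs_le_iff) (metis minus_le_iff)+

lemma integrable_tr: "(\<lambda>y. tr y x) integrable_on Q h"
  unfolding Q_def by (intro integrable_continuous continuous_on_subset[OF continuous_tr]) auto

lemma integrable_tr_linear:
  assumes "bounded_linear T"
  shows "(\<lambda>y. T (tr y x)) integrable_on Q h" "integral (Q h) (\<lambda>y. T (tr y x)) = T (integral (Q h) (\<lambda>y. tr y x))"
  using integrable_linear[OF integrable_tr assms] integral_linear[OF integrable_tr assms] by (auto simp: o_def)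

lemma integral_tr_reflect: "((\<lambda>y. tr (- y) x) has_integral integral (Q h) (\<lambda>y. tr y x)) (Q h)"
  using has_integral_reflect_lemma[OF integrable_integral[OF integrable_tr[of x h, unfolded Q_def]]] by (simp add: Q_def)

lemma avg_bound:
  fixes x z :: "'n::finite l2"
  assumes "h > 0" "B \<ge> 0" "\<And>y. y \<in> Q h \<Longrightarrow> norm (tr y x - z) \<le> B"
  shows "norm (avg h x - z) \<le> B"
proof -
  have "((\<lambda>y. tr y x - z) has_integral (integral (Q h) (\<lambda>y. tr y x) - measure lborel (Q h :: (real^'n) set) *\<^sub>R z)) (Q h)"
    unfolding Q_def by (intro has_integral_diff integrable_integral integrable_tr[unfolded Q_def] has_integral_const)
  from has_integral_bound[OF assms(2) this[unfolded Q_def]]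
  have "norm (integral (Q h) (\<lambda>y. tr y x) - measure lborel (Q h :: (real^'n) set) *\<^sub>R z) \<le> B * measure lborel (Q h :: (real^'n) set)"
    using assms(3) by (simp add: Q_def)
  moreover have "avg h x - z = (1 / measure lborel (Q h :: (real^'n) set)) *\<^sub>R (integral (Q h) (\<lambda>y. tr y x) - measure lborel (Q h :: (real^'n) set) *\<^sub>R z)"
    using assms(1) by (simp add: avg_def content_Q scaleR_diff_right)
  ultimately show ?thesis using assms(1) by (simp add: content_Q pos_divide_le_eq mult.commute)
qed

lemma norm_avg_le: "h > 0 \<Longrightarrow> norm (avg h x) \<le> norm x"
  using avg_bound[of h "norm x" x 0] by simp

lemma bounded_linear_avg: "h > 0 \<Longrightarrow> bounded_linear (avg h)"
proof (rule bounded_linear_intro[of _ 1])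
  show "avg h (x + y) = avg h x + avg h y" for x y :: "'a l2"
    unfolding avg_def tr_add by (simp add: Henstock_Kurzweil_Integration.integral_add integrable_tr scaleR_add_right)
  show "avg h (c *\<^sub>R x) = c *\<^sub>R avg h x" for c and x :: "'a l2"
    unfolding avg_def tr_scale by (simp add: integral_cmul)
qed (simp add: norm_avg_le)

lemma avg_commute:
  assumes "bounded_linear T" "\<And>y x. T (tr y x) = tr y (T x)"
  shows "T (avg h x) = avg h (T x)"
  using integrable_tr_linear(2)[OF assms(1), of h x]
  by (simp add: avg_def assms(2) linear_scale[OF bounded_linear.linear[OF assms(1)]])

lemma avg_tr: "tr y (avg h x) = avg h (tr y x)"
  by (rule avg_commute[OF bounded_linear_tr]) (simp add: tr_tr add.commute)

lemma avg_avg: "k > 0 \<Longrightarrow> avg k (avg h x) = avg h (avg k x)"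
  by (rule avg_commute[OF bounded_linear_avg]) (simp_all add: avg_tr)

lemma avg_diff: "h > 0 \<Longrightarrow> avg h (x - y) = avg h x - avg h y"
  using bounded_linear_avg linear_diff bounded_linear.linear by blast

lemma avg_error_1:
  assumes "h > 0" "x \<in> dom1"
  shows "norm (avg h x - x) \<le> h * (\<Sum>i\<in>UNIV. norm (pd i x))"
  using assms by (intro avg_bound tr_difference_bound) (auto simp: mem_Q intro!: mult_nonneg_nonneg sum_nonneg)

text \<open>The box is symmetric, so pairing y with -y removes the first order term: twice the error
  is an average of centred second differences.\<close>

lemma avg_error_2:
  fixes x :: "'n::finite l2"
  assumes "h > 0" "x \<in> dom2"
  shows "norm (avg h x - x) \<le> h\<^sup>2 * (\<Sum>i\<in>UNIV. \<Sum>j\<in>UNIV. norm (pd j (pd i x)))" (is "_ \<le> ?B")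
proof -
  let ?I = "integral (Q h) (\<lambda>y. tr y x)" and ?c = "measure lborel (Q h :: (real^'n) set)"
  have "((\<lambda>y. tr y x + tr (- y) x - 2 *\<^sub>R x) has_integral (?I + ?I - ?c *\<^sub>R (2 *\<^sub>R x))) (Q h)"
    using integral_tr_reflect[of x h] integrable_integral[OF integrable_tr[of x h]] unfolding Q_def
    by (intro has_integral_diff has_integral_add has_integral_const)
  note i = this[unfolded Q_def]
  have B0: "0 \<le> ?B" by (intro mult_nonneg_nonneg sum_nonneg) auto
  have "norm (tr y x + tr (- y) x - 2 *\<^sub>R x) \<le> ?B" if "y \<in> cbox (- vec h) (vec h)" for y
    using that by (intro tr_second_difference_bound assms) (simp add: Q_def[symmetric] mem_Q)
  from has_integral_bound[OF B0 i this]
  have "norm (?I + ?I - ?c *\<^sub>R (2 *\<^sub>R x)) \<le> ?B * ?c" unfolding Q_def by blast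
  moreover have "2 *\<^sub>R (avg h x - x) = (1 / ?c) *\<^sub>R (?I + ?I - ?c *\<^sub>R (2 *\<^sub>R x))"
    using assms(1) by (simp add: avg_def content_Q scaleR_diff_right flip: scaleR_2)
  then have "2 * norm (avg h x - x) = norm ((1 / ?c) *\<^sub>R (?I + ?I - ?c *\<^sub>R (2 *\<^sub>R x)))"
    using norm_scaleR[of 2 "avg h x - x"] by simp
  ultimately have "2 * norm (avg h x - x) \<le> ?B"
    using assms(1) by (simp add: content_Q pos_divide_le_eq mult.commute)
  then show ?thesis using norm_ge_zero[of "avg h x - x"] by linarith
qed

section \<open>Pointwise values of box averages\<close>

definition box_l2 :: "real \<Rightarrow> 'n::finite l2" where "box_l2 h = l2_of (indicator (Q h))"

lemma Q_measurable [measurable]: "Q h \<in> sets borel" "Q h \<in> sets lebesgue"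
  by (auto simp: Q_def intro: sets_completionI_sets)

lemma indicator_Q_L2: "indicator (Q h) \<in> (L2 :: (real ^ 'n \<Rightarrow> real) set)"
proof -
  have "integrable lebesgue (indicator (Q h :: (real^'n) set) :: _ \<Rightarrow> real)"
    using emeasure_bounded_finite[of "Q h :: (real^'n) set"] by (intro integrable_real_indicator) (auto simp: Q_def)
  moreover have "(indicator (Q h) x)\<^sup>2 = (indicator (Q h) x :: real)" for x :: "real ^ 'n"
    by (simp add: indicator_def)
  ultimately show ?thesis by (simp add: L2_def)
qed

lemma norm_box_l2: "h > 0 \<Longrightarrow> norm (box_l2 h :: 'n::finite l2) = sqrt ((2 * h) ^ CARD('n))"
proof -
  assume h: "h > 0"
  have "(norm (box_l2 h :: 'n l2))\<^sup>2 = (LINT x|lebesgue. (indicator (Q h :: (real^'n) set) x)\<^sup>2)"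
    unfolding box_l2_def by (rule norm_l2_of_sq[OF indicator_Q_L2])
  also have "\<dots> = (LINT x|lebesgue. indicator (Q h :: (real^'n) set) x)"
    by (rule arg_cong[where f = "integral\<^sup>L lebesgue"]) (auto simp: indicator_def)
  also have "\<dots> = (2 * h) ^ CARD('n)" using content_Q[OF h, where 'n='n] by simp
  finally show ?thesis by (metis norm_ge_zero real_sqrt_unique)
qed

lemma continuous_inner_tr: "continuous_on S (\<lambda>t. z \<bullet> tr t x)"
  by (intro continuous_on_inner continuous_on_const continuous_on_subset[OF continuous_tr]) auto

text \<open>Fubini in \<open>inner_avg_test\<close> needs \<open>e (t + y)\<close> jointly Borel
  measurable in y and t.\<close>

lemma borel_representative:
  obtains e where "e \<in> borel_measurable borel" "e \<in> L2" "l2_of e = x"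
proof -
  obtain e where e: "e \<in> borel_measurable lborel" "AE t in lborel. rep x t = e t"
    using completion_ex_borel_measurable_real[OF rep_measurable] by blast
  have ae: "AE t in lebesgue. rep x t = e t" using e(2) by (rule AE_completion)
  have L: "e \<in> L2" by (rule L2_cong_AE'[OF rep_L2 ae])
  have "l2_of (rep x) = l2_of e" using ae by (simp only: l2_of_eq_iff[OF rep_L2 L])
  then show ?thesis using that[of e] e(1) L by simp
qed

lemma integral_lebesgue_lborel:
  fixes f :: "real ^ 'n \<Rightarrow> real"
  assumes "f \<in> borel_measurable borel"
  shows "(LINT x|lebesgue. f x) = (LINT x|lborel. f x)"
  using assms by (intro integral_completion) simp

lemma integrable_lebesgue_lborel:
  fixes f :: "real ^ 'n \<Rightarrow> real"
  assumes "f \<in> borel_measurable borel"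
  shows "integrable lebesgue f \<longleftrightarrow> integrable lborel f"
  using assms by (intro integrable_completion) simp

text \<open>Pairing \<open>box_l2 h\<close> with a translate of \<open>x\<close> integrates
  \<open>x\<close> over the box around t. Fubini identifies this pointwise average with the
  vector-valued one, as far as test functions can see.\<close>

lemma inner_avg_test:
  fixes x :: "'n::finite l2"
  assumes h: "h > 0" and \<phi>: "test_function \<phi>"
  shows "avg h x \<bullet> l2_of \<phi> = (LINT t|lebesgue. (1 / (2 * h) ^ CARD('n)) * (box_l2 h \<bullet> tr t x) * \<phi> t)"
proof -
  obtain e where e[measurable]: "e \<in> borel_measurable borel" and eL: "e \<in> L2" and ex: "l2_of e = x"
    using borel_representative by blast
  have [measurable]: "\<phi> \<in> borel_measurable borel" by (rule test_function_measurable[OF \<phi>])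
  define f where "f y t = indicator (Q h) y * (e (t + y) * \<phi> t)" for y t
  have tre: "tr y x \<bullet> l2_of \<phi> = (LINT t|lborel. e (t + y) * \<phi> t)" for y
    unfolding ex[symmetric] tr_l2_of[OF eL]
    by (subst inner_l2_of) (auto intro: L2_translation eL test_function_L2 \<phi> integral_lebesgue_lborel)
  have int2: "integrable lborel (\<lambda>t. e (t + y) * \<phi> t)" for y
    using L2_integrable_mult[OF L2_translation[OF eL, of y] test_function_L2[OF \<phi>]] by (subst (asm) integrable_lebesgue_lborel) auto
  have abs_eq: "(LINT t|lborel. norm (f y t)) = indicator (Q h) y *\<^sub>R (tr y (l2_of (\<lambda>t. \<bar>e t\<bar>)) \<bullet> l2_of (\<lambda>t. \<bar>\<phi> t\<bar>))" for y
    unfolding tr_l2_of[OF L2_abs[OF eL]]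
    by (subst inner_l2_of) (auto intro: L2_translation[where u = "\<lambda>x. \<bar>_ x\<bar>"] L2_abs eL test_function_L2 \<phi> simp: f_def abs_mult integral_lebesgue_lborel)
  have "integrable (lborel \<Otimes>\<^sub>M lborel) (case_prod f)"
  proof (rule lborel_pair.Fubini_integrable)
    show "case_prod f \<in> borel_measurable (lborel \<Otimes>\<^sub>M lborel)"
      unfolding f_def case_prod_beta by measurable
    show "integrable lborel (\<lambda>y. LINT t|lborel. norm (case (y, t) of (a, b) \<Rightarrow> f a b))"
      unfolding prod.case abs_eq
      by (intro borel_integrable_compact continuous_on_inner continuous_on_const continuous_on_subset[OF continuous_tr])
        (auto simp: Q_def)
    show "AE y in lborel. integrable lborel (\<lambda>t. case (y, t) of (a, b) \<Rightarrow> f a b)"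
      using int2 by (simp add: f_def)
  qed
  note fub = lborel_pair.Fubini_integral[OF this]
  have "integral (Q h) (\<lambda>y. tr y x \<bullet> l2_of \<phi>) = (LINT y|lborel. LINT t|lborel. f y t)"
  proof -
    have "continuous_on (Q h) (\<lambda>y. tr y x \<bullet> l2_of \<phi>)"
      by (intro continuous_on_inner continuous_on_const continuous_on_subset[OF continuous_tr]) auto
    then have "set_integrable lborel (Q h) (\<lambda>y. tr y x \<bullet> l2_of \<phi>)"
      unfolding set_integrable_def by (intro borel_integrable_compact) (auto simp: Q_def)
    from set_borel_integral_eq_integral(2)[OF this] show ?thesis
      by (simp add: set_lebesgue_integral_def f_def tre)
  qed
  also have "\<dots> = (LINT t|lborel. LINT y|lborel. f y t)" by (rule fub[symmetric])
  also have "\<dots> = (LINT t|lborel. (box_l2 h \<bullet> tr t x) * \<phi> t)"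
  proof (rule Bochner_Integration.integral_cong)
    fix t :: "real ^ 'n"
    have "box_l2 h \<bullet> tr t x = (LINT y|lborel. indicator (Q h) y * e (y + t))"
      unfolding ex[symmetric] tr_l2_of[OF eL] box_l2_def
      by (subst inner_l2_of) (auto intro: L2_translation eL indicator_Q_L2 integral_lebesgue_lborel)
    then show "(LINT y|lborel. f y t) = (box_l2 h \<bullet> tr t x) * \<phi> t"
      by (simp add: f_def add.commute flip: mult.assoc)
  qed simp
  also have "\<dots> = (LINT t|lebesgue. (box_l2 h \<bullet> tr t x) * \<phi> t)"
    by (intro integral_lebesgue_lborel[symmetric] borel_measurable_times borel_measurable_continuous_onI continuous_inner_tr test_function_continuous[OF \<phi>])
  finally have eq: "integral (Q h) (\<lambda>y. tr y x \<bullet> l2_of \<phi>) = (LINT t|lebesgue. (box_l2 h \<bullet> tr t x) * \<phi> t)" .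
  have "avg h x \<bullet> l2_of \<phi> = (1 / (2 * h) ^ CARD('n)) * (integral (Q h) (\<lambda>y. tr y x) \<bullet> l2_of \<phi>)"
    by (simp only: avg_def inner_scaleR_left)
  also have "integral (Q h) (\<lambda>y. tr y x) \<bullet> l2_of \<phi> = integral (Q h) (\<lambda>y. tr y x \<bullet> l2_of \<phi>)"
    by (rule integrable_tr_linear(2)[OF bounded_linear_inner_left, symmetric])
  also note eq
  also have "(1 / (2 * h) ^ CARD('n)) * (LINT t|lebesgue. (box_l2 h \<bullet> tr t x) * \<phi> t)
      = (LINT t|lebesgue. (1 / (2 * h) ^ CARD('n)) * (box_l2 h \<bullet> tr t x) * \<phi> t)"
    unfolding mult.assoc by (rule integral_mult_right_zero[symmetric])
  finally show ?thesis .
qed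

lemma rep_avg:
  fixes x :: "'n::finite l2"
  assumes h: "h > 0"
  shows "AE t in lebesgue. rep (avg h x) t = (1 / (2 * h) ^ CARD('n)) * (box_l2 h \<bullet> tr t x)"
proof -
  define m where "m t = (1 / (2 * h) ^ CARD('n)) * (box_l2 h \<bullet> tr t x)" for t
  have cm: "continuous_on UNIV m" unfolding m_def by (intro continuous_intros continuous_inner_tr)
  have lm: "locally_integrable m" unfolding locally_integrable_def set_integrable_def
  proof (intro allI impI)
    fix K :: "(real ^ 'n) set" assume K: "compact K"
    have [measurable]: "K \<in> sets borel" using K by (simp add: compact_imp_closed)
    have [measurable]: "m \<in> borel_measurable borel" using cm by (rule borel_measurable_continuous_onI)
    have "integrable lborel (\<lambda>x. indicator K x *\<^sub>R m x)"
      using K cm by (intro borel_integrable_compact) (auto intro: continuous_on_subset)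
    then show "integrable lebesgue (\<lambda>x. indicator K x *\<^sub>R m x)"
      by (subst integrable_lebesgue_lborel) auto
  qed
  have "AE t in lebesgue. rep (avg h x) t - m t = 0"
  proof (rule fundamental_lemma)
    show "locally_integrable (\<lambda>t. rep (avg h x) t - m t)"
      by (intro locally_integrable_diff lm L2_locally_integrable rep_L2)
    fix \<phi> :: "real ^ 'n \<Rightarrow> real" assume \<phi>: "test_function \<phi>"
    have "(LINT t|lebesgue. rep (avg h x) t * \<phi> t) = (LINT t|lebesgue. m t * \<phi> t)"
      using inner_avg_test[OF h \<phi>, of x] inner_l2_of[OF rep_L2[of "avg h x"] test_function_L2[OF \<phi>]] by (simp add: m_def)
    then show "(LINT t|lebesgue. (rep (avg h x) t - m t) * \<phi> t) = 0"
      using locally_integrable_test[OF lm \<phi>] locally_integrable_test[OF L2_locally_integrable[OF rep_L2[of "avg h x"]] \<phi>]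
      by (simp add: left_diff_distrib)
  qed
  then show ?thesis by eventually_elim (simp add: m_def)
qed

text \<open>Cauchy-Schwarz on the box: averaging at scale h maps L2 into bounded functions at the
  cost of h^(-N/2). This replaces a Sobolev embedding.\<close>

lemma avg_sup_bound:
  fixes x :: "'n::finite l2"
  assumes h: "h > 0"
  shows "AE t in lebesgue. \<bar>rep (avg h x) t\<bar> \<le> norm x / sqrt ((2 * h) ^ CARD('n))"
  using rep_avg[OF h, of x]
proof eventually_elim
  case (elim t)
  have "\<bar>rep (avg h x) t\<bar> = \<bar>box_l2 h \<bullet> tr t x\<bar> / (2 * h) ^ CARD('n)" using h by (simp add: elim abs_mult)
  also have "\<dots> \<le> sqrt ((2 * h) ^ CARD('n)) * norm x / (2 * h) ^ CARD('n)"
    using Cauchy_Schwarz_ineq2[of "box_l2 h" "tr t x"] h by (intro divide_right_mono) (auto simp: norm_box_l2)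
  also have "\<dots> = norm x / sqrt ((2 * h) ^ CARD('n))"
  proof -
    define C where "C = (2 * h) ^ CARD('n)"
    define D where "D = sqrt C"
    have D: "D > 0" "C = D * D" using h by (simp_all add: C_def D_def)
    then have "D * norm x / C = norm x / D" by simp
    then show ?thesis by (simp add: C_def D_def)
  qed
  finally show ?case .
qed

section \<open>Multiplication estimates\<close>

text \<open>Weighted norms are lower semicontinuous, so a uniform bound survives an L2 limit
  although the weight is unbounded.\<close>

lemma L2_Fatou:
  assumes lim: "f \<longlonglongrightarrow> (x :: 'n::finite l2)" and [measurable]: "W \<in> borel_measurable lebesgue"
    and b: "\<And>n. (\<lambda>t. W t * rep (f n) t) \<in> L2" "\<And>n. norm (l2_of (\<lambda>t. W t * rep (f n) t)) \<le> B"
  shows "(\<lambda>t. W t * rep x t) \<in> L2" "norm (l2_of (\<lambda>t. W t * rep x t)) \<le> B"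
proof -
  obtain k where k: "strict_mono (k :: nat \<Rightarrow> nat)" and ae: "AE t in lebesgue. (\<lambda>n. rep (f (k n)) t) \<longlonglongrightarrow> rep x t"
    using tendsto_l2_AE_subseq[OF lim] by blast
  have B0: "B \<ge> 0" using order_trans[OF norm_ge_zero b(2)] .
  have "(\<integral>\<^sup>+t. ennreal ((W t * rep x t)\<^sup>2) \<partial>lebesgue) = (\<integral>\<^sup>+t. liminf (\<lambda>n. ennreal ((W t * rep (f (k n)) t)\<^sup>2)) \<partial>lebesgue)"
  proof (rule nn_integral_cong_AE)
    show "AE t in lebesgue. ennreal ((W t * rep x t)\<^sup>2) = liminf (\<lambda>n. ennreal ((W t * rep (f (k n)) t)\<^sup>2))"
      using ae
    proof eventually_elim
      case (elim t)
      then have "(\<lambda>n. ennreal ((W t * rep (f (k n)) t)\<^sup>2)) \<longlonglongrightarrow> ennreal ((W t * rep x t)\<^sup>2)"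
        by (intro tendsto_intros)
      then show ?case by (metis lim_imp_Liminf trivial_limit_sequentially)
    qed
  qed
  also have "\<dots> \<le> liminf (\<lambda>n. \<integral>\<^sup>+t. ennreal ((W t * rep (f (k n)) t)\<^sup>2) \<partial>lebesgue)"
    by (rule nn_integral_liminf) measurable
  also have "\<dots> \<le> ennreal (B\<^sup>2)"
  proof (rule Liminf_le)
    show "\<forall>\<^sub>F n in sequentially. (\<integral>\<^sup>+t. ennreal ((W t * rep (f (k n)) t)\<^sup>2) \<partial>lebesgue) \<le> ennreal (B\<^sup>2)"
      using b(2) by (intro always_eventually allI) (simp add: nn_integral_L2[OF b(1)] ennreal_leI power_mono)
  qed simp
  finally have le: "(\<integral>\<^sup>+t. ennreal ((W t * rep x t)\<^sup>2) \<partial>lebesgue) \<le> ennreal (B\<^sup>2)" .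
  show L: "(\<lambda>t. W t * rep x t) \<in> L2"
    by (rule L2_nn_integral) (auto intro: le_less_trans[OF le])
  have "(norm (l2_of (\<lambda>t. W t * rep x t)))\<^sup>2 \<le> B\<^sup>2"
    using le unfolding nn_integral_L2[OF L] by (subst (asm) ennreal_le_iff) auto
  then show "norm (l2_of (\<lambda>t. W t * rep x t)) \<le> B" using B0 by (rule power2_le_imp_le)
qed

text \<open>Splitting at a height T of the weight: where |W| <= T the L2 bound of the average
  suffices; elsewhere its sup bound is combined with W^2 <= T^(2-p) |W|^p, valid since p >=
  2.\<close>

lemma mult_avg_bound:
  fixes e :: "'n::finite l2"
  assumes h: "h > 0" and W[measurable]: "W \<in> borel_measurable lebesgue" and Wp: "integrable lebesgue (\<lambda>t. \<bar>W t\<bar> powr p)"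
    and p: "p \<ge> 2" and \<Lambda>: "(LINT t|lebesgue. \<bar>W t\<bar> powr p) \<le> \<Lambda>" "\<Lambda> > 0"
  shows "(\<lambda>t. W t * rep (avg h e) t) \<in> L2"
    "norm (l2_of (\<lambda>t. W t * rep (avg h e) t)) \<le> sqrt 2 * \<Lambda> powr (1 / p) * (2 * h) powr (- real CARD('n) / p) * norm e"
proof -
  define c where "c = (2 * h) ^ CARD('n)"
  have c: "c > 0" using h by (simp add: c_def)
  have c_powr: "c = (2 * h) powr real CARD('n)" using h by (simp add: c_def powr_realpow)
  \<comment> \<open>The height at which both contributions, T^2 and T^(2-p) \<Lambda> / c, agree
    (\<open>T2\<close>); their sum explains the factor sqrt 2.\<close>
  define T where "T = \<Lambda> powr (1 / p) * c powr (- 1 / p)"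
  have T: "T > 0" using \<Lambda> c by (simp add: T_def)
  have T2: "T powr (2 - p) * \<Lambda> / c = T\<^sup>2"
  proof -
    have "(\<Lambda> powr (1 / p)) powr p = \<Lambda>" "(c powr (- 1 / p)) powr p = c powr - 1"
      using p \<Lambda> by (simp_all only: powr_powr) simp_all
    moreover have "T powr p = (\<Lambda> powr (1 / p)) powr p * (c powr (- 1 / p)) powr p"
      unfolding T_def by (subst powr_mult) auto
    ultimately have "T powr p = \<Lambda> / c" using c by (simp only:) (simp add: powr_minus divide_inverse)
    then have "T powr (2 - p) * (\<Lambda> / c) = T powr (2 - p) * T powr p" by simp
    also have "\<dots> = T\<^sup>2" using T by (simp add: powr_add[symmetric])
    finally show ?thesis by simp
  qed
  define d where "d = rep (avg h e)"
  have [measurable]: "d \<in> borel_measurable lebesgue" by (simp add: d_def)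
  have dL: "d \<in> L2" by (simp add: d_def)
  have dn: "norm (l2_of d) \<le> norm e" using norm_avg_le[OF h, of e] by (simp add: d_def)
  define g where "g t = T\<^sup>2 * (d t)\<^sup>2 + T powr (2 - p) * (norm e)\<^sup>2 / c * \<bar>W t\<bar> powr p" for t
  have gi: "integrable lebesgue g" unfolding g_def using dL Wp by (auto simp: L2_def)
  have pt: "AE t in lebesgue. (W t * d t)\<^sup>2 \<le> g t"
    using avg_sup_bound[OF h, of e]
  proof eventually_elim
    case (elim t)
    have "(d t)\<^sup>2 \<le> (norm e / sqrt c)\<^sup>2" 
      using power_mono[OF elim, of 2] by (simp add: d_def c_def)
    then have d2: "(d t)\<^sup>2 \<le> (norm e)\<^sup>2 / c" using c by (simp add: power_divide)
    show ?case
    proof (cases "\<bar>W t\<bar> \<le> T")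
      case True
      then have "(W t)\<^sup>2 \<le> T\<^sup>2" using T by (simp add: abs_le_square_iff[symmetric])
      then have "(W t * d t)\<^sup>2 \<le> T\<^sup>2 * (d t)\<^sup>2" by (simp add: power_mult_distrib mult_right_mono)
      then show ?thesis using c unfolding g_def by (intro add_increasing2) auto
    next
      case False
      have "(W t)\<^sup>2 = \<bar>W t\<bar> powr (2 - p) * \<bar>W t\<bar> powr p" using False T by (simp add: powr_add[symmetric])
      also have "\<dots> \<le> T powr (2 - p) * \<bar>W t\<bar> powr p"
        using False T p by (intro mult_right_mono powr_mono2') auto
      finally have "(W t * d t)\<^sup>2 \<le> (T powr (2 - p) * \<bar>W t\<bar> powr p) * ((norm e)\<^sup>2 / c)"
        unfolding power_mult_distrib using d2 by (intro mult_mono) auto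
      also have "\<dots> \<le> g t" unfolding g_def by (simp add: mult_ac)
      finally show ?thesis .
    qed
  qed
  have i: "integrable lebesgue (\<lambda>t. (W t * d t)\<^sup>2)"
    by (rule Bochner_Integration.integrable_bound[OF gi]) (use pt in \<open>auto elim!: eventually_mono\<close>)
  then have L: "(\<lambda>t. W t * d t) \<in> L2" by (simp add: L2_def)
  then show "(\<lambda>t. W t * rep (avg h e) t) \<in> L2" by (simp add: d_def)
  have "(norm (l2_of (\<lambda>t. W t * d t)))\<^sup>2 \<le> (LINT t|lebesgue. g t)"
    unfolding norm_l2_of_sq[OF L] by (rule integral_mono_AE[OF i gi pt])
  also have "\<dots> = T\<^sup>2 * (norm (l2_of d))\<^sup>2 + T powr (2 - p) * (norm e)\<^sup>2 / c * (LINT t|lebesgue. \<bar>W t\<bar> powr p)"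
    unfolding g_def norm_l2_of_sq[OF dL] using dL Wp by (subst Bochner_Integration.integral_add) (auto simp: L2_def)
  also have "\<dots> \<le> T\<^sup>2 * (norm e)\<^sup>2 + T powr (2 - p) * (norm e)\<^sup>2 / c * \<Lambda>"
    using dn \<Lambda> c by (intro add_mono mult_left_mono power_mono) auto
  also have "\<dots> = T\<^sup>2 * (norm e)\<^sup>2 + (T powr (2 - p) * \<Lambda> / c) * (norm e)\<^sup>2" by (simp add: mult_ac)
  also have "\<dots> = (sqrt 2 * T * norm e)\<^sup>2" unfolding T2 by (simp add: power_mult_distrib)
  finally have "norm (l2_of (\<lambda>t. W t * d t)) \<le> sqrt 2 * T * norm e"
    by (rule power2_le_imp_le) (use T in simp)
  moreover have "T = \<Lambda> powr (1 / p) * (2 * h) powr (- real CARD('n) / p)"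
    unfolding T_def c_powr by (simp add: powr_powr)
  ultimately show "norm (l2_of (\<lambda>t. W t * rep (avg h e) t)) \<le> sqrt 2 * \<Lambda> powr (1 / p) * (2 * h) powr (- real CARD('n) / p) * norm e"
    by (simp add: d_def)
qed

text \<open>The factor sqrt 2 stems from \<open>mult_avg_bound\<close>; 1 / (1 - q) with q = 2^(N/p
  - s) sums the geometric series over scales, and the 2 above it counts the two averaging errors in
  each increment.\<close>

definition mconst :: "real \<Rightarrow> real \<Rightarrow> real \<Rightarrow> real" where
  "mconst N p s = sqrt 2 * (1 + 2 / (1 - 2 powr (N / p - s)))"

lemma mconst_pos: "p > 0 \<Longrightarrow> s * p > N \<Longrightarrow> mconst N p s > 0"
proof -
  assume "p > 0" "s * p > N"
  then have "(2::real) powr (N / p - s) < 2 powr 0" by (intro powr_less_mono) (auto simp: field_simps)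
  then show ?thesis unfolding mconst_def by (intro mult_pos_pos add_pos_pos divide_pos_pos) auto
qed

text \<open>Littlewood-Paley type telescoping over the scales \<open>h / 2 ^ j\<close>; the hypothesis \<open>s * p > N\<close>
  makes the series over the scales geometric.\<close>

lemma mult_estimate:
  fixes u :: "'n::finite l2"
  assumes W[measurable]: "W \<in> borel_measurable lebesgue" and Wp: "integrable lebesgue (\<lambda>t. \<bar>W t\<bar> powr p)"
    and p: "p \<ge> 2" and \<Lambda>: "(LINT t|lebesgue. \<bar>W t\<bar> powr p) \<le> \<Lambda>" "\<Lambda> > 0"
    and sp: "s * p > real CARD('n)" and K: "\<And>h. 0 < h \<Longrightarrow> h \<le> 1 \<Longrightarrow> norm (avg h u - u) \<le> K * h powr s"
    and h: "0 < h" "h \<le> 1"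
  shows "(\<lambda>t. W t * rep u t) \<in> L2"
    "norm (l2_of (\<lambda>t. W t * rep u t))
       \<le> mconst CARD('n) p s * \<Lambda> powr (1 / p) * h powr (- real CARD('n) / p) * (norm u + h powr s * K)"
proof -
  define N where "N = real CARD('n)"
  have Npos: "N > 0" by (simp add: N_def)
  have s: "s > 0" using sp p Npos by (simp add: N_def[symmetric]) (metis less_trans zero_less_mult_pos2 order_less_le_trans zero_less_numeral)
  define \<theta> where "\<theta> = s - N / p"
  have \<theta>: "\<theta> > 0" using sp p by (simp add: \<theta>_def N_def field_simps)
  define q where "q = (2::real) powr (- \<theta>)"
  have q: "0 < q" "q < 1" using \<theta> powr_less_mono[of "-\<theta>" 0 2] by (auto simp: q_def)
  have K0: "K \<ge> 0" using order_trans[OF norm_ge_zero K[of 1]] by simp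
  define hj where "hj j = h / 2 ^ j" for j :: nat
  have hj: "hj j > 0" "hj j \<le> 1" "2 * hj (Suc j) = hj j" for j
    using h by (auto simp: hj_def field_simps) (metis less_le_trans mult.commute one_le_power one_le_numeral order_trans mult_left_mono[of 1 _ h] less_imp_le mult_1_right)
  \<comment> \<open>Averaging at two consecutive scales makes each increment
    \<open>a (Suc j) - a j\<close> again an average, at scale \<open>hj (Suc j)\<close>, of a
    difference of order \<open>hj j powr s\<close>. That is the shape \<open>mult_avg_bound\<close>
    handles.\<close>
  define a where "a j = avg (hj j) (avg (hj (Suc j)) u)" for j
  define c where "c = sqrt 2 * \<Lambda> powr (1 / p)"
  have c: "c > 0" using \<Lambda> by (simp add: c_def)
  define n where "n x = norm (l2_of (\<lambda>t. W t * rep x t))" for x :: "'n l2"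
  note mb = mult_avg_bound[OF _ W Wp p \<Lambda>]
  have Wadd: "(\<lambda>t. W t * rep (x + y) t) \<in> L2" "n (x + y) \<le> n x + n y"
    if "(\<lambda>t. W t * rep x t) \<in> L2" "(\<lambda>t. W t * rep y t) \<in> L2" for x y :: "'n l2"
  proof -
    have ae: "AE t in lebesgue. W t * rep x t + W t * rep y t = W t * rep (x + y) t"
      using rep_add[of x y] by eventually_elim (simp add: distrib_left)
    show L: "(\<lambda>t. W t * rep (x + y) t) \<in> L2" by (rule L2_cong_AE'[OF L2_add[OF that] ae])
    have "l2_of (\<lambda>t. W t * rep (x + y) t) = l2_of (\<lambda>t. W t * rep x t) + l2_of (\<lambda>t. W t * rep y t)"
      using ae l2_of_eq_iff[OF L2_add[OF that] L] by (simp add: l2_of_add that)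
    then show "n (x + y) \<le> n x + n y" unfolding n_def by (simp add: norm_triangle_ineq)
  qed
  have a_step: "a (Suc j) = a j + avg (hj (Suc j)) (avg (hj (Suc (Suc j))) u - avg (hj j) u)" for j
    using hj(1) by (simp add: a_def avg_diff avg_avg[of "hj j" "hj (Suc j)"])
  have diff: "norm (avg (hj (Suc (Suc j))) u - avg (hj j) u) \<le> 2 * K * hj j powr s" for j
  proof -
    have "norm (avg (hj (Suc (Suc j))) u - u) \<le> K * hj j powr s"
    proof -
      have "hj (Suc (Suc j)) \<le> hj j" using h by (simp add: hj_def field_simps)
      then have "K * hj (Suc (Suc j)) powr s \<le> K * hj j powr s"
        using hj(1)[of "Suc (Suc j)"] s K0 by (intro mult_left_mono powr_mono2) auto
      then show ?thesis using K[OF hj(1,2), of "Suc (Suc j)"] by linarith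
    qed
    moreover have "norm (u - avg (hj j) u) \<le> K * hj j powr s" using K[OF hj(1,2)] by (simp add: norm_minus_commute)
    ultimately show ?thesis
      using norm_triangle_ineq[of "avg (hj (Suc (Suc j))) u - u" "u - avg (hj j) u"] by simp
  qed
  have hq: "hj j powr \<theta> = h powr \<theta> * q ^ j" for j
  proof -
    have "(2 ^ j) powr \<theta> = (2 powr \<theta> :: real) ^ j"
      by (simp add: powr_realpow[symmetric] powr_powr mult.commute)
    moreover have "hj j powr \<theta> = h powr \<theta> / (2 ^ j) powr \<theta>" using h by (simp add: hj_def powr_divide)
    moreover have "q ^ j = inverse ((2 powr \<theta>) ^ j)" by (simp add: q_def powr_minus power_inverse)
    ultimately show ?thesis by (simp only: divide_inverse)
  qed
  have incr: "n (avg (hj (Suc j)) (avg (hj (Suc (Suc j))) u - avg (hj j) u)) \<le> c * 2 * K * h powr \<theta> * q ^ j" for j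
  proof -
    have "n (avg (hj (Suc j)) (avg (hj (Suc (Suc j))) u - avg (hj j) u))
        \<le> c * (2 * hj (Suc j)) powr (- N / p) * norm (avg (hj (Suc (Suc j))) u - avg (hj j) u)"
      unfolding n_def c_def N_def using mb(2)[OF hj(1)[of "Suc j"]] by simp
    also have "\<dots> \<le> c * hj j powr (- N / p) * (2 * K * hj j powr s)"
      unfolding hj(3) using c diff by (intro mult_left_mono) auto
    also have "\<dots> = c * 2 * K * (hj j powr s * hj j powr (- N / p))" by (simp add: mult_ac)
    also have "hj j powr s * hj j powr (- N / p) = hj j powr \<theta>" by (simp add: powr_add[symmetric] \<theta>_def)
    also have "\<dots> = h powr \<theta> * q ^ j" by (rule hq)
    finally show ?thesis by (simp add: mult.assoc)
  qed
  have base: "n (a 0) \<le> c * h powr (- N / p) * norm u"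
  proof -
    have "n (a 0) \<le> c * (2 * h) powr (- N / p) * norm (avg (hj (Suc 0)) u)"
      unfolding n_def c_def N_def a_def using mb(2)[OF hj(1)[of 0]] by (simp add: hj_def)
    also have "\<dots> \<le> c * h powr (- N / p) * norm u"
      using c h Npos p norm_avg_le[OF hj(1), of "Suc 0" u]
      by (intro mult_mono mult_left_mono powr_mono2') auto
    finally show ?thesis .
  qed
  have bound: "(\<lambda>t. W t * rep (a j) t) \<in> L2 \<and> n (a j) \<le> c * h powr (- N / p) * norm u + (\<Sum>i<j. c * 2 * K * h powr \<theta> * q ^ i)" for j
  proof (induction j)
    case 0 show ?case using base mb(1)[OF hj(1)[of 0]] by (simp add: a_def)
  next
    case (Suc j)
    have L: "(\<lambda>t. W t * rep (avg (hj (Suc j)) (avg (hj (Suc (Suc j))) u - avg (hj j) u)) t) \<in> L2"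
      by (rule mb(1)[OF hj(1)])
    show ?case unfolding a_step using Suc Wadd[OF _ L, of "a j"] incr[of j] by auto
  qed
  define B where "B = c * h powr (- N / p) * norm u + c * 2 * K * h powr \<theta> * (1 / (1 - q))"
  have nB: "n (a j) \<le> B" for j
  proof -
    have "(\<Sum>i<j. c * 2 * K * h powr \<theta> * q ^ i) = c * 2 * K * h powr \<theta> * (\<Sum>i<j. q ^ i)" by (simp add: sum_distrib_left)
    also have "\<dots> \<le> c * 2 * K * h powr \<theta> * (1 / (1 - q))"
    proof (intro mult_left_mono)
      have "(\<Sum>i<j. q ^ i) \<le> (\<Sum>i. q ^ i)" using q by (intro sum_le_suminf summable_geometric) auto
      then show "(\<Sum>i<j. q ^ i) \<le> 1 / (1 - q)" using q by (simp add: suminf_geometric)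
    qed (use c K0 in auto)
    finally show ?thesis using bound[of j] unfolding B_def by linarith
  qed
  have lim: "a \<longlonglongrightarrow> u"
  proof -
    have hj0: "hj \<longlonglongrightarrow> 0"
    proof -
      have "hj = (\<lambda>j. h * (1/2) ^ j)" by (simp add: hj_def fun_eq_iff power_one_over)
      then show ?thesis using tendsto_mult[OF tendsto_const[of h] LIMSEQ_power_zero[of "1/2::real"]] by simp
    qed
    have "(\<lambda>j. K * hj (Suc j) powr s + K * hj j powr s) \<longlonglongrightarrow> K * 0 + K * 0"
    proof (intro tendsto_add tendsto_mult tendsto_const)
      show "(\<lambda>j. hj j powr s) \<longlonglongrightarrow> 0"
        by (rule tendsto_zero_powrI[OF hj0 tendsto_const]) (use hj(1) s in \<open>auto intro!: always_eventually less_imp_le\<close>)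
      then show "(\<lambda>j. hj (Suc j) powr s) \<longlonglongrightarrow> 0" by (rule LIMSEQ_Suc)
    qed
    moreover have "norm (a j - u) \<le> K * hj (Suc j) powr s + K * hj j powr s" for j
    proof -
      have "a j - u = avg (hj j) (avg (hj (Suc j)) u - u) + (avg (hj j) u - u)" using hj(1) by (simp add: a_def avg_diff)
      then have "norm (a j - u) \<le> norm (avg (hj j) (avg (hj (Suc j)) u - u)) + norm (avg (hj j) u - u)"
        by (simp only: norm_triangle_ineq)
      also have "\<dots> \<le> norm (avg (hj (Suc j)) u - u) + norm (avg (hj j) u - u)"
        by (intro add_right_mono norm_avg_le hj(1))
      also have "\<dots> \<le> K * hj (Suc j) powr s + K * hj j powr s" by (intro add_mono K hj)
      finally show ?thesis .
    qed
    ultimately have "(\<lambda>j. a j - u) \<longlonglongrightarrow> 0"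
      by (intro Lim_null_comparison[of "\<lambda>j. a j - u" "\<lambda>j. K * hj (Suc j) powr s + K * hj j powr s"]) auto
    then show ?thesis by (simp add: LIM_zero_iff)
  qed
  \<comment> \<open>The bound \<open>B\<close> is uniform in j, so it passes to the limit
    \<open>u\<close> by \<open>L2_Fatou\<close>.\<close>
  show "(\<lambda>t. W t * rep u t) \<in> L2"
    by (rule L2_Fatou(1)[OF lim W, of B]) (use bound nB in \<open>auto simp: n_def\<close>)
  have "n u \<le> B" unfolding n_def
    by (rule L2_Fatou(2)[OF lim W, of B]) (use bound nB in \<open>auto simp: n_def\<close>)
  also have "B \<le> (c * h powr (- N / p)) * (1 + 2 / (1 - q)) * (norm u + h powr s * K)"
  proof -
    have "h powr \<theta> = h powr (- N / p) * h powr s" using h by (simp add: powr_add[symmetric] \<theta>_def)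
    then have B: "B = (c * h powr (- N / p)) * (norm u + (2 / (1 - q)) * (h powr s * K))"
      by (simp add: B_def algebra_simps)
    have "norm u + (2 / (1 - q)) * (h powr s * K) \<le> (1 + 2 / (1 - q)) * norm u + (1 + 2 / (1 - q)) * (h powr s * K)"
      using q K0 by (intro add_mono mult_right_mono) (auto simp: algebra_simps)
    also have "\<dots> = (1 + 2 / (1 - q)) * (norm u + h powr s * K)" by (simp add: distrib_left)
    finally show ?thesis unfolding B mult.assoc using c by (intro mult_left_mono) auto
  qed
  also have "\<dots> = mconst CARD('n) p s * \<Lambda> powr (1 / p) * h powr (- real CARD('n) / p) * (norm u + h powr s * K)"
    by (simp add: mconst_def c_def N_def q_def \<theta>_def mult_ac)
  finally show "norm (l2_of (\<lambda>t. W t * rep u t))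
       \<le> mconst CARD('n) p s * \<Lambda> powr (1 / p) * h powr (- real CARD('n) / p) * (norm u + h powr s * K)" by (simp add: n_def)
qed

section \<open>The free resolvent\<close>

lemma hwp_test:
  assumes "test_function \<phi>"
  shows "hwp i (l2_of \<phi>) (l2_of (partial i \<phi>))"
  unfolding hwp_def
proof (intro allI impI)
  fix \<psi> :: "real ^ 'a \<Rightarrow> real" assume \<psi>: "test_function \<psi>"
  let ?e = "axis i 1 :: real ^ 'a"
  have 1: "((\<lambda>h. l2_of \<phi> \<bullet> ((tr (h *\<^sub>R ?e) (l2_of \<psi>) - l2_of \<psi>) /\<^sub>R h)) \<longlongrightarrow> l2_of \<phi> \<bullet> l2_of (partial i \<psi>)) (at 0)"
    by (intro tendsto_inner tendsto_const tr_test_has_derivative \<psi>)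
  have 2: "((\<lambda>h. ((tr (- h *\<^sub>R ?e) (l2_of \<phi>) - l2_of \<phi>) /\<^sub>R h) \<bullet> l2_of \<psi>) \<longlongrightarrow> (- l2_of (partial i \<phi>)) \<bullet> l2_of \<psi>) (at 0)"
    by (intro tendsto_inner tendsto_const tr_test_has_derivative_minus assms)
  have eq: "l2_of \<phi> \<bullet> ((tr (h *\<^sub>R ?e) (l2_of \<psi>) - l2_of \<psi>) /\<^sub>R h) = ((tr (- h *\<^sub>R ?e) (l2_of \<phi>) - l2_of \<phi>) /\<^sub>R h) \<bullet> l2_of \<psi>" for h
    using inner_tr_left[of "- h *\<^sub>R ?e" "l2_of \<phi>" "l2_of \<psi>"] by (simp add: inner_diff_left inner_diff_right)
  then show "l2_of \<phi> \<bullet> l2_of (partial i \<psi>) = - (l2_of (partial i \<phi>) \<bullet> l2_of \<psi>)"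
    using tendsto_unique[OF _ 1[unfolded eq] 2] by simp
qed

lemma test_dom1: "test_function \<phi> \<Longrightarrow> l2_of \<phi> \<in> dom1"
  unfolding dom1_def using hwp_test by blast

lemma zero_if_orthogonal_dom1: "(\<And>y. y \<in> dom1 \<Longrightarrow> x \<bullet> y = 0) \<Longrightarrow> x = 0"
  using l2_zero_if_orthogonal_test[of x] test_dom1 by blast

definition gf :: "'n::finite l2 \<Rightarrow> 'n l2 \<Rightarrow> real" where "gf x y = (\<Sum>i\<in>UNIV. pd i x \<bullet> pd i y)"

lemma gf_commute: "gf x y = gf y x"
  by (simp add: gf_def inner_commute)
lemma gf_nonneg: "gf x x \<ge> 0"
  by (simp add: gf_def sum_nonneg)
lemma gf_eq: "gf x x = (\<Sum>i\<in>UNIV. (norm (pd i x))\<^sup>2)"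
  by (simp add: gf_def power2_norm_eq_inner)
lemma gf_add: "x \<in> dom1 \<Longrightarrow> y \<in> dom1 \<Longrightarrow> gf (x + y) z = gf x z + gf y z"
  by (simp add: gf_def pd_add inner_add_left sum.distrib)
lemma gf_diff: "x \<in> dom1 \<Longrightarrow> y \<in> dom1 \<Longrightarrow> gf (x - y) z = gf x z - gf y z"
  by (simp add: gf_def pd_diff inner_diff_left sum_subtractf)
lemma gf_scale: "x \<in> dom1 \<Longrightarrow> gf (c *\<^sub>R x) z = c * gf x z"
  by (simp add: gf_def pd_scale sum_distrib_left)

lemma inner_lap_gf: "x \<in> dom2 \<Longrightarrow> y \<in> dom1 \<Longrightarrow> lap x \<bullet> y = - gf x y"
  by (simp add: inner_lap gf_def)

lemma norm_pd_le: "(norm (pd i x))\<^sup>2 \<le> gf x x"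
  unfolding gf_eq by (rule member_le_sum) auto

lemma sum_norm_pd_sq: "(\<Sum>i\<in>UNIV. norm (pd i (x :: 'n::finite l2)))\<^sup>2 \<le> real CARD('n) * gf x x"
  unfolding gf_eq using sum_squared_le_sum_of_squares[of "\<lambda>i. norm (pd i x)" UNIV] by (simp add: mult.commute)

text \<open>The weighted gradient graph embeds \<open>dom1\<close>, with the norm \<kappa> |x|^2 +
  |grad x|^2, as a closed subspace of a product Hilbert space. Riesz representation and weak
  compactness in H1 are inherited from there.\<close>

definition grl :: "real \<Rightarrow> 'n::finite l2 \<Rightarrow> 'n l2 \<times> ('n l2 ^ 'n)" where
  "grl \<kappa> x = (sqrt \<kappa> *\<^sub>R x, (\<chi> i. pd i x))"

lemma inner_grl: "\<kappa> \<ge> 0 \<Longrightarrow> grl \<kappa> x \<bullet> grl \<kappa> y = \<kappa> * (x \<bullet> y) + gf x y"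
  by (simp add: grl_def inner_prod_def inner_vec_def gf_def flip: mult.assoc)

lemma norm_grl: "\<kappa> \<ge> 0 \<Longrightarrow> (norm (grl \<kappa> x))\<^sup>2 = \<kappa> * (norm x)\<^sup>2 + gf x x"
  by (simp add: power2_norm_eq_inner inner_grl)

lemma grl_add: "x \<in> dom1 \<Longrightarrow> y \<in> dom1 \<Longrightarrow> grl \<kappa> (x + y) = grl \<kappa> x + grl \<kappa> y"
  by (simp add: grl_def pd_add scaleR_add_right vec_eq_iff)
lemma grl_scale: "x \<in> dom1 \<Longrightarrow> grl \<kappa> (c *\<^sub>R x) = c *\<^sub>R grl \<kappa> x"
  by (simp add: grl_def pd_scale vec_eq_iff mult.commute)

lemma tendsto_wconv: "x \<longlonglongrightarrow> a \<Longrightarrow> wconv x a"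
  unfolding wconv_def by (intro allI tendsto_intros)

lemma closed_grl:
  assumes "\<kappa> > 0"
  shows "subspace (grl \<kappa> ` dom1 :: ('n::finite l2 \<times> ('n l2 ^ 'n)) set)" "closed (grl \<kappa> ` dom1 :: ('n::finite l2 \<times> ('n l2 ^ 'n)) set)"
proof -
  show "subspace (grl \<kappa> ` dom1 :: ('n l2 \<times> ('n l2 ^ 'n)) set)" unfolding subspace_def
  proof (intro conjI ballI allI)
    show "0 \<in> grl \<kappa> ` dom1"
      using dom1_zero by (intro image_eqI[of _ _ 0]) (simp_all add: grl_def pd_zero vec_eq_iff zero_prod_def)
  next
    fix x y :: "'n l2 \<times> ('n l2 ^ 'n)" assume "x \<in> grl \<kappa> ` dom1" "y \<in> grl \<kappa> ` dom1"
    then obtain a b where "a \<in> dom1" "x = grl \<kappa> a" "b \<in> dom1" "y = grl \<kappa> b" by auto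
    then show "x + y \<in> grl \<kappa> ` dom1" using dom1_add by (intro image_eqI[of _ _ "a + b"]) (simp_all add: grl_add)
  next
    fix c and x :: "'n l2 \<times> ('n l2 ^ 'n)" assume "x \<in> grl \<kappa> ` dom1"
    then obtain a where a: "a \<in> dom1" "x = grl \<kappa> a" by auto
    have "c *\<^sub>R x = grl \<kappa> (c *\<^sub>R a)" unfolding a(2) by (rule grl_scale[OF a(1), symmetric])
    then show "c *\<^sub>R x \<in> grl \<kappa> ` dom1" using dom1_scale[OF a(1)] by (rule image_eqI)
  qed
  show "closed (grl \<kappa> ` dom1 :: ('n l2 \<times> ('n l2 ^ 'n)) set)"
  proof (rule closed_sequential_limits[THEN iffD2], intro allI impI)
    fix f :: "nat \<Rightarrow> 'n l2 \<times> ('n l2 ^ 'n)" and l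
    assume h: "(\<forall>n. f n \<in> grl \<kappa> ` dom1) \<and> f \<longlonglongrightarrow> l"
    then have "\<forall>n. \<exists>a. a \<in> dom1 \<and> f n = grl \<kappa> a" by auto
    from choice[OF this] obtain x where x: "\<And>n. x n \<in> dom1" "\<And>n. f n = grl \<kappa> (x n)" by auto
    have "(\<lambda>n. (1 / sqrt \<kappa>) *\<^sub>R fst (f n)) \<longlonglongrightarrow> (1 / sqrt \<kappa>) *\<^sub>R fst l" using h by (intro tendsto_intros) auto
    then have a: "x \<longlonglongrightarrow> (1 / sqrt \<kappa>) *\<^sub>R fst l" using assms by (simp add: x(2) grl_def)
    have "(\<lambda>n. snd (f n) $ i) \<longlonglongrightarrow> snd l $ i" for i using h by (intro tendsto_intros) auto
    then have b: "(\<lambda>n. pd i (x n)) \<longlonglongrightarrow> snd l $ i" for i by (simp add: x(2) grl_def)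
    have w: "hwp i ((1 / sqrt \<kappa>) *\<^sub>R fst l) (snd l $ i)" for i
      by (rule hwp_weak_limit[OF hwp_pd[OF x(1)] tendsto_wconv[OF a] tendsto_wconv[OF b]])
    then have "(1 / sqrt \<kappa>) *\<^sub>R fst l \<in> dom1" unfolding dom1_def by blast
    moreover have "grl \<kappa> ((1 / sqrt \<kappa>) *\<^sub>R fst l) = l"
      using assms pd_eq[OF w] by (simp add: grl_def prod_eq_iff vec_eq_iff)
    ultimately show "l \<in> grl \<kappa> ` dom1" by (intro image_eqI[of l "grl \<kappa>"]) simp_all
  qed
qed

text \<open>Riesz representation on the graph of the gradient; the factor 1 / sqrt \<kappa> undoes
  the weight of the first component, so that the functional takes the value f \<bullet> x at the
  graph point of x.\<close>

lemma weak_solution_exists: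
  fixes f :: "'n::finite l2"
  assumes "\<kappa> > 0"
  obtains u where "u \<in> dom1" "\<And>\<phi>. \<phi> \<in> dom1 \<Longrightarrow> \<kappa> * (u \<bullet> \<phi>) + gf u \<phi> = f \<bullet> \<phi>"
proof -
  define l where "l z = f \<bullet> ((1 / sqrt \<kappa>) *\<^sub>R fst z)" for z :: "'n l2 \<times> ('n l2 ^ 'n)"
  have lg: "l (grl \<kappa> x) = f \<bullet> x" for x using assms by (simp add: l_def grl_def)
  obtain z where z: "z \<in> grl \<kappa> ` dom1" "\<And>x. x \<in> grl \<kappa> ` dom1 \<Longrightarrow> l x = z \<bullet> x"
  proof (rule riesz_subspace[OF closed_grl[OF assms], of l "norm f / sqrt \<kappa>"])
    show "l (x + y) = l x + l y" for x y by (simp add: l_def scaleR_add_right inner_add_right)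
    show "l (c *\<^sub>R x) = c * l x" for c x by (simp add: l_def)
    show "\<bar>l x\<bar> \<le> norm f / sqrt \<kappa> * norm x" for x
    proof -
      have "\<bar>l x\<bar> \<le> norm f * norm ((1 / sqrt \<kappa>) *\<^sub>R fst x)" unfolding l_def by (rule Cauchy_Schwarz_ineq2)
      also have "\<dots> = norm f / sqrt \<kappa> * norm (fst x)" using assms by simp
      also have "\<dots> \<le> norm f / sqrt \<kappa> * norm x" using assms norm_fst_le[of "fst x" "snd x"] by (intro mult_left_mono) auto
      finally show ?thesis .
    qed
  qed blast
  then obtain u where "u \<in> dom1" "z = grl \<kappa> u" by auto
  then show ?thesis 
    using that[of u] z(2)[of "grl \<kappa> _"] lg inner_grl[of \<kappa> u] assms by simp
qed

text \<open>Nirenberg's difference quotients. Tested with a second difference of \<open>u\<close>,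
  the equation leaves gf v v + \<kappa> |v|^2 for the first difference \<open>v\<close>, while the
  test vector has norm at most h |pd j v|. The inequality gf v v <= |f| h |pd j v| then yields |pd i
  v| <= |f| h.\<close>

lemma weak_solution_regular:
  fixes f u :: "'n::finite l2"
  assumes \<kappa>: "\<kappa> > 0" and u: "u \<in> dom1" and weak: "\<And>\<phi>. \<phi> \<in> dom1 \<Longrightarrow> \<kappa> * (u \<bullet> \<phi>) + gf u \<phi> = f \<bullet> \<phi>"
  shows "u \<in> dom2" "norm (pd j (pd i u)) \<le> norm f" "\<kappa> * norm u \<le> norm f" "\<kappa> *\<^sub>R u - lap u = f"
proof -
  have bd: "norm (tr (h *\<^sub>R axis j 1) (pd i u) - pd i u) \<le> norm f * h" if "h > 0" for h i j
  proof -
    define y where "y = h *\<^sub>R (axis j 1 :: real ^ 'n)"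
    define v where "v = tr y u - u"
    have v: "v \<in> dom1" unfolding v_def by (intro dom1_diff dom1_tr u)
    \<comment> \<open>The adjoint difference of \<open>v\<close>: moving one difference back onto
      \<open>u\<close> by \<open>adj\<close> produces the squares of \<open>v\<close> and of its
      derivatives.\<close>
    define \<phi> where "\<phi> = tr (- y) v - v"
    have \<phi>: "\<phi> \<in> dom1" unfolding \<phi>_def by (intro dom1_diff dom1_tr v)
    have pdv: "pd k v = tr y (pd k u) - pd k u" for k by (simp add: v_def pd_diff pd_tr dom1_tr u)
    have pd\<phi>: "pd k \<phi> = tr (- y) (pd k v) - pd k v" for k by (simp add: \<phi>_def pd_diff pd_tr dom1_tr v)
    have adj: "a \<bullet> (tr (- y) b - b) = (tr y a - a) \<bullet> b" for a b :: "'n l2"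
      by (simp add: inner_diff_left inner_diff_right inner_tr_left)
    have "gf v v + \<kappa> * (v \<bullet> v) = f \<bullet> \<phi>"
    proof -
      have "u \<bullet> \<phi> = v \<bullet> v" unfolding \<phi>_def adj by (simp add: v_def)
      moreover have "pd k u \<bullet> pd k \<phi> = pd k v \<bullet> pd k v" for k unfolding pd\<phi> adj by (simp add: pdv)
      ultimately show ?thesis using weak[OF \<phi>] by (simp add: gf_def)
    qed
    also have "\<dots> \<le> norm f * norm \<phi>" by (rule norm_cauchy_schwarz)
    also have "norm \<phi> \<le> h * norm (pd j v)"
      using hwp_difference_bound[OF hwp_pd[OF v], of "- h" j] that by (simp add: \<phi>_def y_def)
    finally have S: "gf v v \<le> norm f * (h * norm (pd j v))"
      using \<kappa> by (smt (verit) inner_ge_zero mult_left_mono mult_nonneg_nonneg norm_ge_zero)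
    have "norm (pd j v) * norm (pd j v) \<le> norm f * h * norm (pd j v)"
      using norm_pd_le[of j v] S by (simp add: power2_eq_square mult.assoc)
    then have "norm (pd j v) \<le> norm f * h" using that by (cases "pd j v = 0") auto
    then have "norm f * h * norm (pd j v) \<le> (norm f * h) * (norm f * h)"
      using that by (intro mult_left_mono) auto
    with S have "gf v v \<le> (norm f * h)\<^sup>2" unfolding power2_eq_square mult.assoc by linarith
    with norm_pd_le have "(norm (pd i v))\<^sup>2 \<le> (norm f * h)\<^sup>2" by (rule order_trans)
    moreover have "0 \<le> norm f * h" using that by simp
    ultimately have "norm (pd i v) \<le> norm f * h" by (rule power2_le_imp_le)
    then show ?thesis by (simp add: pdv y_def)
  qed
  have ex: "\<exists>g. hwp j (pd i u) g \<and> norm g \<le> norm f" for i j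
    by (rule hwp_if_difference_bound[of 1 j "pd i u" "norm f"]) (use bd in auto)
  then have "pd i u \<in> dom1" for i unfolding dom1_def by blast
  then show d2: "u \<in> dom2" using u by (simp add: dom2_def)
  show "norm (pd j (pd i u)) \<le> norm f" using ex[where i=i and j=j] pd_eq by metis
  have "\<kappa> * (norm u * norm u) \<le> f \<bullet> u"
    using weak[OF u] gf_nonneg[of u] by (simp add: power2_norm_eq_inner flip: power2_eq_square)
  also have "\<dots> \<le> norm f * norm u" by (rule norm_cauchy_schwarz)
  finally show "\<kappa> * norm u \<le> norm f" by (cases "u = 0") auto
  have "(\<kappa> *\<^sub>R u - lap u - f) \<bullet> y = 0" if "y \<in> dom1" for y
    using weak[OF that] inner_lap_gf[OF d2 that] by (simp add: inner_diff_left)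
  then have "\<kappa> *\<^sub>R u - lap u - f = 0" by (rule zero_if_orthogonal_dom1)
  then show "\<kappa> *\<^sub>R u - lap u = f" by simp
qed

lemma weak_solution_unique:
  assumes \<kappa>: "\<kappa> > 0" and "u \<in> dom1" "v \<in> dom1"
    and "\<And>\<phi>. \<phi> \<in> dom1 \<Longrightarrow> \<kappa> * (u \<bullet> \<phi>) + gf u \<phi> = \<kappa> * (v \<bullet> \<phi>) + gf v \<phi>"
  shows "u = v"
proof -
  have "\<kappa> * ((u - v) \<bullet> (u - v)) + gf (u - v) (u - v) = 0"
    using assms(4)[OF dom1_diff[OF assms(2,3)]] gf_diff[OF assms(2,3), of "u - v"] by (simp add: inner_diff_left algebra_simps)
  moreover have "\<kappa> * ((u - v) \<bullet> (u - v)) \<ge> 0" using \<kappa> by simp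
  ultimately have "\<kappa> * ((u - v) \<bullet> (u - v)) = 0" using gf_nonneg[of "u - v"] by linarith
  then show ?thesis using \<kappa> by simp
qed

definition Gres :: "real \<Rightarrow> 'n::finite l2 \<Rightarrow> 'n l2" where
  "Gres \<kappa> f = (SOME u. u \<in> dom1 \<and> (\<forall>\<phi>\<in>dom1. \<kappa> * (u \<bullet> \<phi>) + gf u \<phi> = f \<bullet> \<phi>))"

lemma Gres:
  fixes f :: "'n::finite l2"
  assumes "\<kappa> > 0"
  shows "Gres \<kappa> f \<in> dom2" "norm (pd j (pd i (Gres \<kappa> f))) \<le> norm f" "\<kappa> * norm (Gres \<kappa> f) \<le> norm f"
    "\<kappa> *\<^sub>R Gres \<kappa> f - lap (Gres \<kappa> f) = f"
proof -
  have "Gres \<kappa> f \<in> dom1 \<and> (\<forall>\<phi>\<in>dom1. \<kappa> * (Gres \<kappa> f \<bullet> \<phi>) + gf (Gres \<kappa> f) \<phi> = f \<bullet> \<phi>)"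
    unfolding Gres_def by (rule someI_ex) (metis weak_solution_exists[OF assms])
  then have w: "Gres \<kappa> f \<in> dom1" "\<And>\<phi>. \<phi> \<in> dom1 \<Longrightarrow> \<kappa> * (Gres \<kappa> f \<bullet> \<phi>) + gf (Gres \<kappa> f) \<phi> = f \<bullet> \<phi>" by auto
  from weak_solution_regular[OF assms w]
  show "Gres \<kappa> f \<in> dom2" "norm (pd j (pd i (Gres \<kappa> f))) \<le> norm f" "\<kappa> * norm (Gres \<kappa> f) \<le> norm f"
    "\<kappa> *\<^sub>R Gres \<kappa> f - lap (Gres \<kappa> f) = f" by auto
qed

lemma Gres_eq:
  assumes "\<kappa> > 0" "u \<in> dom2"
  shows "Gres \<kappa> (\<kappa> *\<^sub>R u - lap u) = u"
proof (rule weak_solution_unique[OF assms(1)])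
  let ?v = "Gres \<kappa> (\<kappa> *\<^sub>R u - lap u)"
  note v = Gres[OF assms(1), where f = "\<kappa> *\<^sub>R u - lap u"]
  show "?v \<in> dom1" "u \<in> dom1" using v(1) assms(2) dom2_dom1 by auto
  fix \<phi> :: "'a l2" assume \<phi>: "\<phi> \<in> dom1"
  have "(\<kappa> *\<^sub>R ?v - lap ?v) \<bullet> \<phi> = \<kappa> * (?v \<bullet> \<phi>) + gf ?v \<phi>" "(\<kappa> *\<^sub>R u - lap u) \<bullet> \<phi> = \<kappa> * (u \<bullet> \<phi>) + gf u \<phi>"
    using inner_lap_gf[OF v(1) \<phi>] inner_lap_gf[OF assms(2) \<phi>] by (simp_all add: inner_diff_left)
  then show "\<kappa> * (?v \<bullet> \<phi>) + gf ?v \<phi> = \<kappa> * (u \<bullet> \<phi>) + gf u \<phi>" unfolding v(4) by simp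
qed

lemma Gres_diff:
  assumes "\<kappa> > 0"
  shows "Gres \<kappa> (f - g) = Gres \<kappa> f - Gres \<kappa> g"
proof -
  let ?u = "Gres \<kappa> f - Gres \<kappa> g"
  note d = Gres(1)[OF assms, of f] Gres(1)[OF assms, of g]
  have "\<kappa> *\<^sub>R ?u - lap ?u = (\<kappa> *\<^sub>R Gres \<kappa> f - lap (Gres \<kappa> f)) - (\<kappa> *\<^sub>R Gres \<kappa> g - lap (Gres \<kappa> g))"
    by (simp add: lap_diff d scaleR_diff_right)
  also have "\<dots> = f - g" by (simp only: Gres(4)[OF assms])
  finally show ?thesis using Gres_eq[OF assms dom2_diff[OF d]] by simp
qed

section \<open>Schroedinger forms\<close>

definition mulop :: "(real ^ 'n \<Rightarrow> real) \<Rightarrow> 'n::finite l2 \<Rightarrow> 'n l2" where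
  "mulop W x = l2_of (\<lambda>t. W t * rep x t)"

text \<open>Outside this set \<open>mulop\<close> applies \<open>l2_of\<close> to a function that is
  not in \<open>L2\<close>, and its value carries no information.\<close>

definition mul_dom :: "(real ^ 'n \<Rightarrow> real) \<Rightarrow> 'n::finite l2 set" where
  "mul_dom W = {x. (\<lambda>t. W t * rep x t) \<in> L2}"

lemma mul_dom_iff:
  assumes "u \<in> L2"
  shows "l2_of u \<in> mul_dom W \<longleftrightarrow> (\<lambda>t. W t * u t) \<in> L2"
    and "l2_of u \<in> mul_dom W \<Longrightarrow> mulop W (l2_of u) = l2_of (\<lambda>t. W t * u t)"
proof -
  have ae: "AE t in lebesgue. W t * rep (l2_of u) t = W t * u t" using rep_l2_of[OF assms] by eventually_elim simp
  then have ae': "AE t in lebesgue. W t * u t = W t * rep (l2_of u) t" by eventually_elim (rule sym)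
  show 1: "l2_of u \<in> mul_dom W \<longleftrightarrow> (\<lambda>t. W t * u t) \<in> L2"
    using L2_cong_AE'[OF _ ae] L2_cong_AE'[OF _ ae'] by (auto simp: mul_dom_def)
  show "mulop W (l2_of u) = l2_of (\<lambda>t. W t * u t)" if "l2_of u \<in> mul_dom W"
    using that 1 ae l2_of_eq_iff[of "\<lambda>t. W t * rep (l2_of u) t" "\<lambda>t. W t * u t"] by (auto simp: mul_dom_def mulop_def)
qed

lemma mulop_add:
  assumes "x \<in> mul_dom W" "y \<in> mul_dom W"
  shows "x + y \<in> mul_dom W" "mulop W (x + y) = mulop W x + mulop W y"
proof -
  have L: "(\<lambda>t. W t * rep x t) \<in> L2" "(\<lambda>t. W t * rep y t) \<in> L2" using assms by (auto simp: mul_dom_def)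
  have "x + y = l2_of (\<lambda>t. rep x t + rep y t)" by (simp add: l2_of_add)
  moreover have "(\<lambda>t. W t * (rep x t + rep y t)) \<in> L2" using L2_add[OF L] by (simp add: distrib_left)
  ultimately have xy: "x + y \<in> mul_dom W" "mulop W (x + y) = l2_of (\<lambda>t. W t * (rep x t + rep y t))"
    using mul_dom_iff[OF L2_add[OF rep_L2 rep_L2], of x y W] by simp_all
  show "x + y \<in> mul_dom W" by (rule xy)
  show "mulop W (x + y) = mulop W x + mulop W y"
    unfolding xy(2) using l2_of_add[OF L] by (simp add: distrib_left mulop_def)
qed

lemma mulop_scale:
  assumes "x \<in> mul_dom W"
  shows "c *\<^sub>R x \<in> mul_dom W" "mulop W (c *\<^sub>R x) = c *\<^sub>R mulop W x"
proof -
  have L: "(\<lambda>t. W t * rep x t) \<in> L2" using assms by (auto simp: mul_dom_def)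
  have "c *\<^sub>R x = l2_of (\<lambda>t. c * rep x t)" by (simp add: l2_of_scale)
  moreover have "(\<lambda>t. W t * (c * rep x t)) \<in> L2" using L2_scale[OF L, of c] by (simp add: mult.left_commute)
  ultimately have xy: "c *\<^sub>R x \<in> mul_dom W" "mulop W (c *\<^sub>R x) = l2_of (\<lambda>t. W t * (c * rep x t))"
    using mul_dom_iff[OF L2_scale[OF rep_L2], of c x W] by simp_all
  show "c *\<^sub>R x \<in> mul_dom W" by (rule xy)
  show "mulop W (c *\<^sub>R x) = c *\<^sub>R mulop W x"
    unfolding xy(2) using l2_of_scale[OF L, of c] by (simp add: mult.left_commute mulop_def)
qed

lemma mulop_diff:
  assumes "x \<in> mul_dom W" "y \<in> mul_dom W"
  shows "x - y \<in> mul_dom W" "mulop W (x - y) = mulop W x - mulop W y"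
  using mulop_add[OF assms(1) mulop_scale(1)[OF assms(2), of "-1"]] mulop_scale(2)[OF assms(2), of "-1"] by simp_all

lemma mulop_le:
  assumes [measurable]: "W \<in> borel_measurable lebesgue" and "x \<in> mul_dom W'" "AE t in lebesgue. \<bar>W t\<bar> \<le> \<bar>W' t\<bar>"
  shows "x \<in> mul_dom W" "norm (mulop W x) \<le> norm (mulop W' x)"
proof -
  have ae: "AE t in lebesgue. \<bar>W t * rep x t\<bar> \<le> \<bar>W' t * rep x t\<bar>"
    using assms(3) by eventually_elim (simp add: abs_mult mult_right_mono)
  have L: "(\<lambda>t. W' t * rep x t) \<in> L2" using assms(2) by (simp add: mul_dom_def)
  have L': "(\<lambda>t. W t * rep x t) \<in> L2" by (rule L2_bound[OF L _ ae]) measurable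
  then show "x \<in> mul_dom W" by (simp add: mul_dom_def)
  show "norm (mulop W x) \<le> norm (mulop W' x)" unfolding mulop_def by (rule l2_of_norm_mono[OF L L' ae])
qed

lemma mulop_sum_le:
  assumes [measurable]: "W \<in> borel_measurable lebesgue" and x: "x \<in> mul_dom W'" and b: "B \<ge> 0"
    and le: "AE t in lebesgue. \<bar>W t\<bar> \<le> \<bar>W' t\<bar> + B"
  shows "x \<in> mul_dom W" "norm (mulop W x) \<le> norm (mulop W' x) + B * norm x"
proof -
  have L1: "(\<lambda>t. \<bar>W' t * rep x t\<bar>) \<in> L2" using x by (intro L2_abs) (simp add: mul_dom_def)
  have L2: "(\<lambda>t. B * \<bar>rep x t\<bar>) \<in> L2" by (intro L2_scale L2_abs rep_L2)
  have ae: "AE t in lebesgue. \<bar>W t * rep x t\<bar> \<le> \<bar>\<bar>W' t * rep x t\<bar> + B * \<bar>rep x t\<bar>\<bar>"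
    using le
  proof eventually_elim
    case (elim t)
    have "\<bar>W t * rep x t\<bar> \<le> (\<bar>W' t\<bar> + B) * \<bar>rep x t\<bar>" unfolding abs_mult using elim by (intro mult_right_mono) auto
    also have "\<dots> = \<bar>W' t * rep x t\<bar> + B * \<bar>rep x t\<bar>" by (simp add: abs_mult distrib_right)
    also note abs_ge_self
    finally show ?case .
  qed
  have L': "(\<lambda>t. W t * rep x t) \<in> L2" by (rule L2_bound[OF L2_add[OF L1 L2] _ ae]) measurable
  then show "x \<in> mul_dom W" by (simp add: mul_dom_def)
  have "norm (mulop W x) \<le> norm (l2_of (\<lambda>t. \<bar>W' t * rep x t\<bar> + B * \<bar>rep x t\<bar>))"
    unfolding mulop_def by (rule l2_of_norm_mono[OF L2_add[OF L1 L2] L' ae])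
  also have "\<dots> \<le> norm (l2_of (\<lambda>t. \<bar>W' t * rep x t\<bar>)) + norm (l2_of (\<lambda>t. B * \<bar>rep x t\<bar>))"
    unfolding l2_of_add[OF L1 L2] by (rule norm_triangle_ineq)
  also have "norm (l2_of (\<lambda>t. \<bar>W' t * rep x t\<bar>)) \<le> norm (mulop W' x)"
    unfolding mulop_def using x L1 by (intro l2_of_norm_mono) (auto simp: mul_dom_def)
  also have "norm (l2_of (\<lambda>t. B * \<bar>rep x t\<bar>)) \<le> norm (l2_of (\<lambda>t. B * rep x t))"
    by (rule l2_of_norm_mono[OF L2_scale[OF rep_L2] L2]) (simp add: abs_mult)
  also have "\<dots> = B * norm x" using b by (simp add: l2_of_scale)
  finally show "norm (mulop W x) \<le> norm (mulop W' x) + B * norm x" by simp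
qed

lemma inner_mulop:
  assumes "x \<in> mul_dom W" "y \<in> mul_dom W'"
  shows "integrable lebesgue (\<lambda>t. (W t * W' t) * rep x t * rep y t)"
    "mulop W x \<bullet> mulop W' y = (LINT t|lebesgue. (W t * W' t) * rep x t * rep y t)"
proof -
  have L: "(\<lambda>t. W t * rep x t) \<in> L2" "(\<lambda>t. W' t * rep y t) \<in> L2" using assms by (auto simp: mul_dom_def)
  have eq: "(W t * rep x t) * (W' t * rep y t) = (W t * W' t) * rep x t * rep y t" for t by (simp add: mult_ac)
  show "integrable lebesgue (\<lambda>t. (W t * W' t) * rep x t * rep y t)"
    using L2_integrable_mult[OF L] unfolding eq .
  show "mulop W x \<bullet> mulop W' y = (LINT t|lebesgue. (W t * W' t) * rep x t * rep y t)"
    unfolding mulop_def inner_l2_of[OF L] eq ..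
qed

lemma small_scale:
  fixes A \<theta> \<delta> :: real
  assumes "\<theta> > 0" "\<delta> > 0" "A \<ge> 0"
  obtains h where "0 < h" "h \<le> 1" "A * h powr \<theta> \<le> \<delta>"
proof -
  define h where "h = min 1 ((\<delta> / (A + 1)) powr (1 / \<theta>))"
  have h: "0 < h" "h \<le> 1" using assms by (auto simp: h_def)
  have "h powr \<theta> \<le> ((\<delta> / (A + 1)) powr (1 / \<theta>)) powr \<theta>" using h assms by (intro powr_mono2) (auto simp: h_def)
  also have "\<dots> = \<delta> / (A + 1)" using assms by (simp add: powr_powr)
  finally have "A * h powr \<theta> \<le> A * (\<delta> / (A + 1))" using assms by (intro mult_left_mono) auto
  also have "\<dots> \<le> \<delta>" using assms by (simp add: field_simps)
  finally show ?thesis using that h by blast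
qed

text \<open>The form involves only sqrt |W|, which lies in L^(2p). One derivative gives an averaging
  error of order h, so the telescoping runs with s = 1 and converges for 2p > N.\<close>

lemma Lp_form_estimate:
  fixes W :: "real ^ 'n \<Rightarrow> real"
  assumes W[measurable]: "W \<in> borel_measurable lebesgue" and Wp: "integrable lebesgue (\<lambda>t. \<bar>W t\<bar> powr p)"
    and p: "p \<ge> 1" "2 * p > real CARD('n)"
    and \<Lambda>: "(LINT t|lebesgue. \<bar>W t\<bar> powr p) \<le> \<Lambda>" "\<Lambda> > 0"
    and x: "x \<in> dom1" and h: "0 < h" "h \<le> 1"
  shows "x \<in> mul_dom (\<lambda>t. sqrt \<bar>W t\<bar>)"
    "norm (mulop (\<lambda>t. sqrt \<bar>W t\<bar>) x) \<le> mconst CARD('n) (2 * p) 1 * \<Lambda> powr (1 / (2 * p)) * h powr (- real CARD('n) / (2 * p)) *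
        (norm x + h * (\<Sum>i\<in>UNIV. norm (pd i x)))"
proof -
  have eq: "\<bar>sqrt \<bar>W t\<bar>\<bar> powr (2 * p) = \<bar>W t\<bar> powr p" for t
    by (simp add: powr_half_sqrt[symmetric] powr_powr)
  have m: "(\<lambda>t. sqrt \<bar>W t\<bar>) \<in> borel_measurable lebesgue" by measurable
  have err: "norm (avg h x - x) \<le> (\<Sum>i\<in>UNIV. norm (pd i x)) * h powr 1" if "0 < h" "h \<le> 1" for h
    using avg_error_1[OF that(1) x] that by (simp add: mult.commute)
  note est = mult_estimate[where W = "\<lambda>t. sqrt \<bar>W t\<bar>" and p = "2 * p" and s = 1 and u = x and h = h
      and \<Lambda> = \<Lambda> and K = "\<Sum>i\<in>UNIV. norm (pd i x)", unfolded eq, OF m Wp _ \<Lambda> _ err h]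
  show "x \<in> mul_dom (\<lambda>t. sqrt \<bar>W t\<bar>)" using est(1) p by (simp add: mul_dom_def)
  show "norm (mulop (\<lambda>t. sqrt \<bar>W t\<bar>) x) \<le> mconst CARD('n) (2 * p) 1 * \<Lambda> powr (1 / (2 * p)) * h powr (- real CARD('n) / (2 * p)) *
        (norm x + h * (\<Sum>i\<in>UNIV. norm (pd i x)))"
    using est(2) p h by (simp add: mulop_def)
qed

text \<open>Two derivatives give an averaging error of order h^2, so s = 2 is available and W itself
  is controlled under the same condition 2p > N.\<close>

lemma Lp_operator_estimate:
  fixes W :: "real ^ 'n \<Rightarrow> real"
  assumes W[measurable]: "W \<in> borel_measurable lebesgue" and Wp: "integrable lebesgue (\<lambda>t. \<bar>W t\<bar> powr p)"
    and p: "p \<ge> 2" "2 * p > real CARD('n)"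
    and \<Lambda>: "(LINT t|lebesgue. \<bar>W t\<bar> powr p) \<le> \<Lambda>" "\<Lambda> > 0"
    and x: "x \<in> dom2" and h: "0 < h" "h \<le> 1"
  shows "x \<in> mul_dom W"
    "norm (mulop W x) \<le> mconst CARD('n) p 2 * \<Lambda> powr (1 / p) * h powr (- real CARD('n) / p) *
        (norm x + h\<^sup>2 * (\<Sum>i\<in>UNIV. \<Sum>j\<in>UNIV. norm (pd j (pd i x))))"
proof -
  have err: "norm (avg h x - x) \<le> (\<Sum>i\<in>UNIV. \<Sum>j\<in>UNIV. norm (pd j (pd i x))) * h powr 2" if "0 < h" "h \<le> 1" for h
    using avg_error_2[OF that(1) x] that by (simp add: mult.commute)
  note est = mult_estimate[where p = p and s = 2 and u = x and h = h and K = "\<Sum>i\<in>UNIV. \<Sum>j\<in>UNIV. norm (pd j (pd i x))",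
      OF W Wp p(1) \<Lambda> _ err h]
  show "x \<in> mul_dom W" using est(1) p by (simp add: mul_dom_def)
  show "norm (mulop W x) \<le> mconst CARD('n) p 2 * \<Lambda> powr (1 / p) * h powr (- real CARD('n) / p) *
        (norm x + h\<^sup>2 * (\<Sum>i\<in>UNIV. \<Sum>j\<in>UNIV. norm (pd j (pd i x))))"
    using est(2) p h by (simp add: mulop_def)
qed

text \<open>The three dimension cases of the Kato-Rellich condition all give p >= 2 and 2p > N, and
  the estimates are phrased through these two inequalities.\<close>

locale kr_potential =
  fixes V V1 V2 :: "real ^ 'n \<Rightarrow> real" and p C2 :: real
  assumes p2: "p \<ge> 2" and pN: "2 * p > real CARD('n)"
    and V1_measurable [measurable]: "V1 \<in> borel_measurable lebesgue"
    and V1_integrable: "integrable lebesgue (\<lambda>t. \<bar>V1 t\<bar> powr p)"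
    and V2_measurable [measurable]: "V2 \<in> borel_measurable lebesgue"
    and V2_bounded: "AE t in lebesgue. \<bar>V2 t\<bar> \<le> C2"
    and V_eq: "V = (\<lambda>t. V1 t + V2 t)" and C2: "C2 \<ge> 0"
begin

lemma V_measurable [measurable]: "V \<in> borel_measurable lebesgue"
  unfolding V_eq by measurable

text \<open>The summand 1 keeps the constant positive when \<open>V1\<close> vanishes; powers and
  quotients of it occur later.\<close>

definition "\<Lambda> = (LINT t|lebesgue. \<bar>V1 t\<bar> powr p) + 1"

lemma \<Lambda>: "(LINT t|lebesgue. \<bar>V1 t\<bar> powr p) \<le> \<Lambda>" "\<Lambda> > 0"
proof -
  have "(LINT t|lebesgue. \<bar>V1 t\<bar> powr p) \<ge> 0" by (intro Bochner_Integration.integral_nonneg) auto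
  then show "(LINT t|lebesgue. \<bar>V1 t\<bar> powr p) \<le> \<Lambda>" "\<Lambda> > 0" by (simp_all add: \<Lambda>_def add_nonneg_pos)
qed

lemma sqrt_V_le: "AE t in lebesgue. \<bar>sqrt \<bar>V t\<bar>\<bar> \<le> \<bar>sqrt \<bar>V1 t\<bar>\<bar> + sqrt C2"
  using V2_bounded
proof eventually_elim
  case (elim t)
  have "sqrt \<bar>V t\<bar> \<le> sqrt (\<bar>V1 t\<bar> + C2)" using elim by (intro real_sqrt_le_mono) (auto simp: V_eq)
  also have "\<dots> \<le> sqrt \<bar>V1 t\<bar> + sqrt C2" using C2 by (intro sqrt_add_le_add_sqrt) auto
  finally show ?case by simp
qed

lemma V_sqrt_dom: "x \<in> dom1 \<Longrightarrow> x \<in> mul_dom (\<lambda>t. sqrt \<bar>V t\<bar>)"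
  using Lp_form_estimate(1)[OF V1_measurable V1_integrable _ pN \<Lambda>, of x 1] p2 C2
  by (intro mulop_sum_le(1)[OF _ _ _ sqrt_V_le]) auto

text \<open>Infinitesimal form boundedness: the gradient term carries h^(1 - N/(2p)), small for
  small h, and the cost is moved to the L2 norm.\<close>

lemma form_bound:
  assumes "\<epsilon> > 0"
  obtains C where "C \<ge> 0" "\<And>x. x \<in> dom1 \<Longrightarrow> (norm (mulop (\<lambda>t. sqrt \<bar>V t\<bar>) x))\<^sup>2 \<le> \<epsilon> * gf x x + C * (norm x)\<^sup>2"
proof -
  define N where "N = real CARD('n)"
  have N: "N > 0" by (simp add: N_def)
  define A where "A = mconst N (2 * p) 1 * \<Lambda> powr (1 / (2 * p))"
  have A: "A \<ge> 0" using mconst_pos[of "2 * p" N 1] p2 pN by (simp add: A_def N_def less_imp_le)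
  \<comment> \<open>The 2 comes from (a + b)^2 <= 2 a^2 + 2 b^2, and N from comparing the squared
    sum of the partial derivatives with the sum of their squares.\<close>
  define \<delta> where "\<delta> = sqrt (\<epsilon> / (2 * N))"
  have \<delta>: "\<delta> > 0" "\<delta>\<^sup>2 = \<epsilon> / (2 * N)" using assms N by (auto simp: \<delta>_def)
  have \<theta>: "1 - N / (2 * p) > 0" using pN p2 by (simp add: N_def field_simps)
  obtain h where h: "0 < h" "h \<le> 1" "A * h powr (1 - N / (2 * p)) \<le> \<delta>" using small_scale[OF \<theta> \<delta>(1) A] by blast
  define B where "B = A * h powr (- N / (2 * p)) + sqrt C2"
  have B: "B \<ge> 0" using A C2 by (simp add: B_def)
  show ?thesis
  proof (rule that[of "2 * B\<^sup>2"])
    fix x :: "'n l2" assume x: "x \<in> dom1"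
    define K where "K = (\<Sum>i\<in>UNIV. norm (pd i x))"
    have K: "K \<ge> 0" by (simp add: K_def sum_nonneg)
    have e1: "norm (mulop (\<lambda>t. sqrt \<bar>V1 t\<bar>) x) \<le> A * h powr (- N / (2 * p)) * (norm x + h * K)"
      using Lp_form_estimate(2)[OF V1_measurable V1_integrable _ pN \<Lambda> x h(1,2)] p2 by (simp add: A_def N_def K_def)
    have "h powr (- N / (2 * p)) * h = h powr (1 - N / (2 * p))"
      using h powr_add[of h "- N / (2 * p)" 1] by (simp add: add.commute)
    then have "A * h powr (- N / (2 * p)) * (norm x + h * K) = A * h powr (- N / (2 * p)) * norm x + A * h powr (1 - N / (2 * p)) * K"
      by (simp add: distrib_left flip: mult.assoc)
    also have "\<dots> \<le> A * h powr (- N / (2 * p)) * norm x + \<delta> * K" using h(3) K by (intro add_left_mono mult_right_mono) auto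
    finally have e2: "norm (mulop (\<lambda>t. sqrt \<bar>V1 t\<bar>) x) \<le> A * h powr (- N / (2 * p)) * norm x + \<delta> * K" using e1 by linarith
    have "norm (mulop (\<lambda>t. sqrt \<bar>V t\<bar>) x) \<le> norm (mulop (\<lambda>t. sqrt \<bar>V1 t\<bar>) x) + sqrt C2 * norm x"
      using Lp_form_estimate(1)[OF V1_measurable V1_integrable _ pN \<Lambda> x h(1,2)] p2 C2
      by (intro mulop_sum_le(2)[OF _ _ _ sqrt_V_le]) auto
    with e2 have "norm (mulop (\<lambda>t. sqrt \<bar>V t\<bar>) x) \<le> B * norm x + \<delta> * K" by (simp add: B_def distrib_right)
    then have "(norm (mulop (\<lambda>t. sqrt \<bar>V t\<bar>) x))\<^sup>2 \<le> (B * norm x + \<delta> * K)\<^sup>2" by (rule power_mono) simp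
    also have "\<dots> \<le> 2 * (B * norm x)\<^sup>2 + 2 * (\<delta> * K)\<^sup>2"
      using sum_squares_bound[of "B * norm x" "\<delta> * K"] unfolding power2_sum by linarith
    also have "2 * (\<delta> * K)\<^sup>2 \<le> \<epsilon> * gf x x"
    proof -
      have "\<delta>\<^sup>2 * K\<^sup>2 \<le> \<delta>\<^sup>2 * (N * gf x x)" using sum_norm_pd_sq[of x] by (intro mult_left_mono) (auto simp: K_def N_def)
      also have "\<dots> = \<epsilon> / 2 * gf x x" using N by (simp add: \<delta>(2))
      finally show ?thesis by (simp add: power_mult_distrib)
    qed
    finally show "(norm (mulop (\<lambda>t. sqrt \<bar>V t\<bar>) x))\<^sup>2 \<le> \<epsilon> * gf x x + 2 * B\<^sup>2 * (norm x)\<^sup>2" by (simp add: power_mult_distrib)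
  qed simp
qed

lemma V_dom2: "x \<in> dom2 \<Longrightarrow> x \<in> mul_dom V"
  using Lp_operator_estimate(1)[OF V1_measurable V1_integrable p2 pN \<Lambda>, of x 1] C2 V2_bounded
  by (intro mulop_sum_le(1)[of V x V1 C2]) (auto simp: V_eq elim!: eventually_mono)

text \<open>Relative bound zero, the heart of Kato-Rellich: the second derivatives carry h^(2 -
  N/p), which is small for small h.\<close>

lemma operator_bound:
  assumes "\<epsilon> > 0"
  obtains C where "C \<ge> 0" "\<And>x. x \<in> dom2 \<Longrightarrow> norm (mulop V x) \<le> \<epsilon> * (\<Sum>i\<in>UNIV. \<Sum>j\<in>UNIV. norm (pd j (pd i x))) + C * norm x"
proof -
  define N where "N = real CARD('n)"
  define A where "A = mconst N p 2 * \<Lambda> powr (1 / p)"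
  have A: "A \<ge> 0" using mconst_pos[of p N 2] p2 pN by (simp add: A_def N_def less_imp_le)
  have \<theta>: "2 - N / p > 0" using pN p2 by (simp add: N_def field_simps)
  obtain h where h: "0 < h" "h \<le> 1" "A * h powr (2 - N / p) \<le> \<epsilon>" using small_scale[OF \<theta> assms A] by blast
  define B where "B = A * h powr (- N / p) + C2"
  show ?thesis
  proof (rule that[of B])
    show "B \<ge> 0" using A C2 by (simp add: B_def)
    fix x :: "'n l2" assume x: "x \<in> dom2"
    define K where "K = (\<Sum>i\<in>UNIV. \<Sum>j\<in>UNIV. norm (pd j (pd i x)))"
    have K: "K \<ge> 0" by (simp add: K_def sum_nonneg)
    have e1: "norm (mulop V1 x) \<le> A * h powr (- N / p) * (norm x + h\<^sup>2 * K)"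
      using Lp_operator_estimate(2)[OF V1_measurable V1_integrable p2 pN \<Lambda> x h(1,2)] by (simp add: A_def N_def K_def)
    have "h powr (- N / p) * h\<^sup>2 = h powr (2 - N / p)"
      using h powr_add[of h "- N / p" 2] by (simp add: add.commute)
    then have "A * h powr (- N / p) * (norm x + h\<^sup>2 * K) = A * h powr (- N / p) * norm x + A * h powr (2 - N / p) * K"
      by (simp add: distrib_left flip: mult.assoc)
    also have "\<dots> \<le> A * h powr (- N / p) * norm x + \<epsilon> * K" using h(3) K by (intro add_left_mono mult_right_mono) auto
    finally have e2: "norm (mulop V1 x) \<le> A * h powr (- N / p) * norm x + \<epsilon> * K" using e1 by linarith
    have "norm (mulop V x) \<le> norm (mulop V1 x) + C2 * norm x"
      using Lp_operator_estimate(1)[OF V1_measurable V1_integrable p2 pN \<Lambda> x h(1,2)] C2 V2_bounded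
      by (intro mulop_sum_le(2)[of V x V1 C2]) (auto simp: V_eq elim!: eventually_mono)
    with e2 show "norm (mulop V x) \<le> \<epsilon> * (\<Sum>i\<in>UNIV. \<Sum>j\<in>UNIV. norm (pd j (pd i x))) + B * norm x"
      by (simp add: B_def K_def distrib_right)
  qed
qed

definition vf :: "'n l2 \<Rightarrow> 'n l2 \<Rightarrow> real" where "vf x y = (LINT t|lebesgue. V t * rep x t * rep y t)"
definition sV :: "'n l2 \<Rightarrow> 'n l2" where "sV = mulop (\<lambda>t. sqrt \<bar>V t\<bar>)"
text \<open>For x in \<open>dom1\<close> the square integrable quantity is sqrt |V| x. Putting the
  sign of V into one of the two factors writes the form as an inner product.\<close>

definition gV :: "'n l2 \<Rightarrow> 'n l2" where "gV = mulop (\<lambda>t. sgn (V t) * sqrt \<bar>V t\<bar>)"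

lemma gV_dom:
  assumes "x \<in> dom1"
  shows "x \<in> mul_dom (\<lambda>t. sgn (V t) * sqrt \<bar>V t\<bar>)" "norm (gV x) \<le> norm (sV x)"
  unfolding gV_def sV_def
  by (rule mulop_le[OF _ V_sqrt_dom[OF assms]]; auto simp: abs_mult sgn_if)+

lemma vf:
  assumes "x \<in> dom1" "y \<in> dom1"
  shows "integrable lebesgue (\<lambda>t. V t * rep x t * rep y t)" "vf x y = sV x \<bullet> gV y"
proof -
  have eq: "sqrt \<bar>V t\<bar> * (sgn (V t) * sqrt \<bar>V t\<bar>) = V t" for t
  proof -
    have "sqrt \<bar>V t\<bar> * (sgn (V t) * sqrt \<bar>V t\<bar>) = sgn (V t) * (sqrt \<bar>V t\<bar> * sqrt \<bar>V t\<bar>)" by (simp only: mult_ac)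
    also have "\<dots> = V t" by (simp add: sgn_mult_abs)
    finally show ?thesis .
  qed
  note i = inner_mulop[OF V_sqrt_dom[OF assms(1)] gV_dom(1)[OF assms(2)], unfolded eq]
  show "integrable lebesgue (\<lambda>t. V t * rep x t * rep y t)" by (rule i(1))
  show "vf x y = sV x \<bullet> gV y" unfolding vf_def sV_def gV_def by (rule i(2)[symmetric])
qed

lemma vf_commute: "vf x y = vf y x"
  unfolding vf_def by (simp only: mult.assoc mult.commute[of "rep x _"])

lemma sV_add: "x \<in> dom1 \<Longrightarrow> y \<in> dom1 \<Longrightarrow> sV (x + y) = sV x + sV y"
  unfolding sV_def by (intro mulop_add V_sqrt_dom)
lemma sV_diff: "x \<in> dom1 \<Longrightarrow> y \<in> dom1 \<Longrightarrow> sV (x - y) = sV x - sV y"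
  unfolding sV_def by (intro mulop_diff V_sqrt_dom)
lemma sV_scale: "x \<in> dom1 \<Longrightarrow> sV (c *\<^sub>R x) = c *\<^sub>R sV x"
  unfolding sV_def by (intro mulop_scale V_sqrt_dom)

lemma vf_add: "x \<in> dom1 \<Longrightarrow> y \<in> dom1 \<Longrightarrow> z \<in> dom1 \<Longrightarrow> vf (x + y) z = vf x z + vf y z"
  by (simp add: vf dom1_add sV_add inner_add_left)
lemma vf_diff: "x \<in> dom1 \<Longrightarrow> y \<in> dom1 \<Longrightarrow> z \<in> dom1 \<Longrightarrow> vf (x - y) z = vf x z - vf y z"
  by (simp add: vf dom1_diff sV_diff inner_diff_left)
lemma vf_scale: "x \<in> dom1 \<Longrightarrow> z \<in> dom1 \<Longrightarrow> vf (c *\<^sub>R x) z = c * vf x z"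
  by (simp add: vf dom1_scale sV_scale)

lemma vf_bound: "x \<in> dom1 \<Longrightarrow> y \<in> dom1 \<Longrightarrow> \<bar>vf x y\<bar> \<le> norm (sV x) * norm (sV y)"
  using Cauchy_Schwarz_ineq2[of "sV x" "gV y"] gV_dom(2)[of y] mult_left_mono[of "norm (gV y)" "norm (sV y)" "norm (sV x)"]
  by (simp add: vf)

definition qf :: "'n l2 \<Rightarrow> 'n l2 \<Rightarrow> real" where "qf x y = gf x y + vf x y"

lemma qf_commute: "qf x y = qf y x"
  unfolding qf_def gf_commute[of x y] vf_commute[of x y] ..
lemma qf_add: "x \<in> dom1 \<Longrightarrow> y \<in> dom1 \<Longrightarrow> z \<in> dom1 \<Longrightarrow> qf (x + y) z = qf x z + qf y z"
  by (simp add: qf_def gf_add vf_add)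
lemma qf_diff: "x \<in> dom1 \<Longrightarrow> y \<in> dom1 \<Longrightarrow> z \<in> dom1 \<Longrightarrow> qf (x - y) z = qf x z - qf y z"
  by (simp add: qf_def gf_diff vf_diff)
lemma qf_scale: "x \<in> dom1 \<Longrightarrow> z \<in> dom1 \<Longrightarrow> qf (c *\<^sub>R x) z = c * qf x z"
  by (simp add: qf_def gf_scale vf_scale distrib_left)

lemma qf_lower:
  obtains C where "C \<ge> 0" "\<And>x. x \<in> dom1 \<Longrightarrow> gf x x / 2 - C * (norm x)\<^sup>2 \<le> qf x x"
proof -
  obtain C where C: "C \<ge> 0" "\<And>x. x \<in> dom1 \<Longrightarrow> (norm (sV x))\<^sup>2 \<le> 1/2 * gf x x + C * (norm x)\<^sup>2"
    using form_bound[of "1/2"] unfolding sV_def by auto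
  have "gf x x / 2 - C * (norm x)\<^sup>2 \<le> qf x x" if "x \<in> dom1" for x
    using C(2)[OF that] vf_bound[OF that that] unfolding qf_def power2_eq_square by linarith
  with C(1) show ?thesis by (rule that)
qed

definition opA :: "'n l2 \<Rightarrow> 'n l2" where "opA x = mulop V x - lap x"

lemma opA_diff: "x \<in> dom2 \<Longrightarrow> y \<in> dom2 \<Longrightarrow> opA (x - y) = opA x - opA y"
  unfolding opA_def by (simp add: mulop_diff V_dom2 lap_diff)
lemma opA_add: "x \<in> dom2 \<Longrightarrow> y \<in> dom2 \<Longrightarrow> opA (x + y) = opA x + opA y"
  unfolding opA_def by (simp add: mulop_add V_dom2 lap_add)
lemma opA_scale: "x \<in> dom2 \<Longrightarrow> opA (c *\<^sub>R x) = c *\<^sub>R opA x"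
  unfolding opA_def by (simp add: mulop_scale V_dom2 lap_scale scaleR_diff_right)

lemma opA_qf:
  assumes "x \<in> dom2" "y \<in> dom1"
  shows "opA x \<bullet> y = qf x y"
proof -
  have "(\<lambda>t. V t * rep x t) \<in> L2" using V_dom2[OF assms(1)] by (simp add: mul_dom_def)
  then have "mulop V x \<bullet> y = vf x y"
    unfolding mulop_def vf_def using inner_l2_of[of "\<lambda>t. V t * rep x t" "rep y"] by simp
  then show ?thesis by (simp add: opA_def inner_diff_left inner_lap_gf[OF assms] qf_def)
qed

end

section \<open>Resolvents and the spectrum\<close>

lemma quadratic_nonneg_discriminant:
  fixes a b c :: real
  assumes q: "\<And>t. 0 \<le> a - 2 * t * b + t\<^sup>2 * c" and "c \<ge> 0"
  shows "b\<^sup>2 \<le> a * c"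
proof (cases "c = 0")
  case True
  have "b = 0"
  proof (rule ccontr)
    assume "b \<noteq> 0"
    then show False using q[of "(a + 1) / (2 * b)"] True by simp
  qed
  then show ?thesis using True by simp
next
  case False
  then have c: "c > 0" using \<open>c \<ge> 0\<close> by simp
  have "0 \<le> a - 2 * (b / c) * b + (b / c)\<^sup>2 * c" by (rule q)
  also have "\<dots> = a - b\<^sup>2 / c" using c by (simp add: power2_eq_square field_simps)
  finally show ?thesis using c by (simp add: field_simps)
qed

context kr_potential
begin

text \<open>The first bound makes V (\<kappa> - Laplacian)^(-1) a contraction, for solvability in
  \<open>res_ex\<close>; the second makes the shifted form nonnegative and dominating half of the
  gradient, for Cauchy-Schwarz in \<open>Rres_duality\<close>.\<close>

definition lam_ok :: "real \<Rightarrow> bool" where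
  "lam_ok \<kappa> \<longleftrightarrow> \<kappa> > 0 \<and> (\<forall>f. norm (mulop V (Gres \<kappa> f)) \<le> norm f / 2) \<and>
    (\<forall>x\<in>dom1. gf x x / 2 \<le> qf x x + \<kappa> * (norm x)\<^sup>2)"

lemma lam_ok_large: obtains \<kappa>0 where "\<And>\<kappa>. \<kappa> \<ge> \<kappa>0 \<Longrightarrow> lam_ok \<kappa>"
proof -
  define N where "N = real CARD('n)"
  have N: "N > 0" by (simp add: N_def)
  obtain C where C: "C \<ge> 0" "\<And>x. x \<in> dom2 \<Longrightarrow> norm (mulop V x) \<le> 1 / (4 * N\<^sup>2) * (\<Sum>i\<in>UNIV. \<Sum>j\<in>UNIV. norm (pd j (pd i x))) + C * norm x"
    using operator_bound[of "1 / (4 * N\<^sup>2)"] N by auto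
  obtain C' where C': "C' \<ge> 0" "\<And>x. x \<in> dom1 \<Longrightarrow> gf x x / 2 - C' * (norm x)\<^sup>2 \<le> qf x x"
    using qf_lower by blast
  show ?thesis
  proof (rule that[of "max 1 (max (4 * C) C')"])
    fix \<kappa> assume k: "\<kappa> \<ge> max 1 (max (4 * C) C')"
    then have \<kappa>: "\<kappa> > 0" by simp
    have "norm (mulop V (Gres \<kappa> f)) \<le> norm f / 2" for f
    proof -
      have "(\<Sum>i\<in>UNIV. \<Sum>j\<in>UNIV. norm (pd j (pd i (Gres \<kappa> f)))) \<le> (\<Sum>i\<in>(UNIV::'n set). \<Sum>j\<in>(UNIV::'n set). norm f)"
        by (intro sum_mono Gres(2) \<kappa>)
      also have "\<dots> = N\<^sup>2 * norm f" by (simp add: N_def power2_eq_square)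
      finally have "1 / (4 * N\<^sup>2) * (\<Sum>i\<in>UNIV. \<Sum>j\<in>UNIV. norm (pd j (pd i (Gres \<kappa> f)))) \<le> 1 / (4 * N\<^sup>2) * (N\<^sup>2 * norm f)"
        by (intro mult_left_mono) auto
      also have "\<dots> = norm f / 4" using N by simp
      finally have 1: "1 / (4 * N\<^sup>2) * (\<Sum>i\<in>UNIV. \<Sum>j\<in>UNIV. norm (pd j (pd i (Gres \<kappa> f)))) \<le> norm f / 4" .
      have "4 * C * norm (Gres \<kappa> f) \<le> \<kappa> * norm (Gres \<kappa> f)" using k by (intro mult_right_mono) auto
      also have "\<dots> \<le> norm f" by (rule Gres(3)[OF \<kappa>])
      finally show ?thesis using 1 C(2)[OF Gres(1)[OF \<kappa>], of f] by linarith
    qed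
    moreover have "gf x x / 2 \<le> qf x x + \<kappa> * (norm x)\<^sup>2" if "x \<in> dom1" for x
    proof -
      have "C' * (norm x)\<^sup>2 \<le> \<kappa> * (norm x)\<^sup>2" using k by (intro mult_right_mono) auto
      then show ?thesis using C'(2)[OF that] by linarith
    qed
    ultimately show "lam_ok \<kappa>" using \<kappa> by (simp add: lam_ok_def)
  qed
qed

lemma res_bound:
  assumes \<kappa>: "lam_ok \<kappa>" and u: "u \<in> dom2"
  shows "\<kappa> * norm u \<le> 2 * norm (opA u + \<kappa> *\<^sub>R u)"
proof -
  have k: "\<kappa> > 0" using \<kappa> by (simp add: lam_ok_def)
  define f where "f = \<kappa> *\<^sub>R u - lap u"
  have uG: "Gres \<kappa> f = u" unfolding f_def by (rule Gres_eq[OF k u])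
  have "norm (mulop V (Gres \<kappa> f)) \<le> norm f / 2" using \<kappa> by (simp add: lam_ok_def)
  moreover have "norm f \<le> norm (opA u + \<kappa> *\<^sub>R u) + norm (mulop V u)"
    using norm_triangle_ineq4[of "opA u + \<kappa> *\<^sub>R u" "mulop V u"] by (simp add: f_def opA_def)
  moreover have "\<kappa> * norm (Gres \<kappa> f) \<le> norm f" by (rule Gres(3)[OF k])
  ultimately show ?thesis unfolding uG by linarith
qed

text \<open>Writing u = \<open>Gres \<kappa> f\<close> turns (A + \<kappa>) u = g into the fixed
  point equation f = g - V (Gres f), with contraction factor 1/2.\<close>

lemma res_ex:
  assumes \<kappa>: "lam_ok \<kappa>"
  shows "\<exists>u. u \<in> dom2 \<and> opA u + \<kappa> *\<^sub>R u = g"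
proof -
  have k: "\<kappa> > 0" using \<kappa> by (simp add: lam_ok_def)
  define F where "F f = g - mulop V (Gres \<kappa> f)" for f
  have "dist (F f) (F h) \<le> 1/2 * dist f h" for f h
  proof -
    have "F f - F h = - mulop V (Gres \<kappa> (f - h))"
      unfolding F_def Gres_diff[OF k] mulop_diff(2)[OF V_dom2[OF Gres(1)[OF k]] V_dom2[OF Gres(1)[OF k]]] by simp
    then have "norm (F f - F h) = norm (mulop V (Gres \<kappa> (f - h)))" by simp
    also have "\<dots> \<le> norm (f - h) / 2" using \<kappa> unfolding lam_ok_def by blast
    finally show ?thesis by (simp add: dist_norm)
  qed
  then obtain f where "F f = f" using banach_fix_type[of "1/2" F] by auto
  then have "f + mulop V (Gres \<kappa> f) = g" by (simp add: F_def algebra_simps)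
  then have "opA (Gres \<kappa> f) + \<kappa> *\<^sub>R Gres \<kappa> f = g"
    using Gres(4)[OF k, of f] by (simp add: opA_def algebra_simps)
  with Gres(1)[OF k] show ?thesis by blast
qed

definition Rres :: "real \<Rightarrow> 'n l2 \<Rightarrow> 'n l2" where
  "Rres \<kappa> g = (SOME u. u \<in> dom2 \<and> opA u + \<kappa> *\<^sub>R u = g)"

lemma Rres:
  assumes \<kappa>: "lam_ok \<kappa>"
  shows "Rres \<kappa> g \<in> dom2" "opA (Rres \<kappa> g) + \<kappa> *\<^sub>R Rres \<kappa> g = g"
proof -
  have "Rres \<kappa> g \<in> dom2 \<and> opA (Rres \<kappa> g) + \<kappa> *\<^sub>R Rres \<kappa> g = g"
    unfolding Rres_def by (rule someI_ex[OF res_ex[OF \<kappa>]])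
  then show "Rres \<kappa> g \<in> dom2" "opA (Rres \<kappa> g) + \<kappa> *\<^sub>R Rres \<kappa> g = g" by auto
qed

lemma Rres_eq:
  assumes \<kappa>: "lam_ok \<kappa>" and u: "u \<in> dom2" "opA u + \<kappa> *\<^sub>R u = g"
  shows "Rres \<kappa> g = u"
proof -
  have k: "\<kappa> > 0" using \<kappa> by (simp add: lam_ok_def)
  note R = Rres[OF \<kappa>, of g]
  have "opA (Rres \<kappa> g - u) + \<kappa> *\<^sub>R (Rres \<kappa> g - u) = 0"
    using R(2) u(2) by (simp add: opA_diff[OF R(1) u(1)] scaleR_diff_right algebra_simps)
  then have "\<kappa> * norm (Rres \<kappa> g - u) \<le> 0" using res_bound[OF \<kappa> dom2_diff[OF R(1) u(1)]] by simp
  then show ?thesis using k by (simp add: mult_le_0_iff)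
qed

lemma bounded_linear_Rres:
  assumes \<kappa>: "lam_ok \<kappa>"
  shows "bounded_linear (Rres \<kappa>)"
proof (rule bounded_linear_intro[of _ "2 / \<kappa>"])
  have k: "\<kappa> > 0" using \<kappa> by (simp add: lam_ok_def)
  note R = Rres[OF \<kappa>]
  show "Rres \<kappa> (f + g) = Rres \<kappa> f + Rres \<kappa> g" for f g
  proof (rule Rres_eq[OF \<kappa> dom2_add[OF R(1) R(1)]])
    have "opA (Rres \<kappa> f + Rres \<kappa> g) + \<kappa> *\<^sub>R (Rres \<kappa> f + Rres \<kappa> g)
        = (opA (Rres \<kappa> f) + \<kappa> *\<^sub>R Rres \<kappa> f) + (opA (Rres \<kappa> g) + \<kappa> *\<^sub>R Rres \<kappa> g)"
      by (simp add: opA_add[OF R(1) R(1)] scaleR_add_right)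
    then show "opA (Rres \<kappa> f + Rres \<kappa> g) + \<kappa> *\<^sub>R (Rres \<kappa> f + Rres \<kappa> g) = f + g" by (simp only: R(2))
  qed
  show "Rres \<kappa> (c *\<^sub>R f) = c *\<^sub>R Rres \<kappa> f" for c f
  proof (rule Rres_eq[OF \<kappa> dom2_scale[OF R(1)]])
    have "opA (c *\<^sub>R Rres \<kappa> f) + \<kappa> *\<^sub>R (c *\<^sub>R Rres \<kappa> f) = c *\<^sub>R (opA (Rres \<kappa> f) + \<kappa> *\<^sub>R Rres \<kappa> f)"
      by (simp add: opA_scale[OF R(1)] scaleR_add_right mult.commute)
    then show "opA (c *\<^sub>R Rres \<kappa> f) + \<kappa> *\<^sub>R (c *\<^sub>R Rres \<kappa> f) = c *\<^sub>R f" by (simp only: R(2))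
  qed
  show "norm (Rres \<kappa> f) \<le> norm f * (2 / \<kappa>)" for f
    using res_bound[OF \<kappa> R(1)[of f]] k unfolding R(2) by (simp add: pos_le_divide_eq mult.commute)
qed

lemma Rres_form:
  assumes \<kappa>: "lam_ok \<kappa>" and "\<phi> \<in> dom1"
  shows "qf (Rres \<kappa> f) \<phi> + \<kappa> * (Rres \<kappa> f \<bullet> \<phi>) = f \<bullet> \<phi>"
  using arg_cong[OF Rres(2)[OF \<kappa>, of f], of "\<lambda>z. z \<bullet> \<phi>"] opA_qf[OF Rres(1)[OF \<kappa>, of f] assms(2)]
  by (simp add: inner_add_left)

lemma Rres_symmetric:
  assumes \<kappa>: "lam_ok \<kappa>"
  shows "Rres \<kappa> f \<bullet> g = f \<bullet> Rres \<kappa> g"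
  using Rres_form[OF \<kappa> dom2_dom1(1)[OF Rres(1)[OF \<kappa>, of g]], of f]
    Rres_form[OF \<kappa> dom2_dom1(1)[OF Rres(1)[OF \<kappa>, of f]], of g]
    qf_commute[of "Rres \<kappa> f" "Rres \<kappa> g"] inner_commute[of "Rres \<kappa> f" "Rres \<kappa> g"] inner_commute[of g "Rres \<kappa> f"] by simp

text \<open>Cauchy-Schwarz for the nonnegative form of A + \<kappa> between w and R w: their mixed
  value is |w|^2 and the value at R w is <R w, w>. This carries upper bounds on the resolvent to
  lower bounds on the form.\<close>

lemma Rres_duality:
  assumes \<kappa>: "lam_ok \<kappa>" and w: "w \<in> dom1"
  shows "((norm w)\<^sup>2)\<^sup>2 \<le> (qf w w + \<kappa> * (norm w)\<^sup>2) * (Rres \<kappa> w \<bullet> w)"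
proof -
  let ?R = "Rres \<kappa> w"
  have R: "?R \<in> dom1" using Rres(1)[OF \<kappa>] dom2_dom1 by blast
  have nonneg: "0 \<le> qf x x + \<kappa> * (norm x)\<^sup>2" if "x \<in> dom1" for x
  proof -
    have "gf x x / 2 \<le> qf x x + \<kappa> * (norm x)\<^sup>2" using \<kappa> that by (simp add: lam_ok_def)
    then show ?thesis using gf_nonneg[of x] by linarith
  qed
  have 1: "qf ?R w + \<kappa> * (?R \<bullet> w) = (norm w)\<^sup>2" using Rres_form[OF \<kappa> w, of w] by (simp add: power2_norm_eq_inner)
  have 2: "qf ?R ?R + \<kappa> * (norm ?R)\<^sup>2 = ?R \<bullet> w"
    using Rres_form[OF \<kappa> R, of w] by (simp add: power2_norm_eq_inner inner_commute)
  have "((norm w)\<^sup>2)\<^sup>2 \<le> (qf w w + \<kappa> * (norm w)\<^sup>2) * (qf ?R ?R + \<kappa> * (norm ?R)\<^sup>2)"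
  proof (rule quadratic_nonneg_discriminant)
    fix t
    have tR: "t *\<^sub>R ?R \<in> dom1" "w - t *\<^sub>R ?R \<in> dom1" using R w by (auto intro: dom1_scale dom1_diff)
    have A: "qf (w - t *\<^sub>R ?R) (w - t *\<^sub>R ?R) = qf w w - 2 * t * qf ?R w + t\<^sup>2 * qf ?R ?R"
    proof -
      define z where "z = w - t *\<^sub>R ?R"
      have a: "qf z z = qf w z - t * qf ?R z"
        using qf_diff[OF w tR(1) tR(2)] qf_scale[OF R tR(2), of t] by (simp only: z_def)
      have b: "qf w z = qf w w - t * qf ?R w"
        using qf_diff[OF w tR(1) w] qf_scale[OF R w, of t] unfolding qf_commute[of w z] by (simp only: z_def)
      have c: "qf ?R z = qf ?R w - t * qf ?R ?R"
        using qf_diff[OF w tR(1) R] qf_scale[OF R R, of t] unfolding qf_commute[of ?R z] qf_commute[of ?R w] by (simp only: z_def)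
      show ?thesis unfolding z_def[symmetric] a b c by (simp add: algebra_simps power2_eq_square)
    qed
    have B: "(norm (w - t *\<^sub>R ?R))\<^sup>2 = (norm w)\<^sup>2 - 2 * t * (?R \<bullet> w) + t\<^sup>2 * (norm ?R)\<^sup>2"
      unfolding power2_norm_eq_inner
      by (simp add: inner_diff_left inner_diff_right inner_commute[of w ?R] power2_eq_square algebra_simps)
    have "qf (w - t *\<^sub>R ?R) (w - t *\<^sub>R ?R) + \<kappa> * (norm (w - t *\<^sub>R ?R))\<^sup>2
        = (qf w w + \<kappa> * (norm w)\<^sup>2) - 2 * t * (qf ?R w + \<kappa> * (?R \<bullet> w)) + t\<^sup>2 * (qf ?R ?R + \<kappa> * (norm ?R)\<^sup>2)"
      unfolding A B by (simp add: algebra_simps)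
    then show "0 \<le> (qf w w + \<kappa> * (norm w)\<^sup>2) - 2 * t * (norm w)\<^sup>2 + t\<^sup>2 * (qf ?R ?R + \<kappa> * (norm ?R)\<^sup>2)"
      using nonneg[OF tR(2)] by (simp only: 1)
  qed (rule nonneg[OF R])
  then show ?thesis by (simp only: 2)
qed

text \<open>For e = 0 this would be \<open>Rres_duality\<close> together with <R w, w> <= t |w|^2;
  an error e in the resolvent bound costs e / t^2 in the form bound.\<close>

lemma form_lower:
  assumes \<kappa>: "lam_ok \<kappa>" and w: "w \<in> dom1" and "t > 0" "e > 0"
    and b: "t * (norm w)\<^sup>2 - Rres \<kappa> w \<bullet> w \<ge> - e"
  shows "qf w w + \<kappa> * (norm w)\<^sup>2 \<ge> (norm w)\<^sup>2 / t - e / t\<^sup>2"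
proof -
  define x where "x = (norm w)\<^sup>2"
  define P where "P = qf w w + \<kappa> * x"
  have x: "x \<ge> 0" by (simp add: x_def)
  have "gf w w / 2 \<le> P" using \<kappa> w by (simp add: lam_ok_def P_def x_def)
  then have P: "P \<ge> 0" using gf_nonneg[of w] by linarith
  have "x\<^sup>2 \<le> P * (Rres \<kappa> w \<bullet> w)" using Rres_duality[OF \<kappa> w] by (simp add: x_def P_def)
  also have "\<dots> \<le> P * (t * x + e)" using b P by (intro mult_left_mono) (auto simp: x_def)
  finally have xP: "x\<^sup>2 \<le> P * (t * x + e)" .
  have pos: "t * x + e > 0" using assms(3,4) x by (simp add: add_nonneg_pos)
  \<comment> \<open>Multiplied by the positive number t x + e, the left side of the claim becomes a
    difference of squares.\<close>
  have "(x / t - e / t\<^sup>2) * (t * x + e) = x\<^sup>2 - (e / t)\<^sup>2"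
    using assms(3) by (simp add: power2_eq_square field_simps)
  also have "\<dots> \<le> P * (t * x + e)" using xP zero_le_power2[of "e / t"] by linarith
  finally have "x / t - e / t\<^sup>2 \<le> P" using pos by (simp add: mult_le_cancel_right)
  then show ?thesis by (simp add: x_def P_def)
qed

section \<open>Spectral sets of the Schroedinger operator read through its resolvent\<close>

lemma schroedinger_l2:
  assumes "u \<in> H2"
  shows "schroedinger V u \<in> L2" "l2_of (schroedinger V u) = opA (l2_of u)"
proof -
  have u: "u \<in> L2" "l2_of u \<in> dom2" using assms by (auto simp: H2_iff)
  note m = V_dom2[OF u(2)]
  have Vu: "(\<lambda>t. V t * u t) \<in> L2" "mulop V (l2_of u) = l2_of (\<lambda>t. V t * u t)"
    using mul_dom_iff[OF u(1), of V] m by simp_all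
  note lp = weak_laplacian_H2[OF assms]
  have eq: "schroedinger V u = (\<lambda>t. V t * u t - weak_laplacian u t)" by (simp add: schroedinger_def fun_eq_iff)
  show "schroedinger V u \<in> L2" unfolding eq by (rule L2_diff[OF Vu(1) lp(1)])
  show "l2_of (schroedinger V u) = opA (l2_of u)"
    unfolding eq l2_of_diff[OF Vu(1) lp(1)] opA_def Vu(2) lp(2) ..
qed

lemma schroedinger_shift:
  assumes "u \<in> H2"
  shows "(\<lambda>x. schroedinger V u x - \<mu> * u x) \<in> L2"
    "l2_of (\<lambda>x. schroedinger V u x - \<mu> * u x) = opA (l2_of u) - \<mu> *\<^sub>R l2_of u"
proof -
  have u: "u \<in> L2" using assms by (auto simp: H2_iff)
  note L = schroedinger_l2[OF assms]
  show "(\<lambda>x. schroedinger V u x - \<mu> * u x) \<in> L2" by (rule L2_diff[OF L(1) L2_scale[OF u]])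
  show "l2_of (\<lambda>x. schroedinger V u x - \<mu> * u x) = opA (l2_of u) - \<mu> *\<^sub>R l2_of u"
    unfolding l2_of_diff[OF L(1) L2_scale[OF u]] L(2) l2_of_scale[OF u] ..
qed

lemma rep_H2: "x \<in> dom2 \<Longrightarrow> rep x \<in> H2"
  by (simp add: H2_iff)

lemma resolvent_set_lower:
  assumes "\<mu> \<in> resolvent_set H2 (schroedinger V)"
  obtains C where "C \<ge> 0" "\<And>x. x \<in> dom2 \<Longrightarrow> norm x \<le> C * norm (opA x - \<mu> *\<^sub>R x)"
proof -
  obtain C where C: "\<And>u. u \<in> H2 \<Longrightarrow> L2norm u \<le> C * L2norm (\<lambda>x. schroedinger V u x - \<mu> * u x)"
    using assms by (auto simp: resolvent_set_def)
  show ?thesis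
  proof (rule that[of "\<bar>C\<bar>"])
    fix x :: "'n l2" assume x: "x \<in> dom2"
    have "norm x \<le> C * norm (opA x - \<mu> *\<^sub>R x)"
      using C[OF rep_H2[OF x]] norm_l2_of[OF rep_L2[of x]] norm_l2_of[OF schroedinger_shift(1)[OF rep_H2[OF x], of \<mu>]]
        schroedinger_shift(2)[OF rep_H2[OF x], of \<mu>] by simp
    also have "\<dots> \<le> \<bar>C\<bar> * norm (opA x - \<mu> *\<^sub>R x)" by (intro mult_right_mono) auto
    finally show "norm x \<le> \<bar>C\<bar> * norm (opA x - \<mu> *\<^sub>R x)" .
  qed simp
qed

lemma resolvent_setI:
  assumes \<kappa>: "lam_ok \<kappa>"
  shows "- \<kappa> \<in> resolvent_set H2 (schroedinger V)"
proof -
  have k: "\<kappa> > 0" using \<kappa> by (simp add: lam_ok_def)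
  have "\<exists>u\<in>H2. AE x in lebesgue. schroedinger V u x - - \<kappa> * u x = f x" if f: "f \<in> L2" for f
  proof (rule bexI)
    let ?u = "rep (Rres \<kappa> (l2_of f))"
    show u: "?u \<in> H2" by (rule rep_H2[OF Rres(1)[OF \<kappa>]])
    have "l2_of (\<lambda>x. schroedinger V ?u x - - \<kappa> * ?u x) = l2_of f"
      using schroedinger_shift(2)[OF u, of "- \<kappa>"] Rres(2)[OF \<kappa>, of "l2_of f"] by simp
    then show "AE x in lebesgue. schroedinger V ?u x - - \<kappa> * ?u x = f x"
      using l2_of_eq_iff[OF schroedinger_shift(1)[OF u, of "- \<kappa>"] f] by simp
  qed
  moreover have "L2norm u \<le> 2 / \<kappa> * L2norm (\<lambda>x. schroedinger V u x - - \<kappa> * u x)" if u: "u \<in> H2" for u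
  proof -
    have uL: "u \<in> L2" "l2_of u \<in> dom2" using u by (auto simp: H2_iff)
    have "\<kappa> * norm (l2_of u) \<le> 2 * norm (opA (l2_of u) + \<kappa> *\<^sub>R l2_of u)" by (rule res_bound[OF \<kappa> uL(2)])
    then have "norm (l2_of u) \<le> 2 / \<kappa> * norm (opA (l2_of u) + \<kappa> *\<^sub>R l2_of u)"
      using k by (simp add: pos_le_divide_eq mult.commute)
    then show ?thesis
      using norm_l2_of[OF uL(1)] norm_l2_of[OF schroedinger_shift(1)[OF u, of "- \<kappa>"]] schroedinger_shift(2)[OF u, of "- \<kappa>"] by simp
  qed
  ultimately show ?thesis unfolding resolvent_set_def by blast
qed

lemma bdd_below_spectrum: "bdd_below (spectrum H2 (schroedinger V))"
proof -
  obtain \<kappa>0 where \<kappa>0: "\<And>\<kappa>. \<kappa> \<ge> \<kappa>0 \<Longrightarrow> lam_ok \<kappa>" using lam_ok_large by blast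
  show ?thesis
  proof (rule bdd_belowI[of _ "- \<kappa>0"])
    fix \<mu> assume "\<mu> \<in> spectrum H2 (schroedinger V)"
    then have "\<mu> \<notin> resolvent_set H2 (schroedinger V)" by (simp add: spectrum_def)
    then show "- \<kappa>0 \<le> \<mu>" using resolvent_setI[OF \<kappa>0, of "- \<mu>"] by fastforce
  qed
qed

text \<open>The point t of the resolvent corresponds to \<mu> = 1/t - \<kappa> of the operator. As
  the resolvent is bounded and symmetric, boundedness below of t - R means that t is not in its
  spectrum.\<close>

definition reg :: "real \<Rightarrow> real \<Rightarrow> bool" where
  "reg \<kappa> t \<longleftrightarrow> (\<exists>c>0. \<forall>x. norm (t *\<^sub>R x - Rres \<kappa> x) \<ge> c * norm x)"

text \<open>For z = t y - R y one has (A - \<mu>) R y = z / t, so the resolvent bound at \<mu>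
  estimates R y by z, and then y by z and R y.\<close>

lemma reg_if_resolvent:
  assumes \<kappa>: "lam_ok \<kappa>" and t: "t > 0" and r: "1 / t - \<kappa> \<in> resolvent_set H2 (schroedinger V)"
  shows "reg \<kappa> t"
proof -
  obtain C where C: "C \<ge> 0" "\<And>x. x \<in> dom2 \<Longrightarrow> norm x \<le> C * norm (opA x - (1 / t - \<kappa>) *\<^sub>R x)"
    using resolvent_set_lower[OF r] by blast
  have "norm y \<le> (1 / t) * (1 + C / t) * norm (t *\<^sub>R y - Rres \<kappa> y)" for y
  proof -
    define z where "z = t *\<^sub>R y - Rres \<kappa> y"
    have "opA (Rres \<kappa> y) - (1 / t - \<kappa>) *\<^sub>R Rres \<kappa> y = (1 / t) *\<^sub>R z"
      using Rres(2)[OF \<kappa>, of y] t by (simp add: z_def scaleR_diff_right scaleR_diff_left algebra_simps)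
    then have "norm (Rres \<kappa> y) \<le> C / t * norm z" using C(2)[OF Rres(1)[OF \<kappa>, of y]] t by simp
    moreover have "t * norm y \<le> norm z + norm (Rres \<kappa> y)"
      using norm_triangle_ineq[of z "Rres \<kappa> y"] t by (simp add: z_def)
    ultimately have "t * norm y \<le> (1 + C / t) * norm z" by (simp add: distrib_right)
    then show ?thesis using t by (simp add: z_def pos_le_divide_eq mult.commute)
  qed
  note b = this
  define D where "D = (1 / t) * (1 + C / t)"
  have pos: "D > 0" using t C(1) by (simp add: D_def add_pos_nonneg)
  have "1 / D * norm y \<le> norm (t *\<^sub>R y - Rres \<kappa> y)" for y
    using b[of y, folded D_def] pos by (simp add: pos_divide_le_eq mult.commute)
  then show ?thesis unfolding reg_def using pos by (intro exI[of _ "1 / D"]) auto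
qed

lemma reg_step:
  assumes "reg \<kappa> t"
  shows "\<exists>c>0. \<forall>x. (norm (t *\<^sub>R x - Rres \<kappa> x))\<^sup>2 \<ge> c * (norm x)\<^sup>2"
proof -
  obtain c where c: "c > 0" "\<And>x. norm (t *\<^sub>R x - Rres \<kappa> x) \<ge> c * norm x" using assms by (auto simp: reg_def)
  have "c\<^sup>2 * (norm x)\<^sup>2 \<le> (norm (t *\<^sub>R x - Rres \<kappa> x))\<^sup>2" for x
    using power_mono[OF c(2)[of x], of 2] c(1) by (simp add: power_mult_distrib)
  then show ?thesis using c(1) by (intro exI[of _ "c\<^sup>2"]) auto
qed

text \<open>A spectral gap below \<mu>1 bounds the form below. The passage through the bounded
  resolvent uses \<open>symmetric_lower_bound_step\<close> with constant sequences.\<close>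

lemma form_lower_if_resolvent:
  assumes r: "\<And>\<mu>. \<mu> < \<mu>1 \<Longrightarrow> \<mu> \<in> resolvent_set H2 (schroedinger V)" and w: "w \<in> dom1"
  shows "qf w w \<ge> \<mu>1 * (norm w)\<^sup>2"
proof -
  obtain \<kappa>0 where \<kappa>0: "\<And>\<kappa>. \<kappa> \<ge> \<kappa>0 \<Longrightarrow> lam_ok \<kappa>" using lam_ok_large by blast
  define \<kappa> where "\<kappa> = max \<kappa>0 (\<bar>\<mu>1\<bar> + 1)"
  have \<kappa>: "lam_ok \<kappa>" by (rule \<kappa>0) (simp add: \<kappa>_def)
  have "\<kappa> \<ge> \<bar>\<mu>1\<bar> + 1" by (simp add: \<kappa>_def)
  then have pos: "\<kappa> + \<mu>1 > 0" by linarith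
  \<comment> \<open>The resolvent point of \<mu>1; larger T correspond to points 1/T - \<kappa>
    below \<mu>1.\<close>
  define t where "t = 1 / (\<kappa> + \<mu>1)"
  have t: "t > 0" using pos by (simp add: t_def)
  have le: "(norm w)\<^sup>2 / t - e / t\<^sup>2 \<le> qf w w + \<kappa> * (norm w)\<^sup>2" if "e > 0" for e
  proof (rule form_lower[OF \<kappa> w t that])
    have "eventually (\<lambda>n. t * (norm w)\<^sup>2 - Rres \<kappa> w \<bullet> w \<ge> - e) (sequentially :: nat filter)"
    proof (rule symmetric_lower_bound_step[where W = "{\<lambda>n. y | y. True}" and R = "Rres \<kappa>" and w = "\<lambda>n. w"])
      show "\<exists>c>0. \<forall>w\<in>{\<lambda>n. y | y. True}. \<forall>e>0. \<forall>\<^sub>F n in sequentially.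
           c * (norm (w n))\<^sup>2 - e \<le> (norm (T *\<^sub>R w n - Rres \<kappa> (w n)))\<^sup>2" if "T > t" for T
      proof -
        have "T > 0" using that t by simp
        have "1 / T < 1 / t" using that t by (intro divide_strict_left_mono) auto
        then have "1 / T - \<kappa> < \<mu>1" by (simp add: t_def)
        from reg_step[OF reg_if_resolvent[OF \<kappa> \<open>T > 0\<close> r[OF this]]]
        obtain c where c: "c > 0" "\<And>x. (norm (T *\<^sub>R x - Rres \<kappa> x))\<^sup>2 \<ge> c * (norm x)\<^sup>2" by blast
        have "c * (norm x)\<^sup>2 - e \<le> (norm (T *\<^sub>R x - Rres \<kappa> x))\<^sup>2" if "e > 0" for x e
          using c(2)[of x] that by linarith
        then show ?thesis using c(1) by (intro exI[of _ c]) auto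
      qed
      show "Bseq w" if "w \<in> {\<lambda>n. y | y. True}" for w :: "nat \<Rightarrow> 'n l2"
        using that by (auto intro: convergent_imp_Bseq convergent_const)
    qed (use that Rres_symmetric[OF \<kappa>] bounded_linear_Rres[OF \<kappa>] in auto)
    then show "t * (norm w)\<^sup>2 - Rres \<kappa> w \<bullet> w \<ge> - e" by simp
  qed
  have "(norm w)\<^sup>2 / t \<le> qf w w + \<kappa> * (norm w)\<^sup>2"
  proof (rule field_le_epsilon)
    fix e :: real assume "e > 0"
    then show "(norm w)\<^sup>2 / t \<le> qf w w + \<kappa> * (norm w)\<^sup>2 + e" using le[of "e * t\<^sup>2"] t by simp
  qed
  then show ?thesis using pos by (simp add: t_def distrib_right mult.commute)
qed

text \<open>The kernel of R - t is the eigenspace of A at 1/t - \<kappa>; a spanning family almost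
  everywhere becomes a finite spanning set of classes.\<close>

lemma discrete_kernel:
  assumes \<kappa>: "lam_ok \<kappa>" and t: "t > 0" and fin: "finite_dim_ae (eigenspace H2 (schroedinger V) (1 / t - \<kappa>))"
  obtains E where "finite E" "\<And>x. Rres \<kappa> x - t *\<^sub>R x = 0 \<longleftrightarrow> x \<in> span E"
proof -
  define \<mu> where "\<mu> = 1 / t - \<kappa>"
  obtain k :: nat and e where e: "\<And>j. j < k \<Longrightarrow> e j \<in> eigenspace H2 (schroedinger V) \<mu>"
    and sp: "\<And>u. u \<in> eigenspace H2 (schroedinger V) \<mu> \<Longrightarrow> \<exists>c :: nat \<Rightarrow> real. AE x in lebesgue. u x = (\<Sum>j<k. c j * e j x)"
    using fin unfolding finite_dim_ae_def \<mu>_def by blast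
  have eig: "u \<in> eigenspace H2 (schroedinger V) \<mu> \<longleftrightarrow> u \<in> H2 \<and> opA (l2_of u) = \<mu> *\<^sub>R l2_of u" for u
  proof (cases "u \<in> H2")
    case True
    then have "u \<in> L2" by (simp add: H2_iff)
    have "(AE x in lebesgue. schroedinger V u x = \<mu> * u x) \<longleftrightarrow> l2_of (schroedinger V u) = l2_of (\<lambda>x. \<mu> * u x)"
      by (rule l2_of_eq_iff[symmetric, OF schroedinger_l2(1)[OF True] L2_scale[OF \<open>u \<in> L2\<close>]])
    then show ?thesis using True by (simp add: eigenspace_def schroedinger_l2(2) l2_of_scale \<open>u \<in> L2\<close>)
  qed (simp add: eigenspace_def)
  have ker: "Rres \<kappa> x - t *\<^sub>R x = 0 \<longleftrightarrow> x \<in> dom2 \<and> opA x = \<mu> *\<^sub>R x" for x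
  proof
    assume "Rres \<kappa> x - t *\<^sub>R x = 0"
    then have R: "Rres \<kappa> x = t *\<^sub>R x" by simp
    then have x: "x = (1 / t) *\<^sub>R Rres \<kappa> x" using t by simp
    have d: "x \<in> dom2" by (subst x) (rule dom2_scale[OF Rres(1)[OF \<kappa>]])
    have "t *\<^sub>R (opA x + \<kappa> *\<^sub>R x) = x" using Rres(2)[OF \<kappa>, of x] unfolding R by (simp add: opA_scale[OF d] scaleR_add_right mult.commute)
    then have "(1 / t) *\<^sub>R t *\<^sub>R (opA x + \<kappa> *\<^sub>R x) = (1 / t) *\<^sub>R x" by (simp only:)
    then have "opA x + \<kappa> *\<^sub>R x = (1 / t) *\<^sub>R x" using t by simp
    then have "opA x = \<mu> *\<^sub>R x" by (simp add: \<mu>_def scaleR_diff_left eq_diff_eq)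
    with d show "x \<in> dom2 \<and> opA x = \<mu> *\<^sub>R x" by simp
  next
    assume x: "x \<in> dom2 \<and> opA x = \<mu> *\<^sub>R x"
    have "Rres \<kappa> x = t *\<^sub>R x"
      by (rule Rres_eq[OF \<kappa> dom2_scale]) (use x t in \<open>simp_all add: opA_scale \<mu>_def flip: scaleR_add_left\<close>, simp add: algebra_simps)
    then show "Rres \<kappa> x - t *\<^sub>R x = 0" by simp
  qed
  have subsp: "subspace {x. x \<in> dom2 \<and> opA x = \<mu> *\<^sub>R x}"
    unfolding subspace_def using dom2_scale[of 0 0] ker[of 0] linear_0[OF bounded_linear.linear[OF bounded_linear_Rres[OF \<kappa>]]]
    by (auto simp: dom2_add opA_add dom2_scale opA_scale scaleR_add_right mult.commute)
  define E where "E = (\<lambda>j. l2_of (e j)) ` {..<k}"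
  have "x \<in> span E" if "x \<in> dom2" "opA x = \<mu> *\<^sub>R x" for x
  proof -
    have "rep x \<in> eigenspace H2 (schroedinger V) \<mu>" using that by (simp add: eig rep_H2)
    from sp[OF this] obtain c :: "nat \<Rightarrow> real" where c: "AE s in lebesgue. rep x s = (\<Sum>j<k. c j * e j s)" by blast
    have eL: "e j \<in> L2" if "j < k" for j using e[OF that] by (auto simp: eigenspace_def H2_iff)
    have sL: "(\<lambda>s. \<Sum>j<k. c j * e j s) \<in> L2" by (intro L2_sum L2_scale eL) auto
    have "x = l2_of (\<lambda>s. \<Sum>j<k. c j * e j s)" using l2_of_eq_iff[OF rep_L2 sL, of x] c by simp
    also have "\<dots> = (\<Sum>j<k. c j *\<^sub>R l2_of (e j))" by (subst l2_of_sum) (auto intro!: L2_scale eL l2_of_scale sum.cong)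
    also have "\<dots> \<in> span E" by (intro span_sum span_scale span_base) (auto simp: E_def)
    finally show ?thesis .
  qed
  moreover have "span E \<subseteq> {x. x \<in> dom2 \<and> opA x = \<mu> *\<^sub>R x}"
  proof (rule span_minimal[OF _ subsp])
    show "E \<subseteq> {x. x \<in> dom2 \<and> opA x = \<mu> *\<^sub>R x}" using e by (auto simp: E_def eig H2_iff)
  qed
  ultimately have "Rres \<kappa> x - t *\<^sub>R x = 0 \<longleftrightarrow> x \<in> span E" for x unfolding ker by blast
  moreover have "finite E" by (simp add: E_def)
  ultimately show ?thesis using that by blast
qed

text \<open>The map s to 1/(t + s) - \<kappa> is continuous and injective near 0, so it carries
  isolation of the eigenvalue to the resolvent side.\<close>

lemma discrete_isolated:
  assumes \<kappa>: "lam_ok \<kappa>" and t: "t > 0" and iso: "(1 / t - \<kappa>) isolated_in spectrum H2 (schroedinger V)"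
  obtains \<epsilon> where "\<epsilon> > 0" "\<And>s. s \<noteq> 0 \<Longrightarrow> \<bar>s\<bar> < \<epsilon> \<Longrightarrow> reg \<kappa> (t + s)"
proof -
  obtain T where T: "open T" "T \<inter> spectrum H2 (schroedinger V) = {1 / t - \<kappa>}"
    using iso by (auto simp: isolated_in_def)
  have "isCont (\<lambda>s. 1 / (t + s) - \<kappa>) 0" using t by (intro continuous_intros) auto
  moreover have "1 / (t + 0) - \<kappa> \<in> T" using T(2) by auto
  ultimately have "eventually (\<lambda>s. 1 / (t + s) - \<kappa> \<in> T) (at 0)"
    using T(1) unfolding isCont_def by (auto dest: topological_tendstoD)
  then obtain d where d: "d > 0" "\<And>s. s \<noteq> 0 \<Longrightarrow> \<bar>s\<bar> < d \<Longrightarrow> 1 / (t + s) - \<kappa> \<in> T"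
    by (auto simp: eventually_at)
  show ?thesis
  \<comment> \<open>The bound by \<open>t\<close> keeps t + s positive.\<close>
  proof (rule that[of "min d t"])
    fix s :: real assume s: "s \<noteq> 0" "\<bar>s\<bar> < min d t"
    have ts: "t + s > 0" using s by auto
    have "1 / (t + s) \<noteq> 1 / t" using s(1) by simp
    moreover have "1 / (t + s) - \<kappa> = 1 / t - \<kappa>" if "1 / (t + s) - \<kappa> \<in> spectrum H2 (schroedinger V)"
    proof -
      have "1 / (t + s) - \<kappa> \<in> T \<inter> spectrum H2 (schroedinger V)" using d(2)[of s] s that by auto
      then show ?thesis unfolding T(2) by (rule singletonD)
    qed
    ultimately have "1 / (t + s) - \<kappa> \<notin> spectrum H2 (schroedinger V)" by auto
    then show "reg \<kappa> (t + s)" using reg_if_resolvent[OF \<kappa> ts] by (simp add: spectrum_def)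
  qed (use d t in simp)
qed

text \<open>As in \<open>form_lower_if_resolvent\<close>, now along weakly null sequences: points of
  the discrete spectrum below \<mu>1 are admissible because
  \<open>isolated_point_weakly_null\<close> gives the required lower bound there too.\<close>

lemma form_lower_weakly_null:
  assumes r: "\<And>\<mu>. \<mu> < \<mu>1 \<Longrightarrow> \<mu> \<notin> essential_spectrum H2 (schroedinger V)"
    and w: "\<And>n. w n \<in> dom1" "wconv w 0" "Bseq w" and "e > 0"
  shows "eventually (\<lambda>n. qf (w n) (w n) \<ge> \<mu>1 * (norm (w n))\<^sup>2 - e) sequentially"
proof -
  obtain \<kappa>0 where \<kappa>0: "\<And>\<kappa>. \<kappa> \<ge> \<kappa>0 \<Longrightarrow> lam_ok \<kappa>" using lam_ok_large by blast
  define \<kappa> where "\<kappa> = max \<kappa>0 (\<bar>\<mu>1\<bar> + 1)"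
  have \<kappa>: "lam_ok \<kappa>" by (rule \<kappa>0) (simp add: \<kappa>_def)
  have "\<kappa> \<ge> \<bar>\<mu>1\<bar> + 1" by (simp add: \<kappa>_def)
  then have pos: "\<kappa> + \<mu>1 > 0" by linarith
  define t where "t = 1 / (\<kappa> + \<mu>1)"
  have t: "t > 0" using pos by (simp add: t_def)
  note lin = bounded_linear_Rres[OF \<kappa>]
  interpret R: bounded_linear "Rres \<kappa>" by (rule lin)
  have "eventually (\<lambda>n. t * (norm (w n))\<^sup>2 - Rres \<kappa> (w n) \<bullet> w n \<ge> - (e * t\<^sup>2)) sequentially"
  proof (rule symmetric_lower_bound_step[where W = "{w. wconv w 0 \<and> Bseq w}" and R = "Rres \<kappa>"])
    show "(\<lambda>n. w n - \<tau> *\<^sub>R (T *\<^sub>R w n - Rres \<kappa> (w n))) \<in> {w. wconv w 0 \<and> Bseq w}"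
      if "w \<in> {w. wconv w 0 \<and> Bseq w}" for w \<tau> T
    proof -
      have w: "wconv w 0" "Bseq w" using that by auto
      \<comment> \<open>Symmetry moves R onto the fixed vector y, so the perturbed sequence is again
        weakly null.\<close>
      have "(\<lambda>n. w n \<bullet> y - \<tau> * (T * (w n \<bullet> y) - w n \<bullet> Rres \<kappa> y)) \<longlonglongrightarrow> 0 \<bullet> y - \<tau> * (T * (0 \<bullet> y) - 0 \<bullet> Rres \<kappa> y)" for y
        by (intro tendsto_intros wconv_tendsto[OF w(1)])
      then have wc: "wconv (\<lambda>n. w n - \<tau> *\<^sub>R (T *\<^sub>R w n - Rres \<kappa> (w n))) 0"
        by (simp add: wconv_def inner_diff_left Rres_symmetric[OF \<kappa>])
      have "bounded_linear (\<lambda>x. x - \<tau> *\<^sub>R (T *\<^sub>R x - Rres \<kappa> x))"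
        by (intro bounded_linear_sub bounded_linear_ident bounded_linear_const_scaleR lin bounded_linear_scaleR_right)
      then obtain K where K: "\<And>x. norm (x - \<tau> *\<^sub>R (T *\<^sub>R x - Rres \<kappa> x)) \<le> norm x * K" "K \<ge> 0"
        using bounded_linear.nonneg_bounded by blast
      obtain B where B: "\<And>n. norm (w n) \<le> B" using w(2) by (auto simp: Bseq_def)
      have "Bseq (\<lambda>n. w n - \<tau> *\<^sub>R (T *\<^sub>R w n - Rres \<kappa> (w n)))"
        by (rule BseqI'[of _ "B * K"]) (rule order_trans[OF K(1) mult_right_mono[OF B K(2)]])
      with wc show ?thesis by simp
    qed
    show "\<exists>c>0. \<forall>w\<in>{w. wconv w 0 \<and> Bseq w}. \<forall>e>0. \<forall>\<^sub>F n in sequentially.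
           c * (norm (w n))\<^sup>2 - e \<le> (norm (T *\<^sub>R w n - Rres \<kappa> (w n)))\<^sup>2" if "T > t" for T
    proof -
      have T: "T > 0" using that t by simp
      have "1 / T < 1 / t" using that t by (intro divide_strict_left_mono) auto
      then have "1 / T - \<kappa> < \<mu>1" by (simp add: t_def)
      from r[OF this] consider "1 / T - \<kappa> \<in> resolvent_set H2 (schroedinger V)" | "1 / T - \<kappa> \<in> discrete_spectrum H2 (schroedinger V)"
        by (auto simp: essential_spectrum_def spectrum_def)
      then show ?thesis
      proof cases
        case 1
        from reg_step[OF reg_if_resolvent[OF \<kappa> T 1]]
        obtain c where c: "c > 0" "\<And>x. (norm (T *\<^sub>R x - Rres \<kappa> x))\<^sup>2 \<ge> c * (norm x)\<^sup>2" by blast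
        have "c * (norm x)\<^sup>2 - e \<le> (norm (T *\<^sub>R x - Rres \<kappa> x))\<^sup>2" if "e > 0" for x e
          using c(2)[of x] that by linarith
        then show ?thesis using c(1) by (intro exI[of _ c]) auto
      next
        case 2
        then have iso: "(1 / T - \<kappa>) isolated_in spectrum H2 (schroedinger V)"
          and fin: "finite_dim_ae (eigenspace H2 (schroedinger V) (1 / T - \<kappa>))" by (auto simp: discrete_spectrum_def)
        obtain E where E: "finite E" "\<And>x. Rres \<kappa> x - T *\<^sub>R x = 0 \<longleftrightarrow> x \<in> span E"
          using discrete_kernel[OF \<kappa> T fin] by blast
        obtain \<epsilon> where \<epsilon>: "\<epsilon> > 0" "\<And>s. s \<noteq> 0 \<Longrightarrow> \<bar>s\<bar> < \<epsilon> \<Longrightarrow> reg \<kappa> (T + s)"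
          using discrete_isolated[OF \<kappa> T iso] by blast
        have linS: "bounded_linear (\<lambda>x. Rres \<kappa> x - T *\<^sub>R x)"
          by (intro bounded_linear_sub lin bounded_linear_scaleR_right)
        have symS: "(Rres \<kappa> x - T *\<^sub>R x) \<bullet> y = x \<bullet> (Rres \<kappa> y - T *\<^sub>R y)" for x y
          by (simp add: inner_diff_left inner_diff_right Rres_symmetric[OF \<kappa>])
        have isoS: "\<exists>c>0. \<forall>x. norm (Rres \<kappa> x - T *\<^sub>R x - s *\<^sub>R x) \<ge> c * norm x" if "s \<noteq> 0" "\<bar>s\<bar> < \<epsilon>" for s
        proof -
          have "norm (Rres \<kappa> x - T *\<^sub>R x - s *\<^sub>R x) = norm ((T + s) *\<^sub>R x - Rres \<kappa> x)" for x
            by (simp add: scaleR_add_left norm_minus_commute diff_diff_eq)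
          then show ?thesis using \<epsilon>(2)[OF that] by (simp add: reg_def)
        qed
        have "\<forall>\<^sub>F n in sequentially. \<epsilon>\<^sup>2 * (norm (w n))\<^sup>2 - e \<le> (norm (T *\<^sub>R w n - Rres \<kappa> (w n)))\<^sup>2"
          if "wconv w 0" "e > 0" for w e
          using isolated_point_weakly_null[OF linS symS \<epsilon>(1) isoS E that] by (simp add: norm_minus_commute)
        then show ?thesis using \<epsilon>(1) by (intro exI[of _ "\<epsilon>\<^sup>2"]) auto
      qed
    qed
  qed (use w \<open>e > 0\<close> t lin Rres_symmetric[OF \<kappa>] in auto)
  then show ?thesis
  proof eventually_elim
    case (elim n)
    have "e * t\<^sup>2 > 0" using \<open>e > 0\<close> t by simp
    from form_lower[OF \<kappa> w(1) t this elim]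
    have "(norm (w n))\<^sup>2 / t - e \<le> qf (w n) (w n) + \<kappa> * (norm (w n))\<^sup>2" using t by simp
    then show ?case using pos by (simp add: t_def distrib_right mult.commute)
  qed
qed

end

section \<open>Decay of weak solutions\<close>

text \<open>Stands in for the chain rule: applied to difference quotients, it bounds the gradient of \<open>(u - k \<psi>)\<^sup>+\<close>
  without differentiating the positive part.\<close>

lemma truncation_product:
  fixes a b \<alpha> \<beta> k s :: real
  assumes k: "0 < k" "k \<le> 1" and c: "\<bar>\<alpha> - \<beta>\<bar> \<le> 2 * s * \<beta>" "\<bar>\<alpha> - \<beta>\<bar> \<le> 2 * s * \<alpha>" and s: "s \<ge> 0"
  defines "x \<equiv> max (a - k * \<alpha>) 0" and "y \<equiv> max (b - k * \<beta>) 0"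
  shows "(x - y)\<^sup>2 / 2 - 2 * s\<^sup>2 * ((if b > k * \<beta> then \<beta> else 0)\<^sup>2 + (if a > k * \<alpha> then \<alpha> else 0)\<^sup>2) \<le> (a - b) * (x - y)"
proof (cases "a \<le> k * \<alpha> \<and> b \<le> k * \<beta>")
  case True
  then show ?thesis by (simp add: x_def y_def)
next
  case False
  define D where "D = (if b > k * \<beta> then \<beta> else 0)\<^sup>2 + (if a > k * \<alpha> then \<alpha> else 0)\<^sup>2"
  have sq: "\<bar>\<alpha> - \<beta>\<bar>\<^sup>2 \<le> 4 * s\<^sup>2 * D"
  proof (cases "b > k * \<beta>")
    case True
    have "\<bar>\<alpha> - \<beta>\<bar>\<^sup>2 \<le> (2 * s * \<beta>)\<^sup>2" using c(1) by (intro power_mono) auto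
    also have "\<dots> = 4 * s\<^sup>2 * \<beta>\<^sup>2" by (simp add: power_mult_distrib)
    also have "\<dots> \<le> 4 * s\<^sup>2 * D" using True by (intro mult_left_mono) (auto simp: D_def)
    finally show ?thesis .
  next
    case F: False
    have "\<bar>\<alpha> - \<beta>\<bar>\<^sup>2 \<le> (2 * s * \<alpha>)\<^sup>2" using c(2) by (intro power_mono) auto
    also have "\<dots> = 4 * s\<^sup>2 * \<alpha>\<^sup>2" by (simp add: power_mult_distrib)
    also have "\<dots> \<le> 4 * s\<^sup>2 * D" using False F by (intro mult_left_mono) (auto simp: D_def)
    finally show ?thesis .
  qed
  have mono: "((a - k * \<alpha>) - (b - k * \<beta>)) * (x - y) \<ge> (x - y)\<^sup>2"
  proof -
    define p q where "p = a - k * \<alpha>" and "q = b - k * \<beta>"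
    have "(p - q) * (max p 0 - max q 0) \<ge> (max p 0 - max q 0)\<^sup>2"
    proof (cases "p \<ge> 0"; cases "q \<ge> 0")
      assume "p \<ge> 0" "\<not> q \<ge> 0"
      then have "p * q \<le> 0" by (simp add: mult_nonneg_nonpos)
      then show ?thesis using \<open>p \<ge> 0\<close> \<open>\<not> q \<ge> 0\<close> by (simp add: max_def power2_eq_square algebra_simps)
    next
      assume "\<not> p \<ge> 0" "q \<ge> 0"
      then have "p * q \<le> 0" by (simp add: mult_nonpos_nonneg)
      then show ?thesis using \<open>\<not> p \<ge> 0\<close> \<open>q \<ge> 0\<close> by (simp add: max_def power2_eq_square algebra_simps)
    qed (simp_all add: max_def power2_eq_square)
    then show ?thesis by (simp add: p_def q_def x_def y_def)
  qed
  have "(k * (\<alpha> - \<beta>)) * (x - y) \<ge> - ((x - y)\<^sup>2 / 2 + (k * (\<alpha> - \<beta>))\<^sup>2 / 2)"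
    using zero_le_power2[of "k * (\<alpha> - \<beta>) + (x - y)"] unfolding power2_sum by linarith
  moreover have "(k * (\<alpha> - \<beta>))\<^sup>2 \<le> 4 * s\<^sup>2 * D"
  proof -
    have "k\<^sup>2 \<le> 1" using k by (simp add: power_le_one)
    then have "k\<^sup>2 * (\<alpha> - \<beta>)\<^sup>2 \<le> 1 * (\<alpha> - \<beta>)\<^sup>2" by (intro mult_right_mono) auto
    then show ?thesis using sq by (simp add: power_mult_distrib)
  qed
  moreover have "(a - b) * (x - y) = ((a - k * \<alpha>) - (b - k * \<beta>)) * (x - y) + (k * (\<alpha> - \<beta>)) * (x - y)"
    by (simp add: algebra_simps)
  ultimately show ?thesis using mono unfolding D_def[symmetric] by linarith
qed

section \<open>Truncation of a solution against a positive barrier\<close>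

definition trunc :: "(real ^ 'n \<Rightarrow> real) \<Rightarrow> (real ^ 'n \<Rightarrow> real) \<Rightarrow> real \<Rightarrow> real ^ 'n \<Rightarrow> real" where
  "trunc \<psi> U k t = max (U t - k * \<psi> t) 0"

definition lvl :: "(real ^ 'n \<Rightarrow> real) \<Rightarrow> (real ^ 'n \<Rightarrow> real) \<Rightarrow> real \<Rightarrow> (real ^ 'n) set" where
  "lvl \<psi> U k = {t. U t > k * \<psi> t}"

text \<open>The Lipschitz condition is relative to \<psi> itself, so the error made by the gradient
  of the barrier is measured by \<psi> on the level set. The positive lower bound \<epsilon> gives
  the level sets finite measure.\<close>

locale barrier =
  fixes \<psi> U :: "real ^ 'n \<Rightarrow> real" and \<epsilon> :: real
  assumes \<psi>_cont: "continuous_on UNIV \<psi>" and \<epsilon>: "\<epsilon> > 0" and \<psi>_ge: "\<And>t. \<psi> t \<ge> \<epsilon>"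
    and \<psi>_lip: "\<And>t h. norm h \<le> 1 \<Longrightarrow> \<bar>\<psi> (t + h) - \<psi> t\<bar> \<le> 2 * norm h * \<psi> t"
    and UL: "U \<in> L2" and Udom: "l2_of U \<in> dom1"
begin

lemma \<psi>_pos: "\<psi> t > 0" using \<psi>_ge[of t] \<epsilon> by linarith

lemma measurable_\<psi> [measurable]: "\<psi> \<in> borel_measurable lebesgue"
  using borel_measurable_continuous_onI[OF \<psi>_cont] by (intro measurable_completion) simp

lemma measurable_U [measurable]: "U \<in> borel_measurable lebesgue"
  using UL by (rule L2_measurable)

lemma lvl_measurable [measurable]: "lvl \<psi> U k \<in> sets lebesgue"
proof -
  have "{t \<in> space lebesgue. U t > k * \<psi> t} \<in> sets lebesgue" by measurable
  then show ?thesis by (simp add: lvl_def)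
qed

lemma trunc_measurable [measurable]: "trunc \<psi> U k \<in> borel_measurable lebesgue"
  unfolding trunc_def by measurable

lemma trunc_le: "k \<ge> 0 \<Longrightarrow> \<bar>trunc \<psi> U k t\<bar> \<le> \<bar>U t\<bar>"
proof -
  assume "k \<ge> 0"
  then have "k * \<psi> t \<ge> 0" using \<psi>_pos[of t] by simp
  then show ?thesis unfolding trunc_def max_def by simp
qed

lemma trunc_L2: "k \<ge> 0 \<Longrightarrow> trunc \<psi> U k \<in> L2"
  by (rule L2_bound[OF UL]) (use trunc_le in auto)

lemma lvl_\<psi>_L2: "k > 0 \<Longrightarrow> (\<lambda>t. if U t > k * \<psi> t then \<psi> t else 0) \<in> L2"
proof (rule L2_bound[OF L2_scale[OF UL, of "1 / k"]])
  assume k: "k > 0"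
  have "\<bar>if U t > k * \<psi> t then \<psi> t else 0\<bar> \<le> \<bar>1 / k * U t\<bar>" for t
    using k \<psi>_pos[of t] by (auto simp: pos_le_divide_eq mult.commute)
  then show "AE t in lebesgue. \<bar>if U t > k * \<psi> t then \<psi> t else 0\<bar> \<le> \<bar>1 / k * U t\<bar>" by simp
qed measurable

text \<open>The barrier cut off to a level set. It is square integrable since \<psi> < U / k there,
  and its norm measures the error due to the gradient of \<psi>.\<close>

definition level_barrier :: "real \<Rightarrow> 'n l2" where "level_barrier k = l2_of (\<lambda>t. if U t > k * \<psi> t then \<psi> t else 0)"

text \<open>\<open>truncation_product\<close> at the points t + h and t, integrated. Its two barrier
  terms have equal integrals by translation invariance, which turns the 2 into a 4.\<close>

lemma trunc_inner_bound:
  assumes k: "0 < k" "k \<le> 1" and h: "norm h \<le> 1"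
  defines "u \<equiv> l2_of U" and "w \<equiv> l2_of (trunc \<psi> U k)"
  shows "(norm (tr h w - w))\<^sup>2 / 2 - 4 * (norm h)\<^sup>2 * (norm (level_barrier k))\<^sup>2 \<le> (tr h u - u) \<bullet> (tr h w - w)"
proof -
  note wL = trunc_L2[of k] and gL = lvl_\<psi>_L2[OF k(1)]
  let ?w = "trunc \<psi> U k" and ?g = "\<lambda>t. if U t > k * \<psi> t then \<psi> t else 0"
  have wL: "?w \<in> L2" using k by (intro trunc_L2) simp
  have du: "(\<lambda>t. U (t + h) - U t) \<in> L2" "tr h u - u = l2_of (\<lambda>t. U (t + h) - U t)"
    using UL by (simp_all add: u_def tr_l2_of L2_translation l2_of_diff L2_diff)
  have dw: "(\<lambda>t. ?w (t + h) - ?w t) \<in> L2" "tr h w - w = l2_of (\<lambda>t. ?w (t + h) - ?w t)"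
    using wL by (simp_all add: w_def tr_l2_of L2_translation l2_of_diff L2_diff)
  have g2: "integrable lebesgue (\<lambda>t. (?g t)\<^sup>2)" using gL by (simp add: L2_def)
  have g2': "integrable lebesgue (\<lambda>t. (?g (t + h))\<^sup>2)" by (rule integrable_translation[OF g2])
  have ig: "(LINT t|lebesgue. (?g t)\<^sup>2) = (norm (level_barrier k))\<^sup>2" unfolding level_barrier_def by (rule norm_l2_of_sq[OF gL, symmetric])
  have ig': "(LINT t|lebesgue. (?g (t + h))\<^sup>2) = (norm (level_barrier k))\<^sup>2"
    unfolding ig[symmetric] by (rule integral_translation) (use g2 in auto)
  have iw: "integrable lebesgue (\<lambda>t. (?w (t + h) - ?w t)\<^sup>2)" using dw(1) by (simp add: L2_def)
  have "(norm (tr h w - w))\<^sup>2 / 2 - 4 * (norm h)\<^sup>2 * (norm (level_barrier k))\<^sup>2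
      = (LINT t|lebesgue. (?w (t + h) - ?w t)\<^sup>2 / 2 - 2 * (norm h)\<^sup>2 * ((?g t)\<^sup>2 + (?g (t + h))\<^sup>2))"
    unfolding dw(2) norm_l2_of_sq[OF dw(1)] using iw g2 g2'
    by (simp add: Bochner_Integration.integral_diff Bochner_Integration.integral_add ig ig' del: if_split)
  also have "\<dots> \<le> (LINT t|lebesgue. (U (t + h) - U t) * (?w (t + h) - ?w t))"
  proof (rule integral_mono)
    show "integrable lebesgue (\<lambda>t. (?w (t + h) - ?w t)\<^sup>2 / 2 - 2 * (norm h)\<^sup>2 * ((?g t)\<^sup>2 + (?g (t + h))\<^sup>2))"
      by (intro Bochner_Integration.integrable_diff integrable_mult_right Bochner_Integration.integrable_add g2 g2' integrable_divide iw)
    show "integrable lebesgue (\<lambda>t. (U (t + h) - U t) * (?w (t + h) - ?w t))" by (rule L2_integrable_mult[OF du(1) dw(1)])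
    fix t
    have c: "\<bar>\<psi> (t + h) - \<psi> t\<bar> \<le> 2 * norm h * \<psi> t" by (rule \<psi>_lip[OF h])
    \<comment> \<open>The Lipschitz condition read from the other endpoint;
      \<open>truncation_product\<close> needs it relative to both barrier values.\<close>
    have "\<bar>\<psi> (t + h + - h) - \<psi> (t + h)\<bar> \<le> 2 * norm (- h) * \<psi> (t + h)" using h by (intro \<psi>_lip) simp
    then have c': "\<bar>\<psi> (t + h) - \<psi> t\<bar> \<le> 2 * norm h * \<psi> (t + h)" by (simp add: abs_minus_commute)
    show "(?w (t + h) - ?w t)\<^sup>2 / 2 - 2 * (norm h)\<^sup>2 * ((?g t)\<^sup>2 + (?g (t + h))\<^sup>2) \<le> (U (t + h) - U t) * (?w (t + h) - ?w t)"
      unfolding trunc_def by (rule truncation_product[OF k c c' norm_ge_zero])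
  qed
  also have "\<dots> = (tr h u - u) \<bullet> (tr h w - w)" unfolding du(2) dw(2) by (rule inner_l2_of[OF du(1) dw(1), symmetric])
  finally show ?thesis .
qed

text \<open>The inner product bound controls the difference quotients of the truncation by those of
  \<open>U\<close> and by the barrier error, so \<open>hwp_if_difference_bound\<close>
  applies.\<close>

lemma trunc_dom1:
  assumes k: "0 < k" "k \<le> 1"
  shows "l2_of (trunc \<psi> U k) \<in> dom1"
proof -
  define u w where "u = l2_of U" and "w = l2_of (trunc \<psi> U k)"
  have "\<exists>g. hwp i w g" for i
  proof -
    define G where "G = 2 * norm (pd i u) + 4 * norm (level_barrier k)"
    have "norm (tr (s *\<^sub>R axis i 1) w - w) \<le> G * s" if s: "0 < s" "s < 1" for s
    proof -
      define h where "h = s *\<^sub>R (axis i 1 :: real ^ 'n)"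
      have nh: "norm h = s" using s by (simp add: h_def)
      define x where "x = norm (tr h w - w)"
      define D where "D = norm (tr h u - u)"
      have D: "D \<le> s * norm (pd i u)"
        using hwp_difference_bound[OF hwp_pd[OF Udom], of s i] s by (simp add: D_def h_def u_def)
      have "(norm (tr h w - w))\<^sup>2 / 2 - 4 * (norm h)\<^sup>2 * (norm (level_barrier k))\<^sup>2 \<le> (tr h u - u) \<bullet> (tr h w - w)"
        unfolding u_def w_def by (rule trunc_inner_bound[OF k]) (use nh s in simp)
      also have "\<dots> \<le> D * x" unfolding D_def x_def by (rule norm_cauchy_schwarz)
      \<comment> \<open>Young's inequality with weight 1/4, so that half of the left side survives
        the absorption.\<close>
      also have "\<dots> \<le> D\<^sup>2 + x\<^sup>2 / 4" using zero_le_power2[of "D - x / 2"] unfolding power2_diff by (simp add: power_divide)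
      finally have "x\<^sup>2 \<le> 4 * D\<^sup>2 + 16 * (s * norm (level_barrier k))\<^sup>2" by (simp add: x_def nh power_mult_distrib)
      also have "4 * D\<^sup>2 \<le> 4 * (s * norm (pd i u))\<^sup>2" using D by (intro mult_left_mono power_mono) (auto simp: D_def)
      finally have "x\<^sup>2 \<le> (2 * (s * norm (pd i u)))\<^sup>2 + (4 * (s * norm (level_barrier k)))\<^sup>2" by (simp add: power_mult_distrib)
      also have "\<dots> \<le> (2 * (s * norm (pd i u)) + 4 * (s * norm (level_barrier k)))\<^sup>2"
        unfolding power2_sum using s by simp
      finally have "x \<le> 2 * (s * norm (pd i u)) + 4 * (s * norm (level_barrier k))" by (rule power2_le_imp_le) (use s in simp)
      then show ?thesis by (simp add: x_def h_def G_def algebra_simps)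
    qed
    then show ?thesis using hwp_if_difference_bound[of 1 i w G] by (meson zero_less_one)
  qed
  then show ?thesis by (simp add: dom1_def w_def)
qed

text \<open>\<open>trunc_inner_bound\<close> divided by the squared step and passed to the limit in
  each coordinate direction: the energy inequality for the truncation as test function.\<close>

lemma trunc_gf:
  assumes k: "0 < k" "k \<le> 1"
  defines "u \<equiv> l2_of U" and "w \<equiv> l2_of (trunc \<psi> U k)"
  shows "gf w w / 2 - 4 * real CARD('n) * (norm (level_barrier k))\<^sup>2 \<le> gf u w"
proof -
  have "(norm (pd i w))\<^sup>2 / 2 - 4 * (norm (level_barrier k))\<^sup>2 \<le> pd i u \<bullet> pd i w" for i
  proof (rule tendsto_le[of "at (0::real)"])
    let ?d = "\<lambda>x s. (tr (s *\<^sub>R axis i 1) x - x) /\<^sub>R s"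
    have du: "((\<lambda>s. ?d u s) \<longlongrightarrow> pd i u) (at 0)" using Udom unfolding u_def by (intro hwp_difference_tendsto hwp_pd)
    have dw: "((\<lambda>s. ?d w s) \<longlongrightarrow> pd i w) (at 0)" unfolding w_def by (intro hwp_difference_tendsto hwp_pd trunc_dom1 k)
    show "((\<lambda>s. ?d u s \<bullet> ?d w s) \<longlongrightarrow> pd i u \<bullet> pd i w) (at 0)" by (rule tendsto_inner[OF du dw])
    show "((\<lambda>s. (norm (?d w s))\<^sup>2 / 2 - 4 * (norm (level_barrier k))\<^sup>2) \<longlongrightarrow> (norm (pd i w))\<^sup>2 / 2 - 4 * (norm (level_barrier k))\<^sup>2) (at 0)"
      by (intro tendsto_intros dw) auto
    have "(norm (?d w s))\<^sup>2 / 2 - 4 * (norm (level_barrier k))\<^sup>2 \<le> ?d u s \<bullet> ?d w s" if s: "s \<noteq> 0" "\<bar>s\<bar> < 1" for s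
    proof -
      define h where "h = s *\<^sub>R (axis i 1 :: real ^ 'n)"
      have nh: "norm h = \<bar>s\<bar>" by (simp add: h_def)
      have b: "(norm (tr h w - w))\<^sup>2 / 2 - 4 * (norm h)\<^sup>2 * (norm (level_barrier k))\<^sup>2 \<le> (tr h u - u) \<bullet> (tr h w - w)"
        unfolding u_def w_def by (rule trunc_inner_bound[OF k]) (use nh s in simp)
      have "((norm (tr h w - w))\<^sup>2 / 2 - 4 * s\<^sup>2 * (norm (level_barrier k))\<^sup>2) / s\<^sup>2 \<le> ((tr h u - u) \<bullet> (tr h w - w)) / s\<^sup>2"
        using b by (intro divide_right_mono) (auto simp: nh)
      moreover have "((norm (tr h w - w))\<^sup>2 / 2 - 4 * s\<^sup>2 * (norm (level_barrier k))\<^sup>2) / s\<^sup>2 = (norm (?d w s))\<^sup>2 / 2 - 4 * (norm (level_barrier k))\<^sup>2"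
        using s(1) unfolding norm_scaleR h_def[symmetric] by (simp add: power_mult_distrib power_inverse field_simps)
      moreover have "((tr h u - u) \<bullet> (tr h w - w)) / s\<^sup>2 = ?d u s \<bullet> ?d w s"
        unfolding h_def[symmetric] inner_scaleR_left inner_scaleR_right by (simp add: power2_eq_square divide_inverse)
      ultimately show ?thesis by simp
    qed
    then show "\<forall>\<^sub>F s in at 0. (norm (?d w s))\<^sup>2 / 2 - 4 * (norm (level_barrier k))\<^sup>2 \<le> ?d u s \<bullet> ?d w s"
      unfolding eventually_at by (intro exI[of _ 1]) auto
  qed simp
  then have "(\<Sum>i\<in>UNIV. (norm (pd i w))\<^sup>2 / 2 - 4 * (norm (level_barrier k))\<^sup>2) \<le> (\<Sum>i\<in>UNIV. pd i u \<bullet> pd i w)" by (rule sum_mono)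
  then show ?thesis by (simp add: gf_eq gf_def[of u] sum_subtractf flip: sum_divide_distrib)
qed

end

definition h1sq :: "'n::finite l2 \<Rightarrow> real" where "h1sq x = (norm x)\<^sup>2 + gf x x"

text \<open>The equation has right-hand side 0 because a bounded coefficient on the right is moved
  into the potential in \<open>decay_perturbed\<close>.\<close>

locale barrier_solution = kr_potential V V1 V2 p C2 + barrier \<psi> U \<epsilon>
  for V V1 V2 :: "real ^ 'n \<Rightarrow> real" and p C2 and \<psi> U :: "real ^ 'n \<Rightarrow> real" and \<epsilon> +
  assumes weak: "\<And>\<phi>. \<phi> \<in> dom1 \<Longrightarrow> qf (l2_of U) \<phi> = 0"
begin

text \<open>The weight 1 + |V| on the level set bounds the L2 norm, the barrier error and the
  potential term at the same time.\<close>

definition level_weight :: "real \<Rightarrow> real ^ 'n \<Rightarrow> real" where "level_weight k t = (if U t > k * \<psi> t then 1 + \<bar>V t\<bar> else 0)"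

lemma level_weight_measurable [measurable]: "level_weight k \<in> borel_measurable lebesgue"
  unfolding level_weight_def by measurable

lemma level_weight_nonneg: "level_weight k t \<ge> 0" by (simp add: level_weight_def)

lemma level_weight_dom: "x \<in> dom1 \<Longrightarrow> x \<in> mul_dom (\<lambda>t. sqrt (level_weight k t))"
proof (rule mulop_sum_le(1)[OF _ V_sqrt_dom, of _ _ 1])
  have "\<bar>sqrt (level_weight k t)\<bar> \<le> \<bar>sqrt \<bar>V t\<bar>\<bar> + 1" for t
    using sqrt_add_le_add_sqrt[of 1 "\<bar>V t\<bar>"] by (auto simp: level_weight_def)
  then show "AE t in lebesgue. \<bar>sqrt (level_weight k t)\<bar> \<le> \<bar>sqrt \<bar>V t\<bar>\<bar> + 1" by simp
qed auto

lemma level_weight_norm: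
  assumes "f \<in> L2" "l2_of f \<in> dom1"
  shows "integrable lebesgue (\<lambda>t. level_weight k t * (f t)\<^sup>2)"
    "(norm (mulop (\<lambda>t. sqrt (level_weight k t)) (l2_of f)))\<^sup>2 = (LINT t|lebesgue. level_weight k t * (f t)\<^sup>2)"
proof -
  note d = level_weight_dom[OF assms(2), of k]
  have L: "(\<lambda>t. sqrt (level_weight k t) * f t) \<in> L2" and m: "mulop (\<lambda>t. sqrt (level_weight k t)) (l2_of f) = l2_of (\<lambda>t. sqrt (level_weight k t) * f t)"
    using mul_dom_iff[OF assms(1)] d by auto
  have eq: "(sqrt (level_weight k t) * f t)\<^sup>2 = level_weight k t * (f t)\<^sup>2" for t using level_weight_nonneg by (simp add: power_mult_distrib)
  show "integrable lebesgue (\<lambda>t. level_weight k t * (f t)\<^sup>2)" 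
  proof -
    have "integrable lebesgue (\<lambda>t. (sqrt (level_weight k t) * f t)\<^sup>2)" using L by (simp add: L2_def)
    then show ?thesis by (simp only: eq)
  qed
  show "(norm (mulop (\<lambda>t. sqrt (level_weight k t)) (l2_of f)))\<^sup>2 = (LINT t|lebesgue. level_weight k t * (f t)\<^sup>2)"
    unfolding m norm_l2_of_sq[OF L] eq ..
qed

abbreviation w :: "real \<Rightarrow> 'n l2" where "w k \<equiv> l2_of (trunc \<psi> U k)"

text \<open>The truncation belongs to the lower level \<open>k'\<close> and the domain of
  integration to the higher level \<open>k\<close>; the gap between them makes the truncation
  dominate \<psi> and U there.\<close>

definition level_energy :: "real \<Rightarrow> real \<Rightarrow> real" where "level_energy k' k = (LINT t|lebesgue. level_weight k t * (trunc \<psi> U k' t)\<^sup>2)"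

text \<open>A Caccioppoli inequality between two levels: the equation is tested with the truncation
  at level k, and every resulting term is bounded on the level set of k by the larger truncation at
  level k', with a loss of at most d^(-2).\<close>

lemma energy_step:
  assumes k: "0 < k'" "k' < k" "k \<le> 1"
  defines "d \<equiv> k - k'"
  shows "h1sq (w k) \<le> 17 * real CARD('n) / d\<^sup>2 * level_energy k' k"
proof -
  have d: "0 < d" "d \<le> 1" using k by (auto simp: d_def)
  have k0: "0 < k" using k by simp
  let ?w = "trunc \<psi> U k" and ?w' = "trunc \<psi> U k'" and ?g = "\<lambda>t. if U t > k * \<psi> t then \<psi> t else 0"
  define N where "N = real CARD('n)"
  have N: "N \<ge> 1" by (simp add: N_def Suc_leI)
  have wL: "?w \<in> L2" "?w' \<in> L2" using k by (auto intro: trunc_L2)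
  have wd: "w k \<in> dom1" "w k' \<in> dom1" using k by (auto intro: trunc_dom1)
  note iS = level_weight_norm(1)[OF wL(2) wd(2), of k]
  have S0: "level_energy k' k \<ge> 0" unfolding level_energy_def by (intro Bochner_Integration.integral_nonneg) (simp add: level_weight_nonneg)
  \<comment> \<open>Above level k the truncation at k' is at least d \<psi>, and U is the truncation
    at k plus k \<psi>; this accounts for the factor 2 in the bound for d U.\<close>
  have pw: "?w t \<le> ?w' t" "0 \<le> ?w t" "d * \<psi> t \<le> ?w' t" "?w t * d \<le> ?w' t" "d * U t \<le> 2 * ?w' t" "0 \<le> U t"
    if "U t > k * \<psi> t" for t
  proof -
    have p: "\<psi> t > 0" by (rule \<psi>_pos)
    have kk: "k' * \<psi> t \<le> k * \<psi> t" "0 \<le> k' * \<psi> t" "k * \<psi> t \<le> \<psi> t" using k p by auto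
    have e: "?w t = U t - k * \<psi> t" "?w' t = U t - k' * \<psi> t" using that kk by (auto simp: trunc_def)
    show a: "?w t \<le> ?w' t" "0 \<le> ?w t" using e kk that by auto
    show b: "d * \<psi> t \<le> ?w' t" using e that by (simp add: d_def left_diff_distrib)
    have "?w t * d \<le> ?w t * 1" using a(2) d by (intro mult_left_mono) auto
    then show c: "?w t * d \<le> ?w' t" using a by simp
    have "d * U t = ?w t * d + k * (d * \<psi> t)" by (simp add: e algebra_simps)
    also have "k * (d * \<psi> t) \<le> 1 * (d * \<psi> t)" using k d p by (intro mult_right_mono) auto
    finally show "d * U t \<le> 2 * ?w' t" using b c by simp
    show "0 \<le> U t" using that kk by linarith
  qed
  have S1: "(norm (w k))\<^sup>2 \<le> level_energy k' k"
    unfolding norm_l2_of_sq[OF wL(1)] level_energy_def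
  proof (rule integral_mono[OF _ iS])
    show "integrable lebesgue (\<lambda>t. (?w t)\<^sup>2)" using wL(1) by (simp add: L2_def)
    fix t
    show "(?w t)\<^sup>2 \<le> level_weight k t * (?w' t)\<^sup>2"
    proof (cases "U t > k * \<psi> t")
      case True
      have "(?w t)\<^sup>2 \<le> 1 * (?w' t)\<^sup>2" using pw[OF True] by (simp add: power_mono)
      also have "\<dots> \<le> level_weight k t * (?w' t)\<^sup>2" using True by (intro mult_right_mono) (auto simp: level_weight_def)
      finally show ?thesis .
    qed (simp add: trunc_def level_weight_def)
  qed
  have S2: "(norm (level_barrier k))\<^sup>2 \<le> level_energy k' k / d\<^sup>2"
  proof -
    have "(norm (level_barrier k))\<^sup>2 * d\<^sup>2 = (LINT t|lebesgue. (?g t)\<^sup>2 * d\<^sup>2)"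
      unfolding level_barrier_def norm_l2_of_sq[OF lvl_\<psi>_L2[OF k0]] by simp
    also have "\<dots> \<le> level_energy k' k" unfolding level_energy_def
    proof (rule integral_mono[OF _ iS])
      show "integrable lebesgue (\<lambda>t. (?g t)\<^sup>2 * d\<^sup>2)" using lvl_\<psi>_L2[OF k0] by (simp add: L2_def)
      fix t
      show "(?g t)\<^sup>2 * d\<^sup>2 \<le> level_weight k t * (?w' t)\<^sup>2"
      proof (cases "U t > k * \<psi> t")
        case True
        have "(d * \<psi> t)\<^sup>2 \<le> 1 * (?w' t)\<^sup>2" using pw(3)[OF True] d \<psi>_pos[of t] by (simp add: power_mono)
        also have "\<dots> \<le> level_weight k t * (?w' t)\<^sup>2" using True by (intro mult_right_mono) (auto simp: level_weight_def)
        finally show ?thesis using True by (simp add: power_mult_distrib mult.commute)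
      qed (simp add: level_weight_def)
    qed
    finally show ?thesis using d by (simp add: pos_le_divide_eq)
  qed
  have S3: "\<bar>vf (l2_of U) (w k)\<bar> * d \<le> 2 * level_energy k' k"
  proof -
    have ae: "AE t in lebesgue. V t * rep (l2_of U) t * rep (w k) t = V t * U t * ?w t"
      using rep_l2_of[OF UL] rep_l2_of[OF wL(1)] by eventually_elim simp
    have mV: "(\<lambda>t. V t * U t * ?w t) \<in> borel_measurable lebesgue" by measurable
    have "integrable lebesgue (\<lambda>t. V t * rep (l2_of U) t * rep (w k) t)" by (rule vf(1)[OF Udom wd(1)])
    then have i: "integrable lebesgue (\<lambda>t. V t * U t * ?w t)"
      using integrable_cong_AE[OF _ mV ae] by auto
    have "vf (l2_of U) (w k) = (LINT t|lebesgue. V t * U t * ?w t)"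
      unfolding vf_def by (rule integral_cong_AE[OF _ mV ae]) measurable
    then have "\<bar>vf (l2_of U) (w k)\<bar> \<le> (LINT t|lebesgue. \<bar>V t * U t * ?w t\<bar>)" by (simp only: integral_abs_bound)
    then have "\<bar>vf (l2_of U) (w k)\<bar> * d \<le> (LINT t|lebesgue. \<bar>V t * U t * ?w t\<bar>) * d" using d by (intro mult_right_mono) auto
    also have "\<dots> = (LINT t|lebesgue. \<bar>V t * U t * ?w t\<bar> * d)" by simp
    also have "\<dots> \<le> (LINT t|lebesgue. 2 * (level_weight k t * (?w' t)\<^sup>2))"
    proof (rule integral_mono)
      show "integrable lebesgue (\<lambda>t. \<bar>V t * U t * ?w t\<bar> * d)" using i by auto
      show "integrable lebesgue (\<lambda>t. 2 * (level_weight k t * (?w' t)\<^sup>2))" using iS by auto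
      fix t
      show "\<bar>V t * U t * ?w t\<bar> * d \<le> 2 * (level_weight k t * (?w' t)\<^sup>2)"
      proof (cases "U t > k * \<psi> t")
        case True
        note q = pw[OF True]
        have "\<bar>V t * U t * ?w t\<bar> * d = \<bar>V t\<bar> * ((d * U t) * ?w t)" using q by (simp add: abs_mult mult_ac)
        also have "\<dots> \<le> \<bar>V t\<bar> * ((2 * ?w' t) * ?w' t)" using q by (intro mult_left_mono mult_mono[OF q(5) q(1)]) auto
        also have "\<dots> \<le> (1 + \<bar>V t\<bar>) * ((2 * ?w' t) * ?w' t)" using q by (intro mult_right_mono) auto
        finally show ?thesis using True by (simp add: level_weight_def power2_eq_square mult_ac)
      qed (simp add: trunc_def level_weight_def)
    qed
    also have "\<dots> = 2 * level_energy k' k" by (simp add: level_energy_def)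
    finally show ?thesis .
  qed
  have dS: "level_energy k' k \<le> level_energy k' k / d\<^sup>2" "level_energy k' k / d \<le> level_energy k' k / d\<^sup>2"
  proof -
    have "d\<^sup>2 \<le> 1" using d by (simp add: power_le_one)
    then show "level_energy k' k \<le> level_energy k' k / d\<^sup>2" using S0 d by (simp add: pos_le_divide_eq mult_left_le)
    have "d\<^sup>2 \<le> d" using d by (simp add: power2_eq_square mult_left_le)
    then show "level_energy k' k / d \<le> level_energy k' k / d\<^sup>2" using S0 d by (intro divide_left_mono) auto
  qed
  have S3': "\<bar>vf (l2_of U) (w k)\<bar> \<le> 2 * (level_energy k' k / d)" using S3 d by (simp add: pos_le_divide_eq)
  have "gf (l2_of U) (w k) = - vf (l2_of U) (w k)" using weak[OF wd(1)] by (simp add: qf_def)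
  then have "gf (w k) (w k) / 2 - 4 * N * (norm (level_barrier k))\<^sup>2 \<le> \<bar>vf (l2_of U) (w k)\<bar>"
    using trunc_gf[OF k0 k(3)] by (simp add: N_def)
  moreover have "4 * N * (norm (level_barrier k))\<^sup>2 \<le> 4 * N * (level_energy k' k / d\<^sup>2)" using S2 N by (intro mult_left_mono) auto
  ultimately have "gf (w k) (w k) \<le> 8 * N * (level_energy k' k / d\<^sup>2) + 4 * (level_energy k' k / d\<^sup>2)" using S3' dS(2) by linarith
  moreover have "(norm (w k))\<^sup>2 \<le> level_energy k' k / d\<^sup>2" using S1 dS(1) by linarith
  \<comment> \<open>The gradient contributes 8 N + 4 and the L2 norm 1. As N >= 1, the 5 is at most
    9 N, and the total is 17 N.\<close>
  moreover have "5 * (level_energy k' k / d\<^sup>2) \<le> 9 * N * (level_energy k' k / d\<^sup>2)" using N S0 by (intro mult_right_mono) auto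
  ultimately have "h1sq (w k) \<le> 17 * N * (level_energy k' k / d\<^sup>2)" unfolding h1sq_def by linarith
  then show ?thesis by (simp add: N_def)
qed

definition level_volume :: "real \<Rightarrow> real" where "level_volume k = (LINT t|lebesgue. indicator (lvl \<psi> U k) t)"

text \<open>Chebyshev's inequality: above level k the truncation at k' is at least (k - k')
  \<epsilon>.\<close>

lemma level_measure:
  assumes k: "0 \<le> k'" "k' < k"
  shows "integrable lebesgue (indicator (lvl \<psi> U k) :: _ \<Rightarrow> real)" "level_volume k \<le> h1sq (w k') / ((k - k') * \<epsilon>)\<^sup>2"
proof -
  define c where "c = ((k - k') * \<epsilon>)\<^sup>2"
  have c: "c > 0" using k \<epsilon> by (simp add: c_def)
  have wL: "trunc \<psi> U k' \<in> L2" using k by (intro trunc_L2) simp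
  have i: "integrable lebesgue (\<lambda>t. (trunc \<psi> U k' t)\<^sup>2 / c)" using wL by (simp add: L2_def)
  have pt: "indicator (lvl \<psi> U k) t \<le> (trunc \<psi> U k' t)\<^sup>2 / c" for t
  proof (cases "U t > k * \<psi> t")
    case True
    have "(k - k') * \<epsilon> \<le> (k - k') * \<psi> t" using k \<psi>_ge[of t] by (intro mult_left_mono) auto
    also have "\<dots> \<le> trunc \<psi> U k' t" using True by (simp add: trunc_def left_diff_distrib)
    finally have "c \<le> (trunc \<psi> U k' t)\<^sup>2" unfolding c_def using k \<epsilon> by (intro power_mono) auto
    then show ?thesis using c True by (simp add: lvl_def pos_le_divide_eq)
  qed (use c in \<open>simp add: lvl_def\<close>)
  show I: "integrable lebesgue (indicator (lvl \<psi> U k) :: _ \<Rightarrow> real)"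
    by (rule Bochner_Integration.integrable_bound[OF i]) (use pt c in auto)
  have "level_volume k \<le> (LINT t|lebesgue. (trunc \<psi> U k' t)\<^sup>2 / c)" unfolding level_volume_def by (rule integral_mono[OF I i pt])
  also have "\<dots> = (norm (w k'))\<^sup>2 / c" by (simp add: norm_l2_of_sq[OF wL])
  also have "\<dots> \<le> h1sq (w k') / c" using c gf_nonneg[of "w k'"] by (intro divide_right_mono) (auto simp: h1sq_def)
  finally show "level_volume k \<le> h1sq (w k') / ((k - k') * \<epsilon>)\<^sup>2" by (simp add: c_def)
qed

end

text \<open>\<open>mid_exp\<close> lies strictly between \<open>max 1 (N / 2)\<close> and \<open>p\<close>; the room below \<open>p\<close> yields a power of the
  measure of the level set.\<close>

context kr_potential
begin

definition mid_exp :: real where "mid_exp = (p + max 1 (real CARD('n) / 2)) / 2"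

lemma mid_exp: "mid_exp \<ge> 1" "2 * mid_exp > real CARD('n)" "mid_exp < p" "mid_exp > 0"
  using p2 pN by (auto simp: mid_exp_def max_def)

definition gain :: real where "gain = 1 / mid_exp - 1 / p"

lemma gain_pos: "gain > 0"
  using mid_exp p2 by (simp add: gain_def frac_less2)

definition gconst :: real where
  "gconst = (mconst CARD('n) (2 * mid_exp) 1)\<^sup>2 * (1 + 2 powr p * ((1 + C2) powr p + \<Lambda>)) powr (1 / mid_exp) * 2 * real CARD('n)"

lemma gconst_nonneg: "gconst \<ge> 0"
  by (simp add: gconst_def)

text \<open>Splitting the weight at a height T, as in \<open>mult_avg_bound\<close>, makes its norm
  in L^\<open>mid_exp\<close> small with the measure of A. The form estimate at scale h = 1 with
  exponent \<open>mid_exp\<close> instead of p then gains a positive power of that measure.\<close>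

lemma level_gain:
  assumes [measurable]: "A \<in> sets lebesgue" and iA: "integrable lebesgue (indicator A :: real ^ 'n \<Rightarrow> real)"
    and mA: "(LINT t|lebesgue. indicator A t) \<le> \<alpha>" and \<alpha>: "0 < \<alpha>" "\<alpha> \<le> 1" and x: "x \<in> dom1"
  shows "(norm (mulop (\<lambda>t. sqrt (if t \<in> A then 1 + \<bar>V t\<bar> else 0)) x))\<^sup>2 \<le> gconst * \<alpha> powr gain * h1sq x"
proof -
  define W where "W t = (if t \<in> A then 1 + \<bar>V t\<bar> else 0)" for t
  have [measurable]: "W \<in> borel_measurable lebesgue" unfolding W_def by measurable
  \<comment> \<open>At this height T^\<open>mid_exp\<close> \<alpha> and T^(\<open>mid_exp\<close> -
    p) both equal \<alpha>^(1 - \<open>mid_exp\<close> / p) (\<open>Tp\<close>).\<close>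
  define T where "T = \<alpha> powr (- 1 / p)"
  have T: "T > 0" using \<alpha> by (simp add: T_def)
  define c0 where "c0 = 1 + C2"
  have c0: "c0 \<ge> 1" using C2 by (simp add: c0_def)
  define g where "g t = T powr mid_exp * indicator A t + T powr (mid_exp - p) * (2 powr p * (c0 powr p * indicator A t + \<bar>V1 t\<bar> powr p))" for t
  have gi: "integrable lebesgue g" unfolding g_def
    by (intro Bochner_Integration.integrable_add integrable_mult_right iA V1_integrable)
  have pt: "AE t in lebesgue. \<bar>W t\<bar> powr mid_exp \<le> g t"
    using V2_bounded
  proof eventually_elim
    case (elim t)
    show ?case
    proof (cases "t \<in> A")
      case True
      define y where "y = \<bar>W t\<bar>"
      have y: "y \<ge> 1" "y \<le> c0 + \<bar>V1 t\<bar>" using True elim by (auto simp: y_def W_def V_eq c0_def)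
      have "y powr mid_exp \<le> T powr mid_exp + T powr (mid_exp - p) * y powr p"
      proof (cases "y \<le> T")
        case True
        then show ?thesis using y T mid_exp by (intro add_increasing2 powr_mono2) auto
      next
        case False
        have "y powr mid_exp = y powr (mid_exp - p) * y powr p" using y by (simp add: powr_add[symmetric])
        also have "\<dots> \<le> T powr (mid_exp - p) * y powr p" using False T mid_exp by (intro mult_right_mono powr_mono2') auto
        finally show ?thesis by (simp add: add_increasing)
      qed
      also have "y powr p \<le> 2 powr p * (c0 powr p + \<bar>V1 t\<bar> powr p)"
      proof -
        have "y \<le> 2 * max c0 \<bar>V1 t\<bar>" using y by linarith
        then have "y powr p \<le> (2 * max c0 \<bar>V1 t\<bar>) powr p" using y p2 by (intro powr_mono2) auto
        also have "\<dots> = 2 powr p * (max c0 \<bar>V1 t\<bar>) powr p" using c0 by (intro powr_mult)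
        also have "(max c0 \<bar>V1 t\<bar>) powr p \<le> c0 powr p + \<bar>V1 t\<bar> powr p" by (auto simp: max_def)
        finally show ?thesis by simp
      qed
      finally show ?thesis using True T by (simp add: g_def y_def mult_left_mono)
    next
      case False
      then show ?thesis using T mid_exp by (simp add: W_def g_def)
    qed
  qed
  have Wi: "integrable lebesgue (\<lambda>t. \<bar>W t\<bar> powr mid_exp)"
    by (rule Bochner_Integration.integrable_bound[OF gi]) (use pt in \<open>auto elim!: eventually_mono intro: order_trans[OF _ abs_ge_self]\<close>)
  define L where "L = 1 + 2 powr p * (c0 powr p + \<Lambda>)"
  have L: "L > 0" using \<Lambda> by (simp add: L_def add_pos_nonneg)
  define \<Lambda>' where "\<Lambda>' = \<alpha> powr (1 - mid_exp / p) * L"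
  have \<Lambda>': "\<Lambda>' > 0" using \<alpha> L by (simp add: \<Lambda>'_def)
  have Tp: "T powr mid_exp * \<alpha> = \<alpha> powr (1 - mid_exp / p)" "T powr (mid_exp - p) = \<alpha> powr (1 - mid_exp / p)"
  proof -
    have "T powr mid_exp * \<alpha> powr 1 = \<alpha> powr (- 1 / p * mid_exp + 1)" unfolding T_def powr_powr powr_add ..
    then show "T powr mid_exp * \<alpha> = \<alpha> powr (1 - mid_exp / p)" using \<alpha> by (simp add: add.commute)
    have "- 1 / p * (mid_exp - p) = 1 - mid_exp / p" using p2 by (simp add: field_simps)
    then show "T powr (mid_exp - p) = \<alpha> powr (1 - mid_exp / p)" unfolding T_def powr_powr by (rule arg_cong)
  qed
  have "(LINT t|lebesgue. \<bar>W t\<bar> powr mid_exp) \<le> (LINT t|lebesgue. g t)" by (rule integral_mono_AE[OF Wi gi pt])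
  also have "\<dots> = T powr mid_exp * (LINT t|lebesgue. indicator A t) + T powr (mid_exp - p) * (2 powr p * (c0 powr p * (LINT t|lebesgue. indicator A t) + (LINT t|lebesgue. \<bar>V1 t\<bar> powr p)))"
    unfolding g_def using iA V1_integrable by simp
  also have "\<dots> \<le> T powr mid_exp * \<alpha> + T powr (mid_exp - p) * (2 powr p * (c0 powr p * 1 + \<Lambda>))"
    using mA \<alpha> \<Lambda> by (intro add_mono mult_left_mono) auto
  also have "\<dots> = \<Lambda>'" unfolding Tp by (simp add: \<Lambda>'_def L_def distrib_left)
  finally have LW: "(LINT t|lebesgue. \<bar>W t\<bar> powr mid_exp) \<le> \<Lambda>'" .
  define m where "m = mconst CARD('n) (2 * mid_exp) 1"
  have m: "m > 0" unfolding m_def using mid_exp by (intro mconst_pos) auto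
  define K where "K = (\<Sum>i\<in>UNIV. norm (pd i x))"
  have WA: "\<bar>W t\<bar> = (if t \<in> A then 1 + \<bar>V t\<bar> else 0)" for t by (simp add: W_def)
  have "norm (mulop (\<lambda>t. sqrt \<bar>W t\<bar>) x) \<le> m * \<Lambda>' powr (1 / (2 * mid_exp)) * 1 powr (- real CARD('n) / (2 * mid_exp)) * (norm x + 1 * K)"
    unfolding m_def K_def by (rule Lp_form_estimate(2)[OF _ Wi mid_exp(1,2) LW \<Lambda>' x]) auto
  then have e: "norm (mulop (\<lambda>t. sqrt (if t \<in> A then 1 + \<bar>V t\<bar> else 0)) x) \<le> m * \<Lambda>' powr (1 / (2 * mid_exp)) * (norm x + K)"
    unfolding WA by simp
  then have "(norm (mulop (\<lambda>t. sqrt (if t \<in> A then 1 + \<bar>V t\<bar> else 0)) x))\<^sup>2 \<le> (m * \<Lambda>' powr (1 / (2 * mid_exp)) * (norm x + K))\<^sup>2"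
    by (rule power_mono) simp
  also have "\<dots> = m\<^sup>2 * \<Lambda>' powr (1 / mid_exp) * (norm x + K)\<^sup>2"
  proof -
    have "(\<Lambda>' powr (1 / (2 * mid_exp)))\<^sup>2 = \<Lambda>' powr (1 / mid_exp)" using \<Lambda>' mid_exp by (simp add: power2_eq_square flip: powr_add)
    then show ?thesis by (simp add: power_mult_distrib)
  qed
  also have "\<Lambda>' powr (1 / mid_exp) = \<alpha> powr gain * L powr (1 / mid_exp)"
  proof -
    have "\<Lambda>' powr (1 / mid_exp) = (\<alpha> powr (1 - mid_exp / p)) powr (1 / mid_exp) * L powr (1 / mid_exp)"
      unfolding \<Lambda>'_def using L by (intro powr_mult)
    moreover have "(1 - mid_exp / p) * (1 / mid_exp) = gain" using mid_exp p2 by (simp add: gain_def field_simps)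
    ultimately show ?thesis by (simp only: powr_powr)
  qed
  also have "(norm x + K)\<^sup>2 \<le> 2 * real CARD('n) * h1sq x"
  proof -
    have "(norm x + K)\<^sup>2 \<le> 2 * (norm x)\<^sup>2 + 2 * K\<^sup>2"
      using sum_squares_bound[of "norm x" K] unfolding power2_sum by linarith
    also have "K\<^sup>2 \<le> real CARD('n) * gf x x" unfolding K_def by (rule sum_norm_pd_sq)
    also have "(norm x)\<^sup>2 \<le> real CARD('n) * (norm x)\<^sup>2" using mult_right_mono[of 1 "real CARD('n)" "(norm x)\<^sup>2"] by (simp add: Suc_leI)
    finally show ?thesis by (simp add: h1sq_def distrib_left)
  qed
  finally show ?thesis using m \<alpha> L by (simp add: gconst_def m_def[symmetric] L_def[symmetric] c0_def[symmetric] mult_ac mult_left_mono)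
qed

end

context barrier_solution
begin

lemma level_energy_gain:
  assumes "0 < k'" "k' < k" "k \<le> 1" and \<alpha>: "h1sq (w k') / ((k - k') * \<epsilon>)\<^sup>2 \<le> \<alpha>" "0 < \<alpha>" "\<alpha> \<le> 1"
  shows "level_energy k' k \<le> gconst * \<alpha> powr gain * h1sq (w k')"
proof -
  have wL: "trunc \<psi> U k' \<in> L2" "w k' \<in> dom1" using assms by (auto intro: trunc_L2 trunc_dom1)
  note level_volume = level_measure[of k' k]
  have m: "(LINT t|lebesgue. indicator (lvl \<psi> U k) t) \<le> \<alpha>" using level_volume(2) \<alpha>(1) assms by (simp add: level_volume_def)
  have i: "integrable lebesgue (indicator (lvl \<psi> U k) :: _ \<Rightarrow> real)" using level_volume(1) assms by simp
  have eq: "(if t \<in> lvl \<psi> U k then 1 + \<bar>V t\<bar> else 0) = level_weight k t" for t by (simp add: lvl_def level_weight_def)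
  show ?thesis
    using level_gain[OF lvl_measurable i m \<alpha>(2,3) wL(2), unfolded eq] unfolding level_weight_norm(2)[OF wL] level_energy_def[symmetric] .
qed

text \<open>The decay rate of the iteration. It is fixed by (4 rho)^gain = 1/4, so that the gain
  from shrinking level sets cancels the factor 4^j caused by shrinking gaps between levels.\<close>

definition rho :: real where "rho = (1 / 4) powr (1 / gain) / 4"

lemma rho: "rho > 0" "rho < 1" "(4 * rho) powr gain = 1 / 4" "4 * rho \<le> 1"
proof -
  have "(1 / 4 :: real) powr (1 / gain) \<le> 1 powr (1 / gain)" using gain_pos by (intro powr_mono2) auto
  then show "4 * rho \<le> 1" "rho < 1" by (simp_all add: rho_def)
  show "rho > 0" by (simp add: rho_def)
  show "(4 * rho) powr gain = 1 / 4" using gain_pos by (simp add: rho_def powr_powr)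
qed

text \<open>Stage j loses 64 * 4^j in \<open>energy_step\<close>, while Chebyshev bounds the measure
  of the next level set by h (4 rho)^j; the gain restores geometric decay with ratio rho. The
  truncation at level 1 lies below all the others and therefore vanishes.\<close>

lemma de_giorgi:
  assumes h: "0 < h" "h \<le> 1" and small: "17 * real CARD('n) * 64 * gconst * h powr gain \<le> rho"
    and base: "h1sq (w (3 / 4)) \<le> h * \<epsilon>\<^sup>2 / 64"
  shows "AE t in lebesgue. U t \<le> \<psi> t"
proof -
  \<comment> \<open>Normalised so that the quotient in Chebyshev's inequality at stage j is bounded
    exactly by h (4 rho)^j.\<close>
  define \<eta> where "\<eta> = h * \<epsilon>\<^sup>2 / 64"
  have \<eta>: "\<eta> > 0" using h \<epsilon> by (simp add: \<eta>_def)
  \<comment> \<open>Levels 1/2, 3/4, 7/8, ... The induction starts at \<open>lev 1\<close> = 3/4;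
    the level 1/2 is left for \<open>decay_upper\<close>, which obtains the starting bound from
    it.\<close>
  define lev :: "nat \<Rightarrow> real" where "lev j = 1 - 1 / 2 ^ (Suc j)" for j
  have lev: "0 < lev j" "lev j \<le> 1" "lev j < lev (Suc j)" for j
  proof -
    have "(1 :: real) \<le> 2 ^ j" by simp
    then have "(1 :: real) < 2 * 2 ^ j" by linarith
    then show "0 < lev j" "lev j \<le> 1" "lev j < lev (Suc j)" by (simp_all add: lev_def divide_simps)
  qed
  have decay: "h1sq (w (lev (Suc j))) \<le> \<eta> * rho ^ j" for j
  proof (induction j)
    case 0
    have "lev (Suc 0) = 3 / 4" by (simp add: lev_def)
    then show ?case using base by (simp only: \<eta>_def power_0 mult_1_right)
  next
    case (Suc j)
    let ?k' = "lev (Suc j)" and ?k = "lev (Suc (Suc j))"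
    define d where "d = ?k - ?k'"
    have d: "d = 1 / 2 ^ (j + 3)" by (simp add: d_def lev_def field_simps power_add)
    have d2: "d\<^sup>2 = 1 / (64 * 4 ^ j)"
    proof -
      have "(2 ^ (j + 3))\<^sup>2 = 64 * (4 ^ j :: real)"
        by (simp add: power_add power_mult_distrib power_mult[symmetric] mult.commute[of j 2]) (simp add: power_mult)
      then show ?thesis by (simp add: d power_divide)
    qed
    define \<alpha> where "\<alpha> = h * (4 * rho) ^ j"
    have "0 \<le> 4 * rho" using rho(1) by simp
    then have "(4 * rho) ^ j \<le> 1" using rho(4) by (rule power_le_one)
    moreover have "0 < (4 * rho) ^ j" using rho(1) by simp
    ultimately have \<alpha>: "0 < \<alpha>" "\<alpha> \<le> 1"
      unfolding \<alpha>_def using h by (simp, intro mult_le_one) auto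
    have "h1sq (w ?k') / (d * \<epsilon>)\<^sup>2 \<le> (\<eta> * rho ^ j) / (d * \<epsilon>)\<^sup>2" using Suc.IH by (intro divide_right_mono) auto
    also have "\<dots> = \<alpha>" using \<epsilon> by (simp add: power_mult_distrib d2 \<eta>_def \<alpha>_def field_simps)
    finally have a: "h1sq (w ?k') / ((?k - ?k') * \<epsilon>)\<^sup>2 \<le> \<alpha>" by (simp only: d_def)
    have "h1sq (w ?k) \<le> 17 * real CARD('n) / d\<^sup>2 * level_energy ?k' ?k"
      unfolding d_def by (rule energy_step[OF lev(1) lev(3) lev(2)])
    also have "\<dots> \<le> 17 * real CARD('n) / d\<^sup>2 * (gconst * \<alpha> powr gain * (\<eta> * rho ^ j))"
    proof (intro mult_left_mono)
      have "level_energy ?k' ?k \<le> gconst * \<alpha> powr gain * h1sq (w ?k')" by (rule level_energy_gain[OF lev(1) lev(3) lev(2) a \<alpha>])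
      also have "\<dots> \<le> gconst * \<alpha> powr gain * (\<eta> * rho ^ j)"
        using Suc.IH gconst_nonneg by (intro mult_left_mono) auto
      finally show "level_energy ?k' ?k \<le> gconst * \<alpha> powr gain * (\<eta> * rho ^ j)" .
    qed simp
    also have "\<alpha> powr gain = h powr gain * (1 / 4) ^ j"
    proof -
      have "\<alpha> powr gain = h powr gain * ((4 * rho) ^ j) powr gain" unfolding \<alpha>_def using h rho by (intro powr_mult)
      also have "((4 * rho) ^ j) powr gain = ((4 * rho) powr gain) ^ j"
      proof -
        have "(q ^ j) powr gain = (q powr gain) ^ j" if "q > 0" for q :: real
          using that by (simp add: powr_realpow[symmetric] powr_powr mult.commute)
        from this[of "4 * rho"] show ?thesis using rho(1) by (simp only: zero_less_mult_iff zero_less_numeral simp_thms)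
      qed
      finally show ?thesis by (simp only: rho(3))
    qed
    also have "17 * real CARD('n) / d\<^sup>2 * (gconst * (h powr gain * (1 / 4) ^ j) * (\<eta> * rho ^ j))
        = (17 * real CARD('n) * 64 * gconst * h powr gain) * (4 ^ j * (1 / 4) ^ j) * (\<eta> * rho ^ j)"
      unfolding d2 by (simp only: divide_divide_eq_right div_by_1 mult_ac)
    \<comment> \<open>The loss from the gaps and the gain from the measures cancel here, by the
      choice of \<open>rho\<close>.\<close>
    also have "4 ^ j * (1 / 4 :: real) ^ j = 1" by (simp flip: power_mult_distrib)
    also have "(17 * real CARD('n) * 64 * gconst * h powr gain) * 1 * (\<eta> * rho ^ j) \<le> rho * 1 * (\<eta> * rho ^ j)"
      using small \<eta> rho by (intro mult_right_mono) auto
    finally show ?case by (simp add: mult_ac)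
  qed
  have "norm (w 1) \<le> 0"
  proof -
    have le: "(norm (w 1))\<^sup>2 \<le> \<eta> * rho ^ j" for j
    proof -
      have "norm (w 1) \<le> norm (w (lev (Suc j)))"
      proof (rule l2_of_norm_mono)
        have "lev (Suc j) * \<psi> t \<le> 1 * \<psi> t" for t using lev(2)[of "Suc j"] \<psi>_pos[of t] by (intro mult_right_mono) auto
        then have "trunc \<psi> U 1 t \<le> trunc \<psi> U (lev (Suc j)) t" for t
          unfolding trunc_def by (intro max.mono diff_left_mono) auto
        then have "\<bar>trunc \<psi> U 1 t\<bar> \<le> \<bar>trunc \<psi> U (lev (Suc j)) t\<bar>" for t by (simp add: trunc_def)
        then show "AE t in lebesgue. \<bar>trunc \<psi> U 1 t\<bar> \<le> \<bar>trunc \<psi> U (lev (Suc j)) t\<bar>" by simp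
      qed (use lev(1)[of "Suc j"] in \<open>auto intro: trunc_L2\<close>)
      then have "(norm (w 1))\<^sup>2 \<le> (norm (w (lev (Suc j))))\<^sup>2" by (rule power_mono) simp
      also have "\<dots> \<le> h1sq (w (lev (Suc j)))" using gf_nonneg by (simp add: h1sq_def)
      finally show ?thesis using decay[of j] by linarith
    qed
    have "(\<lambda>j. \<eta> * rho ^ j) \<longlonglongrightarrow> \<eta> * 0" using rho by (intro tendsto_intros LIMSEQ_power_zero) auto
    then have "(norm (w 1))\<^sup>2 \<le> \<eta> * 0" by (rule LIMSEQ_le_const) (use le in auto)
    then show ?thesis by simp
  qed
  then have "w 1 = l2_of (\<lambda>t. 0)" by (simp add: l2_of_zero)
  then have "AE t in lebesgue. trunc \<psi> U 1 t = 0" using l2_of_eq_iff[OF trunc_L2[of 1] L2_zero] by simp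
  then show ?thesis by eventually_elim (auto simp: trunc_def max_def split: if_splits)
qed

end

text \<open>For exponents of size at most 1 the second order Taylor bound gives |exp(-r) - 1| <= 2
  |r|; this is the source of the 2 in the locale \<open>barrier\<close>.\<close>

lemma exp_barrier_lipschitz:
  fixes t h :: "real ^ 'n"
  assumes "norm h \<le> 1"
  shows "\<bar>exp (- norm (t + h)) - exp (- norm t)\<bar> \<le> 2 * norm h * exp (- norm t)"
proof -
  define r where "r = norm (t + h) - norm t"
  have r: "\<bar>r\<bar> \<le> norm h" using norm_triangle_ineq3[of "t + h" t] by (simp add: r_def)
  have "\<bar>exp (- r) - 1\<bar> \<le> 2 * \<bar>r\<bar>"
  proof (cases "r \<ge> 0")
    case True
    then show ?thesis using exp_ge_add_one_self[of "- r"] by simp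
  next
    case False
    have "exp (- r) \<le> 1 + (- r) + (- r)\<^sup>2" using False r assms by (intro exp_bound) auto
    also have "(- r)\<^sup>2 \<le> - r" using mult_left_le[of "- r" "- r"] False r assms by (simp only: power2_eq_square)
    finally show ?thesis using False by simp
  qed
  also have "\<dots> \<le> 2 * norm h" using r by simp
  finally have "\<bar>exp (- r) - 1\<bar> * exp (- norm t) \<le> 2 * norm h * exp (- norm t)" by (rule mult_right_mono) simp
  moreover have "exp (- norm (t + h)) - exp (- norm t) = (exp (- r) - 1) * exp (- norm t)"
    by (simp add: r_def left_diff_distrib flip: exp_add)
  ultimately show ?thesis by (simp add: abs_mult)
qed

context kr_potential
begin

text \<open>The barrier is \<open>\<epsilon> + n exp (- \<bar>t\<bar>)\<close>: it tends to \<open>\<epsilon>\<close> at infinity, and for large \<open>n\<close> the first truncation is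
  small by dominated convergence, so that the iteration starts.\<close>

lemma decay_upper:
  assumes U: "U \<in> L2" "l2_of U \<in> dom1" and weak: "\<And>\<phi>. \<phi> \<in> dom1 \<Longrightarrow> qf (l2_of U) \<phi> = 0" and \<epsilon>: "\<epsilon> > 0"
  shows "\<exists>R. AE t in lebesgue. norm t \<ge> R \<longrightarrow> U t < \<epsilon>"
proof -
  \<comment> \<open>Far out the barrier e + n exp(-|t|) is at most 2 e = \<epsilon> / 2, strictly
    below \<epsilon>.\<close>
  define e where "e = \<epsilon> / 4"
  have e: "e > 0" using \<epsilon> by (simp add: e_def)
  have [measurable]: "U \<in> borel_measurable lebesgue" using U(1) by (rule L2_measurable)
  define \<psi> where "\<psi> n t = e + real n * exp (- norm t)" for n and t :: "real ^ 'n"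
  have bs: "barrier_solution V V1 V2 p C2 (\<psi> n) U e" for n
  proof (intro barrier_solution.intro barrier.intro barrier_solution_axioms.intro)
    show "kr_potential V V1 V2 p C2" by unfold_locales
    show "continuous_on UNIV (\<psi> n)" unfolding \<psi>_def by (intro continuous_intros)
    show "e \<le> \<psi> n t" for t by (simp add: \<psi>_def)
    show "\<bar>\<psi> n (t + h) - \<psi> n t\<bar> \<le> 2 * norm h * \<psi> n t" if "norm h \<le> 1" for t h
    proof -
      have "\<psi> n (t + h) - \<psi> n t = real n * (exp (- norm (t + h)) - exp (- norm t))" by (simp add: \<psi>_def right_diff_distrib)
      then have "\<bar>\<psi> n (t + h) - \<psi> n t\<bar> = real n * \<bar>exp (- norm (t + h)) - exp (- norm t)\<bar>" by (simp add: abs_mult)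
      also have "\<dots> \<le> real n * (2 * norm h * exp (- norm t))" by (intro mult_left_mono exp_barrier_lipschitz that) simp
      also have "\<dots> \<le> 2 * norm h * \<psi> n t" using e by (simp add: \<psi>_def distrib_left mult_ac)
      finally show ?thesis .
    qed
  qed (use e U weak in auto)
  obtain h where h: "0 < h" "h \<le> 1" "17 * real CARD('n) * 64 * gconst * h powr gain \<le> (1 / 4) powr (1 / gain) / 4"
    using small_scale[OF gain_pos, of "(1 / 4) powr (1 / gain) / 4" "17 * real CARD('n) * 64 * gconst"] gconst_nonneg by auto
  \<comment> \<open>The weight 1 + |V| is kept on the whole space here. This integral dominates the
    level energy between 1/2 and 3/4 and tends to 0 as the barrier rises.\<close>
  define D where "D n = (LINT t|lebesgue. (1 + \<bar>V t\<bar>) * (trunc (\<psi> n) U (1/2) t)\<^sup>2)" for n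
  have VU: "integrable lebesgue (\<lambda>t. (1 + \<bar>V t\<bar>) * (U t)\<^sup>2)"
  proof -
    have "(\<lambda>t. sqrt \<bar>V t\<bar> * U t) \<in> L2" using mul_dom_iff(1)[OF U(1), of "\<lambda>t. sqrt \<bar>V t\<bar>"] V_sqrt_dom[OF U(2)] by blast
    then have "integrable lebesgue (\<lambda>t. (sqrt \<bar>V t\<bar> * U t)\<^sup>2)" by (simp add: L2_def)
    then have "integrable lebesgue (\<lambda>t. \<bar>V t\<bar> * (U t)\<^sup>2)" by (simp add: power_mult_distrib)
    moreover have "integrable lebesgue (\<lambda>t. (U t)\<^sup>2)" using U(1) by (simp add: L2_def)
    ultimately show ?thesis by (simp add: distrib_right)
  qed
  have meas: "(\<lambda>t. (1 + \<bar>V t\<bar>) * (trunc (\<psi> n) U (1/2) t)\<^sup>2) \<in> borel_measurable lebesgue" for n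
    using barrier.trunc_measurable[OF barrier_solution.axioms(2)[OF bs[of n]], of "1/2"] by measurable
  have tl: "(trunc (\<psi> n) U (1/2) t)\<^sup>2 \<le> (U t)\<^sup>2" for n t
    using barrier.trunc_le[OF barrier_solution.axioms(2)[OF bs[of n]], of "1/2" t] by (simp add: abs_le_square_iff)
  have Ddom: "(1 + \<bar>V t\<bar>) * (trunc (\<psi> n) U (1/2) t)\<^sup>2 \<le> (1 + \<bar>V t\<bar>) * (U t)\<^sup>2" for n t
    using tl by (intro mult_left_mono) auto
  have Dint: "integrable lebesgue (\<lambda>t. (1 + \<bar>V t\<bar>) * (trunc (\<psi> n) U (1/2) t)\<^sup>2)" for n
    by (rule Bochner_Integration.integrable_bound[OF VU meas]) (use Ddom in simp)
  have "D \<longlonglongrightarrow> (LINT t|(lebesgue :: (real^'n) measure). 0)"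
    unfolding D_def
  proof (rule integral_dominated_convergence[OF _ meas VU])
    show "AE t in lebesgue. (\<lambda>n. (1 + \<bar>V t\<bar>) * (trunc (\<psi> n) U (1/2) t)\<^sup>2) \<longlonglongrightarrow> 0"
    proof (intro AE_I2 tendsto_eventually)
      fix t :: "real ^ 'n"
      \<comment> \<open>At a fixed point the barrier eventually exceeds 2 |U t|, so the truncation
        at level 1/2 is eventually 0 there.\<close>
      obtain n0 :: nat where n0: "2 * \<bar>U t\<bar> * exp (norm t) \<le> real n0" using real_arch_simple by blast
      have "trunc (\<psi> n) U (1/2) t = 0" if "n \<ge> n0" for n
      proof -
        have "2 * \<bar>U t\<bar> * exp (norm t) \<le> real n" using n0 that by linarith
        then have "2 * \<bar>U t\<bar> \<le> real n * exp (- norm t)" by (simp add: exp_minus field_simps)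
        then have "U t \<le> 1/2 * \<psi> n t" using e by (simp add: \<psi>_def)
        then show ?thesis by (simp add: trunc_def)
      qed
      then show "\<forall>\<^sub>F n in sequentially. (1 + \<bar>V t\<bar>) * (trunc (\<psi> n) U (1/2) t)\<^sup>2 = 0"
        unfolding eventually_sequentially by (intro exI[of _ n0]) simp
    qed
    show "AE t in lebesgue. norm ((1 + \<bar>V t\<bar>) * (trunc (\<psi> n) U (1/2) t)\<^sup>2) \<le> (1 + \<bar>V t\<bar>) * (U t)\<^sup>2" for n
      using Ddom by simp
  qed simp
  then have "D \<longlonglongrightarrow> 0" by simp
  moreover have "h * e\<^sup>2 / 64 / (272 * real CARD('n)) > 0" using h e by simp
  ultimately obtain n where n: "D n < h * e\<^sup>2 / 64 / (272 * real CARD('n))"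
    using order_tendstoD(2)[of D 0 sequentially] eventually_sequentially by (metis order_refl)
  interpret B: barrier_solution V V1 V2 p C2 "\<psi> n" U e by (rule bs)
  have SD: "B.level_energy (1/2) (3/4) \<le> D n" unfolding B.level_energy_def D_def
  proof (rule integral_mono[OF _ Dint])
    show "integrable lebesgue (\<lambda>t. B.level_weight (3/4) t * (trunc (\<psi> n) U (1/2) t)\<^sup>2)"
      by (rule B.level_weight_norm(1)) (auto intro: B.trunc_L2 B.trunc_dom1)
    show "B.level_weight (3/4) t * (trunc (\<psi> n) U (1/2) t)\<^sup>2 \<le> (1 + \<bar>V t\<bar>) * (trunc (\<psi> n) U (1/2) t)\<^sup>2" for t
      by (intro mult_right_mono) (auto simp: B.level_weight_def)
  qed
  have "h1sq (B.w (3/4)) \<le> 17 * real CARD('n) / (3/4 - 1/2)\<^sup>2 * B.level_energy (1/2) (3/4)" by (rule B.energy_step) auto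
  \<comment> \<open>272 = 17 / (3/4 - 1/2)^2, the constant anticipated in the choice of
    \<open>n\<close>.\<close>
  also have "\<dots> = 272 * real CARD('n) * B.level_energy (1/2) (3/4)" by (simp add: power2_eq_square)
  also have "\<dots> \<le> 272 * real CARD('n) * (h * e\<^sup>2 / 64 / (272 * real CARD('n)))" using SD n by (intro mult_left_mono) auto
  also have "\<dots> = h * e\<^sup>2 / 64" by simp
  finally have "AE t in lebesgue. U t \<le> \<psi> n t"
    by (intro B.de_giorgi[OF h(1,2)]) (use h(3) in \<open>simp_all add: B.rho_def\<close>)
  then have "AE t in lebesgue. norm t \<ge> real n / e \<longrightarrow> U t < \<epsilon>"
  proof eventually_elim
    case (elim t)
    show ?case
    proof
      assume "norm t \<ge> real n / e"
      \<comment> \<open>The crude bound exp r >= 1 + r already makes n exp(-|t|) <= e beyond the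
        radius n / e.\<close>
      then have "real n / e \<le> exp (norm t)" using exp_ge_add_one_self[of "norm t"] by linarith
      then have "real n * exp (- norm t) \<le> e" using e by (simp add: exp_minus field_simps)
      then show "U t < \<epsilon>" using elim e by (simp add: \<psi>_def e_def)
    qed
  qed
  then show ?thesis by blast
qed

lemma decay:
  assumes U: "U \<in> L2" "l2_of U \<in> dom1" and weak: "\<And>\<phi>. \<phi> \<in> dom1 \<Longrightarrow> qf (l2_of U) \<phi> = 0"
  shows "vanishes_at_infinity U"
  unfolding vanishes_at_infinity_def
proof (intro allI impI)
  fix \<epsilon> :: real assume \<epsilon>: "\<epsilon> > 0"
  have m: "(\<lambda>t. - U t) \<in> L2" "l2_of (\<lambda>t. - U t) = (-1) *\<^sub>R l2_of U" using U by (simp_all add: L2_uminus l2_of_uminus)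
  obtain R where R: "AE t in lebesgue. norm t \<ge> R \<longrightarrow> U t < \<epsilon>" using decay_upper[OF U weak \<epsilon>] by blast
  obtain R' where R': "AE t in lebesgue. norm t \<ge> R' \<longrightarrow> - U t < \<epsilon>"
    using decay_upper[OF m(1) _ _ \<epsilon>] dom1_scale[OF U(2), of "-1"] qf_scale[OF U(2), of _ "-1"] weak unfolding m(2) by auto
  have "AE t in lebesgue. norm t \<ge> max R R' \<longrightarrow> \<bar>U t\<bar> < \<epsilon>" using R R' by eventually_elim auto
  then show "\<exists>R. AE t in lebesgue. R \<le> norm t \<longrightarrow> \<bar>U t\<bar> < \<epsilon>" by blast
qed

text \<open>V - c is again a Kato-Rellich potential, with c absorbed into the bounded part, and the
  equation becomes homogeneous for it.\<close>

lemma decay_perturbed: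
  assumes U: "U \<in> L2" "l2_of U \<in> dom1" and [measurable]: "c \<in> borel_measurable lebesgue" and c: "\<And>t. \<bar>c t\<bar> \<le> B"
    and weak: "\<And>\<phi>. \<phi> \<in> dom1 \<Longrightarrow> qf (l2_of U) \<phi> = (LINT t|lebesgue. c t * rep (l2_of U) t * rep \<phi> t)"
  shows "vanishes_at_infinity U"
proof -
  have B: "B \<ge> 0" using order_trans[OF abs_ge_zero c] .
  interpret W: kr_potential "\<lambda>t. V t - c t" V1 "\<lambda>t. V2 t - c t" p "C2 + B"
  proof
    show "AE t in lebesgue. \<bar>V2 t - c t\<bar> \<le> C2 + B"
      using V2_bounded by eventually_elim (use c in \<open>auto intro: order_trans[OF abs_triangle_ineq4 add_mono]\<close>)
  qed (use p2 pN V1_integrable C2 B in \<open>auto simp: V_eq\<close>)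
  show ?thesis
  proof (rule W.decay[OF U])
    fix \<phi> :: "'n l2" assume \<phi>: "\<phi> \<in> dom1"
    have i: "integrable lebesgue (\<lambda>t. c t * rep (l2_of U) t * rep \<phi> t)"
      unfolding mult.assoc[of "c _"] using L2_integrable_mult[OF L2_mult_bounded[of "rep (l2_of U)" c B] rep_L2[of \<phi>]] c
      by (simp add: mult.assoc)
    have "W.vf (l2_of U) \<phi> = vf (l2_of U) \<phi> - (LINT t|lebesgue. c t * rep (l2_of U) t * rep \<phi> t)"
      unfolding W.vf_def vf_def using vf(1)[OF U(2) \<phi>] i by (simp add: left_diff_distrib)
    then show "W.qf (l2_of U) \<phi> = 0" using weak[OF \<phi>] by (simp add: W.qf_def qf_def)
  qed
qed

end

section \<open>Compactness\<close>

lemma LINT_abs_mult_le: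
  assumes "f \<in> L2" "g \<in> L2"
  shows "integrable lebesgue (\<lambda>t. \<bar>f t\<bar> * \<bar>g t\<bar>)" "(LINT t|lebesgue. \<bar>f t\<bar> * \<bar>g t\<bar>) \<le> norm (l2_of f) * norm (l2_of g)"
proof -
  note a = L2_abs[OF assms(1)] L2_abs[OF assms(2)]
  show "integrable lebesgue (\<lambda>t. \<bar>f t\<bar> * \<bar>g t\<bar>)" by (rule L2_integrable_mult[OF a])
  have "(LINT t|lebesgue. \<bar>f t\<bar> * \<bar>g t\<bar>) = l2_of (\<lambda>t. \<bar>f t\<bar>) \<bullet> l2_of (\<lambda>t. \<bar>g t\<bar>)" by (rule inner_l2_of[OF a, symmetric])
  also have "\<dots> \<le> norm (l2_of (\<lambda>t. \<bar>f t\<bar>)) * norm (l2_of (\<lambda>t. \<bar>g t\<bar>))" by (rule norm_cauchy_schwarz)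
  also have "\<dots> \<le> norm (l2_of f) * norm (l2_of g)"
    by (intro mult_mono l2_of_norm_mono assms a) auto
  finally show "(LINT t|lebesgue. \<bar>f t\<bar> * \<bar>g t\<bar>) \<le> norm (l2_of f) * norm (l2_of g)" .
qed

lemma norm_le_grl: "norm x \<le> norm (grl 1 x)" "norm (pd i x) \<le> norm (grl 1 x)"
proof -
  have g: "(norm (grl 1 x))\<^sup>2 = (norm x)\<^sup>2 + gf x x" using norm_grl[of 1 x] by simp
  show "norm x \<le> norm (grl 1 x)" by (rule power2_le_imp_le) (use g gf_nonneg[of x] in auto)
  show "norm (pd i x) \<le> norm (grl 1 x)" by (rule power2_le_imp_le) (use g norm_pd_le[of i x] in \<open>auto intro: order_trans\<close>)
qed

lemma grl_diff: "x \<in> dom1 \<Longrightarrow> y \<in> dom1 \<Longrightarrow> grl \<kappa> (x - y) = grl \<kappa> x - grl \<kappa> y"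
  by (simp add: grl_def pd_diff scaleR_diff_right vec_eq_iff)

text \<open>At a fixed scale the averages of a weakly null sequence tend to 0 pointwise and are
  uniformly bounded, so dominated convergence works on a ball. Outside a large ball the smallness
  comes from \<open>v\<close>.\<close>

lemma LINT_avg_weakly_null:
  fixes v :: "'n::finite l2"
  assumes w: "wconv w 0" "\<And>n. norm (w n) \<le> D" and h: "h > 0"
  shows "(\<lambda>n. LINT t|lebesgue. \<bar>rep v t\<bar> * \<bar>rep (avg h (w n)) t\<bar>) \<longlonglongrightarrow> 0"
proof (rule LIMSEQ_I)
  fix \<epsilon> :: real assume \<epsilon>: "\<epsilon> > 0"
  have D: "D \<ge> 0" using order_trans[OF norm_ge_zero w(2)] .
  define out where "out R t = (if norm t \<le> real R then 0 else rep v t)" for R :: nat and t :: "real ^ 'n"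
  define inn where "inn R t = indicator (cball 0 (real R)) t * rep v t" for R :: nat and t :: "real ^ 'n"
  have ball_sets: "cball 0 (real R) \<in> sets (lebesgue :: (real ^ 'n) measure)" for R
    by (rule fmeasurableD) simp
  have inn_meas [measurable]: "inn R \<in> borel_measurable lebesgue" for R
    unfolding inn_def by (intro borel_measurable_times borel_measurable_indicator ball_sets rep_measurable)
  have out_eq: "out R = (\<lambda>t. rep v t - inn R t)" for R by (auto simp: out_def inn_def fun_eq_iff indicator_def)
  have [measurable]: "out R \<in> borel_measurable lebesgue" for R unfolding out_eq by measurable
  have out_L2: "out R \<in> L2" for R by (rule L2_bound[OF rep_L2[of v]]) (auto simp: out_def)
  have "(\<lambda>R. l2_of (out R)) \<longlonglongrightarrow> l2_of (\<lambda>t. 0)"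
  proof (rule l2_dominated_convergence[OF L2_abs[OF rep_L2[of v]]])
    show "AE t in lebesgue. (\<lambda>R. out R t) \<longlonglongrightarrow> 0"
    proof (intro AE_I2 tendsto_eventually)
      fix t :: "real ^ 'n"
      obtain R0 :: nat where "norm t \<le> real R0" using real_arch_simple by blast
      then show "\<forall>\<^sub>F R in sequentially. out R t = 0"
        unfolding eventually_sequentially by (intro exI[of _ R0]) (auto simp: out_def)
    qed
  qed (auto simp: out_def)
  then have "(\<lambda>R. norm (l2_of (out R)) * D) \<longlonglongrightarrow> 0 * D"
    by (intro tendsto_intros) (simp add: l2_of_zero tendsto_norm_zero)
  then have "\<forall>\<^sub>F R in sequentially. norm (l2_of (out R)) * D < \<epsilon> / 2" using \<epsilon> by (intro order_tendstoD) auto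
  then obtain R where R: "norm (l2_of (out R)) * D < \<epsilon> / 2" by (auto simp: eventually_sequentially)
  have ball: "indicator (cball 0 (real R)) \<in> (L2 :: (real ^ 'n \<Rightarrow> real) set)"
  proof -
    have "integrable lebesgue (indicator (cball 0 (real R)) :: real ^ 'n \<Rightarrow> real)"
      unfolding lmeasurable_iff_integrable[symmetric] by simp
    moreover have "(indicator A t)\<^sup>2 = (indicator A t :: real)" for A and t :: "real ^ 'n" by (simp add: indicator_def)
    ultimately show ?thesis by (simp add: L2_def ball_sets)
  qed
  have inn_int: "integrable lebesgue (inn R)" unfolding inn_def by (rule L2_integrable_mult[OF ball rep_L2])
  \<comment> \<open>The value of an average at t is the inner product of \<open>w n\<close> with a
    fixed translated box, so weak convergence is pointwise convergence of the averages.\<close>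
  have ptw: "AE t in lebesgue. (\<lambda>n. rep (avg h (w n)) t) \<longlonglongrightarrow> 0"
  proof -
    have "AE t in lebesgue. \<forall>n. rep (avg h (w n)) t = (1 / (2 * h) ^ CARD('n)) * (box_l2 h \<bullet> tr t (w n))"
      unfolding AE_all_countable using rep_avg[OF h] by blast
    then show ?thesis
    proof eventually_elim
      case (elim t)
      have b: "box_l2 h \<bullet> tr t (w n) = w n \<bullet> tr (- t) (box_l2 h)" for n
        using inner_tr_left[of t "w n" "box_l2 h"] by (simp add: inner_commute)
      then have "(\<lambda>n. (1 / (2 * h) ^ CARD('n)) * (box_l2 h \<bullet> tr t (w n))) \<longlonglongrightarrow> (1 / (2 * h) ^ CARD('n)) * (0 \<bullet> tr (- t) (box_l2 h))"
        unfolding b by (intro tendsto_mult_left wconv_tendsto w)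
      then show ?case using elim by simp
    qed
  qed
  define S where "S = D / sqrt ((2 * h) ^ CARD('n))"
  have "(\<lambda>n. LINT t|lebesgue. \<bar>inn R t\<bar> * \<bar>rep (avg h (w n)) t\<bar>) \<longlonglongrightarrow> (LINT t|(lebesgue :: (real^'n) measure). 0)"
  proof (rule integral_dominated_convergence[where w = "\<lambda>t. \<bar>inn R t\<bar> * S"])
    show "AE t in lebesgue. (\<lambda>n. \<bar>inn R t\<bar> * \<bar>rep (avg h (w n)) t\<bar>) \<longlonglongrightarrow> 0"
      using ptw by eventually_elim (intro tendsto_mult_right_zero tendsto_rabs_zero)
    show "AE t in lebesgue. norm (\<bar>inn R t\<bar> * \<bar>rep (avg h (w n)) t\<bar>) \<le> \<bar>inn R t\<bar> * S" for n
      using avg_sup_bound[OF h, of "w n"]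
    proof eventually_elim
      case (elim t)
      have "\<bar>rep (avg h (w n)) t\<bar> \<le> S"
        by (rule order_trans[OF elim]) (use w(2)[of n] h in \<open>auto simp: S_def intro!: divide_right_mono\<close>)
      then show ?case by (simp add: mult_left_mono abs_mult)
    qed
  qed (use inn_int in auto)
  then have "(\<lambda>n. LINT t|lebesgue. \<bar>inn R t\<bar> * \<bar>rep (avg h (w n)) t\<bar>) \<longlonglongrightarrow> 0" by simp
  from order_tendstoD(2)[OF this, of "\<epsilon> / 2"] \<epsilon>
  obtain n0 where n0: "\<And>n. n \<ge> n0 \<Longrightarrow> (LINT t|lebesgue. \<bar>inn R t\<bar> * \<bar>rep (avg h (w n)) t\<bar>) < \<epsilon> / 2"
    by (auto simp: eventually_sequentially)
  have inn_L2: "inn R \<in> L2" by (rule L2_bound[OF rep_L2[of v]]) (auto simp: inn_def indicator_def)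
  show "\<exists>no. \<forall>n\<ge>no. norm ((LINT t|lebesgue. \<bar>rep v t\<bar> * \<bar>rep (avg h (w n)) t\<bar>) - 0) < \<epsilon>"
  proof (intro exI[of _ n0] allI impI)
    fix n assume n: "n \<ge> n0"
    have s: "\<bar>rep v t\<bar> * \<bar>y\<bar> = \<bar>inn R t\<bar> * \<bar>y\<bar> + \<bar>out R t\<bar> * \<bar>y\<bar>" for t y by (simp add: inn_def out_def indicator_def)
    have "(LINT t|lebesgue. \<bar>rep v t\<bar> * \<bar>rep (avg h (w n)) t\<bar>)
        = (LINT t|lebesgue. \<bar>inn R t\<bar> * \<bar>rep (avg h (w n)) t\<bar>) + (LINT t|lebesgue. \<bar>out R t\<bar> * \<bar>rep (avg h (w n)) t\<bar>)"
      unfolding s by (intro Bochner_Integration.integral_add LINT_abs_mult_le inn_L2 out_L2 rep_L2)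
    also have "(LINT t|lebesgue. \<bar>out R t\<bar> * \<bar>rep (avg h (w n)) t\<bar>) \<le> norm (l2_of (out R)) * norm (avg h (w n))"
      using LINT_abs_mult_le(2)[OF out_L2 rep_L2] by simp
    also have "\<dots> \<le> norm (l2_of (out R)) * D"
      using order_trans[OF norm_avg_le[OF h] w(2)] by (intro mult_left_mono) auto
    finally have "(LINT t|lebesgue. \<bar>rep v t\<bar> * \<bar>rep (avg h (w n)) t\<bar>) < \<epsilon>" using n0[OF n] R by linarith
    moreover have "(LINT t|lebesgue. \<bar>rep v t\<bar> * \<bar>rep (avg h (w n)) t\<bar>) \<ge> 0" by (intro integral_nonneg_AE) auto
    ultimately show "norm ((LINT t|lebesgue. \<bar>rep v t\<bar> * \<bar>rep (avg h (w n)) t\<bar>) - 0) < \<epsilon>" by simp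
  qed
qed

text \<open>Because of the absolute values, weak convergence in L2 does not suffice. A bounded
  gradient makes the averaging error small uniformly in n, a local compactness in the manner of
  Rellich.\<close>

lemma LINT_mult_weakly_null:
  fixes v :: "'n::finite l2"
  assumes w: "wconv w 0" "\<And>n. w n \<in> dom1" "\<And>n. norm (grl 1 (w n)) \<le> D"
  shows "(\<lambda>n. LINT t|lebesgue. \<bar>rep v t\<bar> * \<bar>rep (w n) t\<bar>) \<longlonglongrightarrow> 0"
proof (rule LIMSEQ_I)
  fix \<epsilon> :: real assume \<epsilon>: "\<epsilon> > 0"
  have D: "D \<ge> 0" using order_trans[OF norm_ge_zero w(3)] .
  \<comment> \<open>The averaging error is at most h N D; weighted with the norm of v it stays below
    \<epsilon> / 2. The 1 covers a vanishing product.\<close>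
  define h where "h = \<epsilon> / 2 / (norm v * (CARD('n) * D) + 1)"
  have d: "norm v * (CARD('n) * D) + 1 > 0" using D by (intro add_nonneg_pos) auto
  have h: "h > 0" using \<epsilon> d by (simp add: h_def)
  have hs: "norm v * (h * (CARD('n) * D)) \<le> \<epsilon> / 2"
  proof -
    have "norm v * (h * (CARD('n) * D)) \<le> h * (norm v * (CARD('n) * D) + 1)" using h by (simp add: distrib_left)
    also have "\<dots> = \<epsilon> / 2" unfolding h_def using d by (intro nonzero_eq_divide_eq[THEN iffD1, OF _ refl]) simp
    finally show ?thesis .
  qed
  have "norm (w n) \<le> D" for n using norm_le_grl(1) w(3) by (rule order_trans)
  from LINT_avg_weakly_null[OF w(1) this h] order_tendstoD(2)[of _ 0 sequentially "\<epsilon> / 2"] \<epsilon>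
  have "\<forall>\<^sub>F n in sequentially. (LINT t|lebesgue. \<bar>rep v t\<bar> * \<bar>rep (avg h (w n)) t\<bar>) < \<epsilon> / 2" by simp
  then obtain n0 where n0: "\<And>n. n \<ge> n0 \<Longrightarrow> (LINT t|lebesgue. \<bar>rep v t\<bar> * \<bar>rep (avg h (w n)) t\<bar>) < \<epsilon> / 2"
    by (auto simp: eventually_sequentially)
  show "\<exists>no. \<forall>n\<ge>no. norm ((LINT t|lebesgue. \<bar>rep v t\<bar> * \<bar>rep (w n) t\<bar>) - 0) < \<epsilon>"
  proof (intro exI[of _ n0] allI impI)
    fix n assume n: "n \<ge> n0"
    let ?a = "avg h (w n)" and ?d = "w n - avg h (w n)"
    note L = LINT_abs_mult_le[OF rep_L2 rep_L2]
    have "(LINT t|lebesgue. \<bar>rep v t\<bar> * \<bar>rep (w n) t\<bar>) \<le> (LINT t|lebesgue. \<bar>rep v t\<bar> * \<bar>rep ?a t\<bar> + \<bar>rep v t\<bar> * \<bar>rep ?d t\<bar>)"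
    proof (rule integral_mono_AE)
      show "AE t in lebesgue. \<bar>rep v t\<bar> * \<bar>rep (w n) t\<bar> \<le> \<bar>rep v t\<bar> * \<bar>rep ?a t\<bar> + \<bar>rep v t\<bar> * \<bar>rep ?d t\<bar>"
        using rep_diff[of "w n" ?a]
      proof eventually_elim
        case (elim t)
        have "\<bar>rep (w n) t\<bar> \<le> \<bar>rep ?a t\<bar> + \<bar>rep ?d t\<bar>" using elim by linarith
        then have "\<bar>rep v t\<bar> * \<bar>rep (w n) t\<bar> \<le> \<bar>rep v t\<bar> * (\<bar>rep ?a t\<bar> + \<bar>rep ?d t\<bar>)" by (intro mult_left_mono) auto
        then show ?case by (simp only: distrib_left)
      qed
    qed (intro L Bochner_Integration.integrable_add)+
    also have "\<dots> = (LINT t|lebesgue. \<bar>rep v t\<bar> * \<bar>rep ?a t\<bar>) + (LINT t|lebesgue. \<bar>rep v t\<bar> * \<bar>rep ?d t\<bar>)"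
      by (intro Bochner_Integration.integral_add L)
    also have "(LINT t|lebesgue. \<bar>rep v t\<bar> * \<bar>rep ?d t\<bar>) \<le> norm v * norm ?d" using L(2)[of v ?d] by simp
    also have "norm v * norm ?d \<le> norm v * (h * (CARD('n) * D))"
    proof (intro mult_left_mono)
      have "norm ?d \<le> h * (\<Sum>i\<in>UNIV. norm (pd i (w n)))" using avg_error_1[OF h w(2)] by (simp add: norm_minus_commute)
      also have "(\<Sum>i\<in>UNIV. norm (pd i (w n))) \<le> (\<Sum>i\<in>(UNIV :: 'n set). D)"
        using norm_le_grl(2) w(3) by (intro sum_mono) (rule order_trans)
      finally show "norm ?d \<le> h * (CARD('n) * D)" using h by simp
    qed simp
    finally have "(LINT t|lebesgue. \<bar>rep v t\<bar> * \<bar>rep (w n) t\<bar>) < \<epsilon>" using n0[OF n] hs by linarith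
    moreover have "(LINT t|lebesgue. \<bar>rep v t\<bar> * \<bar>rep (w n) t\<bar>) \<ge> 0" by (intro integral_nonneg_AE) auto
    ultimately show "norm ((LINT t|lebesgue. \<bar>rep v t\<bar> * \<bar>rep (w n) t\<bar>) - 0) < \<epsilon>" by simp
  qed
qed

text \<open>The component of the limit orthogonal to \<open>S\<close> pairs to 0 with the whole
  sequence, hence with the limit.\<close>

lemma wconv_closed_subspace:
  fixes S :: "'a::{real_inner, complete_space} set"
  assumes S: "subspace S" "closed S" and x: "\<And>n. x n \<in> S" "wconv x a"
  shows "a \<in> S"
proof -
  obtain p where p: "p \<in> S" "\<And>y. y \<in> S \<Longrightarrow> (a - p) \<bullet> y = 0" using orthogonal_projection_exists[OF S, of a] by blast
  have "(\<lambda>n. x n \<bullet> (a - p)) \<longlonglongrightarrow> a \<bullet> (a - p)" by (rule wconv_tendsto[OF x(2)])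
  moreover have "x n \<bullet> (a - p) = 0" for n using p(2)[OF x(1)] by (simp add: inner_commute)
  ultimately have "a \<bullet> (a - p) = 0" by (simp add: LIMSEQ_const_iff)
  moreover have "p \<bullet> (a - p) = 0" using p(2)[OF p(1)] by (simp add: inner_commute)
  ultimately have "(a - p) \<bullet> (a - p) = 0" by (simp add: inner_diff_left)
  then show ?thesis using p(1) by simp
qed

context kr_potential
begin

lemma qf_bounded:
  obtains K where "K \<ge> 0" "\<And>x y. x \<in> dom1 \<Longrightarrow> y \<in> dom1 \<Longrightarrow> \<bar>qf x y\<bar> \<le> K * (norm (grl 1 x) * norm (grl 1 y))"
proof -
  obtain C where C: "C \<ge> 0" "\<And>x. x \<in> dom1 \<Longrightarrow> (norm (mulop (\<lambda>t. sqrt \<bar>V t\<bar>) x))\<^sup>2 \<le> 1 * gf x x + C * (norm x)\<^sup>2"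
    using form_bound[of 1] zero_less_one by blast
  have s: "norm (sV x) \<le> (1 + C) * norm (grl 1 x)" if "x \<in> dom1" for x
  proof (rule power2_le_imp_le)
    have "(norm (sV x))\<^sup>2 \<le> gf x x + C * (norm x)\<^sup>2" using C(2)[OF that] by (simp add: sV_def)
    also have "\<dots> \<le> (1 + C) * ((norm x)\<^sup>2 + gf x x)" using C(1) gf_nonneg[of x] by (simp add: algebra_simps)
    also have "\<dots> \<le> (1 + C) * (1 + C) * ((norm x)\<^sup>2 + gf x x)"
      using C(1) gf_nonneg[of x] mult_right_mono[of 1 "1 + C" "1 + C"] by (intro mult_right_mono) auto
    also have "\<dots> = ((1 + C) * norm (grl 1 x))\<^sup>2" using norm_grl[of 1 x] by (simp add: power_mult_distrib power2_eq_square)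
    finally show "(norm (sV x))\<^sup>2 \<le> ((1 + C) * norm (grl 1 x))\<^sup>2" .
  qed (use C in auto)
  show thesis
  proof
    show "real CARD('n) + (1 + C) * (1 + C) \<ge> 0" using C by simp
    fix x y :: "'n l2" assume xy: "x \<in> dom1" "y \<in> dom1"
    have "\<bar>gf x y\<bar> \<le> (\<Sum>i\<in>UNIV. \<bar>pd i x \<bullet> pd i y\<bar>)" unfolding gf_def by (rule sum_abs)
    also have "\<dots> \<le> (\<Sum>i\<in>(UNIV :: 'n set). norm (grl 1 x) * norm (grl 1 y))"
      by (intro sum_mono order_trans[OF Cauchy_Schwarz_ineq2] mult_mono norm_le_grl) auto
    finally have 1: "\<bar>gf x y\<bar> \<le> real CARD('n) * (norm (grl 1 x) * norm (grl 1 y))" by simp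
    have "\<bar>vf x y\<bar> \<le> ((1 + C) * norm (grl 1 x)) * ((1 + C) * norm (grl 1 y))"
      by (rule order_trans[OF vf_bound[OF xy]]) (intro mult_mono s xy; use C in simp)
    then have 2: "\<bar>vf x y\<bar> \<le> (1 + C) * (1 + C) * (norm (grl 1 x) * norm (grl 1 y))" by (simp only: mult_ac)
    have "\<bar>qf x y\<bar> \<le> \<bar>gf x y\<bar> + \<bar>vf x y\<bar>" unfolding qf_def by (rule abs_triangle_ineq)
    also have "\<dots> \<le> (real CARD('n) + (1 + C) * (1 + C)) * (norm (grl 1 x) * norm (grl 1 y))"
      using add_mono[OF 1 2] by (simp only: distrib_right)
    finally show "\<bar>qf x y\<bar> \<le> (real CARD('n) + (1 + C) * (1 + C)) * (norm (grl 1 x) * norm (grl 1 y))" .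
  qed
qed

text \<open>The form in its second argument is a bounded functional on the graph of the gradient;
  Riesz represents it by a fixed vector, against which weak convergence applies.\<close>

lemma qf_weakly_null:
  assumes v: "v \<in> dom1" and w: "\<And>n. w n \<in> dom1" "wconv (\<lambda>n. grl 1 (w n)) 0"
  shows "(\<lambda>n. qf v (w n)) \<longlonglongrightarrow> 0"
proof -
  obtain K where "K \<ge> 0" and K: "\<And>x y. x \<in> dom1 \<Longrightarrow> y \<in> dom1 \<Longrightarrow> \<bar>qf x y\<bar> \<le> K * (norm (grl 1 x) * norm (grl 1 y))"
    using qf_bounded by blast
  have fg: "fst (grl 1 x) = x" for x :: "'n l2" by (simp add: grl_def)
  define S where "S = (grl 1 ` dom1 :: ('n l2 \<times> ('n l2 ^ 'n)) set)"
  have S: "subspace S" "closed S" unfolding S_def by (rule closed_grl, simp)+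
  have fS: "fst x \<in> dom1" "x = grl 1 (fst x)" if "x \<in> S" for x using that by (auto simp: S_def fg)
  obtain z where "z \<in> S" and z: "\<And>x. x \<in> S \<Longrightarrow> qf v (fst x) = z \<bullet> x"
  proof (rule riesz_subspace[OF S, of "\<lambda>x. qf v (fst x)" "K * norm (grl 1 v)"])
    show "qf v (fst (x + y)) = qf v (fst x) + qf v (fst y)" if "x \<in> S" "y \<in> S" for x y
      using qf_add[OF fS(1)[OF that(1)] fS(1)[OF that(2)] v] by (simp add: qf_commute[of v])
    show "qf v (fst (c *\<^sub>R x)) = c * qf v (fst x)" if "x \<in> S" for c x
      using qf_scale[OF fS(1)[OF that] v] by (simp add: qf_commute[of v])
    show "\<bar>qf v (fst x)\<bar> \<le> K * norm (grl 1 v) * norm x" if "x \<in> S" for x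
      using K[OF v fS(1)[OF that]] unfolding fS(2)[OF that, symmetric] by (simp only: mult.assoc)
  qed (rule that)
  have "qf v (w n) = grl 1 (w n) \<bullet> z" for n using z[of "grl 1 (w n)"] w(1) by (simp add: S_def fg inner_commute)
  then show ?thesis using wconv_tendsto[OF w(2), of z] by simp
qed

end

context kr_potential
begin

text \<open>The weak limit is subtracted; tested with the difference \<open>w\<close>, the equation gives \<open>qf w w \<le> M \<parallel>w\<parallel>\<^sup>2 + o(1)\<close>,
  whereas below the essential spectrum \<open>qf w w \<ge> \<mu>1 \<parallel>w\<parallel>\<^sup>2 - o(1)\<close> for weakly null sequences.\<close>

lemma compactness:
  assumes r: "\<And>\<mu>. \<mu> < \<mu>1 \<Longrightarrow> \<mu> \<notin> essential_spectrum H2 (schroedinger V)" and M: "M < \<mu>1"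
    and x: "\<And>n. x n \<in> dom1" "\<And>n. norm (grl 1 (x n)) \<le> D"
    and d: "\<And>n. d n \<in> borel_measurable lebesgue" "\<And>n t. d n t \<le> M" "\<And>n t. \<bar>d n t\<bar> \<le> B"
    and eq: "\<And>n \<phi>. \<phi> \<in> dom1 \<Longrightarrow> \<bar>qf (x n) \<phi> - (LINT t|lebesgue. d n t * rep (x n) t * rep \<phi> t)\<bar> \<le> e n * norm (grl 1 \<phi>)"
    and e: "e \<longlonglongrightarrow> 0"
  obtains k v where "strict_mono (k :: nat \<Rightarrow> nat)" "v \<in> dom1" "(\<lambda>n. norm (grl 1 (x (k n) - v))) \<longlonglongrightarrow> 0"
proof -
  have B: "B \<ge> 0" using order_trans[OF abs_ge_zero d(3)] .
  obtain k a where k: "strict_mono (k :: nat \<Rightarrow> nat)" and a: "wconv (\<lambda>n. grl 1 (x (k n))) a"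
    using weakly_convergent_subseq[of "\<lambda>n. grl 1 (x n)" D] x(2) by blast
  have "a \<in> grl 1 ` dom1"
    by (rule wconv_closed_subspace[OF closed_grl _ a]) (use x(1) in auto)
  \<comment> \<open>The graph is a closed subspace, so the weak limit is again the graph point of
    some \<open>v\<close>.\<close>
  then obtain v where v: "v \<in> dom1" "a = grl 1 v" by auto
  define w where "w n = x (k n) - v" for n
  define D' where "D' = D + norm (grl 1 v)"
  have w: "w n \<in> dom1" "norm (grl 1 (w n)) \<le> D'" for n
  proof -
    show "w n \<in> dom1" using x(1) v(1) by (simp add: w_def dom1_diff)
    have "norm (grl 1 (w n)) \<le> norm (grl 1 (x (k n))) + norm (grl 1 v)"
      unfolding w_def grl_diff[OF x(1) v(1)] by (rule norm_triangle_ineq4)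
    then show "norm (grl 1 (w n)) \<le> D'" using x(2)[of "k n"] by (simp add: D'_def)
  qed
  have wg: "wconv (\<lambda>n. grl 1 (w n)) 0"
    using wconv_diff[OF a] unfolding w_def grl_diff[OF x(1) v(1)] v(2) .
  have wn: "wconv w 0"
    unfolding wconv_def
  proof
    fix y :: "'n l2"
    have "grl 1 (w n) \<bullet> (y, 0) = w n \<bullet> y" for n by (simp add: grl_def inner_prod_def)
    then show "(\<lambda>n. w n \<bullet> y) \<longlonglongrightarrow> 0 \<bullet> y" using wconv_tendsto[OF wg, of "(y, 0)"] by simp
  qed
  have Bs: "Bseq w" using norm_le_grl(1) w(2) by (intro BseqI'[where K = D']) (rule order_trans)
  define I where "I n = (LINT t|lebesgue. \<bar>rep v t\<bar> * \<bar>rep (w n) t\<bar>)" for n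
  have I: "I \<longlonglongrightarrow> 0" unfolding I_def by (rule LINT_mult_weakly_null[OF wn w])
  \<comment> \<open>All error terms at once: the defect in the equation, the interaction of v and w
    through the coefficient, and the form between v and w.\<close>
  define \<alpha> where "\<alpha> n = \<bar>e (k n)\<bar> * D' + B * I n - qf v (w n)" for n
  have "(\<lambda>n. e (k n)) \<longlonglongrightarrow> 0" using LIMSEQ_subseq_LIMSEQ[OF e k] by (simp add: o_def)
  then have "\<alpha> \<longlonglongrightarrow> 0 * D' + B * 0 - 0"
    unfolding \<alpha>_def by (intro tendsto_intros tendsto_rabs_zero I qf_weakly_null[OF v(1) w(1) wg])
  then have \<alpha>: "\<alpha> \<longlonglongrightarrow> 0" by simp
  have up: "qf (w n) (w n) \<le> M * (norm (w n))\<^sup>2 + \<alpha> n" for n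
  proof -
    let ?d = "d (k n)" and ?x = "x (k n)"
    have i: "integrable lebesgue (\<lambda>t. ?d t * rep ?x t * rep (w n) t)"
      using L2_integrable_mult[OF L2_mult_bounded[OF rep_L2[of ?x] d(1)[of "k n"] AE_I2[OF d(3)]] rep_L2[of "w n"]] .
    have i2: "integrable lebesgue (\<lambda>t. M * (rep (w n) t)\<^sup>2)" using rep_L2[of "w n"] by (simp add: L2_def)
    have i3: "integrable lebesgue (\<lambda>t. B * (\<bar>rep v t\<bar> * \<bar>rep (w n) t\<bar>))"
      by (intro integrable_mult_right LINT_abs_mult_le rep_L2)
    have "(LINT t|lebesgue. ?d t * rep ?x t * rep (w n) t)
        \<le> (LINT t|lebesgue. M * (rep (w n) t)\<^sup>2 + B * (\<bar>rep v t\<bar> * \<bar>rep (w n) t\<bar>))"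
    proof (rule integral_mono_AE[OF i Bochner_Integration.integrable_add[OF i2 i3]])
      show "AE t in lebesgue. ?d t * rep ?x t * rep (w n) t \<le> M * (rep (w n) t)\<^sup>2 + B * (\<bar>rep v t\<bar> * \<bar>rep (w n) t\<bar>)"
        using rep_diff[of ?x v]
      proof eventually_elim
        case (elim t)
        \<comment> \<open>With x = w + v the one-sided bound d <= M is applied to the square only.
          The product v w has no sign, so it is estimated with |d| <= B.\<close>
        have "?d t * rep ?x t * rep (w n) t = ?d t * (rep (w n) t)\<^sup>2 + ?d t * (rep v t * rep (w n) t)"
          using elim unfolding w_def by (simp only: power2_eq_square) (simp add: algebra_simps)
        also have "?d t * (rep (w n) t)\<^sup>2 \<le> M * (rep (w n) t)\<^sup>2" using d(2) by (rule mult_right_mono) simp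
        also have "?d t * (rep v t * rep (w n) t) \<le> \<bar>?d t\<bar> * (\<bar>rep v t\<bar> * \<bar>rep (w n) t\<bar>)"
          by (simp only: abs_mult[symmetric] abs_ge_self)
        also have "\<dots> \<le> B * (\<bar>rep v t\<bar> * \<bar>rep (w n) t\<bar>)" using d(3) by (rule mult_right_mono) simp
        finally show ?case by simp
      qed
    qed
    also have "\<dots> = M * (norm (w n))\<^sup>2 + B * I n"
      using i2 i3 by (simp add: norm_l2_rep I_def)
    finally have 1: "(LINT t|lebesgue. ?d t * rep ?x t * rep (w n) t) \<le> M * (norm (w n))\<^sup>2 + B * I n" .
    have "qf (w n) (w n) = qf ?x (w n) - qf v (w n)" using qf_diff[OF x(1) v(1) w(1)] by (simp add: w_def)
    moreover have "qf ?x (w n) \<le> (LINT t|lebesgue. ?d t * rep ?x t * rep (w n) t) + e (k n) * norm (grl 1 (w n))"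
      using eq[OF w(1), of "k n" n] by linarith
    moreover have "e (k n) * norm (grl 1 (w n)) \<le> \<bar>e (k n)\<bar> * D'" using w(2) by (intro mult_mono) auto
    ultimately show ?thesis using 1 unfolding \<alpha>_def by linarith
  qed
  have n0: "(\<lambda>n. (norm (w n))\<^sup>2) \<longlonglongrightarrow> 0"
  proof (rule order_tendstoI)
    fix \<epsilon> :: real assume \<epsilon>: "0 < \<epsilon>"
    \<comment> \<open>The lower and upper bounds each contribute one \<delta>, so (\<mu>1 - M) |w|^2
      < 2 \<delta>.\<close>
    define \<delta> where "\<delta> = (\<mu>1 - M) * \<epsilon> / 2"
    have \<delta>: "\<delta> > 0" using M \<epsilon> by (simp add: \<delta>_def)
    have low: "\<forall>\<^sub>F n in sequentially. qf (w n) (w n) \<ge> \<mu>1 * (norm (w n))\<^sup>2 - \<delta>"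
      by (rule form_lower_weakly_null[OF _ w(1) wn Bs \<delta>]) (rule r)
    show "\<forall>\<^sub>F n in sequentially. (norm (w n))\<^sup>2 < \<epsilon>"
      using low order_tendstoD(2)[OF \<alpha> \<delta>]
    proof eventually_elim
      case (elim n)
      have "(\<mu>1 - M) * (norm (w n))\<^sup>2 < 2 * \<delta>" using elim up[of n] by (simp add: left_diff_distrib)
      also have "2 * \<delta> = (\<mu>1 - M) * \<epsilon>" by (simp add: \<delta>_def)
      finally show ?case using M by simp
    qed
  next
    fix \<epsilon> :: real assume "\<epsilon> < 0"
    then show "\<forall>\<^sub>F n in sequentially. \<epsilon> < (norm (w n))\<^sup>2" by (intro always_eventually allI) (rule less_le_trans, auto)
  qed
  \<comment> \<open>Convergence in L2 is upgraded to H1: the form controls half of the gradient up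
    to the L2 norm, and the form itself is bounded above by \<open>up\<close>.\<close>
  obtain C where C: "\<And>x. x \<in> dom1 \<Longrightarrow> gf x x / 2 - C * (norm x)\<^sup>2 \<le> qf x x" using qf_lower by blast
  have "(\<lambda>n. (norm (grl 1 (w n)))\<^sup>2) \<longlonglongrightarrow> 0"
  proof (rule tendsto_sandwich[where f = "\<lambda>n. 0"])
    show "\<forall>\<^sub>F n in sequentially. (norm (grl 1 (w n)))\<^sup>2 \<le> (1 + 2 * (M + C)) * (norm (w n))\<^sup>2 + 2 * \<alpha> n"
    proof (intro always_eventually allI)
      fix n
      have "gf (w n) (w n) \<le> 2 * (qf (w n) (w n) + C * (norm (w n))\<^sup>2)" using C[OF w(1), of n] by simp
      then show "(norm (grl 1 (w n)))\<^sup>2 \<le> (1 + 2 * (M + C)) * (norm (w n))\<^sup>2 + 2 * \<alpha> n"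
        using up[of n] norm_grl[of 1 "w n"] by (simp add: algebra_simps)
    qed
    have "(\<lambda>n. (1 + 2 * (M + C)) * (norm (w n))\<^sup>2 + 2 * \<alpha> n) \<longlonglongrightarrow> (1 + 2 * (M + C)) * 0 + 2 * 0"
      by (intro tendsto_intros n0 \<alpha>)
    then show "(\<lambda>n. (1 + 2 * (M + C)) * (norm (w n))\<^sup>2 + 2 * \<alpha> n) \<longlonglongrightarrow> 0" by simp
    show "(\<lambda>n. 0 :: real) \<longlonglongrightarrow> 0" by simp
    show "\<forall>\<^sub>F n in sequentially. 0 \<le> (norm (grl 1 (w n)))\<^sup>2" by simp
  qed
  then have "(\<lambda>n. sqrt ((norm (grl 1 (w n)))\<^sup>2)) \<longlonglongrightarrow> sqrt 0" by (rule tendsto_real_sqrt)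
  then have "(\<lambda>n. norm (grl 1 (x (k n) - v))) \<longlonglongrightarrow> 0" by (simp add: w_def)
  then show thesis by (intro that[OF k v(1)])
qed

end

section \<open>The energy functional\<close>

text \<open>The argument u is rounded down to a grid of mesh 1 / (n + 1). The composite with
  countably many values is measurable, and continuity in the second variable gives the
  limit.\<close>

lemma caratheodory_measurable:
  fixes G :: "'a \<Rightarrow> real \<Rightarrow> real"
  assumes G: "\<And>s. (\<lambda>x. G x s) \<in> borel_measurable M" and cont: "\<And>x. continuous_on UNIV (G x)"
    and u[measurable]: "u \<in> borel_measurable M"
  shows "(\<lambda>x. G x (u x)) \<in> borel_measurable M"
proof (rule borel_measurable_LIMSEQ_real)
  show "(\<lambda>x. G x (real_of_int \<lfloor>real (Suc n) * u x\<rfloor> / real (Suc n))) \<in> borel_measurable M" for n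
  proof -
    have "(\<lambda>x. \<lfloor>real (Suc n) * u x\<rfloor>) \<in> measurable M (count_space UNIV)" by measurable
    then show ?thesis by (rule measurable_compose_countable[OF G])
  qed
  fix x
  have "(\<lambda>n. real_of_int \<lfloor>real (Suc n) * u x\<rfloor> / real (Suc n)) \<longlonglongrightarrow> u x"
  proof (rule tendsto_sandwich)
    show "\<forall>\<^sub>F n in sequentially. u x - 1 / real (Suc n) \<le> real_of_int \<lfloor>real (Suc n) * u x\<rfloor> / real (Suc n)"
    proof (intro always_eventually allI)
      fix n
      have "(real (Suc n) * u x - 1) / real (Suc n) \<le> real_of_int \<lfloor>real (Suc n) * u x\<rfloor> / real (Suc n)"
        by (intro divide_right_mono) linarith+
      then show "u x - 1 / real (Suc n) \<le> real_of_int \<lfloor>real (Suc n) * u x\<rfloor> / real (Suc n)" by (simp add: diff_divide_distrib)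
    qed
    show "\<forall>\<^sub>F n in sequentially. real_of_int \<lfloor>real (Suc n) * u x\<rfloor> / real (Suc n) \<le> u x"
    proof (intro always_eventually allI)
      fix n
      have "real_of_int \<lfloor>real (Suc n) * u x\<rfloor> / real (Suc n) \<le> (real (Suc n) * u x) / real (Suc n)"
        by (intro divide_right_mono) linarith+
      then show "real_of_int \<lfloor>real (Suc n) * u x\<rfloor> / real (Suc n) \<le> u x" by simp
    qed
    have "(\<lambda>n. u x - 1 / real (Suc n)) \<longlonglongrightarrow> u x - 0"
      using lim_1_over_n LIMSEQ_Suc by (intro tendsto_diff tendsto_const) (fastforce simp: inverse_eq_divide)
    then show "(\<lambda>n. u x - 1 / real (Suc n)) \<longlonglongrightarrow> u x" by simp
  qed simp
  then show "(\<lambda>n. G x (real_of_int \<lfloor>real (Suc n) * u x\<rfloor> / real (Suc n))) \<longlonglongrightarrow> G x (u x)"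
    by (rule continuous_on_tendsto_compose[OF cont]) simp_all
qed

lemma lipschitz_continuous:
  fixes g :: "real \<Rightarrow> real"
  assumes lip: "\<And>s t. \<bar>g s - g t\<bar> \<le> L * \<bar>s - t\<bar>"
  shows "continuous_on UNIV g"
proof -
  have "L \<ge> 0" using order_trans[OF abs_ge_zero lip[of 1 0]] by simp
  then have "L-lipschitz_on UNIV g" using lip by (intro lipschitz_onI) (auto simp: dist_real_def)
  then show ?thesis by (rule lipschitz_on_continuous_on)
qed

lemma primitive_deriv:
  fixes f :: "real ^ 'n \<Rightarrow> real \<Rightarrow> real"
  assumes "continuous_on UNIV (f x)"
  shows "(primitive f x has_real_derivative f x t) (at t)"
proof -
  define B where "B = \<bar>t\<bar> + 1"
  have "((\<lambda>u. LBINT y=ereal 0..ereal u. f x y) has_vector_derivative (f x t)) (at t within {-B..B})"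
    by (rule interval_integral_FTC2) (use assms in \<open>auto simp: B_def intro: continuous_on_subset\<close>)
  then have "(primitive f x has_real_derivative f x t) (at t within {-B..B})"
    unfolding primitive_def[abs_def] has_real_derivative_iff_has_vector_derivative .
  moreover have "at t within {-B..B} = at t" by (rule at_within_interior) (simp add: B_def abs_if)
  ultimately show ?thesis by simp
qed

text \<open>Mean value theorem for the primitive minus its tangent; the derivative of this
  difference is an increment of f, controlled by the Lipschitz condition.\<close>

lemma primitive_taylor:
  fixes f :: "real ^ 'n \<Rightarrow> real \<Rightarrow> real"
  assumes lip: "\<And>s t. \<bar>f x s - f x t\<bar> \<le> L * \<bar>s - t\<bar>"
  shows "\<bar>primitive f x t - primitive f x s - f x s * (t - s)\<bar> \<le> L * (t - s)\<^sup>2"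
proof (cases "s = t")
  case False
  have L: "L \<ge> 0" using order_trans[OF abs_ge_zero lip[of 1 0]] by simp
  have d: "((\<lambda>t. primitive f x t - f x s * t) has_real_derivative (f x \<xi> - f x s)) (at \<xi>)" for \<xi>
    by (auto intro!: derivative_eq_intros primitive_deriv lipschitz_continuous[OF lip])
  obtain \<xi> where \<xi>: "\<bar>\<xi> - s\<bar> \<le> \<bar>t - s\<bar>"
    "(primitive f x t - f x s * t) - (primitive f x s - f x s * s) = (t - s) * (f x \<xi> - f x s)"
  proof (cases "s < t")
    case True
    from MVT2[OF this, of "\<lambda>t. primitive f x t - f x s * t" "\<lambda>\<xi>. f x \<xi> - f x s"] d
    obtain \<xi> where "s < \<xi>" "\<xi> < t" "(primitive f x t - f x s * t) - (primitive f x s - f x s * s) = (t - s) * (f x \<xi> - f x s)"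
      by blast
    then show thesis by (intro that[of \<xi>]) auto
  next
    case F: False
    then have "t < s" using False by simp
    from MVT2[OF this, of "\<lambda>t. primitive f x t - f x s * t" "\<lambda>\<xi>. f x \<xi> - f x s"] d
    obtain \<xi> where "t < \<xi>" "\<xi> < s" "(primitive f x s - f x s * s) - (primitive f x t - f x s * t) = (s - t) * (f x \<xi> - f x s)"
      by blast
    then show thesis by (intro that[of \<xi>]) (auto simp: algebra_simps)
  qed
  have "\<bar>primitive f x t - primitive f x s - f x s * (t - s)\<bar> = \<bar>t - s\<bar> * \<bar>f x \<xi> - f x s\<bar>"
    using \<xi>(2) by (simp only: abs_mult[symmetric]) (simp add: algebra_simps)
  also have "\<dots> \<le> \<bar>t - s\<bar> * (L * \<bar>t - s\<bar>)"
    using order_trans[OF lip mult_left_mono[OF \<xi>(1) L]] by (intro mult_left_mono) auto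
  also have "\<dots> = L * (t - s)\<^sup>2" by (simp add: power2_eq_square)
  finally show ?thesis .
qed simp

lemma primitive_zero: "primitive f x 0 = 0"
  by (simp add: primitive_def zero_ereal_def)

text \<open>For a fixed upper limit this is a parameter integral; a variable limit is inserted
  through \<open>caratheodory_measurable\<close>, as the primitive is continuous in it.\<close>

lemma primitive_measurable:
  fixes f :: "real ^ 'n \<Rightarrow> real \<Rightarrow> real"
  assumes m: "\<And>s. (\<lambda>x. f x s) \<in> borel_measurable lebesgue" and lip: "\<And>x s t. \<bar>f x s - f x t\<bar> \<le> L * \<bar>s - t\<bar>"
    and u: "u \<in> borel_measurable lebesgue"
  shows "(\<lambda>x. primitive f x (u x)) \<in> borel_measurable lebesgue"
proof (rule caratheodory_measurable[OF _ _ u])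
  have [measurable]: "(\<lambda>z. f (fst z) (snd z)) \<in> borel_measurable (lebesgue \<Otimes>\<^sub>M lborel)"
  proof (rule caratheodory_measurable[where G = "\<lambda>z. f (fst z)"])
    show "(\<lambda>z. f (fst z) s) \<in> borel_measurable (lebesgue \<Otimes>\<^sub>M lborel)" for s
      using m[of s] by (rule measurable_compose[OF measurable_fst])
    show "continuous_on UNIV (f (fst z))" for z by (rule lipschitz_continuous[OF lip])
  qed measurable
  have int: "(\<lambda>x. LINT s|lborel. indicator A s *\<^sub>R f x s) \<in> borel_measurable lebesgue" if [measurable]: "A \<in> sets borel" for A
  proof (rule lborel.borel_measurable_lebesgue_integral)
    show "(\<lambda>(x, s). indicator A s *\<^sub>R f x s) \<in> borel_measurable (lebesgue \<Otimes>\<^sub>M lborel)"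
      unfolding split_beta by measurable
  qed
  show "(\<lambda>x. primitive f x s) \<in> borel_measurable lebesgue" for s
  proof (cases "0 \<le> s")
    case True
    then have "(\<lambda>x. primitive f x s) = (\<lambda>x. LINT t|lborel. indicator (einterval 0 s) t *\<^sub>R f x t)"
      by (simp add: primitive_def interval_lebesgue_integral_def set_lebesgue_integral_def zero_ereal_def)
    then show ?thesis using int[of "einterval 0 s"] by simp
  next
    case False
    then have "(\<lambda>x. primitive f x s) = (\<lambda>x. - (LINT t|lborel. indicator (einterval s 0) t *\<^sub>R f x t))"
      by (simp add: primitive_def interval_lebesgue_integral_def set_lebesgue_integral_def zero_ereal_def)
    then show ?thesis using int[of "einterval s 0"] by simp
  qed
  show "continuous_on UNIV (primitive f x)" for x
    by (intro continuous_at_imp_continuous_on ballI DERIV_isCont[OF primitive_deriv] lipschitz_continuous[OF lip])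
qed

lemma nonlin_lipschitz:
  assumes "\<And>x s t. \<bar>r x s - r x t\<bar> \<le> \<beta> * \<bar>s - t\<bar>"
  shows "\<bar>nonlin a b r x s - nonlin a b r x t\<bar> \<le> (\<bar>a\<bar> + \<bar>b\<bar> + \<beta>) * \<bar>s - t\<bar>"
proof -
  have n: "\<bar>neg_part s - neg_part t\<bar> \<le> \<bar>s - t\<bar>" "\<bar>pos_part s - pos_part t\<bar> \<le> \<bar>s - t\<bar>"
    by (auto simp: neg_part_def pos_part_def min_def max_def)
  have "nonlin a b r x s - nonlin a b r x t
      = a * (neg_part s - neg_part t) + b * (pos_part s - pos_part t) + (r x s - r x t)"
    by (simp add: nonlin_def algebra_simps)
  also have "\<bar>\<dots>\<bar> \<le> \<bar>a * (neg_part s - neg_part t)\<bar> + \<bar>b * (pos_part s - pos_part t)\<bar> + \<bar>r x s - r x t\<bar>" by linarith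
  also have "\<dots> \<le> \<bar>a\<bar> * \<bar>s - t\<bar> + \<bar>b\<bar> * \<bar>s - t\<bar> + \<beta> * \<bar>s - t\<bar>"
    unfolding abs_mult using n assms by (intro add_mono mult_left_mono) auto
  finally show ?thesis by (simp only: distrib_right)
qed

lemma nonlin_measurable:
  assumes "\<And>s. (\<lambda>x. r x s) \<in> borel_measurable lebesgue"
  shows "(\<lambda>x. nonlin a b r x s) \<in> borel_measurable lebesgue"
  unfolding nonlin_def using assms[of s] by measurable

section \<open>The energy and the norm of X expressed through classes\<close>

lemma H1_add: "u \<in> H1 \<Longrightarrow> v \<in> H1 \<Longrightarrow> (\<lambda>x. u x + v x) \<in> H1"
  by (simp add: H1_iff L2_add l2_of_add dom1_add)

lemma H1_scale: "u \<in> H1 \<Longrightarrow> (\<lambda>x. c * u x) \<in> H1"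
  by (simp add: H1_iff L2_scale l2_of_scale dom1_scale)

lemma H1_L2: "u \<in> H1 \<Longrightarrow> u \<in> L2" and H1_dom1: "u \<in> H1 \<Longrightarrow> l2_of u \<in> dom1"
  by (simp_all add: H1_iff)

lemma gradient_form:
  assumes u: "u \<in> H1" and v: "v \<in> H1"
  shows "integrable lebesgue (\<lambda>x. weak_grad u x \<bullet> weak_grad v x)"
    "(LINT x|lebesgue. weak_grad u x \<bullet> weak_grad v x) = gf (l2_of u) (l2_of v)"
proof -
  have e: "weak_grad u x \<bullet> weak_grad v x = (\<Sum>i\<in>UNIV. weak_partial i u x * weak_partial i v x)" for x
    by (simp add: inner_vec_def weak_grad_def)
  have i: "integrable lebesgue (\<lambda>x. weak_partial i u x * weak_partial i v x)" for i
    by (intro L2_integrable_mult weak_partial_H1 u v)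
  show "integrable lebesgue (\<lambda>x. weak_grad u x \<bullet> weak_grad v x)" unfolding e using i by simp
  show "(LINT x|lebesgue. weak_grad u x \<bullet> weak_grad v x) = gf (l2_of u) (l2_of v)"
    unfolding e gf_def using i
    by (simp add: weak_partial_H1[OF u] weak_partial_H1[OF v] inner_l2_of flip: weak_partial_H1(2)[OF u] weak_partial_H1(2)[OF v])
qed

context kr_potential
begin

lemma potential_form:
  assumes u: "u \<in> H1" and v: "v \<in> H1"
  shows "integrable lebesgue (\<lambda>x. V x * u x * v x)" "(LINT x|lebesgue. V x * u x * v x) = vf (l2_of u) (l2_of v)"
proof -
  have m[measurable]: "u \<in> borel_measurable lebesgue" "v \<in> borel_measurable lebesgue"
    using u v by (auto intro: L2_measurable H1_L2)
  have ae: "AE x in lebesgue. V x * rep (l2_of u) x * rep (l2_of v) x = V x * u x * v x"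
    using rep_l2_of[OF H1_L2[OF u]] rep_l2_of[OF H1_L2[OF v]] by eventually_elim simp
  show "integrable lebesgue (\<lambda>x. V x * u x * v x)"
    by (rule integrable_cong_AE_imp[OF vf(1)[OF H1_dom1[OF u] H1_dom1[OF v]] _ ae]) measurable
  show "(LINT x|lebesgue. V x * u x * v x) = vf (l2_of u) (l2_of v)"
    unfolding vf_def by (rule sym, rule integral_cong_AE[OF _ _ ae]) measurable
qed

lemma weak_form:
  assumes u: "u \<in> H1" and v: "v \<in> H1"
  shows "(LINT x|lebesgue. weak_grad u x \<bullet> weak_grad v x + V x * u x * v x) = qf (l2_of u) (l2_of v)"
  by (simp add: gradient_form[OF assms] potential_form[OF assms] qf_def)

lemma quadratic_form:
  assumes u: "u \<in> H1"
  shows "(LINT x|lebesgue. (norm (weak_grad u x))\<^sup>2 + V x * (u x)\<^sup>2) = qf (l2_of u) (l2_of u)"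
  using weak_form[OF u u] unfolding power2_norm_eq_inner by (simp add: power2_eq_square mult.assoc)

lemma norm_m_eq:
  assumes u: "u \<in> H1"
  shows "norm_m V m u = sqrt (qf (l2_of u) (l2_of u) + m * (norm (l2_of u))\<^sup>2)"
proof -
  have i: "integrable lebesgue (\<lambda>x. (norm (weak_grad u x))\<^sup>2 + V x * (u x)\<^sup>2)"
    using Bochner_Integration.integrable_add[OF gradient_form(1)[OF u u] potential_form(1)[OF u u]]
    unfolding power2_norm_eq_inner by (simp add: power2_eq_square mult.assoc)
  have i2: "integrable lebesgue (\<lambda>x. m * (u x)\<^sup>2)" using H1_L2[OF u] by (simp add: L2_def)
  have "(LINT x|lebesgue. (norm (weak_grad u x))\<^sup>2 + (V x + m) * (u x)\<^sup>2)
      = (LINT x|lebesgue. ((norm (weak_grad u x))\<^sup>2 + V x * (u x)\<^sup>2) + m * (u x)\<^sup>2)"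
    by (simp add: distrib_right add.assoc)
  also have "\<dots> = qf (l2_of u) (l2_of u) + m * (norm (l2_of u))\<^sup>2"
    by (simp only: Bochner_Integration.integral_add[OF i i2] quadratic_form[OF u] integral_mult_right_zero norm_l2_of_sq[OF H1_L2[OF u]])
  finally show ?thesis by (simp add: norm_m_def)
qed

end

text \<open>Coercivity makes the norm of X comparable with the graph norm of H1. A Lipschitz f
  vanishing at 0 maps L2 into itself by substitution and has a primitive of quadratic
  growth.\<close>

locale semilinear = kr_potential V V1 V2 p C2 for V V1 V2 :: "real ^ 'n \<Rightarrow> real" and p C2 +
  fixes m c0 L :: real and f :: "real ^ 'n \<Rightarrow> real \<Rightarrow> real"
  assumes c0: "c0 > 0" and coercive: "\<And>x. x \<in> dom1 \<Longrightarrow> c0 * (norm (grl 1 x))\<^sup>2 \<le> qf x x + m * (norm x)\<^sup>2"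
    and f_meas: "\<And>s. (\<lambda>x. f x s) \<in> borel_measurable lebesgue"
    and f_lip: "\<And>x s t. \<bar>f x s - f x t\<bar> \<le> L * \<bar>s - t\<bar>" and f_zero: "\<And>x. f x 0 = 0"
begin

lemma L_nonneg: "L \<ge> 0" using order_trans[OF abs_ge_zero f_lip[of _ 1 0]] by simp

definition form_norm :: "'n l2 \<Rightarrow> real" where "form_norm x = sqrt (qf x x + m * (norm x)\<^sup>2)"

lemma form_norm_sq: "x \<in> dom1 \<Longrightarrow> (form_norm x)\<^sup>2 = qf x x + m * (norm x)\<^sup>2"
  using coercive[of x] c0 order_trans[of 0 "c0 * (norm (grl 1 x))\<^sup>2"] by (simp add: form_norm_def)

lemma form_norm_nonneg: "x \<in> dom1 \<Longrightarrow> 0 \<le> form_norm x"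
  using form_norm_sq coercive[of x] c0 order_trans[of 0 "c0 * (norm (grl 1 x))\<^sup>2"] by (simp add: form_norm_def)

lemma grl_le_form_norm: "x \<in> dom1 \<Longrightarrow> norm (grl 1 x) \<le> form_norm x / sqrt c0"
proof (rule power2_le_imp_le)
  assume x: "x \<in> dom1"
  show "(norm (grl 1 x))\<^sup>2 \<le> (form_norm x / sqrt c0)\<^sup>2"
    using coercive[OF x] c0 by (simp add: power_divide form_norm_sq[OF x] pos_le_divide_eq mult.commute)
  show "0 \<le> form_norm x / sqrt c0" using form_norm_nonneg[OF x] c0 by simp
qed

lemma form_norm_le_grl: obtains K where "K \<ge> 0" "\<And>x. x \<in> dom1 \<Longrightarrow> form_norm x \<le> K * norm (grl 1 x)"
proof -
  obtain K where K: "K \<ge> 0" "\<And>x y. x \<in> dom1 \<Longrightarrow> y \<in> dom1 \<Longrightarrow> \<bar>qf x y\<bar> \<le> K * (norm (grl 1 x) * norm (grl 1 y))"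
    using qf_bounded by blast
  show thesis
  proof
    show "0 \<le> sqrt (K + \<bar>m\<bar>)" using K by simp
    fix x :: "'n l2" assume x: "x \<in> dom1"
    show "form_norm x \<le> sqrt (K + \<bar>m\<bar>) * norm (grl 1 x)"
    proof (rule power2_le_imp_le)
      have "m * (norm x)\<^sup>2 \<le> \<bar>m\<bar> * (norm (grl 1 x))\<^sup>2" by (intro mult_mono power_mono norm_le_grl) auto
      moreover have "qf x x \<le> K * (norm (grl 1 x))\<^sup>2" using K(2)[OF x x] by (simp add: power2_eq_square)
      ultimately show "(form_norm x)\<^sup>2 \<le> (sqrt (K + \<bar>m\<bar>) * norm (grl 1 x))\<^sup>2"
        using K(1) unfolding form_norm_sq[OF x] power_mult_distrib by (simp add: distrib_right)
    qed (use K in simp)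
  qed
qed

lemma form_norm_scale: "x \<in> dom1 \<Longrightarrow> form_norm (c *\<^sub>R x) = \<bar>c\<bar> * form_norm x"
proof -
  assume x: "x \<in> dom1"
  have "qf (c *\<^sub>R x) (c *\<^sub>R x) = c * (c * qf x x)"
    by (simp only: qf_scale[OF x dom1_scale[OF x]] qf_commute[of x "c *\<^sub>R x"] qf_scale[OF x x])
  then have "qf (c *\<^sub>R x) (c *\<^sub>R x) + m * (norm (c *\<^sub>R x))\<^sup>2 = c\<^sup>2 * (qf x x + m * (norm x)\<^sup>2)"
    by (simp add: power_mult_distrib distrib_left power2_eq_square mult_ac)
  then show ?thesis by (simp add: form_norm_def real_sqrt_mult)
qed

lemma norm_m_form_norm: "u \<in> H1 \<Longrightarrow> norm_m V m u = form_norm (l2_of u)"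
  by (simp add: norm_m_eq form_norm_def)

lemma f_L2:
  assumes "u \<in> L2"
  shows "(\<lambda>x. f x (u x)) \<in> L2"
proof (rule L2_bound[OF L2_scale[OF assms, of L]])
  show "(\<lambda>x. f x (u x)) \<in> borel_measurable lebesgue"
    by (rule caratheodory_measurable[OF f_meas lipschitz_continuous[OF f_lip] L2_measurable[OF assms]])
  have "\<bar>f x (u x)\<bar> \<le> \<bar>L * u x\<bar>" for x using f_lip[of x "u x" 0] L_nonneg by (simp add: f_zero abs_mult)
  then show "AE x in lebesgue. \<bar>f x (u x)\<bar> \<le> \<bar>L * u x\<bar>" by simp
qed

lemma primitive_integrable:
  assumes "u \<in> L2"
  shows "integrable lebesgue (\<lambda>x. primitive f x (u x))"
proof (rule Bochner_Integration.integrable_bound[where f = "\<lambda>x. L * (u x)\<^sup>2"])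
  show "integrable lebesgue (\<lambda>x. L * (u x)\<^sup>2)" using assms by (simp add: L2_def)
  show "(\<lambda>x. primitive f x (u x)) \<in> borel_measurable lebesgue"
    by (rule primitive_measurable[OF f_meas f_lip L2_measurable[OF assms]])
  have "\<bar>primitive f x (u x)\<bar> \<le> L * (u x)\<^sup>2" for x
    using primitive_taylor[of f x L "u x" 0] f_lip[of x] by (simp add: primitive_zero f_zero)
  then show "AE x in lebesgue. norm (primitive f x (u x)) \<le> norm (L * (u x)\<^sup>2)"
    using L_nonneg by (simp add: abs_mult)
qed

definition dJ :: "(real ^ 'n \<Rightarrow> real) \<Rightarrow> (real ^ 'n \<Rightarrow> real) \<Rightarrow> real" where
  "dJ u \<phi> = qf (l2_of u) (l2_of \<phi>) - (LINT x|lebesgue. f x (u x) * \<phi> x)"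

lemma dJ_add:
  assumes "u \<in> H1" "g \<in> H1" "h \<in> H1"
  shows "dJ u (\<lambda>x. g x + h x) = dJ u g + dJ u h"
proof -
  have i: "integrable lebesgue (\<lambda>x. f x (u x) * g x)" "integrable lebesgue (\<lambda>x. f x (u x) * h x)"
    by (rule L2_integrable_mult[OF f_L2[OF H1_L2[OF assms(1)]] H1_L2[OF assms(2)]],
        rule L2_integrable_mult[OF f_L2[OF H1_L2[OF assms(1)]] H1_L2[OF assms(3)]])
  have "(LINT x|lebesgue. f x (u x) * (g x + h x)) = (LINT x|lebesgue. f x (u x) * g x) + (LINT x|lebesgue. f x (u x) * h x)"
    using i by (simp add: distrib_left)
  moreover have "qf (l2_of u) (l2_of (\<lambda>x. g x + h x)) = qf (l2_of u) (l2_of g) + qf (l2_of u) (l2_of h)"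
    using qf_add[OF H1_dom1 H1_dom1 H1_dom1, of g h u] assms
    by (simp add: l2_of_add H1_L2 qf_commute[of "l2_of u"])
  ultimately show ?thesis by (simp add: dJ_def)
qed

lemma dJ_scale:
  assumes "u \<in> H1" "h \<in> H1"
  shows "dJ u (\<lambda>x. c * h x) = c * dJ u h"
proof -
  have "qf (l2_of u) (l2_of (\<lambda>x. c * h x)) = c * qf (l2_of u) (l2_of h)"
    using qf_scale[OF H1_dom1 H1_dom1, of h u c] assms by (simp add: l2_of_scale H1_L2 qf_commute[of "l2_of u"])
  moreover have "(LINT x|lebesgue. f x (u x) * (c * h x)) = c * (LINT x|lebesgue. f x (u x) * h x)"
    by (simp add: mult.left_commute[of _ c])
  ultimately show ?thesis by (simp add: dJ_def right_diff_distrib)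
qed

lemma dJ_bounded:
  assumes u: "u \<in> H1"
  shows "\<exists>C. \<forall>h\<in>H1. \<bar>dJ u h\<bar> \<le> C * norm_m V m h"
proof -
  obtain K where K: "K \<ge> 0" "\<And>x y. x \<in> dom1 \<Longrightarrow> y \<in> dom1 \<Longrightarrow> \<bar>qf x y\<bar> \<le> K * (norm (grl 1 x) * norm (grl 1 y))"
    using qf_bounded by blast
  define A where "A = K * norm (grl 1 (l2_of u)) + norm (l2_of (\<lambda>x. f x (u x)))"
  have A: "A \<ge> 0" using K by (simp add: A_def)
  have "\<bar>dJ u h\<bar> \<le> A / sqrt c0 * norm_m V m h" if h: "h \<in> H1" for h
  proof -
    have i: "(LINT x|lebesgue. f x (u x) * h x) = l2_of (\<lambda>x. f x (u x)) \<bullet> l2_of h"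
      by (rule inner_l2_of[symmetric]) (intro f_L2 H1_L2 u h)+
    have "\<bar>dJ u h\<bar> \<le> \<bar>qf (l2_of u) (l2_of h)\<bar> + \<bar>l2_of (\<lambda>x. f x (u x)) \<bullet> l2_of h\<bar>"
      unfolding dJ_def i by (rule abs_triangle_ineq4)
    also have "\<dots> \<le> K * (norm (grl 1 (l2_of u)) * norm (grl 1 (l2_of h))) + norm (l2_of (\<lambda>x. f x (u x))) * norm (grl 1 (l2_of h))"
      by (intro add_mono K(2) H1_dom1 u h order_trans[OF Cauchy_Schwarz_ineq2] mult_left_mono norm_le_grl) auto
    also have "\<dots> = A * norm (grl 1 (l2_of h))" by (simp add: A_def distrib_right)
    also have "\<dots> \<le> A * (form_norm (l2_of h) / sqrt c0)" by (intro mult_left_mono A grl_le_form_norm H1_dom1 h)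
    also have "\<dots> = A / sqrt c0 * norm_m V m h" by (simp add: norm_m_form_norm[OF h])
    finally show ?thesis .
  qed
  then show ?thesis by blast
qed

text \<open>The quadratic part leaves exactly half of its value at h, and the primitive leaves the
  remainder of \<open>primitive_taylor\<close>. Both are quadratic in the norm, which gives Frechet
  differentiability.\<close>

lemma energy_taylor:
  assumes u: "u \<in> H1" and h: "h \<in> H1"
  shows "\<bar>energy V f (\<lambda>x. u x + h x) - energy V f u - dJ u h\<bar> \<le> \<bar>qf (l2_of h) (l2_of h)\<bar> / 2 + L * (norm (l2_of h))\<^sup>2"
proof -
  note uh = H1_add[OF u h]
  note d = H1_dom1[OF u] H1_dom1[OF h]
  let ?R = "\<lambda>x. primitive f x (u x + h x) - primitive f x (u x) - f x (u x) * h x"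
  have i: "integrable lebesgue (\<lambda>x. primitive f x (u x + h x))" "integrable lebesgue (\<lambda>x. primitive f x (u x))"
    "integrable lebesgue (\<lambda>x. f x (u x) * h x)"
    by (rule primitive_integrable[OF H1_L2[OF uh]], rule primitive_integrable[OF H1_L2[OF u]],
        rule L2_integrable_mult[OF f_L2[OF H1_L2[OF u]] H1_L2[OF h]])
  have q: "qf (l2_of (\<lambda>x. u x + h x)) (l2_of (\<lambda>x. u x + h x))
      = qf (l2_of u) (l2_of u) + 2 * qf (l2_of u) (l2_of h) + qf (l2_of h) (l2_of h)"
    using qf_add[OF d(1) d(2) dom1_add[OF d]] qf_add[OF d(1) d(2) d(1)] qf_add[OF d(1) d(2) d(2)]
      qf_commute[of "l2_of u" "l2_of u + l2_of h"] qf_commute[of "l2_of h" "l2_of u + l2_of h"] qf_commute[of "l2_of h" "l2_of u"]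
    by (simp add: l2_of_add H1_L2[OF u] H1_L2[OF h])
  have "(LINT x|lebesgue. ?R x) = (LINT x|lebesgue. primitive f x (u x + h x)) - (LINT x|lebesgue. primitive f x (u x))
      - (LINT x|lebesgue. f x (u x) * h x)" using i by simp
  then have e: "energy V f (\<lambda>x. u x + h x) - energy V f u - dJ u h = qf (l2_of h) (l2_of h) / 2 - (LINT x|lebesgue. ?R x)"
    unfolding energy_def quadratic_form[OF u] quadratic_form[OF uh] q dJ_def by (simp add: field_simps)
  have "\<bar>LINT x|lebesgue. ?R x\<bar> \<le> (LINT x|lebesgue. \<bar>?R x\<bar>)" by (rule integral_abs_bound)
  also have "\<dots> \<le> (LINT x|lebesgue. L * (h x)\<^sup>2)"
  proof (rule integral_mono)
    show "integrable lebesgue (\<lambda>x. L * (h x)\<^sup>2)" using H1_L2[OF h] by (simp add: L2_def)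
    show "\<bar>?R x\<bar> \<le> L * (h x)\<^sup>2" for x using primitive_taylor[of f x L "u x + h x" "u x"] f_lip by simp
  qed (use i in simp)
  also have "\<dots> = L * (norm (l2_of h))\<^sup>2" by (simp add: norm_l2_of_sq[OF H1_L2[OF h]])
  finally show ?thesis unfolding e by linarith
qed

lemma has_frechet_deriv_dJ:
  assumes u: "u \<in> H1"
  shows "has_frechet_deriv H1 (norm_m V m) (energy V f) u (dJ u)"
proof -
  obtain K where K: "K \<ge> 0" "\<And>x y. x \<in> dom1 \<Longrightarrow> y \<in> dom1 \<Longrightarrow> \<bar>qf x y\<bar> \<le> K * (norm (grl 1 x) * norm (grl 1 y))"
    using qf_bounded by blast
  define A where "A = (K / 2 + L) / c0"
  have A: "A \<ge> 0" using K L_nonneg c0 by (simp add: A_def)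
  have q: "\<bar>energy V f (\<lambda>x. u x + h x) - energy V f u - dJ u h\<bar> \<le> A * (norm_m V m h)\<^sup>2" if h: "h \<in> H1" for h
  proof -
    have "L * (norm (l2_of h))\<^sup>2 \<le> L * (norm (grl 1 (l2_of h)))\<^sup>2" by (intro mult_left_mono power_mono norm_le_grl L_nonneg) simp
    moreover have "\<bar>qf (l2_of h) (l2_of h)\<bar> \<le> K * (norm (grl 1 (l2_of h)))\<^sup>2"
      using K(2)[OF H1_dom1[OF h] H1_dom1[OF h]] by (simp add: power2_eq_square)
    ultimately have "\<bar>energy V f (\<lambda>x. u x + h x) - energy V f u - dJ u h\<bar> \<le> (K / 2 + L) * (norm (grl 1 (l2_of h)))\<^sup>2"
      using energy_taylor[OF u h] by (simp add: distrib_right)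
    also have "\<dots> \<le> (K / 2 + L) * ((norm_m V m h)\<^sup>2 / c0)"
    proof (rule mult_left_mono)
      show "(norm (grl 1 (l2_of h)))\<^sup>2 \<le> (norm_m V m h)\<^sup>2 / c0"
        using coercive[OF H1_dom1[OF h]] c0 by (simp add: norm_m_form_norm[OF h] form_norm_sq[OF H1_dom1[OF h]] pos_le_divide_eq mult.commute)
    qed (use K L_nonneg in simp)
    finally show ?thesis by (simp add: A_def)
  qed
  have small: "\<exists>\<delta>>0. \<forall>h\<in>H1. norm_m V m h < \<delta> \<longrightarrow> \<bar>energy V f (\<lambda>x. u x + h x) - energy V f u - dJ u h\<bar> \<le> \<epsilon> * norm_m V m h"
    if \<epsilon>: "\<epsilon> > 0" for \<epsilon>
  proof (intro exI[of _ "\<epsilon> / (A + 1)"] conjI ballI impI)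
    show "\<epsilon> / (A + 1) > 0" using A \<epsilon> by simp
    fix h assume h: "h \<in> H1" "norm_m V m h < \<epsilon> / (A + 1)"
    have n: "norm_m V m h \<ge> 0" using form_norm_nonneg[OF H1_dom1[OF h(1)]] by (simp add: norm_m_form_norm[OF h(1)])
    have "A * norm_m V m h \<le> (A + 1) * norm_m V m h" using n by (simp add: distrib_right)
    also have "\<dots> \<le> \<epsilon>" using h(2) A by (simp add: pos_less_divide_eq mult.commute)
    finally have "A * norm_m V m h * norm_m V m h \<le> \<epsilon> * norm_m V m h" using n by (rule mult_right_mono)
    then show "\<bar>energy V f (\<lambda>x. u x + h x) - energy V f u - dJ u h\<bar> \<le> \<epsilon> * norm_m V m h"
      using q[OF h(1)] by (simp add: power2_eq_square mult.assoc)
  qed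
  show ?thesis
    unfolding has_frechet_deriv_def
    by (intro conjI ballI allI impI dJ_add dJ_scale u dJ_bounded small)
qed

end

section \<open>The Palais-Smale condition\<close>

text \<open>On small multiples of h the two derivatives differ by at most 2 \<epsilon> times the
  norm, and the multiple cancels. Uniqueness holds on \<open>X\<close> only, since nothing
  constrains a derivative outside.\<close>

lemma has_frechet_deriv_unique:
  assumes L: "has_frechet_deriv X \<nu> J u L" and L': "has_frechet_deriv X \<nu> J u L'"
    and X: "\<And>c h. h \<in> X \<Longrightarrow> (\<lambda>x. c * h x) \<in> X" and \<nu>: "\<And>c h. h \<in> X \<Longrightarrow> \<nu> (\<lambda>x. c * h x) = \<bar>c\<bar> * \<nu> h"
    and \<nu>0: "\<And>h. h \<in> X \<Longrightarrow> 0 \<le> \<nu> h" and h: "h \<in> X"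
  shows "L h = L' h"
proof -
  have "\<bar>L h - L' h\<bar> \<le> \<epsilon> * (2 * \<nu> h)" if \<epsilon>: "\<epsilon> > 0" for \<epsilon>
  proof -
    obtain \<delta> where \<delta>: "\<delta> > 0" "\<And>h. h \<in> X \<Longrightarrow> \<nu> h < \<delta> \<Longrightarrow> \<bar>J (\<lambda>x. u x + h x) - J u - L h\<bar> \<le> \<epsilon> * \<nu> h"
      using L \<epsilon> unfolding has_frechet_deriv_def by blast
    obtain \<delta>' where \<delta>': "\<delta>' > 0" "\<And>h. h \<in> X \<Longrightarrow> \<nu> h < \<delta>' \<Longrightarrow> \<bar>J (\<lambda>x. u x + h x) - J u - L' h\<bar> \<le> \<epsilon> * \<nu> h"
      using L' \<epsilon> unfolding has_frechet_deriv_def by blast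
    \<comment> \<open>The shift by 1 gives a strict inequality and allows h of norm 0.\<close>
    define c where "c = min \<delta> \<delta>' / (\<nu> h + 1)"
    have c: "c > 0" using \<delta> \<delta>' \<nu>0[OF h] by (simp add: c_def)
    let ?k = "\<lambda>x. c * h x"
    have n: "\<nu> ?k = c * \<nu> h" using \<nu>[OF h, of c] c by simp
    have "c * \<nu> h < c * (\<nu> h + 1)" using c by simp
    also have "c * (\<nu> h + 1) = min \<delta> \<delta>'" using \<nu>0[OF h] by (simp add: c_def)
    finally have s: "\<nu> ?k < \<delta>" "\<nu> ?k < \<delta>'" by (simp_all add: n)
    have "L ?k = c * L h" "L' ?k = c * L' h" using L L' h unfolding has_frechet_deriv_def by blast+
    then have "\<bar>c * L h - c * L' h\<bar> \<le> 2 * (\<epsilon> * (c * \<nu> h))"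
      using \<delta>(2)[OF X[OF h] s(1)] \<delta>'(2)[OF X[OF h] s(2)] unfolding n by linarith
    then have "c * \<bar>L h - L' h\<bar> \<le> c * (\<epsilon> * (2 * \<nu> h))"
      using c by (simp add: abs_mult mult_ac flip: right_diff_distrib)
    then show ?thesis using c by simp
  qed
  then have "\<bar>L h - L' h\<bar> \<le> 0 + e" if "e > 0" for e
  proof -
    have "\<bar>L h - L' h\<bar> \<le> e / (2 * \<nu> h + 1) * (2 * \<nu> h)"
      using \<open>\<And>\<epsilon>. \<epsilon> > 0 \<Longrightarrow> \<bar>L h - L' h\<bar> \<le> \<epsilon> * (2 * \<nu> h)\<close>[of "e / (2 * \<nu> h + 1)"] that \<nu>0[OF h] by simp
    also have "\<dots> \<le> e" using that \<nu>0[OF h] by (simp add: pos_divide_le_eq add_pos_nonneg mult_left_mono)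
    finally show ?thesis by simp
  qed
  then have "\<bar>L h - L' h\<bar> \<le> 0" by (rule field_le_epsilon)
  then show ?thesis by simp
qed

text \<open>\<open>frechet_deriv\<close> is a choice and \<open>dual_norm\<close> a real supremum.
  Uniqueness identifies the chosen derivative on \<open>X\<close>, its boundedness makes the
  supremum a genuine upper bound, and vectors of norm 0 are annihilated.\<close>

lemma dual_norm_bound:
  assumes L: "has_frechet_deriv X \<nu> J u L"
    and X: "\<And>c h. h \<in> X \<Longrightarrow> (\<lambda>x. c * h x) \<in> X" and \<nu>: "\<And>c h. h \<in> X \<Longrightarrow> \<nu> (\<lambda>x. c * h x) = \<bar>c\<bar> * \<nu> h"
    and \<nu>0: "\<And>h. h \<in> X \<Longrightarrow> 0 \<le> \<nu> h" and h: "h \<in> X"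
  shows "\<bar>L h\<bar> \<le> dual_norm X \<nu> (frechet_deriv X \<nu> J u) * \<nu> h" "0 \<le> dual_norm X \<nu> (frechet_deriv X \<nu> J u)"
proof -
  define L' where "L' = frechet_deriv X \<nu> J u"
  have L': "has_frechet_deriv X \<nu> J u L'" unfolding L'_def frechet_deriv_def by (rule someI[of _ L], rule L)
  have lin: "L' (\<lambda>x. c * h x) = c * L' h" if "h \<in> X" for c h using L' that unfolding has_frechet_deriv_def by blast
  obtain C where C: "\<And>h. h \<in> X \<Longrightarrow> \<bar>L' h\<bar> \<le> C * \<nu> h" using L' unfolding has_frechet_deriv_def by blast
  have bdd: "bdd_above ((\<lambda>h. \<bar>L' h\<bar>) ` {h \<in> X. \<nu> h \<le> 1})"
  proof (rule bdd_aboveI2)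
    fix h assume "h \<in> {h \<in> X. \<nu> h \<le> 1}"
    then have h: "h \<in> X" "\<nu> h \<le> 1" by auto
    have "\<bar>L' h\<bar> \<le> C * \<nu> h" by (rule C[OF h(1)])
    also have "\<dots> \<le> \<bar>C\<bar> * 1" using h \<nu>0 by (intro mult_mono) auto
    finally show "\<bar>L' h\<bar> \<le> \<bar>C\<bar>" by simp
  qed
  have up: "\<bar>L' h\<bar> \<le> dual_norm X \<nu> L'" if "h \<in> X" "\<nu> h \<le> 1" for h
    unfolding dual_norm_def by (rule cSUP_upper[OF _ bdd]) (use that in simp)
  have "\<nu> (\<lambda>x. 0 * h x) \<le> 1" using \<nu>[OF h, of 0] by simp
  from order_trans[OF abs_ge_zero up[OF X[OF h] this]] show "0 \<le> dual_norm X \<nu> (frechet_deriv X \<nu> J u)"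
    by (simp add: L'_def)
  have "\<bar>L' h\<bar> \<le> dual_norm X \<nu> L' * \<nu> h"
  proof (cases "\<nu> h = 0")
    case True
    then show ?thesis using C[OF h] by simp
  next
    case False
    then have p: "\<nu> h > 0" using \<nu>0[OF h] by simp
    have "\<bar>L' (\<lambda>x. 1 / \<nu> h * h x)\<bar> \<le> dual_norm X \<nu> L'"
      by (rule up[OF X[OF h]]) (use \<nu>[OF h, of "1 / \<nu> h"] p in simp)
    then have "\<bar>L' h\<bar> / \<nu> h \<le> dual_norm X \<nu> L'" unfolding lin[OF h] using p by (simp add: abs_mult)
    then show ?thesis using p by (simp add: pos_divide_le_eq)
  qed
  then show "\<bar>L h\<bar> \<le> dual_norm X \<nu> (frechet_deriv X \<nu> J u) * \<nu> h"
    using has_frechet_deriv_unique[OF L L' X \<nu> \<nu>0 h] by (simp add: L'_def)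
qed

context kr_potential
begin

text \<open>The spectral gap controls only the L2 norm, whereas \<open>qf_lower\<close> controls the
  gradient up to an L2 term; a suitable multiple of the first bound pays for that term in the
  second.\<close>

lemma spectrum_coercive:
  assumes "m + Inf (spectrum H2 (schroedinger V)) > 0"
  obtains c0 where "c0 > 0" "\<And>x. x \<in> dom1 \<Longrightarrow> c0 * (norm (grl 1 x))\<^sup>2 \<le> qf x x + m * (norm x)\<^sup>2"
proof -
  define \<delta> where "\<delta> = m + Inf (spectrum H2 (schroedinger V))"
  have \<delta>: "\<delta> > 0" using assms by (simp add: \<delta>_def)
  obtain C where C: "C \<ge> 0" "\<And>x. x \<in> dom1 \<Longrightarrow> gf x x / 2 - C * (norm x)\<^sup>2 \<le> qf x x" using qf_lower by blast
  \<comment> \<open>\<open>C\<close> and |m| compensate the negative terms in the lower bound of the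
    form, and the 1 leaves a full |x|^2; the multiple of the spectral bound that achieves this is E
    / \<delta>.\<close>
  define E where "E = C + \<bar>m\<bar> + 1"
  have E: "E > 0" using C by (simp add: E_def)
  define c0 where "c0 = 1 / (2 * (1 + E / \<delta>))"
  have d: "1 + E / \<delta> > 0" using E \<delta> by (simp add: add_pos_pos)
  show thesis
  proof
    show "c0 > 0" using d by (simp add: c0_def)
    fix x :: "'n l2" assume x: "x \<in> dom1"
    define P where "P = qf x x + m * (norm x)\<^sup>2"
    have "qf x x \<ge> Inf (spectrum H2 (schroedinger V)) * (norm x)\<^sup>2"
    proof (rule form_lower_if_resolvent[OF _ x])
      fix \<mu> assume "\<mu> < Inf (spectrum H2 (schroedinger V))"
      then have "\<mu> \<notin> spectrum H2 (schroedinger V)" using cInf_lower[OF _ bdd_below_spectrum, of \<mu>] by auto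
      then show "\<mu> \<in> resolvent_set H2 (schroedinger V)" by (simp add: spectrum_def)
    qed
    then have "\<delta> * (norm x)\<^sup>2 \<le> P" by (simp add: \<delta>_def P_def distrib_right)
    then have "(E / \<delta>) * (\<delta> * (norm x)\<^sup>2) \<le> (E / \<delta>) * P" using E \<delta> by (intro mult_left_mono) auto
    then have 1: "E * (norm x)\<^sup>2 \<le> (E / \<delta>) * P" using \<delta> by simp
    have "- \<bar>m\<bar> * (norm x)\<^sup>2 \<le> m * (norm x)\<^sup>2" by (intro mult_right_mono) auto
    then have 2: "gf x x / 2 - C * (norm x)\<^sup>2 - \<bar>m\<bar> * (norm x)\<^sup>2 \<le> P" using C(2)[OF x] by (simp add: P_def)
    have "(norm (grl 1 x))\<^sup>2 / 2 \<le> gf x x / 2 + (norm x)\<^sup>2" using norm_grl[of 1 x] by simp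
    also have "\<dots> \<le> (1 + E / \<delta>) * P" using 1 2 by (simp add: E_def distrib_right)
    finally have "(norm (grl 1 x))\<^sup>2 \<le> P * (2 * (1 + E / \<delta>))" by (simp add: algebra_simps)
    moreover have "2 * (1 + E / \<delta>) > 0" using d by simp
    ultimately have "(norm (grl 1 x))\<^sup>2 / (2 * (1 + E / \<delta>)) \<le> P" by (simp only: pos_divide_le_eq)
    then show "c0 * (norm (grl 1 x))\<^sup>2 \<le> qf x x + m * (norm x)\<^sup>2"
      by (simp only: c0_def P_def times_divide_eq_left mult_1)
  qed
qed

end

context semilinear
begin

lemma dJ_dual:
  assumes "u \<in> H1" "h \<in> H1"
  shows "\<bar>dJ u h\<bar> \<le> dual_norm H1 (norm_m V m) (frechet_deriv H1 (norm_m V m) (energy V f) u) * norm_m V m h"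
    "0 \<le> dual_norm H1 (norm_m V m) (frechet_deriv H1 (norm_m V m) (energy V f) u)"
proof -
  have s: "norm_m V m (\<lambda>x. c * h x) = \<bar>c\<bar> * norm_m V m h" if "h \<in> H1" for c h
    using norm_m_form_norm[OF H1_scale[OF that], of c] form_norm_scale[OF H1_dom1[OF that], of c]
    by (simp add: norm_m_form_norm[OF that] l2_of_scale[OF H1_L2[OF that]])
  have n: "0 \<le> norm_m V m h" if "h \<in> H1" for h using form_norm_nonneg[OF H1_dom1[OF that]] by (simp add: norm_m_form_norm[OF that])
  note b = dual_norm_bound[OF has_frechet_deriv_dJ[OF assms(1)] H1_scale s n assms(2)]
  show "\<bar>dJ u h\<bar> \<le> dual_norm H1 (norm_m V m) (frechet_deriv H1 (norm_m V m) (energy V f) u) * norm_m V m h"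
    by (rule b(1))
  show "0 \<le> dual_norm H1 (norm_m V m) (frechet_deriv H1 (norm_m V m) (energy V f) u)" by (rule b(2))
qed

lemma scaled_equation:
  assumes u: "u \<in> H1" and \<phi>: "\<phi> \<in> dom1" and s: "s > 0"
  shows "\<bar>qf ((1 / s) *\<^sub>R l2_of u) \<phi> - (LINT x|lebesgue. f x (u x) / s * rep \<phi> x)\<bar>
    \<le> dual_norm H1 (norm_m V m) (frechet_deriv H1 (norm_m V m) (energy V f) u) * form_norm \<phi> / s"
proof -
  have r: "rep \<phi> \<in> H1" using \<phi> rep_H1 by blast
  have "qf ((1 / s) *\<^sub>R l2_of u) \<phi> - (LINT x|lebesgue. f x (u x) / s * rep \<phi> x) = dJ u (rep \<phi>) / s"
    using qf_scale[OF H1_dom1[OF u] \<phi>, of "1 / s"] by (simp add: dJ_def diff_divide_distrib)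
  then show ?thesis using dJ_dual(1)[OF u r] s by (simp add: norm_m_form_norm[OF r] divide_right_mono)
qed

end

context semilinear
begin

abbreviation dual_deriv :: "(real ^ 'n \<Rightarrow> real) \<Rightarrow> real" where
  "dual_deriv u \<equiv> dual_norm H1 (norm_m V m) (frechet_deriv H1 (norm_m V m) (energy V f) u)"

lemma rep_scaled:
  assumes "u \<in> L2"
  shows "AE x in lebesgue. rep ((1 / s) *\<^sub>R l2_of u) x = u x / s"
  using rep_scale[of "1 / s" "l2_of u"] rep_l2_of[OF assms] by eventually_elim simp

text \<open>The blow-up limit. The Palais-Smale property removes the defect, the Lipschitz condition
  replaces u_n / s_n by the fixed function v inside f, and for fixed v dominated convergence turns
  f(x, s v) / s into g(v).\<close>

lemma limit_equation:
  assumes u: "\<And>n. u n \<in> H1" and s: "\<And>n. s n \<ge> 1" "filterlim s at_top sequentially" and v: "v \<in> dom1"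
    and conv: "(\<lambda>n. norm (grl 1 ((1 / s n) *\<^sub>R l2_of (u n) - v))) \<longlonglongrightarrow> 0" and dual_deriv: "(\<lambda>n. dual_deriv (u n)) \<longlonglongrightarrow> 0"
    and g: "\<And>x t. ((\<lambda>s. f x (s * t) / s) \<longlongrightarrow> g t) at_top" and [measurable]: "g \<in> borel_measurable borel"
    and \<phi>: "\<phi> \<in> dom1"
  shows "qf v \<phi> = (LINT x|lebesgue. g (rep v x) * rep \<phi> x)"
proof -
  define y where "y n = (1 / s n) *\<^sub>R l2_of (u n)" for n
  have y: "y n \<in> dom1" for n by (simp add: y_def dom1_scale H1_dom1 u)
  have s0: "s n > 0" for n using s(1)[of n] by linarith
  obtain K where K: "K \<ge> 0" "\<And>x y. x \<in> dom1 \<Longrightarrow> y \<in> dom1 \<Longrightarrow> \<bar>qf x y\<bar> \<le> K * (norm (grl 1 x) * norm (grl 1 y))"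
    using qf_bounded by blast
  define I where "I n = (LINT x|lebesgue. f x (u n x) / s n * rep \<phi> x)" for n
  define I' where "I' n = (LINT x|lebesgue. f x (s n * rep v x) / s n * rep \<phi> x)" for n
  have A: "(\<lambda>n. qf (y n - v) \<phi>) \<longlonglongrightarrow> 0"
  proof (rule Lim_null_comparison)
    show "\<forall>\<^sub>F n in sequentially. norm (qf (y n - v) \<phi>) \<le> norm (grl 1 (y n - v)) * (K * norm (grl 1 \<phi>))"
      using K(2)[OF dom1_diff[OF y v] \<phi>] by (intro always_eventually allI) (simp add: mult_ac)
    show "(\<lambda>n. norm (grl 1 (y n - v)) * (K * norm (grl 1 \<phi>))) \<longlonglongrightarrow> 0"
      using tendsto_mult_left_zero[OF conv] by (simp add: y_def)
  qed
  have B: "(\<lambda>n. qf (y n) \<phi> - I n) \<longlonglongrightarrow> 0"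
  proof (rule Lim_null_comparison)
    show "\<forall>\<^sub>F n in sequentially. norm (qf (y n) \<phi> - I n) \<le> dual_deriv (u n) * form_norm \<phi>"
    proof (intro always_eventually allI)
      fix n
      have p: "0 \<le> dual_deriv (u n) * form_norm \<phi>" using dJ_dual(2)[OF u u] form_norm_nonneg[OF \<phi>] by simp
      have "norm (qf (y n) \<phi> - I n) \<le> dual_deriv (u n) * form_norm \<phi> / s n"
        unfolding y_def I_def real_norm_def by (rule scaled_equation[OF u \<phi> s0])
      also have "\<dots> \<le> dual_deriv (u n) * form_norm \<phi> / 1" using p s(1) s0 by (intro divide_left_mono) auto
      finally show "norm (qf (y n) \<phi> - I n) \<le> dual_deriv (u n) * form_norm \<phi>" by simp
    qed
    show "(\<lambda>n. dual_deriv (u n) * form_norm \<phi>) \<longlonglongrightarrow> 0" by (rule tendsto_mult_left_zero[OF dual_deriv])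
  qed
  have C: "(\<lambda>n. I n - I' n) \<longlonglongrightarrow> 0"
  proof (rule Lim_null_comparison)
    show "\<forall>\<^sub>F n in sequentially. norm (I n - I' n) \<le> norm (grl 1 (y n - v)) * (L * norm \<phi>)"
    proof (intro always_eventually allI)
      fix n
      have m1: "(\<lambda>x. f x (u n x)) \<in> L2" by (rule f_L2[OF H1_L2[OF u]])
      have m2: "(\<lambda>x. f x (s n * rep v x)) \<in> L2" by (rule f_L2[OF L2_scale[OF rep_L2]])
      have i: "integrable lebesgue (\<lambda>x. f x (u n x) / s n * rep \<phi> x)" "integrable lebesgue (\<lambda>x. f x (s n * rep v x) / s n * rep \<phi> x)"
        using L2_integrable_mult[OF m1 rep_L2[of \<phi>]] L2_integrable_mult[OF m2 rep_L2[of \<phi>]] by simp_all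
      have "norm (I n - I' n) = \<bar>LINT x|lebesgue. f x (u n x) / s n * rep \<phi> x - f x (s n * rep v x) / s n * rep \<phi> x\<bar>"
        using i by (simp add: I_def I'_def)
      also have "\<dots> \<le> (LINT x|lebesgue. \<bar>f x (u n x) / s n * rep \<phi> x - f x (s n * rep v x) / s n * rep \<phi> x\<bar>)"
        by (rule integral_abs_bound)
      also have "\<dots> \<le> (LINT x|lebesgue. L * (\<bar>rep (y n - v) x\<bar> * \<bar>rep \<phi> x\<bar>))"
      proof (rule integral_mono_AE)
        show "integrable lebesgue (\<lambda>x. L * (\<bar>rep (y n - v) x\<bar> * \<bar>rep \<phi> x\<bar>))"
          by (intro integrable_mult_right LINT_abs_mult_le rep_L2)
        show "integrable lebesgue (\<lambda>x. \<bar>f x (u n x) / s n * rep \<phi> x - f x (s n * rep v x) / s n * rep \<phi> x\<bar>)"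
          using i by (intro integrable_abs Bochner_Integration.integrable_diff)
        show "AE x in lebesgue. \<bar>f x (u n x) / s n * rep \<phi> x - f x (s n * rep v x) / s n * rep \<phi> x\<bar> \<le> L * (\<bar>rep (y n - v) x\<bar> * \<bar>rep \<phi> x\<bar>)"
          using rep_diff[of "y n" v] rep_scaled[OF H1_L2[OF u[of n]], of "s n"]
        proof eventually_elim
          case (elim x)
          have "\<bar>u n x - s n * rep v x\<bar> / s n = \<bar>u n x / s n - rep v x\<bar>"
            unfolding abs_div_pos[OF s0] using s0[of n] by (simp add: diff_divide_distrib)
          also have "\<dots> = \<bar>rep (y n - v) x\<bar>" using elim by (simp add: y_def)
          finally have e: "\<bar>u n x - s n * rep v x\<bar> / s n = \<bar>rep (y n - v) x\<bar>" .
          have "\<bar>f x (u n x) / s n * rep \<phi> x - f x (s n * rep v x) / s n * rep \<phi> x\<bar>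
              = \<bar>f x (u n x) - f x (s n * rep v x)\<bar> / s n * \<bar>rep \<phi> x\<bar>"
            using s0[of n] by (simp add: abs_mult flip: diff_divide_distrib left_diff_distrib)
          also have "\<dots> \<le> L * \<bar>u n x - s n * rep v x\<bar> / s n * \<bar>rep \<phi> x\<bar>"
            using s0[of n] by (intro mult_right_mono divide_right_mono f_lip) auto
          also have "\<dots> = L * (\<bar>rep (y n - v) x\<bar> * \<bar>rep \<phi> x\<bar>)" unfolding e[symmetric] by simp
          finally show ?case .
        qed
      qed
      also have "\<dots> \<le> L * (norm (y n - v) * norm \<phi>)"
        using mult_left_mono[OF LINT_abs_mult_le(2)[OF rep_L2[of "y n - v"] rep_L2[of \<phi>]] L_nonneg] by simp
      also have "\<dots> \<le> L * (norm (grl 1 (y n - v)) * norm \<phi>)"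
        by (intro mult_left_mono mult_right_mono norm_le_grl L_nonneg) auto
      finally show "norm (I n - I' n) \<le> norm (grl 1 (y n - v)) * (L * norm \<phi>)" by (simp only: mult_ac)
    qed
    show "(\<lambda>n. norm (grl 1 (y n - v)) * (L * norm \<phi>)) \<longlonglongrightarrow> 0"
      using tendsto_mult_left_zero[OF conv] by (simp add: y_def)
  qed
  have D: "I' \<longlonglongrightarrow> (LINT x|lebesgue. g (rep v x) * rep \<phi> x)"
    unfolding I'_def
  proof (rule integral_dominated_convergence[where w = "\<lambda>x. L * (\<bar>rep v x\<bar> * \<bar>rep \<phi> x\<bar>)"])
    show "(\<lambda>x. g (rep v x) * rep \<phi> x) \<in> borel_measurable lebesgue" by measurable
    show "(\<lambda>x. f x (s n * rep v x) / s n * rep \<phi> x) \<in> borel_measurable lebesgue" for n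
      using L2_measurable[OF f_L2[OF L2_scale[OF rep_L2[of v], of "s n"]]] by measurable
    show "integrable lebesgue (\<lambda>x. L * (\<bar>rep v x\<bar> * \<bar>rep \<phi> x\<bar>))"
      by (intro integrable_mult_right LINT_abs_mult_le rep_L2)
    show "AE x in lebesgue. (\<lambda>n. f x (s n * rep v x) / s n * rep \<phi> x) \<longlonglongrightarrow> g (rep v x) * rep \<phi> x"
      by (intro AE_I2 tendsto_mult tendsto_const filterlim_compose[OF g s(2)])
    show "AE x in lebesgue. norm (f x (s n * rep v x) / s n * rep \<phi> x) \<le> L * (\<bar>rep v x\<bar> * \<bar>rep \<phi> x\<bar>)" for n
    proof (intro AE_I2)
      fix x
      have "\<bar>f x (s n * rep v x)\<bar> \<le> s n * (L * \<bar>rep v x\<bar>)"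
        using f_lip[of x "s n * rep v x" 0] s0[of n] by (simp add: f_zero abs_mult mult_ac)
      then have "\<bar>f x (s n * rep v x)\<bar> / s n \<le> L * \<bar>rep v x\<bar>" using s0[of n] by (simp add: pos_divide_le_eq mult_ac)
      then have "\<bar>f x (s n * rep v x)\<bar> / s n * \<bar>rep \<phi> x\<bar> \<le> L * \<bar>rep v x\<bar> * \<bar>rep \<phi> x\<bar>" by (rule mult_right_mono) simp
      then show "norm (f x (s n * rep v x) / s n * rep \<phi> x) \<le> L * (\<bar>rep v x\<bar> * \<bar>rep \<phi> x\<bar>)"
        using s0[of n] by (simp add: abs_mult mult.assoc)
    qed
  qed
  \<comment> \<open>The four null or convergent expressions recombine to the constant sequence qf v
    \<phi>.\<close>
  have "(\<lambda>n. (qf (y n) \<phi> - I n) - qf (y n - v) \<phi> + (I n - I' n) + I' n) \<longlonglongrightarrow> 0 - 0 + 0 + (LINT x|lebesgue. g (rep v x) * rep \<phi> x)"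
    by (intro tendsto_intros A B C D)
  moreover have "(qf (y n) \<phi> - I n) - qf (y n - v) \<phi> + (I n - I' n) + I' n = qf v \<phi>" for n
    using qf_diff[OF y v \<phi>] by simp
  ultimately show ?thesis by (simp add: LIMSEQ_const_iff)
qed

text \<open>Writing f(x, u) = d u makes the equation linear with a coefficient unaffected by
  division by s_n, so one compactness argument serves both the bounded sequence (s_n = 1) and the
  normalised unbounded one.\<close>

lemma scaled_compactness:
  assumes ess: "\<And>\<mu>. \<mu> < \<mu>1 \<Longrightarrow> \<mu> \<notin> essential_spectrum H2 (schroedinger V)" and M: "M < \<mu>1"
    and coef: "\<And>u. u \<in> L2 \<Longrightarrow> \<exists>d\<in>borel_measurable lebesgue. \<forall>x. d x \<le> M \<and> \<bar>d x\<bar> \<le> B \<and> f x (u x) = d x * u x"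
    and u: "\<And>n. u n \<in> H1" and s: "\<And>n. s n \<ge> 1" and bd: "\<And>n. norm_m V m (u n) \<le> D * s n"
    and dual_deriv: "(\<lambda>n. dual_deriv (u n)) \<longlonglongrightarrow> 0"
  obtains k v where "strict_mono (k :: nat \<Rightarrow> nat)" "v \<in> dom1" "(\<lambda>n. norm (grl 1 ((1 / s (k n)) *\<^sub>R l2_of (u (k n)) - v))) \<longlonglongrightarrow> 0"
proof -
  define y where "y n = (1 / s n) *\<^sub>R l2_of (u n)" for n
  have y: "y n \<in> dom1" for n by (simp add: y_def dom1_scale H1_dom1 u)
  have s0: "s n > 0" for n using s(1)[of n] by linarith
  have "\<forall>n. \<exists>d\<in>borel_measurable lebesgue. \<forall>x. d x \<le> M \<and> \<bar>d x\<bar> \<le> B \<and> f x (u n x) = d x * u n x"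
    using coef H1_L2[OF u] by blast
  then obtain d where d: "\<And>n. d n \<in> borel_measurable lebesgue" "\<And>n x. d n x \<le> M" "\<And>n x. \<bar>d n x\<bar> \<le> B"
    "\<And>n x. f x (u n x) = d n x * u n x" unfolding Bex_def choice_iff by blast
  obtain K where K: "K \<ge> 0" "\<And>x. x \<in> dom1 \<Longrightarrow> form_norm x \<le> K * norm (grl 1 x)" using form_norm_le_grl by blast
  have yD: "norm (grl 1 (y n)) \<le> D / sqrt c0" for n
  proof -
    have "form_norm (y n) = norm_m V m (u n) / s n" using s0[of n] by (simp add: y_def form_norm_scale[OF H1_dom1[OF u]] norm_m_form_norm[OF u])
    also have "\<dots> \<le> D" using bd[of n] s0[of n] by (simp add: pos_divide_le_eq)
    finally have "form_norm (y n) / sqrt c0 \<le> D / sqrt c0" using c0 by (intro divide_right_mono) auto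
    then show ?thesis by (rule order_trans[OF grl_le_form_norm[OF y]])
  qed
  have eq: "\<bar>qf (y n) \<phi> - (LINT x|lebesgue. d n x * rep (y n) x * rep \<phi> x)\<bar> \<le> (dual_deriv (u n) * K) * norm (grl 1 \<phi>)"
    if \<phi>: "\<phi> \<in> dom1" for n \<phi>
  proof -
    have [measurable]: "d n \<in> borel_measurable lebesgue" by (rule d)
    have [measurable]: "(\<lambda>x. f x (u n x)) \<in> borel_measurable lebesgue" by (rule L2_measurable[OF f_L2[OF H1_L2[OF u]]])
    have "(LINT x|lebesgue. d n x * rep (y n) x * rep \<phi> x) = (LINT x|lebesgue. f x (u n x) / s n * rep \<phi> x)"
    proof (rule integral_cong_AE)
      show "AE x in lebesgue. d n x * rep (y n) x * rep \<phi> x = f x (u n x) / s n * rep \<phi> x"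
        using rep_scaled[OF H1_L2[OF u[of n]], of "s n"] by eventually_elim (simp add: y_def d(4))
    qed measurable
    then have "\<bar>qf (y n) \<phi> - (LINT x|lebesgue. d n x * rep (y n) x * rep \<phi> x)\<bar> \<le> dual_deriv (u n) * form_norm \<phi> / s n"
      using scaled_equation[OF u \<phi> s0, of n n] by (simp add: y_def)
    also have "\<dots> \<le> dual_deriv (u n) * form_norm \<phi> / 1"
      using s(1)[of n] s0[of n] dJ_dual(2)[OF u u] form_norm_nonneg[OF \<phi>] by (intro divide_left_mono) auto
    also have "\<dots> \<le> dual_deriv (u n) * (K * norm (grl 1 \<phi>))"
      using mult_left_mono[OF K(2)[OF \<phi>] dJ_dual(2)[OF u u]] by simp
    finally show ?thesis by (simp only: mult.assoc)
  qed
  have "(\<lambda>n. dual_deriv (u n) * K) \<longlonglongrightarrow> 0" by (rule tendsto_mult_left_zero[OF dual_deriv])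
  from compactness[OF ess M y yD d(1-3) eq this] show thesis using that by (auto simp: y_def)
qed

end

context semilinear
begin

text \<open>Here \<open>g\<close> is the nonlinearity seen at infinity and \<open>nontriv\<close>
  expresses non-resonance. Non-resonance excludes blow-up of the norms; afterwards compactness is
  applied without rescaling.\<close>

lemma palais_smaleI:
  assumes ess: "\<And>\<mu>. \<mu> < \<mu>1 \<Longrightarrow> \<mu> \<notin> essential_spectrum H2 (schroedinger V)" and M: "M < \<mu>1"
    and coef: "\<And>u. u \<in> L2 \<Longrightarrow> \<exists>d\<in>borel_measurable lebesgue. \<forall>x. d x \<le> M \<and> \<bar>d x\<bar> \<le> B \<and> f x (u x) = d x * u x"
    and g: "\<And>x t. ((\<lambda>s. f x (s * t) / s) \<longlongrightarrow> g t) at_top" "g \<in> borel_measurable borel"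
    and nontriv: "\<And>v. v \<in> dom1 \<Longrightarrow> (\<And>\<phi>. \<phi> \<in> dom1 \<Longrightarrow> qf v \<phi> = (LINT x|lebesgue. g (rep v x) * rep \<phi> x)) \<Longrightarrow> v = 0"
  shows "palais_smale H1 (norm_m V m) (energy V f)"
  unfolding palais_smale_def
proof (intro allI impI)
  fix u :: "nat \<Rightarrow> real ^ 'n \<Rightarrow> real"
  assume "(\<forall>n. u n \<in> H1) \<and> bounded (range (\<lambda>n. energy V f (u n))) \<and> (\<lambda>n. dual_deriv (u n)) \<longlonglongrightarrow> 0"
  then have u: "\<And>n. u n \<in> H1" and dual_deriv: "(\<lambda>n. dual_deriv (u n)) \<longlonglongrightarrow> 0" by auto
  define N where "N n = norm_m V m (u n)" for n
  have N: "N n = form_norm (l2_of (u n))" for n by (simp add: N_def norm_m_form_norm[OF u])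
  have N0: "N n \<ge> 0" for n by (simp add: N form_norm_nonneg H1_dom1 u)
  obtain K where K: "K \<ge> 0" "\<And>x. x \<in> dom1 \<Longrightarrow> form_norm x \<le> K * norm (grl 1 x)" using form_norm_le_grl by blast
  have "\<exists>D. \<forall>n. N n \<le> D"
  proof (rule ccontr)
    assume "\<not> (\<exists>D. \<forall>n. N n \<le> D)"
    \<comment> \<open>The sum dominates every earlier norm, which forces j n beyond n, while the
      term n drives the chosen norms to infinity.\<close>
    then have "\<forall>n. \<exists>j. N j > real n + 1 + (\<Sum>i\<le>n. N i)" by (auto simp: not_le)
    then obtain j where j: "\<And>n. N (j n) > real n + 1 + (\<Sum>i\<le>n. N i)" by metis
    have jn: "n \<le> j n" for n
    proof (rule ccontr)
      assume "\<not> n \<le> j n"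
      then have "N (j n) \<le> (\<Sum>i\<le>n. N i)" using N0 by (intro member_le_sum) auto
      then show False using j[of n] by linarith
    qed
    have j_top: "filterlim j at_top sequentially"
      by (rule filterlim_at_top_mono[OF filterlim_ident]) (use jn in simp)
    have S0: "(\<Sum>i\<le>n. N i) \<ge> 0" for n using N0 by (intro sum_nonneg) auto
    have s1: "N (j n) \<ge> 1" for n using j[of n] S0[of n] by linarith
    have s_ge: "real n \<le> N (j n)" for n using j[of n] S0[of n] by linarith
    have s_top: "filterlim (\<lambda>n. N (j n)) at_top sequentially"
      by (rule filterlim_at_top_mono[OF filterlim_real_sequentially]) (use s_ge in simp)
    have dj: "(\<lambda>n. dual_deriv (u (j n))) \<longlonglongrightarrow> 0" by (rule filterlim_compose[OF dual_deriv j_top])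
    have bd: "norm_m V m (u (j n)) \<le> 1 * N (j n)" for n by (simp add: N_def)
    obtain k v where k: "strict_mono (k :: nat \<Rightarrow> nat)" and v: "v \<in> dom1"
      and conv: "(\<lambda>n. norm (grl 1 ((1 / N (j (k n))) *\<^sub>R l2_of (u (j (k n))) - v))) \<longlonglongrightarrow> 0"
      using scaled_compactness[OF ess M coef, of "\<lambda>n. u (j n)" "\<lambda>n. N (j n)" 1] u s1 bd dj by blast
    have k_top: "filterlim k at_top sequentially" by (rule filterlim_subseq[OF k])
    have "v = 0"
    proof (rule nontriv[OF v])
      fix \<phi> :: "'n l2" assume \<phi>: "\<phi> \<in> dom1"
      show "qf v \<phi> = (LINT x|lebesgue. g (rep v x) * rep \<phi> x)"
        by (rule limit_equation[OF u s1 filterlim_compose[OF s_top k_top] v conv filterlim_compose[OF dj k_top] g \<phi>])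
    qed
    then have "(\<lambda>n. K * norm (grl 1 ((1 / N (j (k n))) *\<^sub>R l2_of (u (j (k n)))))) \<longlonglongrightarrow> K * 0"
      using conv by (intro tendsto_mult_left) simp
    \<comment> \<open>Strong convergence preserves the normalisation: the rescaled functions have
      norm 1 in X, so their limit cannot be 0.\<close>
    moreover have "1 \<le> K * norm (grl 1 ((1 / N (j (k n))) *\<^sub>R l2_of (u (j (k n)))))" for n
    proof -
      have "1 = form_norm ((1 / N (j (k n))) *\<^sub>R l2_of (u (j (k n))))"
        using s1[of "k n"] form_norm_scale[OF H1_dom1[OF u], of "1 / N (j (k n))" "j (k n)"] by (simp add: N[symmetric])
      also have "\<dots> \<le> K * norm (grl 1 ((1 / N (j (k n))) *\<^sub>R l2_of (u (j (k n)))))"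
        by (rule K(2)[OF dom1_scale[OF H1_dom1[OF u]]])
      finally show ?thesis .
    qed
    ultimately have "(1 :: real) \<le> K * 0" by (intro LIMSEQ_le_const) auto
    then show False by simp
  qed
  then obtain D where D: "\<And>n. norm_m V m (u n) \<le> D * 1" by (auto simp: N_def)
  obtain k v where k: "strict_mono (k :: nat \<Rightarrow> nat)" and v: "v \<in> dom1"
    and conv: "(\<lambda>n. norm (grl 1 ((1 / 1) *\<^sub>R l2_of (u (k n)) - v))) \<longlonglongrightarrow> 0"
    using scaled_compactness[OF ess M coef, of u "\<lambda>n. 1" D] u D dual_deriv by blast
  have r: "rep v \<in> H1" using v rep_H1 by blast
  have "(\<lambda>n. norm_m V m (\<lambda>x. u (k n) x - rep v x)) \<longlonglongrightarrow> 0"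
  proof (rule Lim_null_comparison)
    show "(\<lambda>n. K * norm (grl 1 (l2_of (u (k n)) - v))) \<longlonglongrightarrow> 0" using tendsto_mult_right_zero[OF conv, of K] by simp
    show "\<forall>\<^sub>F n in sequentially. norm (norm_m V m (\<lambda>x. u (k n) x - rep v x)) \<le> K * norm (grl 1 (l2_of (u (k n)) - v))"
    proof (intro always_eventually allI)
      fix n
      have d: "l2_of (\<lambda>x. u (k n) x - rep v x) = l2_of (u (k n)) - v" by (simp add: l2_of_diff H1_L2 u)
      have "(\<lambda>x. u (k n) x - rep v x) \<in> H1" unfolding H1_iff d by (simp add: L2_diff H1_L2 u dom1_diff H1_dom1 v)
      then have "norm_m V m (\<lambda>x. u (k n) x - rep v x) = form_norm (l2_of (u (k n)) - v)" by (simp add: norm_m_form_norm d)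
      then show "norm (norm_m V m (\<lambda>x. u (k n) x - rep v x)) \<le> K * norm (grl 1 (l2_of (u (k n)) - v))"
        using K(2) form_norm_nonneg dom1_diff[OF H1_dom1[OF u[of "k n"]] v] by simp
    qed
  qed
  then show "\<exists>k. strict_mono k \<and> (\<exists>v\<in>H1. (\<lambda>n. norm_m V m (\<lambda>x. u (k n) x - v x)) \<longlonglongrightarrow> 0)" using k r by blast
qed

end

section \<open>The hypotheses of the abstract criterion for the given potential and
  nonlinearity\<close>

lemma kato_rellich_potential:
  fixes V :: "real ^ 'n \<Rightarrow> real"
  assumes "kato_rellich V"
  obtains V1 V2 p C2 where "kr_potential V V1 V2 p C2"
proof -
  obtain p V1 V2 where p: "CARD('n) \<le> 3 \<longrightarrow> p = 2" "CARD('n) = 4 \<longrightarrow> p > 2" "CARD('n) \<ge> 5 \<longrightarrow> p > real CARD('n) / 2"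
    and V1: "V1 \<in> Lp p" and V2: "V2 \<in> Linf" and V: "V = (\<lambda>x. V1 x + V2 x)"
    using assms unfolding kato_rellich_def by blast
  obtain C where C: "AE x in lebesgue. \<bar>V2 x\<bar> \<le> C" using V2 by (auto simp: Linf_def)
  have "CARD('n) \<le> 3 \<or> CARD('n) = 4 \<or> CARD('n) \<ge> 5" by linarith
  then have "p \<ge> 2 \<and> 2 * p > real CARD('n)"
  proof (elim disjE)
    assume c: "CARD('n) \<ge> 5"
    then have "real CARD('n) \<ge> 5" by linarith
    then show ?thesis using p(3) c by auto
  qed (use p in auto)
  then have "kr_potential V V1 V2 p (max C 0)"
    using V1 V2 V by unfold_locales (auto simp: Lp_def Linf_def intro: AE_mp[OF C])
  then show thesis by (rule that)
qed

lemma pos_neg_homogeneous: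
  assumes "s > 0"
  shows "neg_part (s * t) = s * neg_part t" "pos_part (s * t) = s * pos_part t"
  using assms by (auto simp: neg_part_def pos_part_def min_def max_def mult_le_0_iff zero_le_mult_iff)

text \<open>For t different from 0 the argument s t leaves every bounded set, so r(x, s t) / s tends
  to 0; the piecewise linear part is positively homogeneous.\<close>

lemma nonlin_asymptotic:
  assumes r0: "r x 0 = 0" and r: "((\<lambda>s. r x s / s) \<longlongrightarrow> 0) at_infinity"
  shows "((\<lambda>s. nonlin a b r x (s * t) / s) \<longlongrightarrow> a * neg_part t + b * pos_part t) at_top"
proof -
  have "((\<lambda>s. r x (s * t) / s) \<longlongrightarrow> 0) at_top"
  proof (cases "t = 0")
    case False
    have "filterlim (\<lambda>s. s * t) at_infinity at_top"
    proof (cases "t > 0")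
      case True
      then show ?thesis
        by (intro filterlim_at_top_imp_at_infinity filterlim_at_top_mult_tendsto_pos[OF tendsto_const _ filterlim_ident])
    next
      case F: False
      with False have "t < 0" by simp
      then show ?thesis
        by (intro filterlim_at_bot_imp_at_infinity)
           (use filterlim_tendsto_neg_mult_at_bot[OF tendsto_const[of t] _ filterlim_ident] in \<open>simp add: mult.commute\<close>)
    qed
    from tendsto_mult_left_zero[OF filterlim_compose[OF r this], of t]
    show ?thesis using False by simp
  qed (simp add: r0)
  then have "((\<lambda>s. a * neg_part t + b * pos_part t + r x (s * t) / s) \<longlongrightarrow> a * neg_part t + b * pos_part t + 0) at_top"
    by (intro tendsto_intros)
  moreover have "\<forall>\<^sub>F s in at_top. a * neg_part t + b * pos_part t + r x (s * t) / s = nonlin a b r x (s * t) / s"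
    using eventually_gt_at_top[of 0]
    by eventually_elim (simp add: nonlin_def pos_neg_homogeneous add_divide_distrib)
  ultimately show ?thesis using Lim_transform_eventually by fastforce
qed

text \<open>The quotient f(x, u) / u as a measurable coefficient: the sign condition on r gives the
  upper bound \<open>max a b\<close>, and the Lipschitz condition the two-sided one.\<close>

lemma nonlin_coefficient:
  fixes u :: "real ^ 'n \<Rightarrow> real"
  assumes m: "\<And>s. (\<lambda>x. r x s) \<in> borel_measurable lebesgue" and r0: "\<And>x. r x 0 = 0"
    and lip: "\<And>x s t. \<bar>r x s - r x t\<bar> \<le> \<beta> * \<bar>s - t\<bar>" and neg: "\<And>x s. s \<noteq> 0 \<Longrightarrow> r x s / s \<le> 0"
    and u: "u \<in> L2"
  shows "\<exists>d\<in>borel_measurable lebesgue. \<forall>x. d x \<le> max a b \<and> \<bar>d x\<bar> \<le> \<bar>a\<bar> + \<bar>b\<bar> + \<beta> \<and> nonlin a b r x (u x) = d x * u x"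
proof (intro bexI allI conjI)
  \<comment> \<open>At zeros of u the coefficient is set to b, which satisfies both bounds; the
    product with u is 0 there, as is f.\<close>
  define d where "d x = (if u x < 0 then a else b) + (if u x = 0 then 0 else r x (u x) / u x)" for x
  have [measurable]: "u \<in> borel_measurable lebesgue" by (rule L2_measurable[OF u])
  have [measurable]: "(\<lambda>x. r x (u x)) \<in> borel_measurable lebesgue"
    by (rule caratheodory_measurable[OF m lipschitz_continuous[OF lip]]) measurable
  show "d \<in> borel_measurable lebesgue" unfolding d_def by measurable
  fix x
  have \<beta>: "\<beta> \<ge> 0" using order_trans[OF abs_ge_zero lip[of x 1 0]] by simp
  have q: "(if u x = 0 then 0 else r x (u x) / u x) \<le> 0" using neg by simp
  have "\<bar>r x (u x)\<bar> \<le> \<beta> * \<bar>u x\<bar>" using lip[of x "u x" 0] by (simp add: r0)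
  then have q': "\<bar>if u x = 0 then 0 else r x (u x) / u x\<bar> \<le> \<beta>" using \<beta> by (auto simp: abs_divide divide_le_eq)
  have "d x \<le> (if u x < 0 then a else b) + 0" using q unfolding d_def by (rule add_left_mono)
  then show "d x \<le> max a b" by (auto split: if_splits)
  show "\<bar>d x\<bar> \<le> \<bar>a\<bar> + \<bar>b\<bar> + \<beta>" unfolding d_def
    by (rule order_trans[OF abs_triangle_ineq add_mono[OF _ q']]) simp
  show "nonlin a b r x (u x) = d x * u x"
    by (auto simp: d_def nonlin_def neg_part_def pos_part_def r0 distrib_right)
qed

text \<open>A nonzero solution would be an element of the Fucik spectrum once it vanishes at
  infinity; its right-hand side has the bounded coefficient \<open>c\<close>, so
  \<open>decay_perturbed\<close> supplies exactly that.\<close>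

lemma (in kr_potential) fucik_trivial:
  fixes v :: "'n l2"
  assumes not_fucik: "(a, b) \<notin> fucik_spectrum V" and v: "v \<in> dom1"
    and eq: "\<And>\<phi>. \<phi> \<in> dom1 \<Longrightarrow> qf v \<phi> = (LINT x|lebesgue. (a * neg_part (rep v x) + b * pos_part (rep v x)) * rep \<phi> x)"
  shows "v = 0"
proof (rule ccontr)
  assume "v \<noteq> 0"
  define c where "c x = (if rep v x < 0 then a else b)" for x
  have c: "a * neg_part (rep v x) + b * pos_part (rep v x) = c x * rep v x" for x
    by (simp add: c_def neg_part_def pos_part_def)
  have r: "rep v \<in> H1" using v rep_H1 by blast
  have "vanishes_at_infinity (rep v)"
  proof (rule decay_perturbed[of _ c "\<bar>a\<bar> + \<bar>b\<bar>"])
    show "c \<in> borel_measurable lebesgue" unfolding c_def by measurable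
    show "\<bar>c t\<bar> \<le> \<bar>a\<bar> + \<bar>b\<bar>" for t by (simp add: c_def)
  qed (use v eq in \<open>simp_all add: c\<close>)
  moreover have "\<not> (AE x in lebesgue. rep v x = 0)"
  proof
    assume "AE x in lebesgue. rep v x = 0"
    then have "l2_of (rep v) = l2_of (\<lambda>x. 0)" by (intro l2_of_cong) auto
    then show False using \<open>v \<noteq> 0\<close> by (simp add: l2_of_zero)
  qed
  moreover have "(LINT x|lebesgue. weak_grad (rep v) x \<bullet> weak_grad \<phi> x + V x * rep v x * \<phi> x)
      = (LINT x|lebesgue. (a * neg_part (rep v x) + b * pos_part (rep v x)) * \<phi> x)" if \<phi>: "\<phi> \<in> H1" for \<phi>
  proof -
    have [measurable]: "\<phi> \<in> borel_measurable lebesgue" by (rule L2_measurable[OF H1_L2[OF \<phi>]])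
    have [measurable]: "c \<in> borel_measurable lebesgue" unfolding c_def by measurable
    have "(LINT x|lebesgue. c x * rep v x * rep (l2_of \<phi>) x) = (LINT x|lebesgue. c x * rep v x * \<phi> x)"
    proof (rule integral_cong_AE)
      show "AE x in lebesgue. c x * rep v x * rep (l2_of \<phi>) x = c x * rep v x * \<phi> x"
        using rep_l2_of[OF H1_L2[OF \<phi>]] by eventually_elim simp
    qed measurable
    then show ?thesis using weak_form[OF r \<phi>] eq[OF H1_dom1[OF \<phi>]] by (simp add: c)
  qed
  ultimately have "(a, b) \<in> fucik_spectrum V" unfolding fucik_spectrum_def using r by blast
  then show False using not_fucik by blast
qed

theorem theorem3p1:
  fixes V :: "real ^ 'n \<Rightarrow> real" and r :: "real ^ 'n \<Rightarrow> real \<Rightarrow> real"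
    and a b m \<beta> r0 \<sigma>0 :: real
  assumes V: "kato_rellich V"
    and dis_nonempty: "discrete_spectrum H2 (schroedinger V) \<noteq> {}"
    and inf_dis: "Inf (spectrum H2 (schroedinger V)) = Inf (discrete_spectrum H2 (schroedinger V))"
    and \<sigma>0: "\<sigma>0 = Inf (essential_spectrum H2 (schroedinger V))"
    and m_pos: "m > 0"
    and m_inf: "m + Inf (spectrum H2 (schroedinger V)) > 0"
    and m_inf2: "Inf (spectrum H2 (schroedinger (\<lambda>x. 2 * V x + 2 * m))) > 1"
    and r_car: "caratheodory r"
    and r1_zero: "\<And>x. r x 0 = 0"
    and r1_infinity: "uniform_limit UNIV (\<lambda>s x. r x s / s) (\<lambda>x. 0) at_infinity"
    and r2_pos: "\<beta> > 0"
    and r2: "\<And>x s1 s2. \<bar>r x s1 - r x s2\<bar> \<le> \<beta> * \<bar>s1 - s2\<bar>"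
    and r3: "\<And>x s. s \<noteq> 0 \<Longrightarrow> r x s / s \<le> 0"
    and r4: "uniform_limit UNIV (\<lambda>s x. r x s / s) (\<lambda>x. r0) (at 0)"
    and not_fucik: "(a, b) \<notin> fucik_spectrum V"
    and ab: "max a b < \<sigma>0"
  shows "palais_smale H1 (norm_m V m) (energy V (nonlin a b r))"
proof -
  obtain V1 V2 p C2 where "kr_potential V V1 V2 p C2" using kato_rellich_potential[OF V] by blast
  then interpret kr_potential V V1 V2 p C2 .
  obtain c0 where c0: "c0 > 0" "\<And>x. x \<in> dom1 \<Longrightarrow> c0 * (norm (grl 1 x))\<^sup>2 \<le> qf x x + m * (norm x)\<^sup>2"
    using spectrum_coercive[OF m_inf] by blast
  have r_meas: "(\<lambda>x. r x s) \<in> borel_measurable lebesgue" for s using r_car by (simp add: caratheodory_def)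
  interpret semilinear V V1 V2 p C2 m c0 "\<bar>a\<bar> + \<bar>b\<bar> + \<beta>" "nonlin a b r"
    by unfold_locales
      (auto intro!: c0 nonlin_measurable r_meas nonlin_lipschitz r2 simp: nonlin_def[of a b r _ 0] neg_part_def pos_part_def r1_zero)
  show ?thesis
  proof (rule palais_smaleI[OF _ ab])
    \<comment> \<open>A real infimum bounds its set from below only if the set is bounded below;
      \<open>bdd_below_spectrum\<close> provides this.\<close>
    show "\<mu> \<notin> essential_spectrum H2 (schroedinger V)" if "\<mu> < \<sigma>0" for \<mu>
    proof
      assume "\<mu> \<in> essential_spectrum H2 (schroedinger V)"
      moreover have "bdd_below (essential_spectrum H2 (schroedinger V))"
        by (rule bdd_below_mono[OF bdd_below_spectrum]) (auto simp: essential_spectrum_def)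
      ultimately show False using that cInf_lower[of \<mu> "essential_spectrum H2 (schroedinger V)"] by (simp add: \<sigma>0)
    qed
    show "\<exists>d\<in>borel_measurable lebesgue. \<forall>x. d x \<le> max a b \<and> \<bar>d x\<bar> \<le> \<bar>a\<bar> + \<bar>b\<bar> + \<beta> \<and> nonlin a b r x (u x) = d x * u x"
      if "u \<in> L2" for u by (rule nonlin_coefficient[OF r_meas r1_zero r2 r3 that])
    show "((\<lambda>s. nonlin a b r x (s * t) / s) \<longlongrightarrow> a * neg_part t + b * pos_part t) at_top" for x t
      by (intro nonlin_asymptotic r1_zero tendsto_uniform_limitI[OF r1_infinity] UNIV_I)
    show "(\<lambda>t. a * neg_part t + b * pos_part t) \<in> borel_measurable borel"
      unfolding neg_part_def pos_part_def by measurable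
    show "v = 0" if "v \<in> dom1"
      "\<And>\<phi>. \<phi> \<in> dom1 \<Longrightarrow> qf v \<phi> = (LINT x|lebesgue. (a * neg_part (rep v x) + b * pos_part (rep v x)) * rep \<phi> x)" for v
      by (rule fucik_trivial[OF not_fucik that])
  qed
qed

end
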